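(* Let $S\subset\mathbb{P}^1$ be a finite set with $0,\infty\in S$, $U=\mathbb{P}^1\setminus S$, $D=t\frac{d}{dt}$, and let $L=\sum_{j=0}^r q_j(t)D^{r-j}$ be a differential operator with $q_j$ rational functions regular on $U$, $q_0$ nowhere vanishing on $U$, $q_j$ regular at $t=0$, $q_0(0)\neq 0$, and with regular singularities. Let $K\subseteq\mathbb{C}$ be a field such that there is a monodromy-invariant $K$-structure $\mathrm{Sol}(L)_K$ on the local system of solutions, $\mathrm{Sol}(L)=\mathrm{Sol}(L)_K\otimes_K\mathbb{C}$, and give $\mathrm{Sol}(L^\vee)$ the dual $K$-structure $\mathrm{Sol}(L^\vee)_K$ with respect to the pairing $\{\cdot,\cdot\}$ described in the context. Assume that $c\neq 0,\infty$ is a special reflection point of $L$. Let $\gamma$ be a path from $t=0$ to $t=c$ through regular points of $L$, let $V\subset U_{an}$ be a neighbourhood of $\gamma$ with $V=V_0\cup V_c$, where $V_0,V_c$ are punctured disks centered at $0$ and $c$ with $V_0\cap V_c$ contractible, and fix a base point $p\in V_0\cap V_c$ on $\gamma$ and loops $\sigma_0,\sigma_c$ in $V$ based at $p$ around $0$ and $c$. Let $\delta(t)$ be a $K$-rational solution of $L$ near $p$ spanning the image of $\sigma_c-1$ on $\mathrm{Sol}_p(L)$, and let $\{\kappa_{\rho,n}\}_{\rho\in\mathcal{R},n\ge 0}$ be the corresponding Frobenius constants for $\gamma$ (with a fixed branch of $t^s$ along $\gamma$). Then there is a generator $\Gamma_{\xi_0}(s)$ of the $K[e^{\pm 2\pi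 i s}]$-module of gamma functions $\Gamma_\xi(s)$, $\xi\in H_1(V,\mathrm{Sol}(L^\vee)_K\otimes t^s)$, for the adjoint operator $L^\vee$ (computed with the same branch of $t^s$ at $p$), such that for every $\rho\in\mathcal{R}$ the Taylor expansion at $s=\rho$ satisfies $$\frac{I(s)}{R(e^{-2\pi i s})}\,\Gamma_{\xi_0}(s)=\sum_{n=0}^\infty \kappa_{\rho,n}(s-\rho)^n,$$ where $I(s)$ is the indicial polynomial of $L$ at $t=0$ and $R(T)\in K[T]$ is a nonzero polynomial of minimal degree such that $R(\sigma_0)$ annihilates the image of $\sigma_c-1$ on $\mathrm{Sol}_p(L^\vee)$.
   Context: Frobenius method: expanding the coefficients at $t=0$ write $L=\sum_{j\ge0}t^jp_j(D)$ with polynomials $p_j$ of degree $\le r$; the indicial polynomial is $I(s)=p_0(s)$. Define rational functions $a_n(s)$ by $a_n=0$ for $n<0$, $a_0=1$, $\sum_{j=0}^n p_j(n+s-j)a_{n-j}(s)=0$ for $n\ge1$, and put $\mathcal{R}=\{\rho\in\mathbb{C}: I(\rho)=0,\ I(\rho+n)\ne0 \ \forall n\in\mathbb{Z}_{\ge1}\}$. For $\rho\in\mathcal{R}$, $k\ge0$ the Frobenius functions are $\phi_{\rho,k}(t)=\sum_{j=0}^k\frac{\log(t)^j}{j!}\sum_{n\ge0}\frac{a_n^{(k-j)}(\rho)}{(k-j)!}t^{n+\rho}$ (convergent near $0$; $a_n^{(i)}$ denotes the $i$-th derivative in $s$), using a fixed branch of $\log t$, continued analytically along $\gamma$. The adjoint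 operator is $L^\vee=(-D)^rq_0(t)+(-D)^{r-1}q_1(t)+\dots+q_r(t)$ (composition of operators). The bracket $\{\psi,\phi\}=\sum_{h,\nu,i\ge0,\,h+\nu+i=r-1}(-D)^h(q_\nu\psi)\,D^i\phi$ is constant on $\mathrm{Sol}(L^\vee)\otimes\mathrm{Sol}(L)$ and gives a perfect monodromy-invariant pairing; $\mathrm{Sol}(L^\vee)_K$ consists of $\psi$ with $\{\psi,\phi\}\in K$ for all $\phi\in\mathrm{Sol}(L)_K$. A regular singular point $c$ is a reflection point of an operator if $\sigma_c-1$ on its local solutions near $p$ has one-dimensional image; it is a special reflection point of $L$ if moreover all $\sigma_c$-invariant solutions of $L^\vee$ are analytic at $c$. In that case, for all $\rho\in\mathbb{C}$ and $j\ge0$ the image of $\sigma_c-1$ on solutions of $(D-\rho)^jL$ near $p$ is $\mathbb{C}\delta$, and since each $\phi_{\rho,n}$ is a solution of such an operator the Frobenius constants are defined by $(\sigma_c-1)\phi_{\rho,n}=\kappa_{\rho,n}\delta$. Gamma functions: $H_1(V,\mathrm{Sol}(L^\vee)_K\otimes t^s)$ is the group homology of $\pi_1(V,p)$ (free on $\sigma_0,\sigma_c$) with coefficients in $\mathrm{Sol}_p(L^\vee)_K\otimes_KK[e^{\pm2\pi is}]$, a loop $\sigma$ acting by $\sigma(\psi\otimes f)=\sigma\psi\otimes e^{2\pi i s\,n(\sigma)}f$ with $n(\sigma)$ the winding number about $0$. Every class is represented by a cycle $\xi=\sum_j\sigma_j\otimes\psi_j\otimes e^{2\pi isn_j}$ with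 $\sum_je^{2\pi isn_j}(\sigma_j(\psi_j\otimes1)-\psi_j\otimes1)=0$, and $\Gamma_\xi(s)=\sum_je^{2\pi isn_j}\int_{\sigma_j}\psi_j(t)t^{s-1}dt$ (fixed branch of $t^s$ at $p$); these are entire functions of $s$ depending only on the class and form a $K[e^{\pm2\pi is}]$-module. *)

theory Defs
  imports "HOL-Complex_Analysis.Complex_Analysis" "HOL-Library.Function_Algebras"
begin

section \<open>Germs and analytic continuation\<close>

text \<open>
  A germ of a holomorphic function at \<open>z\<close> is its Taylor series at \<open>z\<close>, that is, an element of
  \<open>complex fps\<close> with positive radius of convergence; the point \<open>z\<close> is not recorded in the type.
\<close>

definition continuation_along :: "(real \<Rightarrow> complex) \<Rightarrow> (real \<Rightarrow> complex fps) \<Rightarrow> bool" where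
  "continuation_along g F \<longleftrightarrow>
     (\<forall>u\<in>{0..1}. fps_conv_radius (F u) > 0 \<and>
        (\<forall>\<^sub>F v in at u within {0..1}.
           F v = fps_expansion (\<lambda>z. eval_fps (F u) (z - g u)) (g v)))"

text \<open>The germ at \<open>g u\<close> obtained from the germ \<open>f\<close> at \<open>g 0\<close>; the family is unique if it exists.\<close>

definition continue :: "(real \<Rightarrow> complex) \<Rightarrow> complex fps \<Rightarrow> real \<Rightarrow> complex fps" where
  "continue g f u = (THE h. \<exists>F. continuation_along g F \<and> F 0 = f \<and> F u = h)"

definition monodromy :: "(real \<Rightarrow> complex) \<Rightarrow> complex fps \<Rightarrow> complex fps" where
  "monodromy \<sigma> f = continue \<sigma> f 1"

text \<open>The contour integral along \<open>g\<close> of the multivalued function with germ \<open>f\<close> at \<open>g 0\<close>.\<close>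

definition germ_integral :: "(real \<Rightarrow> complex) \<Rightarrow> complex fps \<Rightarrow> complex" where
  "germ_integral g f =
     integral {0..1} (\<lambda>u. fps_nth (continue g f u) 0 * vector_derivative g (at u within {0..1}))"

text \<open>The branch of the logarithm near \<open>z \<noteq> 0\<close> with value \<open>l\<close> at \<open>z\<close> (where \<open>exp l = z\<close>).\<close>

definition log_branch :: "complex \<Rightarrow> complex \<Rightarrow> complex \<Rightarrow> complex" where
  "log_branch z l t = l + Ln (t / z)"

definition power_germ :: "complex \<Rightarrow> complex \<Rightarrow> complex \<Rightarrow> complex fps" where
  "power_germ z l s = fps_expansion (\<lambda>t. exp (s * log_branch z l t)) z"


section \<open>The operator \<open>L = (\<Sum>j\<le>r. q j * D ^ (r - j))\<close> with \<open>D = t * d/dt\<close>, and its adjoint\<close>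

definition rational_on :: "complex set \<Rightarrow> (complex \<Rightarrow> complex) \<Rightarrow> bool" where
  "rational_on A f \<longleftrightarrow> (\<exists>a b. \<forall>t\<in>A. poly b t \<noteq> 0 \<and> f t = poly a t / poly b t)"

text \<open>
  Fuchs' condition at every point of \<open>S\<close> and at infinity. Since \<open>D\<close> is logarithmic at \<open>0\<close> and
  at infinity, there the quotients \<open>q j / q 0\<close> themselves have to be regular, while at
  \<open>x \<noteq> 0\<close> poles of order at most \<open>j\<close> are allowed.
\<close>

definition regular_singularities ::
    "complex set \<Rightarrow> nat \<Rightarrow> (nat \<Rightarrow> complex \<Rightarrow> complex) \<Rightarrow> bool" where
  "regular_singularities S r q \<longleftrightarrow>
     (\<forall>j\<le>r. (\<forall>x\<in>S - {0}. \<exists>l. ((\<lambda>t. (t - x) ^ j * (q j t / q 0 t)) \<longlongrightarrow> l) (at x)) \<and>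
            (\<exists>l. ((\<lambda>t. q j t / q 0 t) \<longlongrightarrow> l) (at 0)) \<and>
            (\<exists>l. ((\<lambda>t. q j t / q 0 t) \<longlongrightarrow> l) at_infinity))"

definition D_germ :: "complex \<Rightarrow> complex fps \<Rightarrow> complex fps" where
  "D_germ z f = (fps_const z + fps_X) * fps_deriv f"

definition L_germ ::
    "nat \<Rightarrow> (nat \<Rightarrow> complex \<Rightarrow> complex) \<Rightarrow> complex \<Rightarrow> complex fps \<Rightarrow> complex fps" where
  "L_germ r q z f = (\<Sum>j\<le>r. fps_expansion (q j) z * (D_germ z ^^ (r - j)) f)"

definition L_adj_germ ::
    "nat \<Rightarrow> (nat \<Rightarrow> complex \<Rightarrow> complex) \<Rightarrow> complex \<Rightarrow> complex fps \<Rightarrow> complex fps" where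
  "L_adj_germ r q z f = (\<Sum>j\<le>r. ((\<lambda>g. - D_germ z g) ^^ (r - j)) (fps_expansion (q j) z * f))"

definition Sol :: "nat \<Rightarrow> (nat \<Rightarrow> complex \<Rightarrow> complex) \<Rightarrow> complex \<Rightarrow> complex fps set" where
  "Sol r q z = {f. fps_conv_radius f > 0 \<and> L_germ r q z f = 0}"

definition Sol_adj :: "nat \<Rightarrow> (nat \<Rightarrow> complex \<Rightarrow> complex) \<Rightarrow> complex \<Rightarrow> complex fps set" where
  "Sol_adj r q z = {f. fps_conv_radius f > 0 \<and> L_adj_germ r q z f = 0}"

definition bracket ::
    "nat \<Rightarrow> (nat \<Rightarrow> complex \<Rightarrow> complex) \<Rightarrow> complex \<Rightarrow> complex fps \<Rightarrow> complex fps \<Rightarrow> complex fps" where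
  "bracket r q z \<psi> \<phi> =
     (\<Sum>(h, \<nu>, i)\<in>{(h, \<nu>, i). h + \<nu> + i + 1 = r}.
        ((\<lambda>g. - D_germ z g) ^^ h) (fps_expansion (q \<nu>) z * \<psi>) * (D_germ z ^^ i) \<phi>)"


section \<open>Rational structures\<close>

definition complex_subfield :: "complex set \<Rightarrow> bool" where
  "complex_subfield K \<longleftrightarrow> 0 \<in> K \<and> 1 \<in> K \<and>
     (\<forall>x\<in>K. \<forall>y\<in>K. x + y \<in> K \<and> x * y \<in> K) \<and> (\<forall>x\<in>K. - x \<in> K \<and> inverse x \<in> K)"

abbreviation germ_scale :: "complex \<Rightarrow> complex fps \<Rightarrow> complex fps" where
  "germ_scale \<equiv> (\<lambda>c f. fps_const c * f)"

definition span_over :: "complex set \<Rightarrow> complex fps set \<Rightarrow> complex fps set" where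
  "span_over K B = {(\<Sum>b\<in>A. germ_scale (k b) b) | A k. finite A \<and> A \<subseteq> B \<and> k ` A \<subseteq> K}"

text \<open>
  \<open>W\<^sub>K\<close> is a \<open>K\<close>-form of the complex vector space \<open>W\<close>: extending scalars from \<open>K\<close> to the
  complex numbers turns \<open>W\<^sub>K\<close> into \<open>W\<close>.
\<close>

definition rational_structure ::
    "complex set \<Rightarrow> complex fps set \<Rightarrow> complex fps set \<Rightarrow> bool" where
  "rational_structure K W WK \<longleftrightarrow>
     (\<exists>B. \<not> module.dependent germ_scale B \<and> module.span germ_scale B = W \<and> WK = span_over K B)"

definition dual_structure ::
    "nat \<Rightarrow> (nat \<Rightarrow> complex \<Rightarrow> complex) \<Rightarrow> complex \<Rightarrow> complex set \<Rightarrow> complex fps set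
       \<Rightarrow> complex fps set" where
  "dual_structure r q z K SolK =
     {\<psi> \<in> Sol_adj r q z. \<forall>\<phi>\<in>SolK. \<exists>k\<in>K. bracket r q z \<psi> \<phi> = fps_const k}"


section \<open>Frobenius functions and Frobenius constants\<close>

text \<open>\<open>p\<^sub>j\<close> in the expansion of \<open>L\<close> at \<open>t = 0\<close> as the sum of the operators \<open>t\<^sup>j p\<^sub>j(D)\<close>.\<close>

definition D_poly :: "nat \<Rightarrow> (nat \<Rightarrow> complex \<Rightarrow> complex) \<Rightarrow> nat \<Rightarrow> complex poly" where
  "D_poly r q j = (\<Sum>i\<le>r. monom (fps_nth (fps_expansion (q i) 0) j) (r - i))"

definition indicial_poly :: "nat \<Rightarrow> (nat \<Rightarrow> complex \<Rightarrow> complex) \<Rightarrow> complex poly" where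
  "indicial_poly r q = D_poly r q 0"

definition exponent_set :: "nat \<Rightarrow> (nat \<Rightarrow> complex \<Rightarrow> complex) \<Rightarrow> complex set" where
  "exponent_set r q = {\<rho>. poly (indicial_poly r q) \<rho> = 0 \<and>
     (\<forall>n::nat. n \<ge> 1 \<longrightarrow> poly (indicial_poly r q) (\<rho> + of_nat n) \<noteq> 0)}"

text \<open>
  The rational functions \<open>a\<^sub>n\<close>, as functions. Where \<open>indicial_poly\<close> vanishes at \<open>s + m\<close> for some
  \<open>1 \<le> m \<le> n\<close> the value is meaningless; this never happens for \<open>s\<close> near an element of
  \<open>exponent_set\<close>, where alone \<open>a\<^sub>n\<close> is used.
\<close>

fun frob_coeff :: "nat \<Rightarrow> (nat \<Rightarrow> complex \<Rightarrow> complex) \<Rightarrow> nat \<Rightarrow> complex \<Rightarrow> complex" where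
  "frob_coeff r q n s =
     (if n = 0 then 1
      else - (\<Sum>j\<in>{1..n}. poly (D_poly r q j) (of_nat (n - j) + s) * frob_coeff r q (n - j) s)
             / poly (D_poly r q 0) (of_nat n + s))"

declare frob_coeff.simps [simp del]

text \<open>The Frobenius function \<open>\<phi>\<^sub>\<rho>\<^sub>,\<^sub>k\<close> as a function of \<open>l = log t\<close>.\<close>

definition frobenius_log ::
    "nat \<Rightarrow> (nat \<Rightarrow> complex \<Rightarrow> complex) \<Rightarrow> complex \<Rightarrow> nat \<Rightarrow> complex \<Rightarrow> complex" where
  "frobenius_log r q \<rho> k l =
     (\<Sum>j\<le>k. l ^ j / fact j *
        (\<Sum>n. (deriv ^^ (k - j)) (frob_coeff r q n) \<rho> / fact (k - j) * exp ((of_nat n + \<rho>) * l)))"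

definition frobenius_germ_near_0 ::
    "nat \<Rightarrow> (nat \<Rightarrow> complex \<Rightarrow> complex) \<Rightarrow> complex \<Rightarrow> nat \<Rightarrow> complex \<Rightarrow> complex \<Rightarrow> complex fps" where
  "frobenius_germ_near_0 r q \<rho> k z l =
     fps_expansion (\<lambda>t. frobenius_log r q \<rho> k (log_branch z l t)) z"

text \<open>
  The germ of the Frobenius function at \<open>\<gamma> \<tau>\<close>: its germ at \<open>\<gamma> u\<close> for small \<open>u > 0\<close> is given by the
  series, with \<open>lg u\<close> as the value of \<open>log (\<gamma> u)\<close>, and is continued along \<open>\<gamma>\<close> from \<open>u\<close> to \<open>\<tau>\<close>.
\<close>

definition frobenius_function ::
    "nat \<Rightarrow> (nat \<Rightarrow> complex \<Rightarrow> complex) \<Rightarrow> (real \<Rightarrow> complex) \<Rightarrow> (real \<Rightarrow> complex) \<Rightarrow> real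
       \<Rightarrow> complex \<Rightarrow> nat \<Rightarrow> complex fps" where
  "frobenius_function r q \<gamma> lg \<tau> \<rho> k =
     (THE f. \<forall>\<^sub>F u in at_right 0.
        continue (subpath u \<tau> \<gamma>) (frobenius_germ_near_0 r q \<rho> k (\<gamma> u) (lg u)) 1 = f)"

definition frobenius_constant ::
    "nat \<Rightarrow> (nat \<Rightarrow> complex \<Rightarrow> complex) \<Rightarrow> (real \<Rightarrow> complex) \<Rightarrow> (real \<Rightarrow> complex) \<Rightarrow> real
       \<Rightarrow> (real \<Rightarrow> complex) \<Rightarrow> complex fps \<Rightarrow> complex \<Rightarrow> nat \<Rightarrow> complex" where
  "frobenius_constant r q \<gamma> lg \<tau> \<sigma>\<^sub>c \<delta> \<rho> n =
     (THE k. let \<phi> = frobenius_function r q \<gamma> lg \<tau> \<rho> n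
             in monodromy \<sigma>\<^sub>c \<phi> - \<phi> = germ_scale k \<delta>)"


section \<open>Reflection points\<close>

definition variation_image :: "(real \<Rightarrow> complex) \<Rightarrow> complex fps set \<Rightarrow> complex fps set" where
  "variation_image \<sigma> W = (\<lambda>f. monodromy \<sigma> f - f) ` W"

definition reflection_point :: "(real \<Rightarrow> complex) \<Rightarrow> complex fps set \<Rightarrow> bool" where
  "reflection_point \<sigma> W \<longleftrightarrow> vector_space.dim germ_scale (variation_image \<sigma> W) = 1"

text \<open>
  Here \<open>E\<close> is a disk around \<open>c\<close> containing \<open>p\<close> and no singular point besides \<open>c\<close>, and \<open>\<sigma>\<close> is a
  loop around \<open>c\<close> in \<open>E - {c}\<close> based at \<open>p\<close>. A \<open>\<sigma>\<close>-invariant solution is single-valued on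
  \<open>E - {c}\<close>, so it is analytic at \<open>c\<close> iff it is the germ of a holomorphic function on \<open>E\<close>.
\<close>

definition special_reflection_point ::
    "nat \<Rightarrow> (nat \<Rightarrow> complex \<Rightarrow> complex) \<Rightarrow> complex set \<Rightarrow> complex \<Rightarrow> (real \<Rightarrow> complex) \<Rightarrow> bool" where
  "special_reflection_point r q E p \<sigma> \<longleftrightarrow>
     reflection_point \<sigma> (Sol r q p) \<and>
     (\<forall>\<psi>\<in>Sol_adj r q p. monodromy \<sigma> \<psi> = \<psi> \<longrightarrow>
        (\<exists>g. g holomorphic_on E \<and> fps_expansion g p = \<psi>))"

definition annihilates :: "complex poly \<Rightarrow> (real \<Rightarrow> complex) \<Rightarrow> complex fps set \<Rightarrow> bool" where
  "annihilates R \<sigma> W \<longleftrightarrow>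
     (\<forall>f\<in>W. (\<Sum>i\<le>degree R. germ_scale (coeff R i) ((monodromy \<sigma> ^^ i) f)) = 0)"

definition minimal_annihilator ::
    "complex set \<Rightarrow> (real \<Rightarrow> complex) \<Rightarrow> complex fps set \<Rightarrow> complex poly \<Rightarrow> bool" where
  "minimal_annihilator K \<sigma> W R \<longleftrightarrow>
     is_arg_min degree (\<lambda>P. P \<noteq> 0 \<and> (\<forall>i. coeff P i \<in> K) \<and> annihilates P \<sigma> W) R"


section \<open>Homology with twisted coefficients and gamma functions\<close>

definition exp_laurent :: "complex set \<Rightarrow> (complex \<Rightarrow> complex) set" where
  "exp_laurent K =
     {(\<lambda>s. \<Sum>n\<in>N. k n * exp (2 * pi * \<i> * s * of_int n)) | (N :: int set) k. finite N \<and> k ` N \<subseteq> K}"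

text \<open>
  The tensor product of \<open>A\<close> with \<open>exp_laurent K\<close> over \<open>K\<close>, realised as germ-valued functions of
  \<open>s\<close>; no information is lost, the functions \<open>exp (2 * pi * \<i> * s * n)\<close> being linearly independent.
\<close>

definition twisted_module :: "complex fps set \<Rightarrow> (complex \<Rightarrow> complex fps) set" where
  "twisted_module A =
     {(\<lambda>s. \<Sum>n\<in>N. germ_scale (exp (2 * pi * \<i> * s * of_int n)) (\<psi> n)) | (N :: int set) \<psi>.
        finite N \<and> \<psi> ` N \<subseteq> A}"

definition twisted_action ::
    "(real \<Rightarrow> complex) \<Rightarrow> (complex \<Rightarrow> complex fps) \<Rightarrow> complex \<Rightarrow> complex fps" where
  "twisted_action \<sigma> m =
     (\<lambda>s. germ_scale (exp (2 * pi * \<i> * s * winding_number \<sigma> 0)) (monodromy \<sigma> (m s)))"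

text \<open>
  Group homology of the fundamental group of \<open>V\<close> via the bar complex. Chains are formal sums of
  piecewise smooth loops with coefficients in the twisted module, and the passage to homotopy
  classes of loops is part of the boundary relations. The loop \<open>\<sigma> +++ \<tau>\<close> runs through \<open>\<sigma>\<close>
  first and so acts as \<open>\<sigma>\<close> followed by \<open>\<tau>\<close>.
\<close>

type_synonym chain = "(real \<Rightarrow> complex) \<Rightarrow> complex \<Rightarrow> complex fps"

definition based_loops :: "complex set \<Rightarrow> complex \<Rightarrow> (real \<Rightarrow> complex) set" where
  "based_loops V p =
     {\<sigma>. valid_path \<sigma> \<and> path_image \<sigma> \<subseteq> V \<and> pathstart \<sigma> = p \<and> pathfinish \<sigma> = p}"

definition chain_support :: "chain \<Rightarrow> (real \<Rightarrow> complex) set" where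
  "chain_support x = {\<sigma>. x \<sigma> \<noteq> 0}"

definition chains1 :: "complex set \<Rightarrow> complex \<Rightarrow> (complex \<Rightarrow> complex fps) set \<Rightarrow> chain set" where
  "chains1 V p M =
     {x. finite (chain_support x) \<and> chain_support x \<subseteq> based_loops V p \<and> range x \<subseteq> M}"

definition cycles1 :: "complex set \<Rightarrow> complex \<Rightarrow> (complex \<Rightarrow> complex fps) set \<Rightarrow> chain set" where
  "cycles1 V p M =
     {x \<in> chains1 V p M. (\<Sum>\<sigma>\<in>chain_support x. twisted_action \<sigma> (x \<sigma>) - x \<sigma>) = 0}"

definition single :: "(real \<Rightarrow> complex) \<Rightarrow> (complex \<Rightarrow> complex fps) \<Rightarrow> chain" where
  "single \<sigma> m = (\<lambda>\<tau>. if \<tau> = \<sigma> then m else 0)"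

inductive_set boundaries1 ::
    "complex set \<Rightarrow> complex \<Rightarrow> (complex \<Rightarrow> complex fps) set \<Rightarrow> chain set"
  for V :: "complex set" and p :: complex and M :: "(complex \<Rightarrow> complex fps) set" where
  homotopy: "\<lbrakk>\<sigma> \<in> based_loops V p; \<tau> \<in> based_loops V p; homotopic_paths V \<sigma> \<tau>; m \<in> M\<rbrakk>
     \<Longrightarrow> single \<sigma> m - single \<tau> m \<in> boundaries1 V p M"
| bar: "\<lbrakk>\<sigma> \<in> based_loops V p; \<tau> \<in> based_loops V p; m \<in> M\<rbrakk>
     \<Longrightarrow> single \<sigma> m + single \<tau> (twisted_action \<sigma> m) - single (\<sigma> +++ \<tau>) m \<in> boundaries1 V p M"
| zero: "0 \<in> boundaries1 V p M"
| diff: "\<lbrakk>x \<in> boundaries1 V p M; y \<in> boundaries1 V p M\<rbrakk> \<Longrightarrow> x - y \<in> boundaries1 V p M"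

definition H1 :: "complex set \<Rightarrow> complex \<Rightarrow> (complex \<Rightarrow> complex fps) set \<Rightarrow> chain set set" where
  "H1 V p M = (\<lambda>x. (+) x ` boundaries1 V p M) ` cycles1 V p M"

definition gamma_chain :: "complex \<Rightarrow> complex \<Rightarrow> chain \<Rightarrow> complex \<Rightarrow> complex" where
  "gamma_chain p l x s =
     (\<Sum>\<sigma>\<in>chain_support x. germ_integral \<sigma> (x \<sigma> s * power_germ p l (s - 1)))"

text \<open>The value does not depend on the representative.\<close>

definition gamma_function :: "complex \<Rightarrow> complex \<Rightarrow> chain set \<Rightarrow> complex \<Rightarrow> complex" where
  "gamma_function p l \<xi> = gamma_chain p l (SOME x. x \<in> \<xi>)"

end

theory Submission
  imports Defs
begin

text \<open>
  Write \<open>\<phi>(s)\<close> for the formal power series \<open>\<Sum>k. \<phi>\<^sub>\<rho>\<^sub>,\<^sub>k (s - \<rho>)\<^sup>k\<close> of germs at \<open>p\<close>. The recursion for the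
  \<open>a\<^sub>n\<close> says \<open>L \<phi>(s) = I(s) t\<^sup>s\<close>, so for a solution \<open>\<psi>\<close> of the adjoint equation Lagrange's identity
  gives \<open>D {\<psi>, \<phi>(s)} = I(s) \<psi> t\<^sup>s\<close>, and integration along a loop \<open>\<sigma>\<close> gives
  \<open>I(s) \<integral>\<^sub>\<sigma> \<psi> t\<^sup>s\<^sup>-\<^sup>1 dt = {\<sigma> \<psi>, \<sigma> \<phi>(s)} - {\<psi>, \<phi>(s)}\<close>. Here \<open>\<sigma>\<^sub>0 \<phi>(s) = e\<^sup>2\<^sup>\<pi>\<^sup>i\<^sup>s \<phi>(s)\<close> and
  \<open>\<sigma>\<^sub>c \<phi>(s) = \<phi>(s) + \<kappa>(s) \<delta>\<close>, the latter because \<open>\<sigma>\<^sub>c \<phi>(s) - \<phi>(s)\<close> is orthogonal to the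
  \<open>\<sigma>\<^sub>c\<close>-invariant \<open>\<psi>\<close>, which are analytic at \<open>c\<close>. For a cycle with \<open>\<sigma>\<^sub>c\<close>-component \<open>m\<^sub>c\<close> all
  boundary terms cancel except \<open>\<kappa>(s) \<beta>(m\<^sub>c)\<close>, where \<open>\<beta>(\<psi>) = {\<sigma>\<^sub>c \<psi>, \<delta>}\<close>.

  Every class is carried by the generators \<open>\<sigma>\<^sub>0\<close> and \<open>\<sigma>\<^sub>c\<close> of the fundamental group of \<open>V\<close>, and the
  cycle equation, read as a recursion for the coefficients of the \<open>\<sigma>\<^sub>0\<close>-component, says that
  \<open>\<beta>(m\<^sub>c)\<close>, as a Laurent polynomial, annihilates the image of \<open>\<sigma>\<^sub>c - 1\<close> when \<open>e\<^sup>-\<^sup>2\<^sup>\<pi>\<^sup>i\<^sup>s\<close> is replaced by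
  \<open>\<sigma>\<^sub>0\<close>. Hence it is a multiple of \<open>R\<close>, and a cycle with \<open>\<beta>(m\<^sub>c) = R\<close> generates.
\<close>

section \<open>Germs\<close>

text \<open>The identities at \<open>s = \<rho>\<close> are proved between formal power series in
  \<open>s - \<rho>\<close>, because convergence of the series of Frobenius constants is not known
  beforehand. It is read off at the end: \<open>I(s)\<close> times the gamma function is analytic,
  \<open>R\<close> at \<open>exp (- 2 pi i s)\<close> is analytic and not identically zero, and a
  quotient of such expansions that is a power series converges.

  The generating cycle comes from polynomial division. With \<open>x = exp (- 2 pi i s)\<close>, its
  \<sigma>0-component is \<open>x\<close> times the quotient of \<open>R(T) - R(x)\<close> by
  \<open>T - x\<close>, evaluated at \<open>T = \<sigma>0\<close> on a generator \<open>eps\<close>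
  of the image of the variation. As \<open>R(\<sigma>0)\<close> kills \<open>eps\<close>, its
  boundary is \<open>- R(x) eps\<close>, which the \<sigma>c-component cancels.

  Two obstacles shape the proof. Continuation is a definite description, so existence and uniqueness
  must precede every rule for it. And \<sigma>0, \<sigma>c are only continuous, whereas chains
  consist of piecewise smooth loops; hence integrals are treated as increments of continued
  primitives, which are homotopy invariant.\<close>

lemma fps_expansion_eqI_shift:
  assumes "(\<lambda>x. f (z + x)) has_fps_expansion F"
  shows "fps_expansion f z = F"
proof -
  have "fps_expansion f z = fps_expansion (f \<circ> (\<lambda>x. z + x)) 0"
    by (simp add: fps_expansion_def higher_deriv_shift_0')
  then show ?thesis using fps_expansion_eqI[OF assms] by (simp add: o_def)
qed

lemma has_fps_expansion_at:
  assumes "f holomorphic_on A" "open A" "z \<in> A"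
  shows "(\<lambda>x. f (z + x)) has_fps_expansion fps_expansion f z"
  using assms analytic_at analytic_at_imp_has_fps_expansion by blast

lemma conv_radius_fps_expansion_pos:
  assumes "f holomorphic_on A" "open A" "z \<in> A"
  shows "fps_conv_radius (fps_expansion f z) > 0"
  using has_fps_expansion_at[OF assms] by (simp add: has_fps_expansion_def)

lemma fps_expansion_const: "fps_expansion (\<lambda>t. c) z = fps_const c"
  by (rule fps_expansion_eqI_shift) (intro fps_expansion_intros)

lemma fps_expansion_ident: "fps_expansion (\<lambda>t. t) z = fps_const z + fps_X"
  by (rule fps_expansion_eqI_shift) (intro fps_expansion_intros)

lemma fps_expansion_deriv: "fps_expansion (deriv f) z = fps_deriv (fps_expansion f z)"
proof (rule fps_ext)
  fix n
  have "(deriv ^^ n) (deriv f) z = (deriv ^^ Suc n) f z" by (simp add: funpow_swap1)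
  moreover have "1 + of_nat n \<noteq> (0::complex)" using of_nat_neq_0[of n] by simp
  ultimately show "fps_nth (fps_expansion (deriv f) z) n = fps_nth (fps_deriv (fps_expansion f z)) n"
    by (simp add: fps_expansion_def divide_simps del: funpow.simps)
qed

lemma fps_expansion_nth_0: "fps_nth (fps_expansion f z) 0 = f z"
  by (simp add: fps_expansion_def)

context
  fixes A :: "complex set" and z assumes A: "open A" "z \<in> A"
begin

lemma fps_expansion_add:
  "f holomorphic_on A \<Longrightarrow> g holomorphic_on A \<Longrightarrow>
     fps_expansion (\<lambda>t. f t + g t) z = fps_expansion f z + fps_expansion g z"
  by (rule fps_expansion_eqI_shift) (intro fps_expansion_intros has_fps_expansion_at[OF _ A])

lemma fps_expansion_diff:
  "f holomorphic_on A \<Longrightarrow> g holomorphic_on A \<Longrightarrow>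
     fps_expansion (\<lambda>t. f t - g t) z = fps_expansion f z - fps_expansion g z"
  by (rule fps_expansion_eqI_shift) (intro fps_expansion_intros has_fps_expansion_at[OF _ A])

lemma fps_expansion_uminus:
  "f holomorphic_on A \<Longrightarrow> fps_expansion (\<lambda>t. - f t) z = - fps_expansion f z"
  by (rule fps_expansion_eqI_shift) (intro fps_expansion_intros has_fps_expansion_at[OF _ A])

lemma fps_expansion_mult:
  "f holomorphic_on A \<Longrightarrow> g holomorphic_on A \<Longrightarrow>
     fps_expansion (\<lambda>t. f t * g t) z = fps_expansion f z * fps_expansion g z"
  by (rule fps_expansion_eqI_shift) (intro fps_expansion_intros has_fps_expansion_at[OF _ A])

lemma fps_expansion_sum:
  "(\<And>i. i \<in> N \<Longrightarrow> f i holomorphic_on A) \<Longrightarrow>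
     fps_expansion (\<lambda>t. \<Sum>i\<in>N. f i t) z = (\<Sum>i\<in>N. fps_expansion (f i) z)"
  by (rule fps_expansion_eqI_shift) (intro fps_expansion_intros has_fps_expansion_at[OF _ A])

end

lemma fps_expansion_eq_on:
  assumes "open A" "z \<in> A" "\<And>t. t \<in> A \<Longrightarrow> f t = g t"
  shows "fps_expansion f z = fps_expansion g z"
  by (rule fps_expansion_cong) (use assms in \<open>auto simp: eventually_nhds\<close>)

text \<open>Equal Taylor series at \<open>w\<close> give equality on a ball around \<open>w\<close>,
  and connectedness of \<open>A\<close> carries it to every \<open>z\<close>.\<close>

lemma fps_expansion_identity:
  assumes "f holomorphic_on A" "g holomorphic_on A" "open A" "connected A" "w \<in> A"
    and "fps_expansion f w = fps_expansion g w" and "z \<in> A"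
  shows "f z = g z"
proof -
  have "eventually (\<lambda>x. eval_fps (fps_expansion f w) x = f (w + x)) (nhds 0)"
       "eventually (\<lambda>x. eval_fps (fps_expansion g w) x = g (w + x)) (nhds 0)"
    using has_fps_expansion_at[OF assms(1,3,5)] has_fps_expansion_at[OF assms(2,3,5)]
    by (auto simp: has_fps_expansion_def)
  then have "eventually (\<lambda>x. f (w + x) = g (w + x)) (nhds 0)"
    by eventually_elim (use assms(6) in auto)
  then obtain e where e: "e > 0" "\<And>x. dist x 0 < e \<Longrightarrow> f (w + x) = g (w + x)"
    by (auto simp: eventually_nhds_metric)
  have eq: "f x = g x" if "x \<in> ball w e" for x
    using e(2)[of "x - w"] that by (auto simp: dist_norm norm_minus_commute)
  show ?thesis
    by (rule analytic_continuation_open[of "ball w e \<inter> A" A f g])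
       (use assms e eq centre_in_ball[of w e] in \<open>auto simp del: centre_in_ball mem_ball\<close>)
qed

abbreviation germ_fun :: "complex \<Rightarrow> complex fps \<Rightarrow> complex \<Rightarrow> complex" where
  "germ_fun z f \<equiv> (\<lambda>t. eval_fps f (t - z))"

lemma germ_fun_holomorphic:
  assumes "ereal R \<le> fps_conv_radius f"
  shows "germ_fun z f holomorphic_on ball z R"
proof -
  have "ereal (norm (t - z)) < fps_conv_radius f" if "t \<in> ball z R" for t
    using that by (intro less_le_trans[OF _ assms]) (simp add: dist_norm norm_minus_commute)
  then show ?thesis
    by (intro holomorphic_on_compose_gen[of "\<lambda>t. t - z" _ "eval_fps f" "eball 0 (fps_conv_radius f)", unfolded o_def]
          holomorphic_intros) auto
qed

lemma fps_expansion_germ_fun: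
  "fps_conv_radius f > 0 \<Longrightarrow> fps_expansion (germ_fun z f) z = f"
  by (rule fps_expansion_eqI_shift) (simp add: eval_fps_has_fps_expansion)

lemma germ_fun_fps_expansion:
  assumes "f holomorphic_on ball z R" "t \<in> ball z R"
  shows "germ_fun z (fps_expansion f z) t = f t"
  using eval_fps_expansion[of f z "ereal R" t] assms by auto

lemma conv_radius_fps_expansion_ball:
  "f holomorphic_on ball z R \<Longrightarrow> fps_conv_radius (fps_expansion f z) \<ge> ereal R"
  using conv_radius_fps_expansion[of f z "ereal R"] by auto

section \<open>Analytic continuation over sets of parameters\<close>

text \<open>
  A variant of \<^const>\<open>continuation_along\<close> over an arbitrary parameter set and with local
  representatives that are not centred at \<open>g u\<close>; this form is stable under gluing and under
  algebraic operations.
\<close>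

definition continuation_on ::
    "real set \<Rightarrow> (real \<Rightarrow> complex) \<Rightarrow> (real \<Rightarrow> complex fps) \<Rightarrow> bool" where
  "continuation_on I g F \<longleftrightarrow> continuous_on I g \<and>
     (\<forall>u\<in>I. \<exists>h d. d > 0 \<and> h holomorphic_on ball (g u) d \<and>
        (\<forall>\<^sub>F v in nhds u. v \<in> I \<longrightarrow> F v = fps_expansion h (g v)))"

lemma continuous_on_nhds_ball:
  fixes g :: "real \<Rightarrow> complex"
  assumes "continuous_on I g" "u \<in> I" "d > 0"
  shows "\<forall>\<^sub>F v in nhds u. v \<in> I \<longrightarrow> g v \<in> ball (g u) d"
proof -
  obtain e where "e > 0" "\<And>v. v \<in> I \<Longrightarrow> dist v u < e \<Longrightarrow> dist (g v) (g u) < d"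
    using assms unfolding continuous_on_iff by metis
  then show ?thesis by (auto simp: eventually_nhds_metric dist_commute)
qed

text \<open>The radius \<open>d'\<close> is arbitrary by continuity of \<open>g\<close>; this lets
  two continuations with different local representatives be compared on a common smaller ball around
  \<open>g u\<close>.\<close>

lemma continuation_onD:
  assumes "continuation_on I g F" "u \<in> I"
  shows "\<exists>h d. d > 0 \<and> h holomorphic_on ball (g u) d \<and> F u = fps_expansion h (g u) \<and>
    (\<forall>d'>0. \<forall>\<^sub>F v in nhds u. v \<in> I \<longrightarrow> g v \<in> ball (g u) d' \<and> F v = fps_expansion h (g v))"
proof -
  obtain h d where *: "d > 0" "h holomorphic_on ball (g u) d"
    "\<forall>\<^sub>F v in nhds u. v \<in> I \<longrightarrow> F v = fps_expansion h (g v)"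
    using assms unfolding continuation_on_def by blast
  have g: "continuous_on I g" using assms(1) by (simp add: continuation_on_def)
  have "\<forall>\<^sub>F v in nhds u. v \<in> I \<longrightarrow> g v \<in> ball (g u) d' \<and> F v = fps_expansion h (g v)" if "0 < d'" for d'
    using continuous_on_nhds_ball[OF g assms(2) that] *(3) by eventually_elim blast
  moreover have "F u = fps_expansion h (g u)"
    using eventually_nhds_x_imp_x[OF *(3)] assms(2) by blast
  ultimately show ?thesis using * by blast
qed

lemma continuation_on_conv_radius:
  assumes "continuation_on I g F" "u \<in> I" shows "fps_conv_radius (F u) > 0"
proof -
  obtain h d where *: "d > 0" "h holomorphic_on ball (g u) d" "F u = fps_expansion h (g u)"
    "\<forall>d'>0. \<forall>\<^sub>F v in nhds u. v \<in> I \<longrightarrow> g v \<in> ball (g u) d' \<and> F v = fps_expansion h (g v)"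
    using continuation_onD[OF assms] by blast
  then show ?thesis using conv_radius_fps_expansion_pos[OF *(2), of "g u"] by auto
qed

lemma continuation_on_subset:
  assumes "continuation_on I g F" "J \<subseteq> I"
  shows "continuation_on J g F"
  unfolding continuation_on_def
proof (intro conjI ballI)
  show "continuous_on J g" using assms by (auto simp: continuation_on_def intro: continuous_on_subset)
  fix u assume "u \<in> J"
  then obtain h d where *: "d > 0" "h holomorphic_on ball (g u) d"
      "(\<forall>\<^sub>F v in nhds u. v \<in> I \<longrightarrow> F v = fps_expansion h (g v))"
    using assms unfolding continuation_on_def by blast
  have "\<forall>\<^sub>F v in nhds u. v \<in> J \<longrightarrow> F v = fps_expansion h (g v)"
    using *(3) by eventually_elim (use assms in blast)
  then show "\<exists>h d. d > 0 \<and> h holomorphic_on ball (g u) d \<and>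
       (\<forall>\<^sub>F v in nhds u. v \<in> J \<longrightarrow> F v = fps_expansion h (g v))"
    using * by blast
qed

lemma continuation_on_cong:
  assumes "continuation_on I g F" "\<And>u. u \<in> I \<Longrightarrow> g u = g' u" "\<And>u. u \<in> I \<Longrightarrow> F u = F' u"
  shows "continuation_on I g' F'"
proof -
  have "continuous_on I g'"
    by (rule continuous_on_eq[of I g]) (use assms in \<open>auto simp: continuation_on_def\<close>)
  moreover have "\<exists>h d. d > 0 \<and> h holomorphic_on ball (g' u) d \<and>
        (\<forall>\<^sub>F v in nhds u. v \<in> I \<longrightarrow> F' v = fps_expansion h (g' v))" if u: "u \<in> I" for u
  proof -
    obtain h d where *: "d > 0" "h holomorphic_on ball (g u) d"
      "(\<forall>\<^sub>F v in nhds u. v \<in> I \<longrightarrow> F v = fps_expansion h (g v))"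
      using assms(1) u unfolding continuation_on_def by blast
    have "\<forall>\<^sub>F v in nhds u. v \<in> I \<longrightarrow> F' v = fps_expansion h (g' v)"
      using *(3) by eventually_elim (use assms(2,3) in auto)
    then show ?thesis using * assms(2)[OF u] by auto
  qed
  ultimately show ?thesis by (auto simp: continuation_on_def)
qed

text \<open>On a ball around \<open>g u\<close> the Taylor series of \<open>F u\<close> sums to any
  holomorphic representative of it, so re-centring a representative at \<open>g u\<close> does not
  change its germs.\<close>

lemma continuation_along_iff:
  assumes "path g"
  shows "continuation_along g F \<longleftrightarrow> continuation_on {0..1} g F"
proof
  assume L: "continuation_along g F"
  have "\<exists>h d. d > 0 \<and> h holomorphic_on ball (g u) d \<and>
        (\<forall>\<^sub>F v in nhds u. v \<in> {0..1} \<longrightarrow> F v = fps_expansion h (g v))" if u: "u \<in> {0..1}" for u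
  proof -
    have *: "fps_conv_radius (F u) > 0"
      "\<forall>\<^sub>F v in at u within {0..1}. F v = fps_expansion (germ_fun (g u) (F u)) (g v)"
      using L u by (auto simp: continuation_along_def)
    obtain d where d: "0 < ereal d" "ereal d < fps_conv_radius (F u)"
      using ereal_dense2[OF *(1)] by auto
    have "\<forall>\<^sub>F v in nhds u. v \<in> {0..1} \<longrightarrow> F v = fps_expansion (germ_fun (g u) (F u)) (g v)"
      using *(2) unfolding eventually_at_filter
      by eventually_elim (use fps_expansion_germ_fun[OF *(1), of "g u"] in auto)
    moreover have "germ_fun (g u) (F u) holomorphic_on ball (g u) d" "d > 0"
      using d germ_fun_holomorphic[of d "F u" "g u"] by auto
    ultimately show ?thesis by blast
  qed
  then show "continuation_on {0..1} g F"
    using assms by (auto simp: continuation_on_def path_def)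
next
  assume R: "continuation_on {0..1} g F"
  show "continuation_along g F"
    unfolding continuation_along_def
  proof (intro ballI conjI)
    fix u :: real assume u: "u \<in> {0..1}"
    show "fps_conv_radius (F u) > 0" by (rule continuation_on_conv_radius[OF R u])
    obtain h d where *: "d > 0" "h holomorphic_on ball (g u) d" "F u = fps_expansion h (g u)"
      "\<forall>d'>0. \<forall>\<^sub>F v in nhds u. v \<in> {0..1} \<longrightarrow> g v \<in> ball (g u) d' \<and> F v = fps_expansion h (g v)"
      using continuation_onD[OF R u] by blast
    note Fu = *(3)
    have G: "fps_expansion (germ_fun (g u) (F u)) w = fps_expansion h w" if "w \<in> ball (g u) d" for w
      by (rule fps_expansion_eq_on[of "ball (g u) d"])
         (use that Fu germ_fun_fps_expansion[OF *(2)] in auto)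
    show "\<forall>\<^sub>F v in at u within {0..1}. F v = fps_expansion (germ_fun (g u) (F u)) (g v)"
      using *(4)[rule_format, OF *(1)] unfolding eventually_at_filter by eventually_elim (use G in auto)
  qed
qed

text \<open>Near each parameter both families come from holomorphic functions on one ball. Agreement
  of the germs at a single nearby parameter makes these functions equal, so agreement spreads
  locally and then over the connected set \<open>I\<close>. This is what makes the definite
  description in \<open>continue\<close> well defined.\<close>

lemma continuation_on_unique:
  assumes F: "continuation_on I g F" and G: "continuation_on I g G" and I: "connected I"
    and "a \<in> I" "F a = G a" "b \<in> I"
  shows "F b = G b"
proof (rule connected_induction_simple[OF I \<open>a \<in> I\<close> \<open>b \<in> I\<close>, of "\<lambda>u. F u = G u"])
  fix u assume u: "u \<in> I"
  obtain h d where h: "d > 0" "h holomorphic_on ball (g u) d" "F u = fps_expansion h (g u)"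
    "\<forall>d'>0. \<forall>\<^sub>F v in nhds u. v \<in> I \<longrightarrow> g v \<in> ball (g u) d' \<and> F v = fps_expansion h (g v)"
    using continuation_onD[OF F u] by blast
  obtain k e where k: "e > 0" "k holomorphic_on ball (g u) e" "G u = fps_expansion k (g u)"
    "\<forall>d'>0. \<forall>\<^sub>F v in nhds u. v \<in> I \<longrightarrow> g v \<in> ball (g u) d' \<and> G v = fps_expansion k (g v)"
    using continuation_onD[OF G u] by blast
  define m where "m = min d e"
  have m: "m > 0" "h holomorphic_on ball (g u) m" "k holomorphic_on ball (g u) m"
    using h k by (auto simp: m_def intro: holomorphic_on_subset)
  have "\<forall>\<^sub>F v in nhds u. v \<in> I \<longrightarrow> g v \<in> ball (g u) m \<and> F v = fps_expansion h (g v) \<and> G v = fps_expansion k (g v)"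
    using h(4)[rule_format, OF m(1)] k(4)[rule_format, OF m(1)] by eventually_elim auto
  then obtain T where T: "open T" "u \<in> T" "\<And>v. v \<in> T \<Longrightarrow> v \<in> I \<Longrightarrow>
     g v \<in> ball (g u) m \<and> F v = fps_expansion h (g v) \<and> G v = fps_expansion k (g v)"
    by (auto simp: eventually_nhds)
  have "F y = G y" if x: "x \<in> T \<inter> I" "y \<in> T \<inter> I" "F x = G x" for x y
  proof -
    have "h z = k z" if "z \<in> ball (g u) m" for z
      by (rule fps_expansion_identity[OF m(2,3) _ _ _ _ that, of "g x"]) (use x T in auto)
    moreover have "g y \<in> ball (g u) m" using x T by blast
    ultimately have "fps_expansion h (g y) = fps_expansion k (g y)"
      using fps_expansion_eq_on[OF open_ball] by blast
    then show ?thesis using T(3)[of y] x by simp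
  qed
  then show "\<exists>T. openin (top_of_set I) T \<and> u \<in> T \<and> (\<forall>x\<in>T. \<forall>y\<in>T. F x = G x \<longrightarrow> F y = G y)"
    using T(1,2) u by (intro exI[of _ "T \<inter> I"]) (metis IntI Int_commute openin_open_Int)
qed fact

lemma continue_eq:
  assumes "continuation_on {0..1} g F" "u \<in> {0..1}" "F 0 = f"
  shows "continue g f u = F u"
proof -
  have p: "path g" using assms(1) by (simp add: continuation_on_def path_def)
  show ?thesis unfolding continue_def
  proof (rule the_equality)
    show "\<exists>G. continuation_along g G \<and> G 0 = f \<and> G u = F u"
      using assms continuation_along_iff[OF p] by blast
    fix h assume "\<exists>G. continuation_along g G \<and> G 0 = f \<and> G u = h"
    then obtain G where G: "continuation_on {0..1} g G" "G 0 = f" "G u = h"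
      using continuation_along_iff[OF p] by blast
    show "h = F u"
      using continuation_on_unique[OF assms(1) G(1) _ _ _ assms(2), of 0] G assms(3) by simp
  qed
qed

lemma monodromy_eq:
  "continuation_on {0..1} g F \<Longrightarrow> F 0 = f \<Longrightarrow> monodromy g f = F 1"
  by (simp add: monodromy_def continue_eq)

subsection \<open>Operations on continuations\<close>

lemma continuation_on_holomorphic:
  assumes "h holomorphic_on A" "open A" "g ` I \<subseteq> A" "continuous_on I g"
  shows "continuation_on I g (\<lambda>u. fps_expansion h (g u))"
  unfolding continuation_on_def
proof (intro conjI ballI assms)
  fix u assume "u \<in> I"
  then have "g u \<in> A" using assms by auto
  then obtain d where "d > 0" "ball (g u) d \<subseteq> A" using assms openE by blast
  then show "\<exists>k d. d > 0 \<and> k holomorphic_on ball (g u) d \<and>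
        (\<forall>\<^sub>F v in nhds u. v \<in> I \<longrightarrow> fps_expansion h (g v) = fps_expansion k (g v))"
    using assms by (intro exI[of _ h] exI[of _ d]) (auto intro: holomorphic_on_subset)
qed

text \<open>One scheme for the pointwise rules: \<open>opf\<close> acts on local representatives and
  \<open>opg\<close> on germs. A unary operation such as the derivative is obtained by passing the
  same family twice.\<close>

lemma continuation_on_binop:
  assumes F: "continuation_on I g F" and G: "continuation_on I g G"
    and op_hol: "\<And>h k A. h holomorphic_on A \<Longrightarrow> k holomorphic_on A \<Longrightarrow> open A \<Longrightarrow> opf h k holomorphic_on A"
    and op_exp: "\<And>h k A z. h holomorphic_on A \<Longrightarrow> k holomorphic_on A \<Longrightarrow> open A \<Longrightarrow> z \<in> A \<Longrightarrow>
      fps_expansion (opf h k) z = opg z (fps_expansion h z) (fps_expansion k z)"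
  shows "continuation_on I g (\<lambda>u. opg (g u) (F u) (G u))"
  unfolding continuation_on_def
proof (intro conjI ballI)
  show "continuous_on I g" using F by (simp add: continuation_on_def)
  fix u assume u: "u \<in> I"
  obtain h d where h: "d > 0" "h holomorphic_on ball (g u) d" "F u = fps_expansion h (g u)"
    "\<forall>d'>0. \<forall>\<^sub>F v in nhds u. v \<in> I \<longrightarrow> g v \<in> ball (g u) d' \<and> F v = fps_expansion h (g v)"
    using continuation_onD[OF F u] by blast
  obtain k e where k: "e > 0" "k holomorphic_on ball (g u) e" "G u = fps_expansion k (g u)"
    "\<forall>d'>0. \<forall>\<^sub>F v in nhds u. v \<in> I \<longrightarrow> g v \<in> ball (g u) d' \<and> G v = fps_expansion k (g v)"
    using continuation_onD[OF G u] by blast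
  define m where "m = min d e"
  have m: "m > 0" "h holomorphic_on ball (g u) m" "k holomorphic_on ball (g u) m"
    using h k by (auto simp: m_def intro: holomorphic_on_subset)
  have "\<forall>\<^sub>F v in nhds u. v \<in> I \<longrightarrow> opg (g v) (F v) (G v) = fps_expansion (opf h k) (g v)"
    using h(4)[rule_format, OF m(1)] k(4)[rule_format, OF m(1)] by eventually_elim (use op_exp[OF m(2,3)] in auto)
  then show "\<exists>h d. d > 0 \<and> h holomorphic_on ball (g u) d \<and>
      (\<forall>\<^sub>F v in nhds u. v \<in> I \<longrightarrow> opg (g v) (F v) (G v) = fps_expansion h (g v))"
    using op_hol[OF m(2,3)] m by blast
qed

lemma continuation_on_add:
  "continuation_on I g F \<Longrightarrow> continuation_on I g G \<Longrightarrow> continuation_on I g (\<lambda>u. F u + G u)"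
  by (rule continuation_on_binop[where opf = "\<lambda>h k t. h t + k t" and opg = "\<lambda>_ x y. x + y"])
     (auto intro: holomorphic_intros fps_expansion_add)

lemma continuation_on_diff:
  "continuation_on I g F \<Longrightarrow> continuation_on I g G \<Longrightarrow> continuation_on I g (\<lambda>u. F u - G u)"
  by (rule continuation_on_binop[where opf = "\<lambda>h k t. h t - k t" and opg = "\<lambda>_ x y. x - y"])
     (auto intro: holomorphic_intros fps_expansion_diff)

lemma continuation_on_mult:
  "continuation_on I g F \<Longrightarrow> continuation_on I g G \<Longrightarrow> continuation_on I g (\<lambda>u. F u * G u)"
  by (rule continuation_on_binop[where opf = "\<lambda>h k t. h t * k t" and opg = "\<lambda>_ x y. x * y"])
     (auto intro: holomorphic_intros fps_expansion_mult)

lemma continuation_on_deriv: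
  "continuation_on I g F \<Longrightarrow> continuation_on I g (\<lambda>u. fps_deriv (F u))"
  by (rule continuation_on_binop[where opf = "\<lambda>h k. deriv h" and opg = "\<lambda>_ x y. fps_deriv x", of I g F F])
     (auto intro: holomorphic_deriv fps_expansion_deriv)

lemma continuation_on_const:
  "continuous_on I g \<Longrightarrow> continuation_on I g (\<lambda>u. fps_const c)"
  using continuation_on_holomorphic[of "\<lambda>_. c" UNIV g I] by (simp add: fps_expansion_const)

lemma continuation_on_scale:
  "continuation_on I g F \<Longrightarrow> continuation_on I g (\<lambda>u. fps_const c * F u)"
  by (intro continuation_on_mult continuation_on_const) (auto simp: continuation_on_def)

lemma continuation_on_sum:
  assumes "continuous_on I g" "\<And>i. i \<in> N \<Longrightarrow> continuation_on I g (F i)"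
  shows "continuation_on I g (\<lambda>u. \<Sum>i\<in>N. F i u)"
  using assms(2)
proof (induction N rule: infinite_finite_induct)
  case (insert x N)
  then show ?case by (simp add: continuation_on_add)
qed (use continuation_on_const[OF assms(1), of 0] in simp_all)

lemma continuation_on_reparam:
  assumes F: "continuation_on I g F" and th: "continuous_on J \<theta>" "\<theta> ` J \<subseteq> I"
  shows "continuation_on J (g \<circ> \<theta>) (F \<circ> \<theta>)"
  unfolding continuation_on_def
proof (intro conjI ballI)
  show "continuous_on J (g \<circ> \<theta>)"
    using F th by (intro continuous_on_compose) (auto simp: continuation_on_def intro: continuous_on_subset)
  fix u assume u: "u \<in> J"
  then have tu: "\<theta> u \<in> I" using th by auto
  obtain h d where h: "d > 0" "h holomorphic_on ball (g (\<theta> u)) d" "F (\<theta> u) = fps_expansion h (g (\<theta> u))"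
    "\<forall>d'>0. \<forall>\<^sub>F v in nhds (\<theta> u). v \<in> I \<longrightarrow> g v \<in> ball (g (\<theta> u)) d' \<and> F v = fps_expansion h (g v)"
    using continuation_onD[OF F tu] by blast
  obtain e where e: "e > 0" "\<And>v. dist v (\<theta> u) < e \<Longrightarrow> v \<in> I \<longrightarrow> F v = fps_expansion h (g v)"
    using h(4)[rule_format, OF h(1)] by (auto simp: eventually_nhds_metric)
  obtain e' where e': "e' > 0" "\<And>v. v \<in> J \<Longrightarrow> dist v u < e' \<Longrightarrow> dist (\<theta> v) (\<theta> u) < e"
    using th(1) u e(1) unfolding continuous_on_iff by metis
  have "\<forall>\<^sub>F v in nhds u. v \<in> J \<longrightarrow> (F \<circ> \<theta>) v = fps_expansion h ((g \<circ> \<theta>) v)"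
    using e e' th(2) by (auto simp: eventually_nhds_metric intro!: exI[of _ e'])
  then show "\<exists>h d. d > 0 \<and> h holomorphic_on ball ((g \<circ> \<theta>) u) d \<and>
       (\<forall>\<^sub>F v in nhds u. v \<in> J \<longrightarrow> (F \<circ> \<theta>) v = fps_expansion h ((g \<circ> \<theta>) v))"
    using h by auto
qed

lemma continuation_on_glue:
  fixes a b c :: real
  assumes F: "continuation_on (I \<inter> {..b}) g F" and G: "continuation_on (I \<inter> {b..}) g F" and I: "b \<in> I"
  shows "continuation_on I g F"
  unfolding continuation_on_def
proof (intro conjI ballI)
  have "I = (I \<inter> {..b}) \<union> (I \<inter> {b..})" by auto
  moreover have "closedin (top_of_set I) (I \<inter> {..b})" "closedin (top_of_set I) (I \<inter> {b..})"
    by (intro closedin_closed_Int; simp)+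
  ultimately have "continuous_on ((I \<inter> {..b}) \<union> (I \<inter> {b..})) (\<lambda>x. if True then g x else g x)"
    using F G by (intro continuous_on_cases_local) (auto simp: continuation_on_def)
  with \<open>I = _\<close> show "continuous_on I g" by simp
  fix u assume u: "u \<in> I"
  consider "u < b" | "u > b" | "u = b" by linarith
  then show "\<exists>h d. d > 0 \<and> h holomorphic_on ball (g u) d \<and>
        (\<forall>\<^sub>F v in nhds u. v \<in> I \<longrightarrow> F v = fps_expansion h (g v))"
  proof cases
    case 1
    then obtain h d where h: "d > 0" "h holomorphic_on ball (g u) d"
      "\<forall>\<^sub>F v in nhds u. v \<in> I \<inter> {..b} \<longrightarrow> F v = fps_expansion h (g v)"
      using F u unfolding continuation_on_def by (metis IntI atMost_iff less_imp_le)
    have "\<forall>\<^sub>F v in nhds u. v \<in> {..<b}" using 1 by (intro eventually_nhds_in_open) auto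
    then have "\<forall>\<^sub>F v in nhds u. v \<in> I \<longrightarrow> F v = fps_expansion h (g v)"
      using h(3) by eventually_elim auto
    then show ?thesis using h by blast
  next
    case 2
    then obtain h d where h: "d > 0" "h holomorphic_on ball (g u) d"
      "\<forall>\<^sub>F v in nhds u. v \<in> I \<inter> {b..} \<longrightarrow> F v = fps_expansion h (g v)"
      using G u unfolding continuation_on_def by (metis IntI atLeast_iff less_imp_le)
    have "\<forall>\<^sub>F v in nhds u. v \<in> {b<..}" using 2 by (intro eventually_nhds_in_open) auto
    then have "\<forall>\<^sub>F v in nhds u. v \<in> I \<longrightarrow> F v = fps_expansion h (g v)"
      using h(3) by eventually_elim auto
    then show ?thesis using h by blast
  next
    case 3
    \<comment> \<open>At the joint both representatives have the germ \<open>F b\<close>, so they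
      agree on a common ball and one of them serves on both sides.\<close>
    have b: "b \<in> I \<inter> {..b}" "b \<in> I \<inter> {b..}" using I by auto
    obtain h d where h: "d > 0" "h holomorphic_on ball (g b) d" "F b = fps_expansion h (g b)"
      "\<forall>d'>0. \<forall>\<^sub>F v in nhds b. v \<in> I \<inter> {..b} \<longrightarrow> g v \<in> ball (g b) d' \<and> F v = fps_expansion h (g v)"
      using continuation_onD[OF F b(1)] by blast
    obtain k e where k: "e > 0" "k holomorphic_on ball (g b) e" "F b = fps_expansion k (g b)"
      "\<forall>d'>0. \<forall>\<^sub>F v in nhds b. v \<in> I \<inter> {b..} \<longrightarrow> g v \<in> ball (g b) d' \<and> F v = fps_expansion k (g v)"
      using continuation_onD[OF G b(2)] by blast
    define m where "m = min d e"
    have m: "m > 0" "h holomorphic_on ball (g b) m" "k holomorphic_on ball (g b) m"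
      using h k by (auto simp: m_def intro: holomorphic_on_subset)
    have "fps_expansion h (g b) = fps_expansion k (g b)"
      using h(3) k(3) by simp
    note eq0 = this
    have eq: "h z = k z" if "z \<in> ball (g b) m" for z
      by (rule fps_expansion_identity[OF m(2,3) _ _ _ eq0 that]) (use m in auto)
    then have eq': "fps_expansion h z = fps_expansion k z" if "z \<in> ball (g b) m" for z
      using fps_expansion_eq_on[of "ball (g b) m" z h k] that by auto
    have "\<forall>\<^sub>F v in nhds b. v \<in> I \<longrightarrow> F v = fps_expansion h (g v)"
      using h(4)[rule_format, OF m(1)] k(4)[rule_format, OF m(1)]
    proof eventually_elim
      case (elim v) then show ?case using eq'[of "g v"] by (cases "v \<le> b") auto
    qed
    then show ?thesis using h 3 by blast
  qed
qed

lemma continuation_on_join: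
  assumes F: "continuation_on {0..1} g F" and G: "continuation_on {0..1} h G"
    and "F 1 = G 0" "g 1 = h 0"
  shows "continuation_on {0..1} (g +++ h) (\<lambda>u. if u \<le> 1/2 then F (2*u) else G (2*u - 1))"
proof (rule continuation_on_glue[where b = "1/2"])
  show "continuation_on ({0..1} \<inter> {..1/2}) (g +++ h) (\<lambda>u. if u \<le> 1/2 then F (2*u) else G (2*u - 1))"
    by (rule continuation_on_cong[OF continuation_on_reparam[OF F, of _ "\<lambda>u. 2*u"]])
       (auto intro!: continuous_intros simp: joinpaths_def)
  show "continuation_on ({0..1} \<inter> {1/2..}) (g +++ h) (\<lambda>u. if u \<le> 1/2 then F (2*u) else G (2*u - 1))"
  proof (rule continuation_on_cong[OF continuation_on_reparam[OF G, of _ "\<lambda>u. 2*u-1"]])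
    fix u :: real assume u: "u \<in> {0..1} \<inter> {1/2..}"
    show "(h \<circ> (\<lambda>u. 2*u-1)) u = (g +++ h) u"
    proof (cases "u = 1/2")
      case True show ?thesis unfolding True using assms(4) by (simp add: joinpaths_def)
    qed (use u in \<open>auto simp: joinpaths_def\<close>)
    show "(G \<circ> (\<lambda>u. 2*u-1)) u = (if u \<le> 1/2 then F (2*u) else G (2*u - 1))"
    proof (cases "u = 1/2")
      case True show ?thesis unfolding True using assms(3) by simp
    qed (use u in auto)
  qed (auto intro!: continuous_intros)
qed auto

lemma continuation_on_reversepath:
  assumes "continuation_on {0..1} g F"
  shows "continuation_on {0..1} (reversepath g) (\<lambda>u. F (1 - u))"
  by (rule continuation_on_cong[OF continuation_on_reparam[OF assms, of _ "\<lambda>u. 1 - u"]])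
     (auto simp: reversepath_def intro!: continuous_intros)

lemma continuation_on_subpath:
  assumes "continuation_on {a..b} g F" "a \<le> b"
  shows "continuation_on {0..1} (subpath a b g) (\<lambda>u. F ((b - a) * u + a))"
proof (rule continuation_on_cong[OF continuation_on_reparam[OF assms(1), of _ "\<lambda>u. (b - a) * u + a"]])
  show "(\<lambda>u. (b - a) * u + a) ` {0..1} \<subseteq> {a..b}"
  proof clarsimp
    fix x :: real assume "0 \<le> x" "x \<le> 1"
    then have "(b - a) * x \<le> (b - a) * 1" using assms by (intro mult_left_mono) auto
    then show "0 \<le> (b - a) * x \<and> (b - a) * x + a \<le> b" using assms \<open>0 \<le> x\<close> by auto
  qed
qed (auto simp: subpath_def intro!: continuous_intros)

subsection \<open>Existence of continuations\<close>

text \<open>\<open>Q v f\<close> stands for a condition on a germ \<open>f\<close> at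
  \<open>g v\<close>, in the applications a differential equation. The radius \<open>d\<close> in
  \<open>ext\<close> depends on \<open>u\<close> but not on \<open>v\<close> or \<open>f\<close>.
  Hence, near \<open>u\<close>, a continuation that reaches one parameter reaches all the others,
  and the set of parameters reached is open and closed in \<open>{a..b}\<close>.\<close>

lemma continuation_exists:
  fixes a b :: real
  assumes g: "continuous_on {a..b} g" and ab: "a \<le> b"
    and ext: "\<And>u. u \<in> {a..b} \<Longrightarrow> \<exists>d e. e > 0 \<and> (\<forall>v\<in>{a..b}. dist u v < e \<longrightarrow> g v \<in> ball (g u) d \<and>
       (\<forall>f. Q v f \<longrightarrow> (\<exists>h. h holomorphic_on ball (g u) d \<and> fps_expansion h (g v) = f \<and>
          (\<forall>w\<in>{a..b}. dist u w < e \<longrightarrow> Q w (fps_expansion h (g w))))))"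
    and f: "Q a f"
  shows "\<exists>F. continuation_on {a..b} g F \<and> F a = f \<and> (\<forall>u\<in>{a..b}. Q u (F u))"
proof -
  define P where "P x \<longleftrightarrow> (\<exists>F. continuation_on {a..x} g F \<and> F a = f \<and> (\<forall>u\<in>{a..x}. Q u (F u)))" for x
  have aab: "a \<in> {a..b}" "b \<in> {a..b}" using ab by auto
  have "P b"
  proof (rule connected_induction_simple[of "{a..b}" a b P])
    obtain d e where de: "e > 0" "\<forall>v\<in>{a..b}. dist a v < e \<longrightarrow> g v \<in> ball (g a) d \<and>
       (\<forall>f. Q v f \<longrightarrow> (\<exists>h. h holomorphic_on ball (g a) d \<and> fps_expansion h (g v) = f \<and>
          (\<forall>w\<in>{a..b}. dist a w < e \<longrightarrow> Q w (fps_expansion h (g w)))))"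
      using ext[OF aab(1)] by blast
    then obtain h where h: "h holomorphic_on ball (g a) d" "fps_expansion h (g a) = f" "g a \<in> ball (g a) d"
      using f aab(1) dist_self by metis
    have "continuation_on {a..a} g (\<lambda>u. fps_expansion h (g u))"
      by (rule continuation_on_holomorphic[OF h(1)]) (use h(3) in auto)
    then show "P a" unfolding P_def using h(2) f by (intro exI[of _ "\<lambda>u. fps_expansion h (g u)"]) simp
  next
    fix u assume u: "u \<in> {a..b}"
    obtain d e where de: "e > 0" "\<forall>v\<in>{a..b}. dist u v < e \<longrightarrow> g v \<in> ball (g u) d \<and>
       (\<forall>f. Q v f \<longrightarrow> (\<exists>h. h holomorphic_on ball (g u) d \<and> fps_expansion h (g v) = f \<and>
          (\<forall>w\<in>{a..b}. dist u w < e \<longrightarrow> Q w (fps_expansion h (g w)))))"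
      using ext[OF u] by blast
    define T where "T = {a..b} \<inter> ball u e"
    have "P y" if x: "x \<in> T" "y \<in> T" "P x" for x y
    proof -
      obtain F where F: "continuation_on {a..x} g F" "F a = f" "\<forall>u\<in>{a..x}. Q u (F u)"
        using x(3) unfolding P_def by blast
      show ?thesis
      proof (cases "y \<le> x")
        case True
        then have "{a..y} \<subseteq> {a..x}" by auto
        then show ?thesis
          unfolding P_def by (intro exI[of _ F]) (use continuation_on_subset[OF F(1)] F(2,3) in auto)
      next
        case False
        have xab: "x \<in> {a..b}" "dist u x < e" "y \<in> {a..b}" "dist u y < e" using x by (auto simp: T_def)
        have "Q x (F x)" using F(3) xab by auto
        then obtain h where h: "h holomorphic_on ball (g u) d" "fps_expansion h (g x) = F x"
          "\<forall>w\<in>{a..b}. dist u w < e \<longrightarrow> Q w (fps_expansion h (g w))"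
          using de(2) xab(1,2) by metis
        have xy: "w \<in> {a..b} \<and> dist u w < e" if "w \<in> {x..y}" for w
          using that xab by (auto simp: dist_real_def)
        define F' where "F' v = (if v \<le> x then F v else fps_expansion h (g v))" for v
        have "continuation_on {a..y} g F'"
        proof (rule continuation_on_glue[of _ x])
          show "continuation_on ({a..y} \<inter> {..x}) g F'"
            by (rule continuation_on_cong[OF continuation_on_subset[OF F(1)]]) (auto simp: F'_def)
          have "continuation_on {x..y} g (\<lambda>u. fps_expansion h (g u))"
          proof (rule continuation_on_holomorphic[OF h(1)])
            show "g ` {x..y} \<subseteq> ball (g u) d" using de(2) xy by blast
            show "continuous_on {x..y} g" by (rule continuous_on_subset[OF g]) (use xab in auto)
          qed auto
          then show "continuation_on ({a..y} \<inter> {x..}) g F'"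
            by (rule continuation_on_cong[OF continuation_on_subset]) (use h(2) in \<open>auto simp: F'_def\<close>)
        qed (use False xab in auto)
        moreover have "F' a = f" using F(2) xab by (simp add: F'_def)
        moreover have "Q w (F' w)" if "w \<in> {a..y}" for w
          using F(3) h(3) xy[of w] that by (auto simp: F'_def)
        ultimately show ?thesis unfolding P_def by blast
      qed
    qed
    moreover have "openin (top_of_set {a..b}) T" "u \<in> T"
      using u de(1) by (auto simp: T_def openin_open_Int)
    ultimately show "\<exists>T. openin (top_of_set {a..b}) T \<and> u \<in> T \<and> (\<forall>x\<in>T. \<forall>y\<in>T. P x \<longrightarrow> P y)"
      by blast
  qed (use aab in auto)
  then show ?thesis by (simp add: P_def)
qed

text \<open>A ball that carries a representative of \<open>F\<close> carries a primitive of it, so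
  the condition \<open>fps_deriv f = F v\<close> has the uniform extension property required by
  \<open>continuation_exists\<close>.\<close>

lemma continuation_primitive:
  assumes F: "continuation_on {0..1} g F" and P: "fps_deriv P = F 0"
  shows "\<exists>G. continuation_on {0..1} g G \<and> G 0 = P \<and> (\<forall>u\<in>{0..1}. fps_deriv (G u) = F u)"
proof (rule continuation_exists)
  show "continuous_on {0..1} g" using F by (simp add: continuation_on_def)
  fix u :: real assume u: "u \<in> {0..1}"
  obtain h d where h: "d > 0" "h holomorphic_on ball (g u) d" "F u = fps_expansion h (g u)"
    "\<forall>d'>0. \<forall>\<^sub>F v in nhds u. v \<in> {0..1} \<longrightarrow> g v \<in> ball (g u) d' \<and> F v = fps_expansion h (g v)"
    using continuation_onD[OF F u] by blast
  obtain e where e: "e > 0" "\<And>v. dist v u < e \<Longrightarrow> v \<in> {0..1} \<Longrightarrow> g v \<in> ball (g u) d \<and> F v = fps_expansion h (g v)"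
    using h(4)[rule_format, OF h(1)] unfolding eventually_nhds_metric by blast
  obtain H where H: "\<And>z. z \<in> ball (g u) d \<Longrightarrow> (H has_field_derivative h z) (at z)"
    using holomorphic_convex_primitive'[OF convex_ball open_ball h(2)] by (metis at_within_open open_ball)
  have Hh: "H holomorphic_on ball (g u) d" using H unfolding holomorphic_on_open[OF open_ball] by blast
  have dH: "deriv (\<lambda>z. H z + c) z = h z" if "z \<in> ball (g u) d" for z c
    by (rule DERIV_imp_deriv) (use H[OF that] in \<open>auto intro!: derivative_eq_intros\<close>)
  have ex: "fps_deriv (fps_expansion (\<lambda>z. H z + c) z) = fps_expansion h z" if "z \<in> ball (g u) d" for z c
    unfolding fps_expansion_deriv[symmetric] by (rule fps_expansion_eq_on[OF open_ball that dH])
  show "\<exists>d e. e > 0 \<and> (\<forall>v\<in>{0..1}. dist u v < e \<longrightarrow> g v \<in> ball (g u) d \<and>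
       (\<forall>f. fps_deriv f = F v \<longrightarrow> (\<exists>h. h holomorphic_on ball (g u) d \<and> fps_expansion h (g v) = f \<and>
          (\<forall>w\<in>{0..1}. dist u w < e \<longrightarrow> fps_deriv (fps_expansion h (g w)) = F w))))"
  proof (rule exI[of _ d], rule exI[of _ e], intro conjI ballI impI allI)
    fix v f assume v: "v \<in> {0..1::real}" "dist u v < e" and f: "fps_deriv f = F v"
    have gv: "g v \<in> ball (g u) d" "F v = fps_expansion h (g v)" using e(2)[of v] v by (auto simp: dist_commute)
    \<comment> \<open>The constant adjusts the value at \<open>g v\<close> to that of
      \<open>f\<close>; a power series is determined by its derivative and its constant
      term.\<close>
    define k where "k = (\<lambda>z. H z + (fps_nth f 0 - H (g v)))"
    have "fps_deriv (fps_expansion k (g v)) = fps_deriv f"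
      using ex[OF gv(1)] f gv(2) by (simp add: k_def)
    moreover have "fps_nth (fps_expansion k (g v)) 0 = fps_nth f 0" by (simp add: fps_expansion_nth_0 k_def)
    ultimately have "fps_expansion k (g v) = f" by (simp add: fps_deriv_eq_iff)
    moreover have "k holomorphic_on ball (g u) d" unfolding k_def by (intro holomorphic_intros Hh)
    moreover have "\<forall>w\<in>{0..1}. dist u w < e \<longrightarrow> fps_deriv (fps_expansion k (g w)) = F w"
      using e(2) ex by (simp add: k_def dist_commute)
    ultimately show "\<exists>h. h holomorphic_on ball (g u) d \<and> fps_expansion h (g v) = f \<and>
          (\<forall>w\<in>{0..1}. dist u w < e \<longrightarrow> fps_deriv (fps_expansion h (g w)) = F w)" by blast
  qed (use e in \<open>auto simp: dist_commute\<close>)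
qed (use P in auto)

subsection \<open>Homotopy invariance\<close>

text \<open>Finitely many parameter intervals cover \<open>{0..1}\<close>, on each of which
  \<open>F\<close> comes from one function on a ball of radius \<open>d u\<close> while
  \<open>g\<close> stays in the half ball. A path closer to \<open>g\<close> than half of each of
  these radii remains in the balls and can use the same functions.\<close>

lemma continuation_nearby:
  assumes F: "continuation_on {0..1} g F"
  shows "\<exists>\<epsilon>>0. \<forall>k. path k \<and> k 0 = g 0 \<and> k 1 = g 1 \<and> (\<forall>u\<in>{0..1}. dist (g u) (k u) < \<epsilon>) \<longrightarrow>
     (\<exists>G. continuation_on {0..1} k G \<and> G 0 = F 0 \<and> G 1 = F 1)"
proof -
  have "\<exists>h d e. d > 0 \<and> e > 0 \<and> h holomorphic_on ball (g u) d \<and>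
     (\<forall>v. dist v u < e \<longrightarrow> v \<in> {0..1} \<longrightarrow> g v \<in> ball (g u) (d/2) \<and> F v = fps_expansion h (g v))"
    if u: "u \<in> {0..1}" for u
  proof -
    obtain h d where h: "d > 0" "h holomorphic_on ball (g u) d"
      "\<forall>d'>0. \<forall>\<^sub>F v in nhds u. v \<in> {0..1} \<longrightarrow> g v \<in> ball (g u) d' \<and> F v = fps_expansion h (g v)"
      using continuation_onD[OF F u] by blast
    have "d/2 > 0" using h(1) by simp
    then show ?thesis using h unfolding eventually_nhds_metric by metis
  qed
  then obtain h d e where hde: "\<And>u. u \<in> {0..1} \<Longrightarrow> d u > 0 \<and> e u > 0 \<and> h u holomorphic_on ball (g u) (d u) \<and>
     (\<forall>v. dist v u < e u \<longrightarrow> v \<in> {0..1} \<longrightarrow> g v \<in> ball (g u) (d u/2) \<and> F v = fps_expansion (h u) (g v))"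
    by metis
  have cov: "{0..1::real} \<subseteq> (\<Union>u\<in>{0..1}. ball u (e u))"
  proof
    fix u :: real assume u: "u \<in> {0..1}"
    then show "u \<in> (\<Union>u\<in>{0..1}. ball u (e u))" using hde[OF u] by (intro UN_I[of u]) simp_all
  qed
  obtain N where N: "N \<subseteq> {0..1}" "finite N" "{0..1::real} \<subseteq> (\<Union>u\<in>N. ball u (e u))"
    by (rule compactE_image[OF compact_Icc _ cov]) simp_all
  have Nne: "N \<noteq> {}" using N(3) by auto
  define \<epsilon> where "\<epsilon> = Min ((\<lambda>u. d u / 2) ` N)"
  have eps: "\<epsilon> > 0" "\<And>u. u \<in> N \<Longrightarrow> \<epsilon> \<le> d u / 2"
  proof -
    have "\<forall>u\<in>N. 0 < d u / 2" using N(1) hde by (metis half_gt_zero subsetD)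
    then show "\<epsilon> > 0" unfolding \<epsilon>_def using N(2) Nne by (simp add: Min_gr_iff)
    show "\<epsilon> \<le> d u / 2" if "u \<in> N" for u
      unfolding \<epsilon>_def using N(2) that by (intro Min_le) auto
  qed
  have "\<exists>G. continuation_on {0..1} k G \<and> G 0 = F 0 \<and> G 1 = F 1"
    if k: "path k" "k 0 = g 0" "k 1 = g 1" "\<And>u. u \<in> {0..1} \<Longrightarrow> dist (g u) (k u) < \<epsilon>" for k
  proof -
    \<comment> \<open>The germ \<open>F v\<close> is moved from \<open>g v\<close> to the nearby
      point \<open>k v\<close>; this involves no choice of a covering interval.\<close>
    define G where "G v = fps_expansion (germ_fun (g v) (F v)) (k v)" for v
    have G: "G v = fps_expansion (h u) (k v)" "k v \<in> ball (g u) (d u)"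
      if u: "u \<in> N" "v \<in> {0..1}" "dist v u < e u" for u v
    proof -
      have u': "u \<in> {0..1}" using u N by auto
      have gv: "g v \<in> ball (g u) (d u/2)" "F v = fps_expansion (h u) (g v)" "h u holomorphic_on ball (g u) (d u)"
        using hde[OF u'] u by blast+
      have sub: "ball (g v) (d u/2) \<subseteq> ball (g u) (d u)"
      proof
        fix x assume "x \<in> ball (g v) (d u/2)"
        then show "x \<in> ball (g u) (d u)" using gv(1) dist_triangle[of "g u" x "g v"] by simp
      qed
      have kv: "k v \<in> ball (g v) (d u / 2)" using k(4)[OF u(2)] eps(2)[OF u(1)] by simp
      then show "k v \<in> ball (g u) (d u)" using sub by blast
      show "G v = fps_expansion (h u) (k v)" unfolding G_def gv(2)
        by (rule fps_expansion_eq_on[OF open_ball kv])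
           (rule germ_fun_fps_expansion[OF holomorphic_on_subset[OF gv(3) sub]])
    qed
    have "continuation_on {0..1} k G"
      unfolding continuation_on_def
    proof (intro conjI ballI)
      show "continuous_on {0..1} k" using k(1) by (simp add: path_def)
      fix w :: real assume w: "w \<in> {0..1}"
      then obtain u where u: "u \<in> N" "dist w u < e u" using N(3) by (auto simp: dist_commute)
      have "k w \<in> ball (g u) (d u)" using G(2)[OF u(1) w u(2)] .
      then obtain d' where d': "d' > 0" "ball (k w) d' \<subseteq> ball (g u) (d u)" using openE[OF open_ball] by blast
      have "u \<in> {0..1}" using u N by auto
      then have "h u holomorphic_on ball (k w) d'" using hde d'(2) holomorphic_on_subset by blast
      moreover have "\<forall>\<^sub>F v in nhds w. v \<in> ball u (e u)"
        by (rule eventually_nhds_in_open) (use u in \<open>auto simp: dist_commute\<close>)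
      then have "\<forall>\<^sub>F v in nhds w. v \<in> {0..1} \<longrightarrow> G v = fps_expansion (h u) (k v)"
        by eventually_elim (use G(1)[OF u(1)] in \<open>simp add: dist_commute\<close>)
      ultimately show "\<exists>h d. 0 < d \<and> h holomorphic_on ball (k w) d \<and>
         (\<forall>\<^sub>F v in nhds w. v \<in> {0..1} \<longrightarrow> G v = fps_expansion h (k v))"
        using d'(1) by blast
    qed
    moreover have "G 0 = F 0" "G 1 = F 1"
      using fps_expansion_germ_fun[OF continuation_on_conv_radius[OF F, of 0], of "g 0"]
        fps_expansion_germ_fun[OF continuation_on_conv_radius[OF F, of 1], of "g 1"]
      by (simp_all add: G_def k)
    ultimately show ?thesis by blast
  qed
  then show ?thesis using eps(1) by blast
qed

text \<open>Since \<open>monodromy\<close> is a definite description, it obeys algebraic rules only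
  where continuations exist. This predicate is the domain on which it is additive, multiplicative
  and homotopy invariant.\<close>

definition continuable :: "complex set \<Rightarrow> complex \<Rightarrow> complex fps \<Rightarrow> bool" where
  "continuable X z f \<longleftrightarrow> (\<forall>g. path g \<longrightarrow> path_image g \<subseteq> X \<longrightarrow> pathstart g = z \<longrightarrow>
     (\<exists>F. continuation_on {0..1} g F \<and> F 0 = f))"

lemma continuable_monodromy_obtain:
  assumes "continuable X z f" "path g" "path_image g \<subseteq> X" "pathstart g = z"
  obtains F where "continuation_on {0..1} g F" "F 0 = f" "F 1 = monodromy g f"
  using assms unfolding continuable_def by (metis monodromy_eq)

text \<open>By uniform continuity of the homotopy, neighbouring stages are uniformly close and have
  common end points; so \<open>continuation_nearby\<close> makes the final germ locally constant in
  the homotopy parameter.\<close>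

lemma monodromy_homotopic:
  assumes f: "continuable X z f" and hom: "homotopic_paths X g g'" and z: "pathstart g = z"
  shows "monodromy g f = monodromy g' f"
proof -
  obtain H :: "real \<times> real \<Rightarrow> complex" where H0: "continuous_on ({0..1} \<times> {0..1}) H" "H \<in> ({0..1} \<times> {0..1}) \<rightarrow> X"
    "\<forall>x\<in>{0..1}. H (0, x) = g x" "\<forall>x\<in>{0..1}. H (1, x) = g' x"
    "\<forall>t\<in>{0..1}. pathstart (H \<circ> Pair t) = pathstart g \<and> pathfinish (H \<circ> Pair t) = pathfinish g"
    using hom unfolding homotopic_paths image_subset_iff_funcset by blast
  have H: "continuous_on ({0..1} \<times> {0..1}) H" "H ` ({0..1} \<times> {0..1}) \<subseteq> X"
    "\<And>x. x \<in> {0..1} \<Longrightarrow> H (0, x) = g x" "\<And>x. x \<in> {0..1} \<Longrightarrow> H (1, x) = g' x"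
    "\<And>t. t \<in> {0..1} \<Longrightarrow> H (t, 0) = g 0 \<and> H (t, 1) = g 1"
    using H0 by (auto simp: pathstart_def pathfinish_def)
  define k where "k t = (\<lambda>x. H (t, x))" for t
  have path_k: "path (k t)" "path_image (k t) \<subseteq> X" "pathstart (k t) = z" if "t \<in> {0..1}" for t
  proof -
    have "continuous_on {0..1} (H \<circ> Pair t)"
      by (rule continuous_on_compose) (use that in \<open>auto intro!: continuous_intros continuous_on_subset[OF H(1)]\<close>)
    then show "path (k t)" by (simp add: path_def k_def o_def)
    show "path_image (k t) \<subseteq> X" using H(2) that by (auto simp: path_image_def k_def image_subset_iff)
    show "pathstart (k t) = z" using H(5)[OF that] z by (simp add: k_def pathstart_def)
  qed
  have ends: "k t 0 = g 0" "k t 1 = g 1" if "t \<in> {0..1}" for t using H(5)[OF that] by (auto simp: k_def)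
  define P where "P t \<longleftrightarrow> monodromy (k t) f = monodromy (k 0) f" for t
  have uc: "uniformly_continuous_on ({0..1} \<times> {0..1}) H"
    by (rule compact_uniformly_continuous[OF H(1)]) (intro compact_Times compact_Icc)
  have "P 1"
  proof (rule connected_induction_simple[of "{0..1}" 0 1 P])
    fix t :: real assume t: "t \<in> {0..1}"
    obtain F where F: "continuation_on {0..1} (k t) F" "F 0 = f" "F 1 = monodromy (k t) f"
      using continuable_monodromy_obtain[OF f path_k[OF t]] by blast
    obtain \<epsilon> where eps: "\<epsilon> > 0" "\<And>k'. path k' \<Longrightarrow> k' 0 = k t 0 \<Longrightarrow> k' 1 = k t 1 \<Longrightarrow>
        (\<forall>u\<in>{0..1}. dist (k t u) (k' u) < \<epsilon>) \<Longrightarrow>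
        \<exists>G. continuation_on {0..1} k' G \<and> G 0 = F 0 \<and> G 1 = F 1"
      using continuation_nearby[OF F(1)] by blast
    obtain \<delta> where del: "\<delta> > 0" "\<And>x y. x \<in> {0..1} \<times> {0..1} \<Longrightarrow> y \<in> {0..1} \<times> {0..1} \<Longrightarrow>
        dist x y < \<delta> \<Longrightarrow> dist (H x) (H y) < \<epsilon>"
      using uc eps(1) unfolding uniformly_continuous_on_def by (metis dist_commute)
    define T where "T = {0..1} \<inter> ball t \<delta>"
    have near: "monodromy (k s) f = monodromy (k t) f" if s: "s \<in> T" for s
    proof -
      have s': "s \<in> {0..1}" "dist t s < \<delta>" using s by (auto simp: T_def)
      have "\<forall>u\<in>{0..1}. dist (k t u) (k s u) < \<epsilon>"
        using s' t del(2)[of "(t, u)" "(s, u)" for u] by (simp add: k_def dist_Pair_Pair)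
      then obtain G where "continuation_on {0..1} (k s) G" "G 0 = F 0" "G 1 = F 1"
        using eps(2)[of "k s"] path_k(1)[OF s'(1)] ends[OF s'(1)] ends[OF t] by metis
      then show ?thesis using monodromy_eq[of "k s" G f] F by simp
    qed
    then have "\<forall>x\<in>T. \<forall>y\<in>T. P x \<longrightarrow> P y" by (simp add: P_def)
    moreover have "openin (top_of_set {0..1}) T" "t \<in> T"
      using t del(1) by (auto simp: T_def openin_open_Int)
    ultimately show "\<exists>T. openin (top_of_set {0..1}) T \<and> t \<in> T \<and> (\<forall>x\<in>T. \<forall>y\<in>T. P x \<longrightarrow> P y)" by blast
  qed (auto simp: P_def)
  moreover have "monodromy (k 0) f = monodromy g f" 
  proof -
    have z0: "(0::real) \<in> {0..1}" by simp
    obtain F where F: "continuation_on {0..1} (k 0) F" "F 0 = f" "F 1 = monodromy (k 0) f"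
      using continuable_monodromy_obtain[OF f path_k[OF z0]] by blast
    have "continuation_on {0..1} g F" by (rule continuation_on_cong[OF F(1)]) (use H(3) in \<open>auto simp: k_def\<close>)
    then show ?thesis using monodromy_eq F by metis
  qed
  moreover have "monodromy (k 1) f = monodromy g' f" 
  proof -
    have z1: "(1::real) \<in> {0..1}" by simp
    obtain F where F: "continuation_on {0..1} (k 1) F" "F 0 = f" "F 1 = monodromy (k 1) f"
      using continuable_monodromy_obtain[OF f path_k[OF z1]] by blast
    have "continuation_on {0..1} g' F" by (rule continuation_on_cong[OF F(1)]) (use H(4) in \<open>auto simp: k_def\<close>)
    then show ?thesis using monodromy_eq F by metis
  qed
  ultimately show ?thesis by (simp add: P_def)
qed

subsection \<open>Calculus of continuable germs\<close>

lemma monodromy_obtain_halves: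
  assumes F: "continuation_on {0..1} (g +++ h) F" and gh: "pathfinish g = pathstart h"
  shows "continuation_on {0..1} g (\<lambda>u. F (u / 2))" "continuation_on {0..1} h (\<lambda>u. F ((u + 1) / 2))"
proof -
  show "continuation_on {0..1} g (\<lambda>u. F (u / 2))"
    by (rule continuation_on_cong[OF continuation_on_reparam[OF F, of _ "\<lambda>u. u / 2"]])
       (auto simp: joinpaths_def intro!: continuous_intros)
  show "continuation_on {0..1} h (\<lambda>u. F ((u + 1) / 2))"
  proof (rule continuation_on_cong[OF continuation_on_reparam[OF F, of _ "\<lambda>u. (u + 1) / 2"]])
    fix u :: real assume u: "u \<in> {0..1}"
    show "((g +++ h) \<circ> (\<lambda>u. (u + 1) / 2)) u = h u"
    proof (cases "u = 0")
      case True then show ?thesis using gh by (simp add: joinpaths_def pathstart_def pathfinish_def)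
    next
      case False then show ?thesis using u by (simp add: joinpaths_def add_divide_distrib)
    qed
  qed (auto intro!: continuous_intros)
qed

lemma continuable_monodromy:
  assumes f: "continuable X z f" and g: "path g" "path_image g \<subseteq> X" "pathstart g = z" "pathfinish g = w"
  shows "continuable X w (monodromy g f)"
  unfolding continuable_def
proof (intro allI impI)
  fix k assume k: "path k" "path_image k \<subseteq> X" "pathstart k = w"
  obtain F where F: "continuation_on {0..1} (g +++ k) F" "F 0 = f"
    using f g k by (metis continuable_def path_join path_join_imp pathstart_join subset_path_image_join)
  note h = monodromy_obtain_halves[OF F(1)]
  have "monodromy g f = F (1/2)" using monodromy_eq[OF h(1)] F(2) g k by simp
  then show "\<exists>F. continuation_on {0..1} k F \<and> F 0 = monodromy g f"
    using h(2) g k by (intro exI[of _ "\<lambda>u. F ((u + 1) / 2)"]) auto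
qed

lemma monodromy_join:
  assumes f: "continuable X z f" and g: "path g" "path_image g \<subseteq> X" "pathstart g = z"
    and k: "path k" "path_image k \<subseteq> X" "pathstart k = pathfinish g"
  shows "monodromy (g +++ k) f = monodromy k (monodromy g f)"
proof -
  obtain F where F: "continuation_on {0..1} (g +++ k) F" "F 0 = f"
    using f g k by (metis continuable_def path_join_imp pathstart_join subset_path_image_join)
  note h = monodromy_obtain_halves[OF F(1) k(3)[symmetric]]
  have "monodromy g f = F (1/2)" using monodromy_eq[OF h(1)] F(2) by simp
  then show ?thesis using monodromy_eq[OF h(2), of "F (1/2)"] monodromy_eq[OF F] by simp
qed

lemma monodromy_reversepath:
  assumes f: "continuable X z f" and g: "path g" "path_image g \<subseteq> X" "pathstart g = z"
  shows "monodromy (reversepath g) (monodromy g f) = f"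
proof -
  obtain F where F: "continuation_on {0..1} g F" "F 0 = f" "F 1 = monodromy g f"
    using continuable_monodromy_obtain[OF f g] by blast
  show ?thesis using monodromy_eq[OF continuation_on_reversepath[OF F(1)]] F by simp
qed

lemma monodromy_reversepath':
  assumes f: "continuable X w f" and g: "path g" "path_image g \<subseteq> X" "pathfinish g = w"
  shows "monodromy g (monodromy (reversepath g) f) = f"
  using monodromy_reversepath[of X w f "reversepath g"] assms by simp

lemma continuable_add: "continuable X z f \<Longrightarrow> continuable X z g \<Longrightarrow> continuable X z (f + g)"
  unfolding continuable_def by (metis continuation_on_add)

lemma continuable_diff: "continuable X z f \<Longrightarrow> continuable X z g \<Longrightarrow> continuable X z (f - g)"
  unfolding continuable_def by (metis continuation_on_diff)

lemma continuable_mult: "continuable X z f \<Longrightarrow> continuable X z g \<Longrightarrow> continuable X z (f * g)"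
  unfolding continuable_def by (metis continuation_on_mult)

lemma continuable_scale: "continuable X z f \<Longrightarrow> continuable X z (fps_const c * f)"
  unfolding continuable_def by (metis continuation_on_scale)

lemma continuable_const: "continuable X z (fps_const c)"
  unfolding continuable_def path_def by (metis continuation_on_const)

lemma continuable_0: "continuable X z 0"
  using continuable_const[of X z 0] by simp

lemma continuable_sum:
  "(\<And>i. i \<in> N \<Longrightarrow> continuable X z (f i)) \<Longrightarrow> continuable X z (\<Sum>i\<in>N. f i)"
  by (induction N rule: infinite_finite_induct) (auto intro: continuable_add continuable_0)

lemma continuable_subset: "continuable X z f \<Longrightarrow> Y \<subseteq> X \<Longrightarrow> continuable Y z f"
  unfolding continuable_def by blast

lemma continuable_primitive: "continuable X z (fps_deriv f) \<Longrightarrow> continuable X z f"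
  unfolding continuable_def using continuation_primitive by metis

context
  fixes X :: "complex set" and z g assumes g: "path g" "path_image g \<subseteq> X" "pathstart g = z"
begin

lemma monodromy_holomorphic:
  assumes "h holomorphic_on A" "open A" "X \<subseteq> A"
  shows "monodromy g (fps_expansion h z) = fps_expansion h (pathfinish g)"
proof -
  have "continuation_on {0..1} g (\<lambda>u. fps_expansion h (g u))"
    by (rule continuation_on_holomorphic[OF assms(1,2)]) (use g assms in \<open>auto simp: path_image_def path_def\<close>)
  then show ?thesis using g(3) by (subst monodromy_eq) (auto simp: pathstart_def pathfinish_def)
qed

lemma monodromy_const: "monodromy g (fps_const c) = fps_const c"
  using monodromy_eq[OF continuation_on_const[of "{0..1}" g c]] g by (simp add: path_def)

lemma monodromy_0: "monodromy g 0 = 0"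
  using monodromy_const[of 0] by simp

lemma monodromy_add:
  "continuable X z a \<Longrightarrow> continuable X z b \<Longrightarrow> monodromy g (a + b) = monodromy g a + monodromy g b"
  by (rule continuable_monodromy_obtain[OF _ g, of a], assumption,
      rule continuable_monodromy_obtain[OF _ g, of b], assumption)
     (simp add: monodromy_eq[OF continuation_on_add])

lemma monodromy_diff:
  "continuable X z a \<Longrightarrow> continuable X z b \<Longrightarrow> monodromy g (a - b) = monodromy g a - monodromy g b"
  by (rule continuable_monodromy_obtain[OF _ g, of a], assumption,
      rule continuable_monodromy_obtain[OF _ g, of b], assumption)
     (simp add: monodromy_eq[OF continuation_on_diff])

lemma monodromy_mult:
  "continuable X z a \<Longrightarrow> continuable X z b \<Longrightarrow> monodromy g (a * b) = monodromy g a * monodromy g b"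
  by (rule continuable_monodromy_obtain[OF _ g, of a], assumption,
      rule continuable_monodromy_obtain[OF _ g, of b], assumption)
     (simp add: monodromy_eq[OF continuation_on_mult])

lemma monodromy_deriv:
  "continuable X z a \<Longrightarrow> monodromy g (fps_deriv a) = fps_deriv (monodromy g a)"
  by (rule continuable_monodromy_obtain[OF _ g, of a], assumption)
     (simp add: monodromy_eq[OF continuation_on_deriv])

lemma monodromy_scale:
  "continuable X z a \<Longrightarrow> monodromy g (fps_const c * a) = fps_const c * monodromy g a"
  by (simp add: monodromy_mult monodromy_const continuable_const)

lemma monodromy_sum:
  "(\<And>i. i \<in> N \<Longrightarrow> continuable X z (f i)) \<Longrightarrow> monodromy g (\<Sum>i\<in>N. f i) = (\<Sum>i\<in>N. monodromy g (f i))"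
proof (induction N rule: infinite_finite_induct)
  case (insert x N)
  then show ?case by (simp add: monodromy_add continuable_sum)
qed (simp_all add: monodromy_0)

end

subsection \<open>Integrals of continued germs\<close>

lemma continuous_on_germ_value:
  assumes F: "continuation_on I g F"
  shows "continuous_on I (\<lambda>u. fps_nth (F u) 0)"
  unfolding continuous_on_eq_continuous_within
proof
  fix u assume u: "u \<in> I"
  obtain h d where h: "d > 0" "h holomorphic_on ball (g u) d" "F u = fps_expansion h (g u)"
    "\<forall>d'>0. \<forall>\<^sub>F v in nhds u. v \<in> I \<longrightarrow> g v \<in> ball (g u) d' \<and> F v = fps_expansion h (g v)"
    using continuation_onD[OF F u] by blast
  have "isCont h (g u)" using h(1,2)
    by (metis centre_in_ball continuous_on_interior holomorphic_on_imp_continuous_on interior_ball)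
  moreover have "continuous (at u within I) g"
    using F u by (simp add: continuation_on_def continuous_on_eq_continuous_within)
  ultimately have "continuous (at u within I) (\<lambda>v. h (g v))" by (rule continuous_within_compose3)
  moreover have "\<forall>\<^sub>F v in at u within I. h (g v) = fps_nth (F v) 0"
    using h(4)[rule_format, OF h(1)] unfolding eventually_at_filter
    by eventually_elim (simp add: fps_expansion_nth_0)
  moreover have "h (g u) = fps_nth (F u) 0" using h(3) by (simp add: fps_expansion_nth_0)
  ultimately show "continuous (at u within I) (\<lambda>u. fps_nth (F u) 0)"
    unfolding continuous_within using tendsto_cong by force
qed

lemma germ_value_has_vector_derivative:
  assumes P: "continuation_on {0..1} g P" and u: "u \<in> {0<..<1}"
    and g: "(g has_vector_derivative g') (at u)"
  shows "((\<lambda>u. fps_nth (P u) 0) has_vector_derivative (fps_nth (fps_deriv (P u)) 0 * g')) (at u)"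
proof -
  have u': "u \<in> {0..1}" using u by auto
  obtain h d where h: "d > 0" "h holomorphic_on ball (g u) d" "P u = fps_expansion h (g u)"
    "\<forall>d'>0. \<forall>\<^sub>F v in nhds u. v \<in> {0..1} \<longrightarrow> g v \<in> ball (g u) d' \<and> P v = fps_expansion h (g v)"
    using continuation_onD[OF P u'] by blast
  have "(h has_field_derivative deriv h (g u)) (at (g u))"
    using h(1,2) holomorphic_derivI[OF h(2) open_ball] by auto
  from field_vector_diff_chain_at[OF g this]
  have "((\<lambda>v. h (g v)) has_vector_derivative g' * deriv h (g u)) (at u)" by (simp add: o_def)
  moreover have "\<forall>\<^sub>F v in nhds u. v \<in> {0<..<1}" using u by (intro eventually_nhds_in_open) auto
  then have "\<forall>\<^sub>F v in nhds u. h (g v) = fps_nth (P v) 0"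
    using h(4)[rule_format, OF h(1)] by eventually_elim (simp add: fps_expansion_nth_0)
  ultimately have "((\<lambda>u. fps_nth (P u) 0) has_vector_derivative g' * deriv h (g u)) (at u)"
    by (subst (asm) has_vector_derivative_cong_ev[where g = "\<lambda>u. fps_nth (P u) 0"])
       (auto elim: eventually_mono dest: eventually_nhds_x_imp_x)
  moreover have "fps_nth (fps_deriv (P u)) 0 = deriv h (g u)"
    unfolding h(3) fps_expansion_deriv[symmetric] by (rule fps_expansion_nth_0)
  ultimately show ?thesis by (simp add: mult.commute)
qed

text \<open>The value of the continued germ \<open>P u\<close> at its own base point is an
  antiderivative of the integrand. As \<open>g\<close> is piecewise smooth, the fundamental theorem
  is applied with finitely many exceptional parameters.\<close>

lemma germ_integral_primitive:
  assumes g: "valid_path g" and P: "continuation_on {0..1} g P"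
  shows "((\<lambda>u. fps_nth (fps_deriv (P u)) 0 * vector_derivative g (at u within {0..1}))
           has_integral (fps_nth (P 1) 0 - fps_nth (P 0) 0)) {0..1}"
proof -
  obtain S where S: "finite S" "g C1_differentiable_on ({0..1} - S)"
    using g by (auto simp: valid_path_def piecewise_C1_differentiable_on_def)
  show ?thesis
  proof (rule fundamental_theorem_of_calculus_interior_strong[OF S(1)])
    fix u :: real assume u: "u \<in> {0<..<1} - S"
    have "(g has_vector_derivative vector_derivative g (at u)) (at u)"
      using S(2) u unfolding C1_differentiable_on_eq by (auto simp: vector_derivative_works)
    moreover have "vector_derivative g (at u within {0..1}) = vector_derivative g (at u)"
      using u by (intro vector_derivative_at_within_ivl[OF calculation]) auto
    ultimately show "((\<lambda>u. fps_nth (P u) 0) has_vector_derivative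
        fps_nth (fps_deriv (P u)) 0 * vector_derivative g (at u within {0..1})) (at u)"
      using germ_value_has_vector_derivative[OF P, of u] u by simp
  qed (use continuous_on_germ_value[OF P] in auto)
qed

lemma germ_integral_continuation:
  assumes F: "continuation_on {0..1} g F" "F 0 = f"
  shows "germ_integral g f = integral {0..1} (\<lambda>u. fps_nth (F u) 0 * vector_derivative g (at u within {0..1}))"
  unfolding germ_integral_def
  by (rule integral_cong) (simp add: continue_eq[OF F(1) _ F(2)])

text \<open>Turns a contour integral into the increment of a continued primitive, a quantity that
  makes sense for continuous paths and is invariant under homotopy.\<close>

lemma germ_integral_eq:
  assumes g: "valid_path g" "path_image g \<subseteq> X" "pathstart g = z" and P: "continuable X z P"
  shows "germ_integral g (fps_deriv P) = fps_nth (monodromy g P) 0 - fps_nth P 0"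
proof -
  obtain F where F: "continuation_on {0..1} g F" "F 0 = P" "F 1 = monodromy g P"
    using continuable_monodromy_obtain[OF P valid_path_imp_path[OF g(1)] g(2,3)] by blast
  show ?thesis
    using germ_integral_continuation[OF continuation_on_deriv[OF F(1)] refl]
      integral_unique[OF germ_integral_primitive[OF g(1) F(1)]] F by simp
qed

section \<open>Germs of functions of the logarithm\<close>

text \<open>A function of \<open>log t\<close> as a germ at \<open>z\<close>, where the logarithm
  takes the value \<open>l\<close>. In this form continuation around 0 is a translation of the
  argument of \<open>H\<close>, and \<open>D\<close> is the derivative of \<open>H\<close>.\<close>

definition log_germ :: "(complex \<Rightarrow> complex) \<Rightarrow> complex \<Rightarrow> complex \<Rightarrow> complex fps" where
  "log_germ H z l = fps_expansion (\<lambda>t. H (log_branch z l t)) z"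

lemma power_germ_eq: "power_germ z l s = log_germ (\<lambda>x. exp (s * x)) z l"
  by (simp add: power_germ_def log_germ_def)

text \<open>The principal logarithm of \<open>t / z\<close> is holomorphic on the half plane
  \<open>0 < Re (t / z)\<close>, and intersecting with the preimage of \<open>W\<close> gives
  \<open>A\<close>. The bound on \<open>Re (t / z)\<close> is kept for comparing branches at
  different points.\<close>

lemma log_branch_nhd:
  assumes "open W" "l \<in> W" "exp l = z"
  obtains A where "open A" "z \<in> A" "0 \<notin> A" "log_branch z l holomorphic_on A" "log_branch z l ` A \<subseteq> W"
    "\<And>t. t \<in> A \<Longrightarrow> (log_branch z l has_field_derivative 1 / t) (at t)" "\<And>t. t \<in> A \<Longrightarrow> 0 < Re (t / z)"
proof -
  have z: "z \<noteq> 0" using assms(3) exp_not_eq_zero by metis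
  define B where "B = {t. 0 < Re (t / z)}"
  have B: "open B" unfolding B_def by (intro open_Collect_less continuous_intros)(use z in auto)
  have der: "(log_branch z l has_field_derivative 1 / t) (at t)" if "t \<in> B" for t
  proof -
    have "t / z \<notin> \<real>\<^sub>\<le>\<^sub>0" "t \<noteq> 0" using that by (auto simp: B_def complex_nonpos_Reals_iff)
    then show ?thesis
      unfolding log_branch_def[abs_def] using z by (auto intro!: derivative_eq_intros simp: field_simps)
  qed
  then have hol: "log_branch z l holomorphic_on B"
    unfolding holomorphic_on_open[OF B] by blast
  define A where "A = B \<inter> log_branch z l -` W"
  have "open A" unfolding A_def
    by (rule continuous_open_preimage[OF holomorphic_on_imp_continuous_on[OF hol] B assms(1)])
  moreover have "z \<in> A" using z assms(2) by (simp add: A_def B_def log_branch_def)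
  moreover have "0 \<notin> A" by (simp add: A_def B_def)
  moreover have "log_branch z l holomorphic_on A" using hol by (rule holomorphic_on_subset) (auto simp: A_def)
  moreover have "log_branch z l ` A \<subseteq> W" by (auto simp: A_def)
  moreover have "(log_branch z l has_field_derivative 1 / t) (at t)" "0 < Re (t / z)" if "t \<in> A" for t
    using that der by (auto simp: A_def B_def)
  ultimately show ?thesis by (rule that)
qed

context
  fixes W :: "complex set" and l z
  assumes W: "open W" "l \<in> W" "exp l = z"
begin

lemma log_germ_nhd:
  obtains A where "open A" "z \<in> A" "0 \<notin> A"
    "\<And>H. H holomorphic_on W \<Longrightarrow> (\<lambda>t. H (log_branch z l t)) holomorphic_on A"
    "\<And>H t. H holomorphic_on W \<Longrightarrow> t \<in> A \<Longrightarrow> deriv (\<lambda>t. H (log_branch z l t)) t = deriv H (log_branch z l t) * (1 / t)"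
proof -
  obtain A where A: "open A" "z \<in> A" "0 \<notin> A" "log_branch z l holomorphic_on A" "log_branch z l ` A \<subseteq> W"
    "\<And>t. t \<in> A \<Longrightarrow> (log_branch z l has_field_derivative 1 / t) (at t)"
    using log_branch_nhd[OF W] by metis
  have "(\<lambda>t. H (log_branch z l t)) holomorphic_on A" if "H holomorphic_on W" for H
    using holomorphic_on_compose_gen[OF A(4) that A(5)] by (simp add: o_def)
  moreover have "deriv (\<lambda>t. H (log_branch z l t)) t = deriv H (log_branch z l t) * (1 / t)"
    if H: "H holomorphic_on W" and t: "t \<in> A" for H t
  proof (rule DERIV_imp_deriv, rule DERIV_chain2[OF _ A(6)[OF t]])
    show "(H has_field_derivative deriv H (log_branch z l t)) (at (log_branch z l t))"
      by (rule holomorphic_derivI[OF H W(1)]) (use A(5) t in auto)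
  qed
  ultimately show ?thesis using that A(1,2,3) by metis
qed

lemma log_germ_mult:
  "H holomorphic_on W \<Longrightarrow> K holomorphic_on W \<Longrightarrow> log_germ (\<lambda>x. H x * K x) z l = log_germ H z l * log_germ K z l"
  unfolding log_germ_def by (rule log_germ_nhd, rule fps_expansion_mult) auto

lemma log_germ_scale:
  "H holomorphic_on W \<Longrightarrow> log_germ (\<lambda>x. c * H x) z l = fps_const c * log_germ H z l"
  using log_germ_mult[of "\<lambda>_. c" H] by (simp add: log_germ_def fps_expansion_const)

lemma log_germ_sum:
  "(\<And>i. i \<in> N \<Longrightarrow> H i holomorphic_on W) \<Longrightarrow> log_germ (\<lambda>x. \<Sum>i\<in>N. H i x) z l = (\<Sum>i\<in>N. log_germ (H i) z l)"
  unfolding log_germ_def by (rule log_germ_nhd, rule fps_expansion_sum) auto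

lemma log_germ_cong:
  assumes "\<And>x. x \<in> W \<Longrightarrow> H x = K x" shows "log_germ H z l = log_germ K z l"
proof -
  obtain A where A: "open A" "z \<in> A" "log_branch z l ` A \<subseteq> W"
    using log_branch_nhd[OF W] by metis
  show ?thesis unfolding log_germ_def by (rule fps_expansion_eq_on[OF A(1,2)]) (use assms A(3) in auto)
qed

lemma log_germ_exp:
  shows "log_germ (\<lambda>x. f (exp x)) z l = fps_expansion f z"
proof -
  have "exp (log_branch z l t) = t" if "t \<noteq> 0" for t
    using W(3) that by (auto simp: log_branch_def exp_add)
  then show ?thesis unfolding log_germ_def
    by (intro fps_expansion_eq_on[of "- {0}"]) (use W(3) in auto)
qed

text \<open>In the coordinate \<open>x = log t\<close> the operator \<open>t d/dt\<close> is
  \<open>d/dx\<close>: the factor \<open>1 / t\<close> of the chain rule cancels the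
  \<open>t\<close>.\<close>

lemma D_germ_log_germ:
  assumes H: "H holomorphic_on W" shows "D_germ z (log_germ H z l) = log_germ (deriv H) z l"
proof -
  obtain A where A: "open A" "z \<in> A" "0 \<notin> A"
    "\<And>H. H holomorphic_on W \<Longrightarrow> (\<lambda>t. H (log_branch z l t)) holomorphic_on A"
    "\<And>H t. H holomorphic_on W \<Longrightarrow> t \<in> A \<Longrightarrow> deriv (\<lambda>t. H (log_branch z l t)) t = deriv H (log_branch z l t) * (1 / t)"
    using log_germ_nhd by metis
  have dH: "deriv H holomorphic_on W" by (rule holomorphic_deriv[OF H W(1)])
  have "D_germ z (log_germ H z l) = fps_expansion (\<lambda>t. t) z * fps_expansion (deriv (\<lambda>t. H (log_branch z l t))) z"
    by (simp add: D_germ_def log_germ_def fps_expansion_ident fps_expansion_deriv)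
  also have "\<dots> = fps_expansion (\<lambda>t. t * deriv (\<lambda>t. H (log_branch z l t)) t) z"
    by (rule fps_expansion_mult[symmetric, OF A(1,2)]) (auto intro!: holomorphic_intros holomorphic_deriv A H)
  also have "\<dots> = log_germ (deriv H) z l"
    unfolding log_germ_def by (rule fps_expansion_eq_on[OF A(1,2)]) (use A(3,5) H in auto)
  finally show ?thesis .
qed

lemma log_germ_nth_0: "fps_nth (log_germ H z l) 0 = H l"
  using W(3) exp_not_eq_zero[of l] by (auto simp: log_germ_def fps_expansion_nth_0 log_branch_def)

end

lemma log_germ_shift: "log_germ H z (l + c) = log_germ (\<lambda>x. H (x + c)) z l"
  by (simp add: log_germ_def log_branch_def add_ac)

text \<open>The arguments of \<open>w / z\<close> and \<open>t / w\<close> are below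
  \<open>pi / 2\<close> in absolute value, so their principal logarithms add without a multiple of
  \<open>2 pi i\<close>; the bound on \<open>Im (m - l)\<close> excludes such a multiple between
  \<open>l\<close> and \<open>m\<close>.\<close>

lemma log_branch_change:
  assumes l: "exp l = z" and m: "exp m = w" and close: "\<bar>Im (m - l)\<bar> < pi" "0 < Re (w / z)" and t: "0 < Re (t / w)"
  shows "log_branch w m t = log_branch z l t"
proof -
  have nz: "w \<noteq> 0" "z \<noteq> 0" using l m exp_not_eq_zero by metis+
  have "Ln (w / z) = m - l" using Ln_exp[of "m - l"] close l m by (simp add: exp_diff)
  moreover have "Ln ((w / z) * (t / w)) = Ln (w / z) + Ln (t / w)"
  proof (rule Ln_times_simple)
    have nz': "w / z \<noteq> 0" "t / w \<noteq> 0" using close t by auto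
    then show "w / z \<noteq> 0" "t / w \<noteq> 0" by auto
    have "\<bar>Im (Ln (w / z))\<bar> < pi / 2" "\<bar>Im (Ln (t / w))\<bar> < pi / 2"
      using Re_Ln_pos_lt nz' close t by blast+
    then show "- pi < Im (Ln (w / z)) + Im (Ln (t / w))" "Im (Ln (w / z)) + Im (Ln (t / w)) \<le> pi" by linarith+
  qed
  moreover have "(w / z) * (t / w) = t / z" using nz by simp
  ultimately show ?thesis by (simp add: log_branch_def)
qed

text \<open>Along a continuous logarithm \<open>\<Lambda>\<close> of the path the branches at
  neighbouring parameters coincide by \<open>log_branch_change\<close>, so one function of
  \<open>t\<close> represents all nearby germs.\<close>

lemma continuation_on_log_germ:
  assumes H: "H holomorphic_on W" "open W" and L: "continuous_on I \<Lambda>" "\<Lambda> ` I \<subseteq> W"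
    and g: "\<And>u. u \<in> I \<Longrightarrow> exp (\<Lambda> u) = g u"
  shows "continuation_on I g (\<lambda>u. log_germ H (g u) (\<Lambda> u))"
  unfolding continuation_on_def
proof (intro conjI ballI)
  show cg: "continuous_on I g"
    by (rule continuous_on_eq[of I "\<lambda>u. exp (\<Lambda> u)"]) (auto intro!: continuous_intros L g)
  fix u assume u: "u \<in> I"
  have lW: "\<Lambda> u \<in> W" using L u by auto
  obtain A where A: "open A" "g u \<in> A" "0 \<notin> A" "log_branch (g u) (\<Lambda> u) holomorphic_on A"
    "log_branch (g u) (\<Lambda> u) ` A \<subseteq> W" "\<And>t. t \<in> A \<Longrightarrow> 0 < Re (t / g u)"
    by (rule log_branch_nhd[OF H(2) lW g[OF u]]) (rule that; assumption)
  obtain d where d: "d > 0" "ball (g u) d \<subseteq> A" using openE[OF A(1,2)] by blast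
  define h where "h t = H (log_branch (g u) (\<Lambda> u) t)" for t
  have "h holomorphic_on A"
    unfolding h_def using holomorphic_on_compose_gen[OF A(4) H(1) A(5)] by (simp add: o_def)
  then have "h holomorphic_on ball (g u) d" using d(2) holomorphic_on_subset by blast
  moreover have "\<forall>\<^sub>F v in nhds u. v \<in> I \<longrightarrow> log_germ H (g v) (\<Lambda> v) = fps_expansion h (g v)"
    using continuous_on_nhds_ball[OF cg u d(1)] continuous_on_nhds_ball[OF L(1) u pi_gt_zero]
  proof eventually_elim
    case (elim v)
    show ?case
    proof
      assume v: "v \<in> I"
      have gv: "g v \<in> A" using elim v d by blast
      have "norm (\<Lambda> v - \<Lambda> u) < pi" using elim v by (simp add: dist_norm norm_minus_commute)
      then have im: "\<bar>Im (\<Lambda> v - \<Lambda> u)\<bar> < pi" using abs_Im_le_cmod le_less_trans by blast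
      have nz: "g v \<noteq> 0" using g[OF v] exp_not_eq_zero by metis
      have op: "open {t. 0 < Re (t / g v)}"
        by (intro open_Collect_less continuous_intros) (use nz in auto)
      show "log_germ H (g v) (\<Lambda> v) = fps_expansion h (g v)"
        unfolding log_germ_def
        by (rule fps_expansion_eq_on[OF op])
           (use nz log_branch_change[OF g[OF u] g[OF v] im A(6)[OF gv]] in \<open>auto simp: h_def\<close>)
    qed
  qed
  ultimately show "\<exists>h d. d > 0 \<and> h holomorphic_on ball (g u) d \<and>
        (\<forall>\<^sub>F v in nhds u. v \<in> I \<longrightarrow> log_germ H (g v) (\<Lambda> v) = fps_expansion h (g v))"
    using d(1) by blast
qed

lemma monodromy_log_germ:
  assumes H: "H holomorphic_on UNIV" and l: "exp l = z"
    and g: "path g" "path_image g \<subseteq> - {0}" "pathstart g = z" "pathfinish g = z"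
  shows "monodromy g (log_germ H z l) = log_germ (\<lambda>x. H (x + 2 * pi * \<i> * winding_number g 0)) z l"
    and "continuable (- {0}) z (log_germ H z l)"
proof -
  have ex: "\<exists>F. continuation_on {0..1} k F \<and> F 0 = log_germ H z l \<and>
      (pathfinish k = z \<longrightarrow> F 1 = log_germ (\<lambda>x. H (x + 2 * pi * \<i> * winding_number k 0)) z l)"
    if k: "path k" "path_image k \<subseteq> - {0}" "pathstart k = z" for k
  proof -
    have "0 \<notin> path_image k" using k by auto
    then obtain q where q: "path q" "pathfinish q - pathstart q = 2 * of_real pi * \<i> * winding_number k 0"
                  "\<And>t. t \<in> {0..1} \<Longrightarrow> k t = 0 + exp (q t)"
      using winding_number_as_continuous_log[OF k(1)] by metis
    \<comment> \<open>The continuous logarithm of \<open>k\<close> is shifted so as to start at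
      \<open>l\<close>; its increment remains \<open>2 pi i\<close> times the winding
      number.\<close>
    define \<Lambda> where "\<Lambda> u = l + (q u - q 0)" for u
    have "exp (q 0) = z" using q(3)[of 0] k(3) by (simp add: pathstart_def)
    then have *: "exp (\<Lambda> u) = k u" if "u \<in> {0..1}" for u
      using q(3)[OF that] l exp_not_eq_zero[of l] by (simp add: \<Lambda>_def exp_add exp_diff)
    have c: "continuous_on {0..1} \<Lambda>" unfolding \<Lambda>_def using q(1) by (auto simp: path_def intro!: continuous_intros)
    have "continuation_on {0..1} k (\<lambda>u. log_germ H (k u) (\<Lambda> u))"
      by (rule continuation_on_log_germ[OF H open_UNIV c _ *]) auto
    moreover have "\<Lambda> 1 = l + 2 * pi * \<i> * winding_number k 0"
      using q(2) by (simp add: \<Lambda>_def pathstart_def pathfinish_def)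
    then have "pathfinish k = z \<longrightarrow> log_germ H (k 1) (\<Lambda> 1) = log_germ (\<lambda>x. H (x + 2 * pi * \<i> * winding_number k 0)) z l"
      by (simp add: log_germ_shift pathfinish_def)
    moreover have "log_germ H (k 0) (\<Lambda> 0) = log_germ H z l"
      using k(3) by (simp add: pathstart_def \<Lambda>_def)
    ultimately show ?thesis by blast
  qed
  show "monodromy g (log_germ H z l) = log_germ (\<lambda>x. H (x + 2 * pi * \<i> * winding_number g 0)) z l"
    using ex[OF g(1-3)] g(4) by (metis monodromy_eq)
  show "continuable (- {0}) z (log_germ H z l)"
    unfolding continuable_def using ex by blast
qed

section \<open>Linear differential systems\<close>

lemma conv_radius_geI_bounded:
  fixes f :: "complex fps"
  assumes "\<And>r. 0 < r \<Longrightarrow> r < R \<Longrightarrow> \<exists>C. \<forall>n. norm (fps_nth f n) * r ^ n \<le> C"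
  shows "fps_conv_radius f \<ge> ereal R"
  unfolding fps_conv_radius_def
proof (rule conv_radius_geI_ex')
  fix r :: real assume r: "0 < r" "ereal r < ereal R"
  then obtain r1 where r1: "r < r1" "r1 < R" using dense by auto
  obtain C where C: "\<And>n. norm (fps_nth f n) * r1 ^ n \<le> C" using assms[of r1] r r1 by auto
  have bd: "norm (fps_nth f n * of_real r ^ n) \<le> C * (r / r1) ^ n" for n
  proof -
    have "norm (fps_nth f n * of_real r ^ n) = norm (fps_nth f n) * r1 ^ n * (r / r1) ^ n"
      using r r1 by (simp add: norm_mult norm_power power_divide)
    also have "\<dots> \<le> C * (r / r1) ^ n" using C r r1 by (intro mult_right_mono) auto
    finally show ?thesis .
  qed
  have "summable (\<lambda>n. C * (r / r1) ^ n)" using r r1 by (intro summable_mult summable_geometric) simp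
  then show "summable (\<lambda>n. fps_nth f n * of_real r ^ n)"
    by (rule summable_comparison_test') (rule bd)
qed

lemma fps_coeff_bounded:
  fixes f :: "complex fps"
  assumes "ereal r < fps_conv_radius f" "0 \<le> r"
  shows "\<exists>C\<ge>0. \<forall>n. norm (fps_nth f n) * r ^ n \<le> C"
proof -
  have s: "summable (\<lambda>n. norm (fps_nth f n * of_real r ^ n))"
    using assms by (intro norm_summable_fps) auto
  have "norm (fps_nth f n) * r ^ n \<le> (\<Sum>n. norm (fps_nth f n * of_real r ^ n))" for n
    using sum_le_suminf[OF s, of "{n}"] assms by (simp add: norm_mult norm_power)
  moreover have "0 \<le> (\<Sum>n. norm (fps_nth f n * of_real r ^ n))" by (rule suminf_nonneg[OF s]) simp
  ultimately show ?thesis by blast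
qed

text \<open>
  A Gronwall argument for the partial sums: they grow at most like \<open>\<Prod>k\<le>n. 1 + A / k\<close>,
  hence slower than any geometric sequence of ratio greater than 1.
\<close>

lemma partial_sums_subgeometric:
  fixes w :: "nat \<Rightarrow> real"
  assumes w: "\<And>n. 0 \<le> w n" and A: "0 \<le> A" and rec: "\<And>n. real (Suc n) * w (Suc n) \<le> A * (\<Sum>k\<le>n. w k)"
    and q: "0 < q" "q < 1"
  shows "\<exists>C. \<forall>n. w n * q ^ n \<le> C"
proof -
  define S where "S n = (\<Sum>k\<le>n. w k)" for n
  have S0: "0 \<le> S n" for n unfolding S_def by (intro sum_nonneg w)
  have wS: "w n \<le> S n" for n unfolding S_def by (rule member_le_sum) (auto intro: w)
  have step: "S (Suc n) \<le> S n * (1 + A / real (Suc n))" for n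
    using rec[of n] by (simp add: S_def field_simps)
  \<comment> \<open>From \<open>M\<close> on, one factor times \<open>q\<close> is at most 1, so
    \<open>S n * q ^ n\<close> no longer increases and is bounded by its maximum over the indices up
    to \<open>M\<close>.\<close>
  obtain M where M: "A * q / (1 - q) < real M" using reals_Archimedean2 by blast
  have ratio: "(1 + A / real (Suc n)) * q \<le> 1" if "n \<ge> M" for n
  proof -
    have "A * q / (1 - q) \<le> real (Suc n)" using M that by simp
    then have "A * q \<le> real (Suc n) * (1 - q)" using q by (simp add: divide_le_eq)
    then show ?thesis by (simp add: field_simps)
  qed
  define C where "C = Max ((\<lambda>n. S n * q ^ n) ` {..M})"
  have "S n * q ^ n \<le> C" for n
  proof (induction n)
    case 0 show ?case unfolding C_def by (intro Max_ge image_eqI[of _ _ 0]) auto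
  next
    case (Suc n)
    show ?case
    proof (cases "n < M")
      case True
      then show ?thesis unfolding C_def by (intro Max_ge image_eqI[of _ _ "Suc n"]) auto
    next
      case False
      have "S (Suc n) * q ^ Suc n \<le> S n * (1 + A / real (Suc n)) * q ^ Suc n"
        using step q by (intro mult_right_mono) auto
      also have "\<dots> = S n * q ^ n * ((1 + A / real (Suc n)) * q)" by (simp add: mult_ac)
      also have "\<dots> \<le> S n * q ^ n * 1"
        by (rule mult_left_mono) (use ratio False S0 q in auto)
      finally show ?thesis using Suc by simp
    qed
  qed
  moreover have "w n * q ^ n \<le> S n * q ^ n" for n using wS q by (intro mult_right_mono) auto
  ultimately show ?thesis by (meson order_trans)
qed

text \<open>No convergence of \<open>y\<close> is assumed: a formal solution converges wherever the
  coefficients do. With the weights \<open>r ^ n\<close>, where \<open>r0 < r < R\<close>, the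
  Cauchy product turns the recursion for the coefficients of \<open>y\<close> into the hypothesis of
  \<open>partial_sums_subgeometric\<close>, which with ratio \<open>r0 / r\<close> bounds them at
  radius \<open>r0\<close>.\<close>

lemma linear_system_conv_radius:
  fixes y :: "nat \<Rightarrow> complex fps" and B :: "nat \<Rightarrow> nat \<Rightarrow> complex fps"
  assumes B: "\<And>i j. i < N \<Longrightarrow> j < N \<Longrightarrow> fps_conv_radius (B i j) \<ge> ereal R"
    and y: "\<And>i. i < N \<Longrightarrow> fps_deriv (y i) = (\<Sum>j<N. B i j * y j)"
    and i: "i < N"
  shows "fps_conv_radius (y i) \<ge> ereal R"
proof (rule conv_radius_geI_bounded)
  fix r0 :: real assume r0: "0 < r0" "r0 < R"
  obtain r where r: "r0 < r" "r < R" using dense r0 by blast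
  have r_pos: "0 < r" using r r0 by simp
  have "\<forall>i j. \<exists>C\<ge>0. i < N \<longrightarrow> j < N \<longrightarrow> (\<forall>n. norm (fps_nth (B i j) n) * r ^ n \<le> C)"
  proof (intro allI)
    fix i j
    show "\<exists>C\<ge>0. i < N \<longrightarrow> j < N \<longrightarrow> (\<forall>n. norm (fps_nth (B i j) n) * r ^ n \<le> C)"
    proof (cases "i < N \<and> j < N")
      case True
      have "ereal r < fps_conv_radius (B i j)" using B[of i j] True r by (meson ereal_less_le less_ereal.simps(1) less_le_trans)
      then show ?thesis using fps_coeff_bounded[of r "B i j"] r_pos by force
    qed auto
  qed
  then obtain C where C: "\<And>i j. 0 \<le> C i j" "\<And>i j n. i < N \<Longrightarrow> j < N \<Longrightarrow> norm (fps_nth (B i j) n) * r ^ n \<le> C i j"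
    by metis
  define K where "K = (\<Sum>i<N. \<Sum>j<N. C i j)"
  have K: "C i j \<le> K" if "i < N" "j < N" for i j
  proof -
    have "C i j \<le> (\<Sum>j<N. C i j)" using that by (intro member_le_sum) (auto intro: C)
    also have "\<dots> \<le> K" unfolding K_def
      using that by (intro member_le_sum[of i "{..<N}" "\<lambda>i. \<Sum>j<N. C i j"]) (auto intro!: sum_nonneg C)
    finally show ?thesis .
  qed
  have K0: "0 \<le> K" unfolding K_def by (intro sum_nonneg C)
  define w where "w n = (\<Sum>i<N. norm (fps_nth (y i) n)) * r ^ n" for n
  have w0: "0 \<le> w n" for n unfolding w_def using r_pos by (intro mult_nonneg_nonneg sum_nonneg) auto
  have rec: "real (Suc n) * w (Suc n) \<le> (real N * r * K) * (\<Sum>k\<le>n. w k)" for n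
  proof -
    have one: "real (Suc n) * norm (fps_nth (y i) (Suc n)) * r ^ Suc n \<le> r * K * (\<Sum>k\<le>n. w k)" if i: "i < N" for i
    proof -
      have "of_nat (Suc n) * fps_nth (y i) (Suc n) = fps_nth (\<Sum>j<N. B i j * y j) n"
        unfolding y[OF i, symmetric] by simp
      also have "\<dots> = (\<Sum>j<N. \<Sum>k=0..n. fps_nth (B i j) k * fps_nth (y j) (n - k))"
        by (simp add: fps_sum_nth fps_mult_nth)
      finally have "norm (of_nat (Suc n) * fps_nth (y i) (Suc n)) = norm (\<Sum>j<N. \<Sum>k=0..n. fps_nth (B i j) k * fps_nth (y j) (n - k))"
        by simp
      then have "real (Suc n) * norm (fps_nth (y i) (Suc n)) = norm (\<Sum>j<N. \<Sum>k=0..n. fps_nth (B i j) k * fps_nth (y j) (n - k))"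
        by (simp only: norm_mult norm_of_nat)
      also have "\<dots> \<le> (\<Sum>j<N. \<Sum>k=0..n. norm (fps_nth (B i j) k) * norm (fps_nth (y j) (n - k)))"
        by (intro order_trans[OF norm_sum] sum_mono) (simp add: norm_mult)
      finally have "real (Suc n) * norm (fps_nth (y i) (Suc n)) * r ^ Suc n \<le>
          (\<Sum>j<N. \<Sum>k=0..n. norm (fps_nth (B i j) k) * norm (fps_nth (y j) (n - k))) * r ^ Suc n"
        using r_pos by (intro mult_right_mono) auto
      also have "\<dots> = r * (\<Sum>j<N. \<Sum>k=0..n. (norm (fps_nth (B i j) k) * r ^ k) * (norm (fps_nth (y j) (n - k)) * r ^ (n - k)))"
        unfolding sum_distrib_left sum_distrib_right
      proof (intro sum.cong refl)
        fix j k assume "k \<in> {0..n}"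
        then have "r ^ Suc n = r * (r ^ k * r ^ (n - k))" by (simp add: power_add[symmetric])
        then show "norm (fps_nth (B i j) k) * norm (fps_nth (y j) (n - k)) * r ^ Suc n =
            r * (norm (fps_nth (B i j) k) * r ^ k * (norm (fps_nth (y j) (n - k)) * r ^ (n - k)))"
          by (simp only: mult_ac)
      qed
      also have "\<dots> \<le> r * (\<Sum>j<N. \<Sum>k=0..n. K * (norm (fps_nth (y j) (n - k)) * r ^ (n - k)))"
        using r_pos i by (intro mult_left_mono sum_mono mult_right_mono order_trans[OF C(2) K]) auto
      also have "\<dots> = r * (K * (\<Sum>k=0..n. w (n - k)))"
        by (subst sum.swap) (simp add: w_def sum_distrib_left sum_distrib_right)
      also have "(\<Sum>k=0..n. w (n - k)) = (\<Sum>k\<le>n. w k)"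
        using sum.atLeastAtMost_rev[of w 0 n] by (simp add: atLeast0AtMost)
      finally show ?thesis by (simp add: mult_ac)
    qed
    have "real (Suc n) * w (Suc n) = (\<Sum>i<N. real (Suc n) * norm (fps_nth (y i) (Suc n)) * r ^ Suc n)"
      by (simp add: w_def sum_distrib_left sum_distrib_right mult_ac)
    also have "\<dots> \<le> (\<Sum>i<N. r * K * (\<Sum>k\<le>n. w k))" by (intro sum_mono one) auto
    finally show ?thesis by (simp add: mult_ac)
  qed
  have "\<exists>C. \<forall>n. w n * (r0 / r) ^ n \<le> C"
    by (rule partial_sums_subgeometric[OF w0 _ rec]) (use r_pos K0 r0 r in auto)
  then obtain C' where C': "\<And>n. w n * (r0 / r) ^ n \<le> C'" by blast
  have "norm (fps_nth (y i) n) * r0 ^ n \<le> C'" for n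
  proof -
    have "norm (fps_nth (y i) n) \<le> (\<Sum>i<N. norm (fps_nth (y i) n))" using i by (intro member_le_sum) auto
    then have "norm (fps_nth (y i) n) * r0 ^ n \<le> (\<Sum>i<N. norm (fps_nth (y i) n)) * r0 ^ n"
      using r0 by (intro mult_right_mono) auto
    also have "\<dots> = w n * (r0 / r) ^ n" using r_pos by (simp add: w_def power_divide)
    finally show ?thesis using C'[of n] by simp
  qed
  then show "\<exists>C. \<forall>n. norm (fps_nth (y i) n) * r0 ^ n \<le> C" by blast
qed

fun system_coeff :: "nat \<Rightarrow> (nat \<Rightarrow> nat \<Rightarrow> complex fps) \<Rightarrow> (nat \<Rightarrow> complex) \<Rightarrow> nat \<Rightarrow> nat \<Rightarrow> complex" where
  "system_coeff N B c 0 i = c i"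
| "system_coeff N B c (Suc n) i =
     (\<Sum>j<N. \<Sum>k=0..n. fps_nth (B i j) k * system_coeff N B c (n - k) j) / of_nat (Suc n)"

lemma linear_system_exists:
  fixes B :: "nat \<Rightarrow> nat \<Rightarrow> complex fps"
  shows "\<exists>y. (\<forall>i. fps_nth (y i) 0 = c i) \<and> (\<forall>i. fps_deriv (y i) = (\<Sum>j<N. B i j * y j))"
proof (intro exI conjI allI)
  fix i
  show "fps_nth (Abs_fps (\<lambda>n. system_coeff N B c n i)) 0 = c i" by simp
  show "fps_deriv (Abs_fps (\<lambda>n. system_coeff N B c n i)) = (\<Sum>j<N. B i j * Abs_fps (\<lambda>n. system_coeff N B c n j))"
  proof (rule fps_ext)
    fix n
    have "(of_nat (Suc n) :: complex) \<noteq> 0" by (rule of_nat_neq_0)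
    then show "fps_nth (fps_deriv (Abs_fps (\<lambda>n. system_coeff N B c n i))) n =
        fps_nth (\<Sum>j<N. B i j * Abs_fps (\<lambda>n. system_coeff N B c n j)) n"
      by (simp add: fps_sum_nth fps_mult_nth del: of_nat_Suc)
  qed
qed

lemma linear_system_unique:
  fixes B :: "nat \<Rightarrow> nat \<Rightarrow> complex fps"
  assumes y: "\<And>i. i < N \<Longrightarrow> fps_deriv (y i) = (\<Sum>j<N. B i j * y j)"
    and init: "\<And>i. i < N \<Longrightarrow> fps_nth (y i) 0 = 0" and i: "i < N"
  shows "y i = 0"
proof -
  have "\<forall>i<N. fps_nth (y i) n = 0" for n
  proof (induction n rule: less_induct)
    case (less n)
    show ?case
    proof (cases n)
      case 0 then show ?thesis using init by simp
    next
      case (Suc m)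
      have "fps_nth (y i) (Suc m) = 0" if i: "i < N" for i
      proof -
        have "of_nat (Suc m) * fps_nth (y i) (Suc m) = fps_nth (\<Sum>j<N. B i j * y j) m"
          unfolding y[OF i, symmetric] by simp
        also have "\<dots> = 0" using less Suc by (simp add: fps_sum_nth fps_mult_nth)
        finally show ?thesis using of_nat_neq_0[of m] by (simp del: of_nat_Suc)
      qed
      then show ?thesis using Suc by simp
    qed
  qed
  then show ?thesis using i by (intro fps_ext) simp
qed

section \<open>The operator and its adjoint\<close>

lemma D_germ_add: "D_germ z (f + g) = D_germ z f + D_germ z g"
  by (simp add: D_germ_def algebra_simps)

lemma D_germ_0 [simp]: "D_germ z 0 = 0"
  by (simp add: D_germ_def)

lemma D_germ_scale: "D_germ z (fps_const c * f) = fps_const c * D_germ z f"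
  by (simp add: D_germ_def algebra_simps)

lemma D_germ_mult: "D_germ z (f * g) = D_germ z f * g + f * D_germ z g"
  by (simp add: D_germ_def algebra_simps)

lemma D_germ_sum: "D_germ z (\<Sum>i\<in>N. f i) = (\<Sum>i\<in>N. D_germ z (f i))"
  by (induction N rule: infinite_finite_induct) (simp_all add: D_germ_add)

lemma D_germ_pow_add: "(D_germ z ^^ n) (f + g) = (D_germ z ^^ n) f + (D_germ z ^^ n) g"
  by (induction n) (simp_all add: D_germ_add)

lemma D_germ_pow_scale: "(D_germ z ^^ n) (fps_const c * f) = fps_const c * (D_germ z ^^ n) f"
  by (induction n) (simp_all add: D_germ_scale)

lemma D_germ_pow_sum: "(D_germ z ^^ n) (\<Sum>i\<in>N. f i) = (\<Sum>i\<in>N. (D_germ z ^^ n) (f i))"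
  by (induction n) (simp_all add: D_germ_sum)

lemma neg_D_germ_pow_add:
  "((\<lambda>g. - D_germ z g) ^^ n) (f + g) = ((\<lambda>g. - D_germ z g) ^^ n) f + ((\<lambda>g. - D_germ z g) ^^ n) g"
  by (induction n) (simp_all add: D_germ_add)

lemma neg_D_germ_pow_scale:
  "((\<lambda>g. - D_germ z g) ^^ n) (fps_const c * f) = fps_const c * ((\<lambda>g. - D_germ z g) ^^ n) f"
  by (induction n) (simp_all add: D_germ_scale)

text \<open>
  The partial adjoints: the solutions of the adjoint equation correspond to the solutions of the
  first-order system \<open>- D Y\<^sub>m + q\<^sub>m\<^sub>+\<^sub>1 \<psi> = Y\<^sub>m\<^sub>+\<^sub>1\<close>, \<open>Y\<^sub>r = 0\<close>, and the bracket
  pairs \<open>Y\<^sub>r\<^sub>-\<^sub>1\<^sub>-\<^sub>i\<close> with the \<open>i\<close>-th derivative.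
\<close>

definition partial_adj ::
    "(nat \<Rightarrow> complex \<Rightarrow> complex) \<Rightarrow> complex \<Rightarrow> nat \<Rightarrow> complex fps \<Rightarrow> complex fps" where
  "partial_adj q z m \<psi> = (\<Sum>\<nu>\<le>m. ((\<lambda>g. - D_germ z g) ^^ (m - \<nu>)) (fps_expansion (q \<nu>) z * \<psi>))"

lemma partial_adj_0: "partial_adj q z 0 \<psi> = fps_expansion (q 0) z * \<psi>"
  by (simp add: partial_adj_def)

lemma partial_adj_Suc:
  "partial_adj q z (Suc m) \<psi> = - D_germ z (partial_adj q z m \<psi>) + fps_expansion (q (Suc m)) z * \<psi>"
proof -
  have "(\<Sum>\<nu>\<le>m. ((\<lambda>g. - D_germ z g) ^^ (Suc m - \<nu>)) (fps_expansion (q \<nu>) z * \<psi>)) =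
        (\<Sum>\<nu>\<le>m. - D_germ z (((\<lambda>g. - D_germ z g) ^^ (m - \<nu>)) (fps_expansion (q \<nu>) z * \<psi>)))"
    by (intro sum.cong refl) (simp add: Suc_diff_le)
  then show ?thesis by (simp add: partial_adj_def D_germ_sum sum_negf)
qed

lemma partial_adj_top: "partial_adj q z r \<psi> = L_adj_germ r q z \<psi>"
  by (simp add: partial_adj_def L_adj_germ_def)

lemma partial_adj_add: "partial_adj q z m (f + g) = partial_adj q z m f + partial_adj q z m g"
  by (simp add: partial_adj_def neg_D_germ_pow_add distrib_left sum.distrib)

lemma partial_adj_scale: "partial_adj q z m (fps_const c * f) = fps_const c * partial_adj q z m f"
  by (simp add: partial_adj_def neg_D_germ_pow_scale[symmetric] sum_distrib_left mult.left_commute)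

text \<open>Collecting the terms with a fixed \<open>i\<close> leaves a sum over
  \<open>h + \<nu> = r - 1 - i\<close>, which is a partial adjoint.\<close>

lemma bracket_eq:
  assumes "r > 0"
  shows "bracket r q z \<psi> \<phi> = (\<Sum>i<r. partial_adj q z (r - 1 - i) \<psi> * (D_germ z ^^ i) \<phi>)"
proof -
  have "bracket r q z \<psi> \<phi> = (\<Sum>(i, \<nu>)\<in>Sigma {..<r} (\<lambda>i. {..r - 1 - i}).
      ((\<lambda>g. - D_germ z g) ^^ (r - 1 - i - \<nu>)) (fps_expansion (q \<nu>) z * \<psi>) * (D_germ z ^^ i) \<phi>)"
    unfolding bracket_def
    by (rule sum.reindex_bij_witness[of _ "\<lambda>(i, \<nu>). (r - 1 - i - \<nu>, \<nu>, i)" "\<lambda>(h, \<nu>, i). (i, \<nu>)"])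
       (use assms in auto)
  also have "\<dots> = (\<Sum>i<r. \<Sum>\<nu>\<le>r - 1 - i. ((\<lambda>g. - D_germ z g) ^^ (r - 1 - i - \<nu>)) (fps_expansion (q \<nu>) z * \<psi>) * (D_germ z ^^ i) \<phi>)"
    by (rule sum.Sigma[symmetric]) auto
  finally show ?thesis by (simp add: partial_adj_def sum_distrib_right)
qed

lemma L_germ_eq:
  "L_germ r q z f = fps_expansion (q 0) z * (D_germ z ^^ r) f +
     (\<Sum>k<r. fps_expansion (q (r - k)) z * (D_germ z ^^ k) f)"
proof -
  have "L_germ r q z f = (\<Sum>j=0..r. fps_expansion (q j) z * (D_germ z ^^ (r - j)) f)"
    by (simp add: L_germ_def atLeast0AtMost)
  also have "\<dots> = (\<Sum>j=0..r. fps_expansion (q (r - j)) z * (D_germ z ^^ (r - (r - j))) f)"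
    by (subst sum.atLeastAtMost_rev) simp
  also have "\<dots> = (\<Sum>k\<in>insert r {..<r}. fps_expansion (q (r - k)) z * (D_germ z ^^ k) f)"
    by (intro sum.cong) auto
  finally show ?thesis by simp
qed

lemma L_germ_add: "L_germ r q z (f + g) = L_germ r q z f + L_germ r q z g"
  by (simp add: L_germ_def D_germ_pow_add distrib_left sum.distrib)

lemma L_germ_scale: "L_germ r q z (fps_const c * f) = fps_const c * L_germ r q z f"
  by (simp add: L_germ_def D_germ_pow_scale sum_distrib_left mult.left_commute)

lemma L_germ_diff: "L_germ r q z (f - g) = L_germ r q z f - L_germ r q z g"
  using L_germ_add[of r q z "f - g" g] by simp

lemma L_adj_germ_add: "L_adj_germ r q z (f + g) = L_adj_germ r q z f + L_adj_germ r q z g"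
  unfolding partial_adj_top[symmetric] by (rule partial_adj_add)

lemma L_adj_germ_scale: "L_adj_germ r q z (fps_const c * f) = fps_const c * L_adj_germ r q z f"
  unfolding partial_adj_top[symmetric] by (rule partial_adj_scale)

text \<open>The derivative of a partial adjoint is \<open>D Y\<^sub>m = q\<^sub>m\<^sub>+\<^sub>1
  \<psi> - Y\<^sub>m\<^sub>+\<^sub>1\<close>, so the product rule telescopes. The end term with
  \<open>Y\<^sub>0 = q\<^sub>0 \<psi>\<close> supplies the leading term of \<open>L\<close>, the one
  with \<open>Y\<^sub>r\<close> the adjoint operator.\<close>

lemma D_germ_bracket:
  assumes "r > 0"
  shows "D_germ z (bracket r q z \<psi> \<phi>) = \<psi> * L_germ r q z \<phi> - L_adj_germ r q z \<psi> * \<phi>"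
proof -
  let ?Y = "\<lambda>m. partial_adj q z m \<psi>" and ?x = "\<lambda>i. (D_germ z ^^ i) \<phi>" and ?e = "\<lambda>j. fps_expansion (q j) z"
  have Y: "D_germ z (?Y (r - Suc i)) = ?e (r - i) * \<psi> - ?Y (r - i)" if "i < r" for i
    using partial_adj_Suc[of q z "r - 1 - i" \<psi>] that by (simp add: Suc_diff_Suc)
  have "D_germ z (bracket r q z \<psi> \<phi>) = (\<Sum>i<r. (?e (r - i) * \<psi> - ?Y (r - i)) * ?x i + ?Y (r - Suc i) * ?x (Suc i))"
    unfolding bracket_eq[OF assms] D_germ_sum by (intro sum.cong refl) (simp add: D_germ_mult Y)
  also have "\<dots> = \<psi> * (\<Sum>i<r. ?e (r - i) * ?x i) + (\<Sum>i<r. ?Y (r - Suc i) * ?x (Suc i) - ?Y (r - i) * ?x i)"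
    by (simp add: sum_distrib_left sum.distrib[symmetric] algebra_simps)
  also have "(\<Sum>i<r. ?Y (r - Suc i) * ?x (Suc i) - ?Y (r - i) * ?x i) = ?Y 0 * ?x r - ?Y r * ?x 0"
    using sum_lessThan_telescope[of "\<lambda>i. ?Y (r - i) * ?x i" r] by simp
  finally have "D_germ z (bracket r q z \<psi> \<phi>) =
      \<psi> * (\<Sum>i<r. ?e (r - i) * ?x i) + (?e 0 * \<psi> * ?x r - L_adj_germ r q z \<psi> * \<phi>)"
    by (simp only: partial_adj_0[of q z \<psi>] partial_adj_top[of q z r \<psi>] funpow_0)
  then show ?thesis unfolding L_germ_eq by (simp only: algebra_simps)
qed

section \<open>Operators on germs that commute with continuation\<close>

lemma D_fun_holomorphic:
  assumes "h holomorphic_on B" "open B"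
  shows "(\<lambda>t. t * deriv h t) holomorphic_on B"
    and "w \<in> B \<Longrightarrow> fps_expansion (\<lambda>t. t * deriv h t) w = D_germ w (fps_expansion h w)"
proof -
  have d: "deriv h holomorphic_on B" by (rule holomorphic_deriv[OF assms])
  then show "(\<lambda>t. t * deriv h t) holomorphic_on B" by (rule holomorphic_on_mult[OF holomorphic_on_ident])
  show "fps_expansion (\<lambda>t. t * deriv h t) w = D_germ w (fps_expansion h w)" if "w \<in> B"
    using fps_expansion_mult[OF assms(2) that _ d, of "\<lambda>t. t"]
    by (simp add: D_germ_def fps_expansion_ident fps_expansion_deriv)
qed

text \<open>The operator depends on the base point \<open>w\<close>, but on the germs of one
  holomorphic function it yields the germs of one holomorphic function. This is what commutes with
  continuation; differential operators with holomorphic coefficients are of this kind.\<close>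

definition holomorphic_operator :: "complex set \<Rightarrow> (complex \<Rightarrow> complex fps \<Rightarrow> complex fps) \<Rightarrow> bool" where
  "holomorphic_operator A T \<longleftrightarrow> (\<forall>B h. open B \<longrightarrow> B \<subseteq> A \<longrightarrow> h holomorphic_on B \<longrightarrow>
     (\<exists>k. k holomorphic_on B \<and> (\<forall>w\<in>B. T w (fps_expansion h w) = fps_expansion k w)))"

lemma holomorphic_operatorD:
  "holomorphic_operator A T \<Longrightarrow> open B \<Longrightarrow> B \<subseteq> A \<Longrightarrow> h holomorphic_on B \<Longrightarrow>
     \<exists>k. k holomorphic_on B \<and> (\<forall>w\<in>B. T w (fps_expansion h w) = fps_expansion k w)"
  unfolding holomorphic_operator_def by blast

lemma holomorphic_operator_id: "holomorphic_operator A (\<lambda>w f. f)"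
  unfolding holomorphic_operator_def by blast

lemma holomorphic_operator_comp:
  "holomorphic_operator A T \<Longrightarrow> holomorphic_operator A T' \<Longrightarrow> holomorphic_operator A (\<lambda>w f. T w (T' w f))"
  unfolding holomorphic_operator_def by metis

lemma holomorphic_operator_D: "holomorphic_operator A D_germ"
  unfolding holomorphic_operator_def using D_fun_holomorphic by metis

lemma holomorphic_operator_uminus:
  assumes "holomorphic_operator A T" shows "holomorphic_operator A (\<lambda>w f. - T w f)"
  unfolding holomorphic_operator_def
proof (intro allI impI)
  fix B h assume B: "open B" "B \<subseteq> A" "h holomorphic_on B"
  obtain k where k: "k holomorphic_on B" "\<forall>w\<in>B. T w (fps_expansion h w) = fps_expansion k w"
    using holomorphic_operatorD[OF assms B] by blast
  then show "\<exists>k. k holomorphic_on B \<and> (\<forall>w\<in>B. - T w (fps_expansion h w) = fps_expansion k w)"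
    by (intro exI[of _ "\<lambda>t. - k t"]) (simp add: fps_expansion_uminus[OF B(1)] holomorphic_on_minus)
qed

lemma holomorphic_operator_mult:
  assumes "e holomorphic_on A" shows "holomorphic_operator A (\<lambda>w f. fps_expansion e w * f)"
  unfolding holomorphic_operator_def
proof (intro allI impI)
  fix B h assume B: "open B" "B \<subseteq> A" "h holomorphic_on B"
  have e: "e holomorphic_on B" using assms B holomorphic_on_subset by blast
  show "\<exists>k. k holomorphic_on B \<and> (\<forall>w\<in>B. fps_expansion e w * fps_expansion h w = fps_expansion k w)"
    by (intro exI[of _ "\<lambda>t. e t * h t"]) (simp add: fps_expansion_mult[OF B(1)] e B holomorphic_on_mult)
qed

lemma holomorphic_operator_pow:
  "holomorphic_operator A T \<Longrightarrow> holomorphic_operator A (\<lambda>w. T w ^^ n)"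
proof (induction n)
  case 0 then show ?case using holomorphic_operator_id by (simp add: id_def)
next
  case (Suc n) then show ?case using holomorphic_operator_comp[of A T "\<lambda>w. T w ^^ n"] by (simp add: o_def)
qed

lemma holomorphic_operator_sum:
  assumes "\<And>i. i \<in> N \<Longrightarrow> holomorphic_operator A (T i)"
  shows "holomorphic_operator A (\<lambda>w f. \<Sum>i\<in>N. T i w f)"
  unfolding holomorphic_operator_def
proof (intro allI impI)
  fix B h assume B: "open B" "B \<subseteq> A" "h holomorphic_on B"
  have "\<forall>i\<in>N. \<exists>k. k holomorphic_on B \<and> (\<forall>w\<in>B. T i w (fps_expansion h w) = fps_expansion k w)"
    using assms holomorphic_operatorD[OF _ B] by blast
  then obtain k where k: "\<And>i. i \<in> N \<Longrightarrow> k i holomorphic_on B"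
     "\<And>i w. i \<in> N \<Longrightarrow> w \<in> B \<Longrightarrow> T i w (fps_expansion h w) = fps_expansion (k i) w"
    by metis
  show "\<exists>k. k holomorphic_on B \<and> (\<forall>w\<in>B. (\<Sum>i\<in>N. T i w (fps_expansion h w)) = fps_expansion k w)"
    by (intro exI[of _ "\<lambda>t. \<Sum>i\<in>N. k i t"]) (simp add: fps_expansion_sum[OF B(1)] k holomorphic_on_sum)
qed

lemma holomorphic_operator_L:
  "(\<And>j. j \<le> r \<Longrightarrow> q j holomorphic_on A) \<Longrightarrow> holomorphic_operator A (L_germ r q)"
  unfolding L_germ_def[abs_def]
  by (intro holomorphic_operator_sum holomorphic_operator_comp[OF holomorphic_operator_mult]
        holomorphic_operator_pow holomorphic_operator_D) auto

lemma holomorphic_operator_L_adj: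
  "(\<And>j. j \<le> r \<Longrightarrow> q j holomorphic_on A) \<Longrightarrow> holomorphic_operator A (L_adj_germ r q)"
  unfolding L_adj_germ_def[abs_def]
  by (intro holomorphic_operator_sum
        holomorphic_operator_comp[where T = "\<lambda>w. (\<lambda>g. - D_germ w g) ^^ _", OF _ holomorphic_operator_mult]
        holomorphic_operator_pow holomorphic_operator_uminus holomorphic_operator_D) auto

text \<open>By \<open>conv\<close> a germ solving the equation extends to any ball in
  \<open>A\<close> on which the right-hand side is holomorphic, and by the identity theorem the
  extension still solves it. So the equation has the uniform extension property of
  \<open>continuation_exists\<close>.\<close>

lemma continuation_operator_equation:
  assumes T: "holomorphic_operator A T" and A: "open A"
    and conv: "\<And>z R f. 0 < R \<Longrightarrow> ball z R \<subseteq> A \<Longrightarrow> fps_conv_radius (T z f) \<ge> ereal R \<Longrightarrow> fps_conv_radius f \<ge> ereal R"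
    and G: "continuation_on {a..b} g G" and g: "g ` {a..b} \<subseteq> A" and f: "T (g a) f = G a" and ab: "a \<le> b"
  shows "\<exists>F. continuation_on {a..b} g F \<and> F a = f \<and> (\<forall>u\<in>{a..b}. T (g u) (F u) = G u)"
proof (rule continuation_exists[where Q = "\<lambda>v f. T (g v) f = G v", OF _ ab _ f])
  show "continuous_on {a..b} g" using G by (simp add: continuation_on_def)
  fix u assume u: "u \<in> {a..b}"
  obtain k dk where k: "dk > 0" "k holomorphic_on ball (g u) dk" "G u = fps_expansion k (g u)"
    "\<forall>d'>0. \<forall>\<^sub>F v in nhds u. v \<in> {a..b} \<longrightarrow> g v \<in> ball (g u) d' \<and> G v = fps_expansion k (g v)"
    using continuation_onD[OF G u] by blast
  obtain da where da: "da > 0" "ball (g u) da \<subseteq> A" using openE[OF A, of "g u"] u g by blast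
  \<comment> \<open>With a third of the radius, the ball of radius \<open>2 * d\<close> around a
    nearby \<open>g v\<close> contains \<open>ball (g u) d\<close> and lies in
    \<open>ball (g u) (3 * d)\<close>, where the right-hand side is holomorphic.\<close>
  define d where "d = min dk da / 3"
  have d: "d > 0" "ball (g u) (3 * d) \<subseteq> A" "k holomorphic_on ball (g u) (3 * d)"
    using k da by (auto simp: d_def min_def intro: holomorphic_on_subset)
  obtain e where e: "e > 0" "\<And>v. dist v u < e \<Longrightarrow> v \<in> {a..b} \<longrightarrow> g v \<in> ball (g u) d \<and> G v = fps_expansion k (g v)"
    using k(4)[rule_format, OF d(1)] unfolding eventually_nhds_metric by blast
  have main: "\<exists>h. h holomorphic_on ball (g u) d \<and> fps_expansion h (g v) = f \<and>
          (\<forall>w\<in>{a..b}. dist u w < e \<longrightarrow> T (g w) (fps_expansion h (g w)) = G w)"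
    if v: "v \<in> {a..b}" "dist u v < e" and f: "T (g v) f = G v" for v f
  proof -
    have gv: "g v \<in> ball (g u) d" "G v = fps_expansion k (g v)" using e(2)[of v] v by (auto simp: dist_commute)
    have sub: "ball (g v) (2 * d) \<subseteq> ball (g u) (3 * d)" "ball (g u) d \<subseteq> ball (g v) (2 * d)"
    proof safe
      fix x assume "x \<in> ball (g v) (2 * d)"
      then show "x \<in> ball (g u) (3 * d)" using gv(1) dist_triangle[of "g u" x "g v"] by simp
    next
      fix x assume "x \<in> ball (g u) d"
      then show "x \<in> ball (g v) (2 * d)" using gv(1) dist_triangle3[of "g v" x "g u"] by simp
    qed
    have "fps_conv_radius (G v) \<ge> ereal (2 * d)"
      unfolding gv(2) by (rule conv_radius_fps_expansion_ball[OF holomorphic_on_subset[OF d(3) sub(1)]])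
    then have cf: "fps_conv_radius f \<ge> ereal (2 * d)"
      using conv[of "2 * d" "g v" f] f d(1,2) sub(1) by simp
    then have cf0: "fps_conv_radius f > 0" using d(1)
      by (metis ereal_less(2) less_le_trans mult_pos_pos zero_less_numeral)
    define h where "h = germ_fun (g v) f"
    have h: "h holomorphic_on ball (g u) d" "fps_expansion h (g v) = f"
      unfolding h_def using holomorphic_on_subset[OF germ_fun_holomorphic[OF cf] sub(2)] fps_expansion_germ_fun[OF cf0] by auto
    have "ball (g u) d \<subseteq> ball (g u) (3 * d)" using d(1) by (intro subset_ball) simp
    then have sub3: "ball (g u) d \<subseteq> A" "k holomorphic_on ball (g u) d"
      using d(2,3) holomorphic_on_subset by blast+
    obtain k' where k': "k' holomorphic_on ball (g u) d" "\<And>w. w \<in> ball (g u) d \<Longrightarrow> T w (fps_expansion h w) = fps_expansion k' w"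
      using holomorphic_operatorD[OF T open_ball sub3(1) h(1)] by blast
    have kk: "k' z = k z" if "z \<in> ball (g u) d" for z
      by (rule fps_expansion_identity[OF k'(1) sub3(2) open_ball connected_ball gv(1) _ that])
         (use k'(2)[OF gv(1)] h(2) f gv(2) in simp)
    have "T (g w) (fps_expansion h (g w)) = G w" if w: "w \<in> {a..b}" "dist u w < e" for w
    proof -
      have gw: "g w \<in> ball (g u) d" "G w = fps_expansion k (g w)" using e(2)[of w] w by (auto simp: dist_commute)
      show ?thesis using k'(2)[OF gw(1)] fps_expansion_eq_on[OF open_ball gw(1) kk] gw(2) by simp
    qed
    then show ?thesis using h by blast
  qed
  show "\<exists>d e. e > 0 \<and> (\<forall>v\<in>{a..b}. dist u v < e \<longrightarrow> g v \<in> ball (g u) d \<and>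
       (\<forall>f. T (g v) f = G v \<longrightarrow> (\<exists>h. h holomorphic_on ball (g u) d \<and> fps_expansion h (g v) = f \<and>
          (\<forall>w\<in>{a..b}. dist u w < e \<longrightarrow> T (g w) (fps_expansion h (g w)) = G w))))"
  proof (rule exI[of _ d], rule exI[of _ e], intro conjI ballI impI allI e(1))
    fix v assume v: "v \<in> {a..b}" "dist u v < e"
    then show "g v \<in> ball (g u) d" using e(2)[of v] by (simp add: dist_commute)
    fix f assume "T (g v) f = G v"
    then show "\<exists>h. h holomorphic_on ball (g u) d \<and> fps_expansion h (g v) = f \<and>
          (\<forall>w\<in>{a..b}. dist u w < e \<longrightarrow> T (g w) (fps_expansion h (g w)) = G w)"
      by (rule main[OF v])
  qed
qed

section \<open>The associated first-order systems: convergence, existence, uniqueness\<close>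

locale regular_operator =
  fixes r :: nat and q :: "nat \<Rightarrow> complex \<Rightarrow> complex" and A :: "complex set"
  assumes A: "open A" "0 \<notin> A" and r: "r > 0"
    and q: "\<And>j. j \<le> r \<Longrightarrow> q j holomorphic_on A" and q0: "\<And>t. t \<in> A \<Longrightarrow> q 0 t \<noteq> 0"
begin

abbreviation e :: "nat \<Rightarrow> complex \<Rightarrow> complex fps" where "e j z \<equiv> fps_expansion (q j) z"
abbreviation inv_e0 :: "complex \<Rightarrow> complex fps" where "inv_e0 z \<equiv> fps_expansion (\<lambda>t. 1 / q 0 t) z"
abbreviation inv_z :: "complex \<Rightarrow> complex fps" where "inv_z z \<equiv> fps_expansion (\<lambda>t. 1 / t) z"

lemma hol_inv: "(\<lambda>t. 1 / q 0 t) holomorphic_on A" "(\<lambda>t. 1 / t) holomorphic_on A"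
  using q[of 0] q0 A by (auto intro!: holomorphic_intros)

lemma inv_e0: assumes "z \<in> A" shows "inv_e0 z * e 0 z = 1" "e 0 z * inv_e0 z = 1"
proof -
  have "inv_e0 z * e 0 z = fps_expansion (\<lambda>t. 1 / q 0 t * q 0 t) z"
    using fps_expansion_mult[OF A(1) assms hol_inv(1) q[of 0]] by simp
  also have "\<dots> = fps_expansion (\<lambda>t. 1) z" by (rule fps_expansion_eq_on[OF A(1) assms]) (use q0 in auto)
  finally show "inv_e0 z * e 0 z = 1" by (simp add: fps_expansion_const)
  then show "e 0 z * inv_e0 z = 1" by (simp add: mult.commute)
qed

lemma inv_z: assumes "z \<in> A" shows "inv_z z * (fps_const z + fps_X) = 1"
proof -
  have "inv_z z * (fps_const z + fps_X) = fps_expansion (\<lambda>t. 1 / t * t) z"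
    unfolding fps_expansion_ident[symmetric]
    by (rule fps_expansion_mult[OF A(1) assms hol_inv(2), symmetric]) (intro holomorphic_intros)
  also have "\<dots> = fps_expansion (\<lambda>t. 1) z" by (rule fps_expansion_eq_on[OF A(1) assms]) (use A(2) in auto)
  finally show ?thesis by (simp add: fps_expansion_const)
qed

lemma fps_deriv_eq: assumes "z \<in> A" shows "fps_deriv f = inv_z z * D_germ z f"
  using inv_z[OF assms] by (simp add: D_germ_def mult.assoc[symmetric])

lemma D_germ_eqI:
  assumes "z \<in> A" "fps_deriv f = inv_z z * g" shows "D_germ z f = g"
proof -
  have "D_germ z f = (inv_z z * (fps_const z + fps_X)) * g" using assms(2) by (simp add: D_germ_def mult_ac)
  then show ?thesis using inv_z[OF assms(1)] by simp
qed

text \<open>The companion system of \<open>L f = G\<close> for the iterates of \<open>D\<close> on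
  \<open>f\<close>. The extra index \<open>r\<close> belongs to a component equal to 1 whose column
  carries \<open>G\<close>, which makes an inhomogeneous equation a homogeneous system. The factors
  \<open>inv_z\<close> convert \<open>D\<close> into the derivative of power series.\<close>

definition L_mat :: "complex \<Rightarrow> complex fps \<Rightarrow> nat \<Rightarrow> nat \<Rightarrow> complex fps" where
  "L_mat z G i j =
     (if i < r - 1 then (if j = Suc i then inv_z z else 0)
      else if i = r - 1 then inv_z z * inv_e0 z * (if j < r then - e (r - j) z else G) else 0)"

text \<open>The system for the partial adjoints of \<open>f\<close>, from which \<open>f\<close> is
  recovered by dividing the one of index 0 by \<open>q 0\<close>. Index \<open>r\<close> is again a
  component equal to 1 that carries \<open>G\<close>.\<close>

definition adj_mat :: "complex \<Rightarrow> complex fps \<Rightarrow> nat \<Rightarrow> nat \<Rightarrow> complex fps" where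
  "adj_mat z G i j =
     (if i < r then
        (if j < r then (if j = 0 then inv_z z * e (Suc i) z * inv_e0 z else 0) - (if j = Suc i then inv_z z else 0)
         else if i = r - 1 then - inv_z z * G else 0)
      else 0)"

lemma conv_coeff:
  assumes "ball z R \<subseteq> A"
  shows "j \<le> r \<Longrightarrow> ereal R \<le> fps_conv_radius (e j z)" "ereal R \<le> fps_conv_radius (inv_e0 z)"
    "ereal R \<le> fps_conv_radius (inv_z z)"
  using assms hol_inv q by (auto intro!: conv_radius_fps_expansion_ball intro: holomorphic_on_subset)

lemma conv_mult: "ereal R \<le> fps_conv_radius f \<Longrightarrow> ereal R \<le> fps_conv_radius g \<Longrightarrow> ereal R \<le> fps_conv_radius (f * g)"
  for f g :: "complex fps"
  using fps_conv_radius_mult[of f g] by (meson min.boundedI order_trans)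

lemma conv_diff: "ereal R \<le> fps_conv_radius f \<Longrightarrow> ereal R \<le> fps_conv_radius g \<Longrightarrow> ereal R \<le> fps_conv_radius (f - g)"
  for f g :: "complex fps"
  using fps_conv_radius_diff[of f g] by (meson min.boundedI order_trans)

lemma conv_L_mat:
  assumes "ball z R \<subseteq> A" "ereal R \<le> fps_conv_radius G"
  shows "ereal R \<le> fps_conv_radius (L_mat z G i j)"
  unfolding L_mat_def using conv_coeff[OF assms(1)] assms(2) by (auto intro!: conv_mult)

lemma conv_adj_mat:
  assumes "ball z R \<subseteq> A" "ereal R \<le> fps_conv_radius G"
  shows "ereal R \<le> fps_conv_radius (adj_mat z G i j)"
  unfolding adj_mat_def using conv_coeff[OF assms(1)] assms(2) by (auto intro!: conv_mult conv_diff)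

lemma L_system:
  assumes z: "z \<in> A" and L: "L_germ r q z f = G" and i: "i < Suc r"
  defines "y \<equiv> (\<lambda>i. if i < r then (D_germ z ^^ i) f else 1)"
  shows "fps_deriv (y i) = (\<Sum>j<Suc r. L_mat z G i j * y j)"
proof -
  consider "i < r - 1" | "i = r - 1" | "i = r" using i by linarith
  then show ?thesis
  proof cases
    case 1
    have "(\<Sum>j<Suc r. L_mat z G i j * y j) = (\<Sum>j<Suc r. if j = Suc i then inv_z z * y j else 0)"
      by (intro sum.cong refl) (use 1 in \<open>auto simp: L_mat_def\<close>)
    also have "\<dots> = inv_z z * D_germ z (y i)" using 1 by (auto simp: y_def)
    finally show ?thesis using fps_deriv_eq[OF z] by simp
  next
    case 2
    have "(D_germ z ^^ r) f = inv_e0 z * (e 0 z * (D_germ z ^^ r) f)"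
      using inv_e0[OF z] by (simp add: mult.assoc[symmetric])
    also have "e 0 z * (D_germ z ^^ r) f = (\<Sum>j<r. - e (r - j) z * y j) + G"
      using L unfolding L_germ_eq by (simp add: y_def sum_negf algebra_simps)
    finally have *: "(D_germ z ^^ r) f = inv_e0 z * ((\<Sum>j<r. - e (r - j) z * y j) + G)" .
    have "(\<Sum>j<Suc r. L_mat z G i j * y j) = inv_z z * (inv_e0 z * ((\<Sum>j<r. - e (r - j) z * y j) + G))"
      using 2 r by (simp add: L_mat_def y_def sum_distrib_left algebra_simps)
    also have "\<dots> = inv_z z * D_germ z (y i)"
    proof -
      have "(D_germ z ^^ Suc i) f = D_germ z ((D_germ z ^^ i) f)" by simp
      moreover have "Suc i = r" "i < r" using 2 r by auto
      ultimately show ?thesis unfolding *[symmetric] by (simp add: y_def)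
    qed
    finally show ?thesis using fps_deriv_eq[OF z] by simp
  next
    case 3
    then have "\<not> i < r - 1" "i \<noteq> r - 1" "\<not> i < r" using r by auto
    then show ?thesis by (simp add: y_def L_mat_def)
  qed
qed

lemma conv_radius_L:
  assumes R: "0 < R" "ball z R \<subseteq> A" and G: "fps_conv_radius (L_germ r q z f) \<ge> ereal R"
  shows "fps_conv_radius f \<ge> ereal R"
proof -
  have z: "z \<in> A" using R by auto
  have "fps_conv_radius (if 0 < r then (D_germ z ^^ 0) f else 1) \<ge> ereal R"
    by (rule linear_system_conv_radius[where N = "Suc r" and B = "L_mat z (L_germ r q z f)"
          and y = "\<lambda>i. if i < r then (D_germ z ^^ i) f else 1"])
       (use conv_L_mat[OF R(2) G] L_system[OF z refl] in auto)
  then show ?thesis using r by simp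
qed

lemma adj_system:
  assumes z: "z \<in> A" and L: "L_adj_germ r q z f = G" and i: "i < Suc r"
  defines "y \<equiv> (\<lambda>i. if i < r then partial_adj q z i f else 1)"
  shows "fps_deriv (y i) = (\<Sum>j<Suc r. adj_mat z G i j * y j)"
proof (cases "i < r")
  case True
  have f: "f = inv_e0 z * y 0"
    using inv_e0[OF z] r by (simp add: y_def partial_adj_0 mult.assoc[symmetric])
  have "partial_adj q z (Suc i) f = - D_germ z (y i) + e (Suc i) z * f"
    using True by (simp add: y_def partial_adj_Suc)
  then have *: "D_germ z (y i) = e (Suc i) z * inv_e0 z * y 0 - partial_adj q z (Suc i) f"
    using f by (simp add: mult.assoc)
  have "(\<Sum>j<r. adj_mat z G i j * y j) =
      (\<Sum>j<r. (if j = 0 then inv_z z * e (Suc i) z * inv_e0 z * y j else 0) - (if j = Suc i then inv_z z * y j else 0))"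
    by (intro sum.cong refl) (use True in \<open>auto simp: adj_mat_def algebra_simps\<close>)
  also have "\<dots> = inv_z z * e (Suc i) z * inv_e0 z * y 0 - (if Suc i < r then inv_z z * y (Suc i) else 0)"
    unfolding sum_subtractf using r by simp
  finally have "(\<Sum>j<Suc r. adj_mat z G i j * y j) =
      inv_z z * e (Suc i) z * inv_e0 z * y 0 - (if Suc i < r then inv_z z * y (Suc i) else 0) + adj_mat z G i r"
    by (simp add: y_def)
  also have "\<dots> = inv_z z * (e (Suc i) z * inv_e0 z * y 0 - partial_adj q z (Suc i) f)"
  proof (cases "Suc i < r")
    case True then show ?thesis by (simp add: adj_mat_def y_def algebra_simps)
  next
    case False
    then have "Suc i = r" using \<open>i < r\<close> by simp
    then show ?thesis using L by (auto simp: adj_mat_def partial_adj_top algebra_simps)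
  qed
  finally show ?thesis using fps_deriv_eq[OF z] * by simp
next
  case False then show ?thesis by (simp add: y_def adj_mat_def)
qed

lemma conv_radius_L_adj:
  assumes R: "0 < R" "ball z R \<subseteq> A" and G: "fps_conv_radius (L_adj_germ r q z f) \<ge> ereal R"
  shows "fps_conv_radius f \<ge> ereal R"
proof -
  have z: "z \<in> A" using R by auto
  have "fps_conv_radius (if 0 < r then partial_adj q z 0 f else 1) \<ge> ereal R"
    by (rule linear_system_conv_radius[where N = "Suc r" and B = "adj_mat z (L_adj_germ r q z f)"
          and y = "\<lambda>i. if i < r then partial_adj q z i f else 1"])
       (use conv_adj_mat[OF R(2) G] adj_system[OF z refl] in auto)
  then have "fps_conv_radius (e 0 z * f) \<ge> ereal R" using r by (simp add: partial_adj_0)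
  from conv_mult[OF conv_coeff(2)[OF R(2)] this] show ?thesis using inv_e0[OF z] by (simp add: mult.assoc[symmetric])
qed

lemma continuation_L:
  assumes "continuation_on {a..b} g G" "g ` {a..b} \<subseteq> A" "L_germ r q (g a) f = G a" "a \<le> b"
  shows "\<exists>F. continuation_on {a..b} g F \<and> F a = f \<and> (\<forall>u\<in>{a..b}. L_germ r q (g u) (F u) = G u)"
  by (rule continuation_operator_equation[OF holomorphic_operator_L[OF q] A(1) conv_radius_L assms]) auto

lemma continuation_L_adj:
  assumes "continuation_on {a..b} g G" "g ` {a..b} \<subseteq> A" "L_adj_germ r q (g a) f = G a" "a \<le> b"
  shows "\<exists>F. continuation_on {a..b} g F \<and> F a = f \<and> (\<forall>u\<in>{a..b}. L_adj_germ r q (g u) (F u) = G u)"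
  by (rule continuation_operator_equation[OF holomorphic_operator_L_adj[OF q] A(1) conv_radius_L_adj assms]) auto

lemma continuable_L:
  assumes "continuable A z (L_germ r q z f)" shows "continuable A z f"
  unfolding continuable_def
proof (intro allI impI)
  fix g assume g: "path g" "path_image g \<subseteq> A" "pathstart g = z"
  obtain G where "continuation_on {0..1} g G" "G 0 = L_germ r q z f"
    using assms g unfolding continuable_def by blast
  then show "\<exists>F. continuation_on {0..1} g F \<and> F 0 = f"
    using continuation_L[of 0 1 g G f] g by (auto simp: path_image_def pathstart_def)
qed

lemma continuable_L_adj:
  assumes "continuable A z (L_adj_germ r q z f)" shows "continuable A z f"
  unfolding continuable_def
proof (intro allI impI)
  fix g assume g: "path g" "path_image g \<subseteq> A" "pathstart g = z"
  obtain G where "continuation_on {0..1} g G" "G 0 = L_adj_germ r q z f"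
    using assms g unfolding continuable_def by blast
  then show "\<exists>F. continuation_on {0..1} g F \<and> F 0 = f"
    using continuation_L_adj[of 0 1 g G f] g by (auto simp: path_image_def pathstart_def)
qed

lemma continuable_Sol: "f \<in> Sol r q z \<Longrightarrow> continuable A z f"
  by (rule continuable_L) (simp add: Sol_def continuable_0)

lemma continuable_Sol_adj: "f \<in> Sol_adj r q z \<Longrightarrow> continuable A z f"
  by (rule continuable_L_adj) (simp add: Sol_adj_def continuable_0)

text \<open>At a regular point every formal solution converges, by the estimate for first-order
  systems; membership in the solution space thus reduces to an algebraic identity.\<close>

lemma Sol_iff:
  assumes z: "z \<in> A" shows "f \<in> Sol r q z \<longleftrightarrow> L_germ r q z f = 0"
proof
  assume f: "L_germ r q z f = 0"
  obtain R where R: "R > 0" "ball z R \<subseteq> A" using A(1) z unfolding open_contains_ball by metis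
  have "ereal R \<le> fps_conv_radius (L_germ r q z f)" unfolding f by simp
  then have "ereal R \<le> fps_conv_radius f" by (rule conv_radius_L[OF R])
  moreover have "0 < ereal R" using R(1) by simp
  ultimately have "0 < fps_conv_radius f" by order
  then show "f \<in> Sol r q z" using f by (simp add: Sol_def)
qed (simp add: Sol_def)

lemma Sol_adj_iff:
  assumes z: "z \<in> A" shows "f \<in> Sol_adj r q z \<longleftrightarrow> L_adj_germ r q z f = 0"
proof
  assume f: "L_adj_germ r q z f = 0"
  obtain R where R: "R > 0" "ball z R \<subseteq> A" using A(1) z unfolding open_contains_ball by metis
  have "ereal R \<le> fps_conv_radius (L_adj_germ r q z f)" unfolding f by simp
  then have "ereal R \<le> fps_conv_radius f" by (rule conv_radius_L_adj[OF R])
  moreover have "0 < ereal R" using R(1) by simp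
  ultimately have "0 < fps_conv_radius f" by order
  then show "f \<in> Sol_adj r q z" using f by (simp add: Sol_adj_def)
qed (simp add: Sol_adj_def)

lemma Sol_exists:
  assumes z: "z \<in> A" shows "\<exists>f\<in>Sol r q z. \<forall>i<r. fps_nth ((D_germ z ^^ i) f) 0 = c i"
proof -
  obtain y where y: "\<And>i. fps_nth (y i) 0 = c i" "\<And>i. fps_deriv (y i) = (\<Sum>j<r. L_mat z 0 i j * y j)"
    using linear_system_exists[where c = c and N = r and B = "L_mat z 0"] by blast
  have step: "D_germ z (y i) = y (Suc i)" if "Suc i < r" for i
  proof (rule D_germ_eqI[OF z])
    have "fps_deriv (y i) = (\<Sum>j<r. if j = Suc i then inv_z z * y j else 0)"
      unfolding y(2) by (intro sum.cong refl) (use that in \<open>auto simp: L_mat_def\<close>)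
    then show "fps_deriv (y i) = inv_z z * y (Suc i)" using that by simp
  qed
  have pow: "(D_germ z ^^ i) (y 0) = y i" if "i < r" for i
    using that by (induction i) (simp_all add: step)
  have "D_germ z (y (r - 1)) = inv_e0 z * - (\<Sum>j<r. e (r - j) z * y j)"
  proof (rule D_germ_eqI[OF z])
    have "fps_deriv (y (r - 1)) = (\<Sum>j<r. inv_z z * (inv_e0 z * - (e (r - j) z * y j)))"
      unfolding y(2) by (intro sum.cong refl) (simp add: L_mat_def mult_ac)
    then show "fps_deriv (y (r - 1)) = inv_z z * (inv_e0 z * - (\<Sum>j<r. e (r - j) z * y j))"
      by (simp add: sum_distrib_left sum_negf)
  qed
  moreover have "(D_germ z ^^ r) (y 0) = D_germ z (y (r - 1))"
  proof -
    have "D_germ z ((D_germ z ^^ (r - 1)) (y 0)) = (D_germ z ^^ Suc (r - 1)) (y 0)" by simp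
    also have "Suc (r - 1) = r" using r by simp
    finally show ?thesis using pow[of "r - 1"] r by simp
  qed
  ultimately have "e 0 z * (D_germ z ^^ r) (y 0) = - (\<Sum>j<r. e (r - j) z * y j)"
    using inv_e0[OF z] by (simp add: mult.assoc[symmetric])
  then have "L_germ r q z (y 0) = 0" by (simp add: L_germ_eq pow)
  then show ?thesis using pow y(1) by (intro bexI[of _ "y 0"]) (auto simp: Sol_iff[OF z])
qed

lemma Sol_unique:
  assumes z: "z \<in> A" and f: "f \<in> Sol r q z" and init: "\<And>i. i < r \<Longrightarrow> fps_nth ((D_germ z ^^ i) f) 0 = 0"
  shows "f = 0"
proof -
  have L: "L_germ r q z f = 0" using f by (simp add: Sol_def)
  have "fps_deriv ((D_germ z ^^ i) f) = (\<Sum>j<r. L_mat z 0 i j * (D_germ z ^^ j) f)" if "i < r" for i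
  proof -
    have "L_mat z 0 i r = 0" using that by (auto simp: L_mat_def)
    then show ?thesis using L_system[OF z L, of i] that by simp
  qed
  then have "(D_germ z ^^ 0) f = 0"
    by (rule linear_system_unique[where N = r and y = "\<lambda>i. (D_germ z ^^ i) f"]) (use init r in auto)
  then show ?thesis by simp
qed

lemma Sol_adj_exists:
  assumes z: "z \<in> A" shows "\<exists>f\<in>Sol_adj r q z. \<forall>i<r. fps_nth (partial_adj q z i f) 0 = c i"
proof -
  obtain y where y: "\<And>i. fps_nth (y i) 0 = c i" "\<And>i. fps_deriv (y i) = (\<Sum>j<r. adj_mat z 0 i j * y j)"
    using linear_system_exists[where c = c and N = r and B = "adj_mat z 0"] by blast
  define f where "f = inv_e0 z * y 0"
  have step: "D_germ z (y i) = e (Suc i) z * f - (if Suc i < r then y (Suc i) else 0)" if "i < r" for i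
  proof (rule D_germ_eqI[OF z])
    have "fps_deriv (y i) = (\<Sum>j<r. (if j = 0 then inv_z z * e (Suc i) z * inv_e0 z * y j else 0) - (if j = Suc i then inv_z z * y j else 0))"
      unfolding y(2) by (intro sum.cong refl) (use that in \<open>auto simp: adj_mat_def algebra_simps\<close>)
    also have "\<dots> = inv_z z * e (Suc i) z * inv_e0 z * y 0 - (if Suc i < r then inv_z z * y (Suc i) else 0)"
      unfolding sum_subtractf using r by simp
    finally show "fps_deriv (y i) = inv_z z * (e (Suc i) z * f - (if Suc i < r then y (Suc i) else 0))"
      by (cases "Suc i < r") (simp_all add: f_def algebra_simps)
  qed
  have Y: "partial_adj q z i f = y i" if "i < r" for i
    using that
  proof (induction i)
    case 0 then show ?case using inv_e0[OF z] by (simp add: partial_adj_0 f_def mult.assoc[symmetric])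
  next
    case (Suc i) then show ?case using step[of i] by (simp add: partial_adj_Suc)
  qed
  have "L_adj_germ r q z f = partial_adj q z (Suc (r - 1)) f" using r by (simp add: partial_adj_top)
  also have "\<dots> = 0" unfolding partial_adj_Suc using step[of "r - 1"] Y[of "r - 1"] r by simp
  finally show ?thesis using Y y(1) by (intro bexI[of _ f]) (auto simp: Sol_adj_iff[OF z])
qed

lemma Sol_adj_unique:
  assumes z: "z \<in> A" and f: "f \<in> Sol_adj r q z" and init: "\<And>i. i < r \<Longrightarrow> fps_nth (partial_adj q z i f) 0 = 0"
  shows "f = 0"
proof -
  have L: "L_adj_germ r q z f = 0" using f by (simp add: Sol_adj_def)
  have "fps_deriv (partial_adj q z i f) = (\<Sum>j<r. adj_mat z 0 i j * partial_adj q z j f)" if "i < r" for i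
  proof -
    have "adj_mat z 0 i r = 0" using that by (auto simp: adj_mat_def)
    then show ?thesis using adj_system[OF z L, of i] that by simp
  qed
  then have "partial_adj q z 0 f = 0"
    by (rule linear_system_unique[where N = r and y = "\<lambda>i. partial_adj q z i f"]) (use init r in auto)
  then have "inv_e0 z * (e 0 z * f) = 0" by (simp add: partial_adj_0)
  then show ?thesis using inv_e0[OF z] by (simp add: mult.assoc[symmetric])
qed

end

section \<open>Generators of the fundamental group\<close>

text \<open>\<open>lg\<close> is a closed path in the plane, which is simply connected; applying
  \<open>k\<close> to a contraction of it contracts \<open>g\<close> inside
  \<open>S\<close>.\<close>

lemma closed_log_imp_null_homotopic:
  fixes g lg :: "real \<Rightarrow> complex" and k :: "complex \<Rightarrow> complex"
  assumes lg: "path lg" "pathfinish lg = pathstart lg" and k: "continuous_on UNIV k" "range k \<subseteq> S"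
    and g: "path g" "path_image g \<subseteq> S" "\<And>u. u \<in> {0..1} \<Longrightarrow> k (lg u) = g u"
  shows "homotopic_paths S g (linepath (pathstart g) (pathstart g))"
proof -
  have sc: "simply_connected (UNIV :: complex set)" by (intro convex_imp_simply_connected convex_UNIV)
  have "homotopic_paths UNIV lg (linepath (pathstart lg) (pathstart lg))"
    using sc lg unfolding simply_connected_eq_homotopic_paths by auto
  then have "homotopic_paths S (k \<circ> lg) (k \<circ> linepath (pathstart lg) (pathstart lg))"
    by (rule homotopic_paths_continuous_image) (use k in auto)
  moreover have "k \<circ> linepath (pathstart lg) (pathstart lg) = linepath (pathstart g) (pathstart g)"
    using g(3)[of 0] by (auto simp: linepath_def pathstart_def algebra_simps scaleR_left.diff)
  moreover have "homotopic_paths S g (k \<circ> lg)"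
    by (rule homotopic_paths_eq[OF g(1,2)]) (use g(3) in auto)
  ultimately show ?thesis using homotopic_paths_trans by metis
qed

text \<open>The radial retraction onto a closed disk of radius \<open>R < 1\<close> that contains
  \<open>K\<close> and has \<open>b\<close> in its interior. Points outside go to the circle of
  radius \<open>R\<close>, hence never to \<open>b\<close>.\<close>

lemma punctured_ball_retraction:
  fixes b :: complex
  assumes K: "compact K" "K \<subseteq> ball 0 1" and b: "norm b < 1"
  obtains \<rho> where "continuous_on UNIV \<rho>" "range \<rho> \<subseteq> ball 0 1" "\<And>x. x \<in> K \<Longrightarrow> \<rho> x = x" "\<And>x. x \<noteq> b \<Longrightarrow> \<rho> x \<noteq> b"
proof -
  have "compact (insert b K)" "insert b K \<noteq> {}" using K by auto
  then obtain m where m: "m \<in> insert b K" "\<And>x. x \<in> insert b K \<Longrightarrow> norm x \<le> norm m"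
    using continuous_attains_sup[of "insert b K" norm] by (metis continuous_on_norm_id)
  then have "norm m < 1" using K b by auto
  then obtain R where R: "norm m < R" "R < 1" using dense by blast
  have R0: "0 < R" using R(1) norm_ge_zero[of m] by linarith
  define \<rho> :: "complex \<Rightarrow> complex" where "\<rho> x = (R / max R (norm x)) *\<^sub>R x" for x
  have inside: "\<rho> x = x" if "norm x \<le> R" for x using that R0 by (simp add: \<rho>_def max_def)
  have outside: "norm (\<rho> x) = R" if "norm x > R" for x using that R0 by (auto simp: \<rho>_def max_def)
  show ?thesis
  proof
    show "continuous_on UNIV \<rho>" unfolding \<rho>_def by (intro continuous_intros) (use R0 in auto)
    show "range \<rho> \<subseteq> ball 0 1"
    proof clarsimp
      fix x show "norm (\<rho> x) < 1" using inside[of x] outside[of x] R by (cases "norm x \<le> R") auto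
    qed
    show "\<rho> x = x" if "x \<in> K" for x using m(2)[of x] R that inside by auto
    show "\<rho> x \<noteq> b" if "x \<noteq> b" for x
      using that m(2)[of b] R inside[of x] outside[of x] by (cases "norm x \<le> R") auto
  qed
qed

text \<open>Winding number 0 makes the logarithm \<open>q\<close> of \<open>g - a\<close> a closed
  path. For a Riemann map \<open>f\<close> onto the unit disk, \<open>f - f a\<close> is
  \<open>z - a\<close> times a zero-free function, which has a holomorphic logarithm; so
  \<open>f \<circ> g - f a\<close> has a closed logarithm too. Contracting this one in the plane and
  returning through the exponential, the retraction and the inverse of \<open>f\<close> avoids
  \<open>a\<close>.\<close>

lemma winding_0_imp_null_homotopic:
  assumes D: "open D" "simply_connected D" "a \<in> D"
    and g: "path g" "path_image g \<subseteq> D - {a}" "pathfinish g = pathstart g" "winding_number g a = 0"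
  shows "homotopic_paths (D - {a}) g (linepath (pathstart g) (pathstart g))"
proof -
  have ag: "a \<notin> path_image g" using g by auto
  obtain q where q: "path q" "pathfinish q = pathstart q" "\<And>t. t \<in> {0..1} \<Longrightarrow> g t = a + exp (q t)"
    using winding_number_as_continuous_log[OF g(1) ag] g(4) by (metis mult_zero_right right_minus_eq)
  consider "D = UNIV" | f k where "f holomorphic_on D" "k holomorphic_on ball 0 1"
      "\<forall>z\<in>D. f z \<in> ball 0 1 \<and> k (f z) = z" "\<forall>z\<in>ball 0 1. k z \<in> D \<and> f (k z) = z"
    using Riemann_mapping_theorem[of D] D by auto
  then show ?thesis
  proof cases
    case 1
    show ?thesis
      by (rule closed_log_imp_null_homotopic[OF q(1,2), where k = "\<lambda>x. a + exp x"])
         (use g q(3) 1 in \<open>auto intro!: continuous_intros\<close>)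
  next
    case 2
    define b where "b = f a"
    have b: "norm b < 1" using 2(3) D(3) by (auto simp: b_def)
    have inj: "inj_on f D" using 2(3) by (metis inj_onI)
    \<comment> \<open>The difference quotient has no zero because \<open>f\<close> is injective; its
      value at \<open>a\<close> is the derivative, which is nonzero for the same reason.\<close>
    define F where "F z = (if z = a then deriv f a else (f z - f a) / (z - a))" for z
    have F: "F holomorphic_on D" unfolding F_def[abs_def] by (rule pole_lemma_open[OF 2(1) D(1)])
    have "F z \<noteq> 0" if "z \<in> D" for z
      using holomorphic_injective_imp_regular[OF 2(1) D(1) inj D(3)] inj_onD[OF inj _ that D(3)]
      by (auto simp: F_def)
    then obtain \<kappa> where \<kappa>: "\<kappa> holomorphic_on D" "\<And>z. z \<in> D \<Longrightarrow> F z = exp (\<kappa> z)"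
      using D F simply_connected_eq_holomorphic_log[OF D(1)] by metis
    define lg where "lg u = q u + \<kappa> (g u)" for u
    have gD: "g u \<in> D" "g u \<noteq> a" if "u \<in> {0..1}" for u
    proof -
      have "g u \<in> path_image g" using that by (simp add: path_image_def)
      then show "g u \<in> D" "g u \<noteq> a" using g(2) by auto
    qed
    have fg: "f (g u) = b + exp (lg u)" if u: "u \<in> {0..1}" for u
    proof -
      have "f (g u) - b = (g u - a) * F (g u)" using gD[OF u] by (simp add: F_def b_def)
      also have "\<dots> = exp (q u) * exp (\<kappa> (g u))" using q(3)[OF u] \<kappa>(2) gD[OF u] by simp
      finally show ?thesis by (simp add: lg_def exp_add algebra_simps)
    qed
    have "continuous_on {0..1} (\<kappa> \<circ> g)"
      using g(1) gD by (intro continuous_on_compose continuous_on_subset[OF holomorphic_on_imp_continuous_on[OF \<kappa>(1)]])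
        (auto simp: path_def)
    then have path_l: "path lg" "pathfinish lg = pathstart lg"
      using q g unfolding lg_def path_def
      by (auto intro!: continuous_intros simp: o_def pathstart_def pathfinish_def)
    have cf: "continuous_on D f" "continuous_on (ball 0 1) k"
      using 2 holomorphic_on_imp_continuous_on by blast+
    have "compact (f ` path_image g)"
      by (intro compact_continuous_image continuous_on_subset[OF cf(1)] compact_path_image g) (use g in auto)
    moreover have "f ` path_image g \<subseteq> ball 0 1" using 2(3) g(2) by auto
    ultimately obtain \<rho> where \<rho>: "continuous_on UNIV \<rho>" "range \<rho> \<subseteq> ball 0 1"
        "\<And>x. x \<in> f ` path_image g \<Longrightarrow> \<rho> x = x" "\<And>x. x \<noteq> b \<Longrightarrow> \<rho> x \<noteq> b"
      using punctured_ball_retraction[of "f ` path_image g" b] b by metis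
    have \<rho>': "\<rho> (f (g u)) = f (g u)" if "u \<in> {0..1}" for u using \<rho>(3) that by (auto simp: path_image_def)
    define K where "K x = k (\<rho> (b + exp x))" for x
    have inb: "\<rho> y \<in> ball 0 1" for y using \<rho>(2) by blast
    have "continuous_on UNIV (\<lambda>x. \<rho> (b + exp x))"
      by (rule continuous_on_compose2[OF \<rho>(1)]) (auto intro!: continuous_intros)
    then have "continuous_on UNIV K" unfolding K_def
      by (rule continuous_on_compose2[OF cf(2)]) (use inb in auto)
    moreover have "K x \<in> D - {a}" for x
    proof -
      have "\<rho> (b + exp x) \<noteq> b" by (rule \<rho>(4)) simp
      moreover have "f (K x) = \<rho> (b + exp x)" "K x \<in> D" using 2(4) inb unfolding K_def by blast+
      ultimately show ?thesis by (auto simp: b_def)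
    qed
    then have "range K \<subseteq> D - {a}" by blast
    moreover have "K (lg u) = g u" if u: "u \<in> {0..1}" for u
      unfolding K_def fg[OF u, symmetric] \<rho>'[OF u] using 2(3) gD[OF u] by blast
    ultimately show ?thesis by (intro closed_log_imp_null_homotopic[OF path_l] g)
  qed
qed

text \<open>\<open>P\<close> plays the role of a subgroup of the fundamental group of
  \<open>S\<close> at \<open>p\<close>, expressed as a property of loops. That certain loops
  generate the group becomes an induction rule: such a property, once it holds for them, holds for
  all loops.\<close>

locale loop_subgroup =
  fixes S :: "complex set" and p :: complex and P :: "(real \<Rightarrow> complex) \<Rightarrow> bool"
  assumes P_homotopic: "\<And>g h. P g \<Longrightarrow> homotopic_paths S g h \<Longrightarrow> pathstart g = p \<Longrightarrow> pathfinish g = p \<Longrightarrow> P h"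
    and P_join: "\<And>g h. P g \<Longrightarrow> P h \<Longrightarrow> path g \<Longrightarrow> path_image g \<subseteq> S \<Longrightarrow> pathstart g = p \<Longrightarrow> pathfinish g = p \<Longrightarrow>
       path h \<Longrightarrow> path_image h \<subseteq> S \<Longrightarrow> pathstart h = p \<Longrightarrow> pathfinish h = p \<Longrightarrow> P (g +++ h)"
    and P_reverse: "\<And>g. P g \<Longrightarrow> path g \<Longrightarrow> path_image g \<subseteq> S \<Longrightarrow> pathstart g = p \<Longrightarrow> pathfinish g = p \<Longrightarrow> P (reversepath g)"
begin

text \<open>In a simply connected domain without \<open>a\<close> the winding number determines the
  homotopy class, so \<open>g\<close> is a power of \<open>\<sigma>\<close>. The induction splits
  off one factor \<open>\<sigma>\<close> at a time; negative exponents are reached by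
  reversal.\<close>

lemma P_punctured:
  assumes D: "open D" "simply_connected D" "a \<in> D" "D - {a} \<subseteq> S"
    and s: "path \<sigma>" "path_image \<sigma> \<subseteq> D - {a}" "pathstart \<sigma> = p" "pathfinish \<sigma> = p" "winding_number \<sigma> a = 1" "P \<sigma>"
    and g: "path g" "path_image g \<subseteq> D - {a}" "pathstart g = p" "pathfinish g = p"
  shows "P g"
proof -
  have sS: "path_image \<sigma> \<subseteq> S" using s(2) D(4) by blast
  have as: "a \<notin> path_image \<sigma>" using s by auto
  have nat_case: "P g" if g: "path g" "path_image g \<subseteq> D - {a}" "pathstart g = p" "pathfinish g = p"
      "winding_number g a = of_nat n" for g n
    using g
  proof (induction n arbitrary: g)
    case 0
    have "homotopic_paths (D - {a}) g (linepath p p)"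
      using winding_0_imp_null_homotopic[OF D(1-3) 0(1,2)] 0 by simp
    then have "homotopic_paths S g (linepath p p)" using D(4) homotopic_paths_subset by blast
    \<comment> \<open>The constant loop is reached as \<open>\<sigma>\<close> followed by its
      inverse, since the closure rules speak of products and inverses.\<close>
    moreover have "homotopic_paths S (\<sigma> +++ reversepath \<sigma>) (linepath p p)"
      using homotopic_paths_rinv[OF s(1) sS] s by simp
    ultimately have "homotopic_paths S (\<sigma> +++ reversepath \<sigma>) g"
      using homotopic_paths_sym homotopic_paths_trans by blast
    moreover have "P (\<sigma> +++ reversepath \<sigma>)"
      using P_join[OF s(6) P_reverse[OF s(6)]] s sS by simp
    ultimately show ?case using P_homotopic s by simp
  next
    case (Suc n)
    have gS: "path_image g \<subseteq> S" and ag: "a \<notin> path_image g" using Suc D(4) by auto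
    let ?h = "g +++ reversepath \<sigma>"
    have h: "path ?h" "path_image ?h \<subseteq> D - {a}" "pathstart ?h = p" "pathfinish ?h = p"
      using Suc s by (auto simp: path_image_join)
    have "winding_number ?h a = of_nat n"
      using Suc s as ag by (simp add: winding_number_join winding_number_reversepath)
    then have Ph: "P ?h" using Suc.IH h by blast
    have "path_image ?h \<subseteq> S" using h D(4) by blast
    then have "P (?h +++ \<sigma>)" using P_join[OF Ph s(6)] h s sS by simp
    moreover have "homotopic_paths S (?h +++ \<sigma>) g"
    proof -
      have "homotopic_paths S (?h +++ \<sigma>) (g +++ (reversepath \<sigma> +++ \<sigma>))"
        by (rule homotopic_paths_sym, rule homotopic_paths_assoc) (use Suc s gS sS in auto)
      also have "homotopic_paths S (g +++ (reversepath \<sigma> +++ \<sigma>)) (g +++ linepath p p)"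
        by (rule homotopic_paths_join) (use Suc s gS sS homotopic_paths_linv[OF s(1) sS] in auto)
      also have "homotopic_paths S (g +++ linepath p p) g"
        using homotopic_paths_rid[OF Suc(2) gS] Suc by simp
      finally show ?thesis .
    qed
    ultimately show ?case using P_homotopic h s by simp
  qed
  have ag: "a \<notin> path_image g" using g by auto
  have "winding_number g a \<in> \<int>" using g ag by (intro integer_winding_number) auto
  then obtain n where n: "winding_number g a = of_int n" by (elim Ints_cases)
  show ?thesis
  proof (cases "n \<ge> 0")
    case True
    then show ?thesis using nat_case[OF g, of "nat n"] n by simp
  next
    case False
    have Pr: "P (reversepath g)"
      by (rule nat_case[of _ "nat (- n)"]) (use g ag False n in \<open>simp_all add: winding_number_reversepath\<close>)
    then have "P (reversepath (reversepath g))"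
      by (rule P_reverse) (use g D(4) in auto)
    then show ?thesis by simp
  qed
qed

lemma homotopic_insert_detour:
  assumes "path a" "path_image a \<subseteq> S" "path b" "path_image b \<subseteq> S" "path z" "path_image z \<subseteq> S"
    "path w" "path_image w \<subseteq> S"
    "pathfinish a = pathstart b" "pathfinish b = pathstart z" "pathstart w = pathstart z"
  shows "homotopic_paths S ((a +++ (b +++ z)) +++ (reversepath z +++ w)) (a +++ (b +++ w))"
proof -
  let ?r = "reversepath z"
  have "homotopic_paths S (z +++ (?r +++ w)) ((z +++ ?r) +++ w)"
    by (rule homotopic_paths_assoc) (use assms in auto)
  also have "homotopic_paths S ((z +++ ?r) +++ w) (linepath (pathstart z) (pathstart z) +++ w)"
    by (rule homotopic_paths_join[OF homotopic_paths_rinv]) (use assms in auto)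
  also have "homotopic_paths S (linepath (pathstart z) (pathstart z) +++ w) w"
    by (rule homotopic_paths_lid') (use assms in auto)
  finally have 1: "homotopic_paths S (z +++ (?r +++ w)) w" .
  have "homotopic_paths S ((b +++ z) +++ (?r +++ w)) (b +++ (z +++ (?r +++ w)))"
    by (rule homotopic_paths_sym, rule homotopic_paths_assoc) (use assms in \<open>auto simp: path_image_join\<close>)
  also have "homotopic_paths S (b +++ (z +++ (?r +++ w))) (b +++ w)"
    by (rule homotopic_paths_join[OF _ 1]) (use assms in auto)
  finally have 2: "homotopic_paths S ((b +++ z) +++ (?r +++ w)) (b +++ w)" .
  have "homotopic_paths S ((a +++ (b +++ z)) +++ (?r +++ w)) (a +++ ((b +++ z) +++ (?r +++ w)))"
    by (rule homotopic_paths_sym, rule homotopic_paths_assoc) (use assms in \<open>auto simp: path_image_join\<close>)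
  also have "homotopic_paths S (a +++ ((b +++ z) +++ (?r +++ w))) (a +++ (b +++ w))"
    by (rule homotopic_paths_join[OF _ 2]) (use assms in auto)
  finally show ?thesis .
qed

text \<open>The surjectivity half of van Kampen's theorem.\<close>

lemma P_union:
  assumes S: "S = V1 \<union> V2" and V: "open V1" "open V2" "path_connected (V1 \<inter> V2)" "p \<in> V1 \<inter> V2"
    and base: "\<And>X g. X \<in> {V1, V2} \<Longrightarrow> path g \<Longrightarrow> path_image g \<subseteq> X \<Longrightarrow> pathstart g = p \<Longrightarrow> pathfinish g = p \<Longrightarrow> P g"
    and g: "path g" "path_image g \<subseteq> S" "pathstart g = p" "pathfinish g = p"
  shows "P g"
proof -
  have sub: "X \<subseteq> S" if "X \<in> {V1, V2}" for X using that S by auto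
  \<comment> \<open>\<open>Q x\<close> says that the piece of \<open>g\<close> up to
    \<open>x\<close>, closed by any path to \<open>p\<close> inside one of the two sets, has
    property \<open>P\<close>. The freedom in \<open>w\<close> allows the closing path to change
    from one set to the other.\<close>
  define Q where "Q x \<longleftrightarrow> (\<forall>X\<in>{V1, V2}. \<forall>w. path w \<longrightarrow> path_image w \<subseteq> X \<longrightarrow> pathstart w = g x \<longrightarrow> pathfinish w = p \<longrightarrow>
     P (subpath 0 x g +++ w))" for x
  have sp: "path (subpath x y g)" "path_image (subpath x y g) \<subseteq> S" if "x \<in> {0..1}" "y \<in> {0..1}" for x y
    using that g path_image_subpath_subset[of x y g] by (auto simp: path_subpath)
  have "Q 1"
  proof (rule connected_induction_simple[of "{0..1}" 0 1 Q])
    show "Q 0"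
      unfolding Q_def
    proof (intro ballI allI impI)
      fix X w assume w: "X \<in> {V1, V2}" "path w" "path_image w \<subseteq> X" "pathstart w = g 0" "pathfinish w = p"
      have g0: "g 0 = p" using g by (simp add: pathstart_def)
      have wS: "path_image w \<subseteq> S" using w sub by blast
      have "subpath 0 0 g = linepath p p" using g0 by (simp add: subpath_refl linepath_refl)
      then have hom: "homotopic_paths S (subpath 0 0 g +++ w) w"
        using homotopic_paths_lid[OF w(2) wS] w(4) g0 by simp
      have "P w" using base w g0 by simp
      then show "P (subpath 0 0 g +++ w)"
        using P_homotopic[OF _ homotopic_paths_sym[OF hom]] w g0 by simp
    qed
    fix t :: real assume t: "t \<in> {0..1}"
    then have "g t \<in> S" using g by (auto simp: path_image_def)
    then obtain Y where Y: "Y \<in> {V1, V2}" "g t \<in> Y" "open Y" using S V by auto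
    have cg: "continuous_on {0..1} g" using g by (simp add: path_def)
    obtain d where d: "d > 0" "\<And>s. s \<in> {0..1} \<Longrightarrow> dist t s < d \<Longrightarrow> g s \<in> Y"
    proof -
      obtain \<epsilon> where "\<epsilon> > 0" "ball (g t) \<epsilon> \<subseteq> Y" using Y openE by blast
      moreover obtain d where "d > 0" "\<And>s. s \<in> {0..1} \<Longrightarrow> dist s t < d \<Longrightarrow> dist (g s) (g t) < \<epsilon>"
        using cg t \<open>\<epsilon> > 0\<close> unfolding continuous_on_iff by metis
      ultimately show ?thesis using that[of d] by (auto simp: dist_commute subset_iff)
    qed
    define T where "T = {0..1} \<inter> ball t d"
    have "Q y" if x: "x \<in> T" and y: "y \<in> T" and Qx: "Q x" for x y
      unfolding Q_def
    proof (intro ballI allI impI)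
      fix X w assume w: "X \<in> {V1, V2}" "path w" "path_image w \<subseteq> X" "pathstart w = g y" "pathfinish w = p"
      have xy: "x \<in> {0..1}" "y \<in> {0..1}" using x y by (auto simp: T_def)
      have wS: "path_image w \<subseteq> S" using w sub by blast
      let ?a = "subpath 0 x g" and ?b = "subpath x y g"
      have ab: "path ?a" "path_image ?a \<subseteq> S" "path ?b" "path_image ?b \<subseteq> S" using sp xy by auto
      have bY: "path_image ?b \<subseteq> Y"
      proof -
        have "closed_segment x y \<subseteq> T" unfolding T_def using x y
          by (intro closed_segment_subset convex_Int) (auto simp: T_def)
        moreover have "g s \<in> Y" if "s \<in> T" for s using that d(2) by (simp add: T_def)
        ultimately show ?thesis unfolding path_image_subpath_gen by blast
      qed
      have ends: "pathstart ?a = p" "pathfinish ?a = g x" "pathstart ?b = g x" "pathfinish ?b = g y"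
        using g by (auto simp: pathstart_def[of g])
      have hom: "homotopic_paths S (?a +++ (?b +++ w)) (subpath 0 y g +++ w)"
      proof -
        have "homotopic_paths S (?a +++ (?b +++ w)) ((?a +++ ?b) +++ w)"
          by (rule homotopic_paths_assoc) (use ab w wS ends in auto)
        also have "homotopic_paths S ((?a +++ ?b) +++ w) (subpath 0 y g +++ w)"
          by (rule homotopic_paths_join[OF homotopic_join_subpaths[OF g(1,2)]]) (use xy w wS ends in auto)
        finally show ?thesis .
      qed
      have Pabw: "P (?a +++ (?b +++ w))"
      proof (cases "X = Y")
        case True
        have "path (?b +++ w)" "path_image (?b +++ w) \<subseteq> Y" "pathstart (?b +++ w) = g x" "pathfinish (?b +++ w) = p"
          using ab bY w True ends by (auto simp: path_image_join)
        then show ?thesis using Qx Y(1) unfolding Q_def by blast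
      next
        \<comment> \<open>Here the closing path runs in the other set. A path \<open>z\<close> in
          the connected intersection closes the piece inside \<open>Y\<close>, and \<open>z\<close>
          reversed followed by \<open>w\<close> is a loop inside \<open>X\<close>.\<close>
        case False
        then have XY: "X \<inter> Y = V1 \<inter> V2" using w(1) Y(1) by auto
        have "g y \<in> X" using w(3) pathstart_in_path_image[of w] unfolding w(4) by (rule subsetD)
        moreover have "g y \<in> Y" using d(2)[of y] y by (auto simp: T_def)
        ultimately have "g y \<in> V1 \<inter> V2" using XY by blast
        then obtain z where z: "path z" "path_image z \<subseteq> V1 \<inter> V2" "pathstart z = g y" "pathfinish z = p"
          using V(3,4) unfolding path_connected_def by blast
        have zXY: "path_image z \<subseteq> X" "path_image z \<subseteq> Y" "path_image z \<subseteq> S" using z XY S by blast+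
        have "path (?b +++ z)" "path_image (?b +++ z) \<subseteq> Y" "pathstart (?b +++ z) = g x" "pathfinish (?b +++ z) = p"
          using ab bY z zXY ends by (auto simp: path_image_join)
        then have P1: "P (?a +++ (?b +++ z))" using Qx Y(1) unfolding Q_def by blast
        have P2: "P (reversepath z +++ w)"
          by (rule base[OF w(1)]) (use z zXY w in \<open>auto simp: path_image_join\<close>)
        have "P ((?a +++ (?b +++ z)) +++ (reversepath z +++ w))"
          by (rule P_join[OF P1 P2]) (use ab z zXY w wS ends in \<open>auto simp: path_image_join\<close>)
        moreover have "homotopic_paths S ((?a +++ (?b +++ z)) +++ (reversepath z +++ w)) (?a +++ (?b +++ w))"
          by (rule homotopic_insert_detour) (use ab z zXY w wS ends in auto)
        ultimately show ?thesis using P_homotopic ends w by simp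
      qed
      show "P (subpath 0 y g +++ w)" using P_homotopic[OF Pabw hom] ends w by simp
    qed
    moreover have "openin (top_of_set {0..1}) T" "t \<in> T"
      using t d(1) by (auto simp: T_def openin_open_Int)
    ultimately show "\<exists>T. openin (top_of_set {0..1}) T \<and> t \<in> T \<and> (\<forall>x\<in>T. \<forall>y\<in>T. Q x \<longrightarrow> Q y)" by blast
  qed auto
  moreover have "path_image (linepath p p) \<subseteq> V1" "pathstart (linepath p p) = g 1" "pathfinish (linepath p p) = p"
    using V(4) g by (auto simp: pathfinish_def)
  ultimately have "P (subpath 0 1 g +++ linepath p p)" unfolding Q_def by blast
  moreover have "homotopic_paths S (subpath 0 1 g +++ linepath p p) g"
    using homotopic_paths_rid[OF g(1,2)] g by simp
  ultimately show ?thesis using P_homotopic g by simp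
qed

end

section \<open>Monodromy of solutions and the pairing\<close>

lemma continuation_on_operator:
  assumes T: "holomorphic_operator A T" and A: "open A" and F: "continuation_on I g F" and g: "g ` I \<subseteq> A"
  shows "continuation_on I g (\<lambda>u. T (g u) (F u))"
  unfolding continuation_on_def
proof (intro conjI ballI)
  show "continuous_on I g" using F by (simp add: continuation_on_def)
  fix u assume u: "u \<in> I"
  obtain h d where h: "d > 0" "h holomorphic_on ball (g u) d" "F u = fps_expansion h (g u)"
    "\<forall>d'>0. \<forall>\<^sub>F v in nhds u. v \<in> I \<longrightarrow> g v \<in> ball (g u) d' \<and> F v = fps_expansion h (g v)"
    using continuation_onD[OF F u] by blast
  have "g u \<in> A" using g u by blast
  then obtain d' where d': "d' > 0" "ball (g u) d' \<subseteq> A" using A unfolding open_contains_ball by metis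
  define m where "m = min d d'"
  have m: "m > 0" "h holomorphic_on ball (g u) m" "ball (g u) m \<subseteq> A"
    using h d' by (auto simp: m_def intro: holomorphic_on_subset)
  obtain k where k: "k holomorphic_on ball (g u) m" "\<forall>w\<in>ball (g u) m. T w (fps_expansion h w) = fps_expansion k w"
    using holomorphic_operatorD[OF T open_ball m(3,2)] by blast
  have "\<forall>\<^sub>F v in nhds u. v \<in> I \<longrightarrow> T (g v) (F v) = fps_expansion k (g v)"
    using h(4)[rule_format, OF m(1)] by eventually_elim (use k(2) in simp)
  then show "\<exists>h d. d > 0 \<and> h holomorphic_on ball (g u) d \<and>
      (\<forall>\<^sub>F v in nhds u. v \<in> I \<longrightarrow> T (g v) (F v) = fps_expansion h (g v))"
    using m(1) k(1) by blast
qed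

lemma continuable_operator:
  assumes "holomorphic_operator A T" "open A" "continuable A z f" shows "continuable A z (T z f)"
  unfolding continuable_def
proof (intro allI impI)
  fix g assume g: "path g" "path_image g \<subseteq> A" "pathstart g = z"
  obtain F where F: "continuation_on {0..1} g F" "F 0 = f" using assms(3) g unfolding continuable_def by blast
  have "continuation_on {0..1} g (\<lambda>u. T (g u) (F u))"
    by (rule continuation_on_operator[OF assms(1,2) F(1)]) (use g in \<open>simp add: path_image_def\<close>)
  then show "\<exists>F. continuation_on {0..1} g F \<and> F 0 = T z f"
    using F(2) g(3) by (intro exI[of _ "\<lambda>u. T (g u) (F u)"]) (simp add: pathstart_def)
qed

lemma monodromy_operator:
  assumes "holomorphic_operator A T" "open A" "continuable A z f"
    and g: "path g" "path_image g \<subseteq> A" "pathstart g = z"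
  shows "monodromy g (T z f) = T (pathfinish g) (monodromy g f)"
proof -
  obtain F where F: "continuation_on {0..1} g F" "F 0 = f" "F 1 = monodromy g f"
    using continuable_monodromy_obtain[OF assms(3) g] by blast
  have "continuation_on {0..1} g (\<lambda>u. T (g u) (F u))"
    by (rule continuation_on_operator[OF assms(1,2) F(1)]) (use g in \<open>simp add: path_image_def\<close>)
  from monodromy_eq[OF this refl] show ?thesis using F g by (simp add: pathstart_def pathfinish_def)
qed

interpretation germ_space: vector_space germ_scale
  by unfold_locales (simp_all add: algebra_simps flip: fps_const_add fps_const_mult)

context regular_operator
begin

abbreviation loop :: "complex \<Rightarrow> (real \<Rightarrow> complex) \<Rightarrow> bool" where
  "loop p g \<equiv> path g \<and> path_image g \<subseteq> A \<and> pathstart g = p \<and> pathfinish g = p"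

lemma holomorphic_operator_partial_adj: "m \<le> r \<Longrightarrow> holomorphic_operator A (\<lambda>w. partial_adj q w m)"
  using holomorphic_operator_L_adj[of m q A] q by (simp add: partial_adj_top[abs_def])

lemma holomorphic_operator_D_pow: "holomorphic_operator A (\<lambda>w. D_germ w ^^ i)"
  by (rule holomorphic_operator_pow[OF holomorphic_operator_D])

lemma continuable_bracket:
  assumes "continuable A z \<psi>" "continuable A z \<phi>"
  shows "continuable A z (bracket r q z \<psi> \<phi>)"
  unfolding bracket_eq[OF r]
  by (intro continuable_sum continuable_mult continuable_operator[OF holomorphic_operator_partial_adj A(1) assms(1)]
        continuable_operator[OF holomorphic_operator_D_pow A(1) assms(2)]) simp

lemma monodromy_bracket:
  assumes "continuable A z \<psi>" "continuable A z \<phi>" and g: "path g" "path_image g \<subseteq> A" "pathstart g = z"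
  shows "monodromy g (bracket r q z \<psi> \<phi>) = bracket r q (pathfinish g) (monodromy g \<psi>) (monodromy g \<phi>)"
proof -
  have c: "continuable A z (partial_adj q z (r - 1 - i) \<psi>)" "continuable A z ((D_germ z ^^ i) \<phi>)" for i
    by (rule continuable_operator[OF holomorphic_operator_partial_adj A(1) assms(1)], simp)
       (rule continuable_operator[OF holomorphic_operator_D_pow A(1) assms(2)])
  have "monodromy g (partial_adj q z (r - 1 - i) \<psi>) = partial_adj q (pathfinish g) (r - 1 - i) (monodromy g \<psi>)" for i
    by (rule monodromy_operator[OF holomorphic_operator_partial_adj A(1) assms(1) g]) simp
  moreover have "monodromy g ((D_germ z ^^ i) \<phi>) = (D_germ (pathfinish g) ^^ i) (monodromy g \<phi>)" for i
    by (rule monodromy_operator[OF holomorphic_operator_D_pow A(1) assms(2) g])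
  ultimately show ?thesis
    unfolding bracket_eq[OF r] using monodromy_sum[OF g] monodromy_mult[OF g] c continuable_mult[OF c]
    by (simp add: monodromy_sum[OF g] monodromy_mult[OF g] c)
qed

lemma monodromy_L:
  assumes "continuable A z f" "path g" "path_image g \<subseteq> A" "pathstart g = z"
  shows "monodromy g (L_germ r q z f) = L_germ r q (pathfinish g) (monodromy g f)"
  by (rule monodromy_operator[OF holomorphic_operator_L[OF q] A(1) assms]) simp

lemma monodromy_L_adj:
  assumes "continuable A z f" "path g" "path_image g \<subseteq> A" "pathstart g = z"
  shows "monodromy g (L_adj_germ r q z f) = L_adj_germ r q (pathfinish g) (monodromy g f)"
  by (rule monodromy_operator[OF holomorphic_operator_L_adj[OF q] A(1) assms]) simp

lemma Sol_monodromy: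
  assumes f: "f \<in> Sol r q z" and g: "path g" "path_image g \<subseteq> A" "pathstart g = z"
  shows "monodromy g f \<in> Sol r q (pathfinish g)"
proof -
  have "pathfinish g \<in> A" using g pathfinish_in_path_image by blast
  moreover have "L_germ r q (pathfinish g) (monodromy g f) = 0"
    using monodromy_L[OF continuable_Sol[OF f] g] monodromy_0[OF g] f by (simp add: Sol_def)
  ultimately show ?thesis by (simp add: Sol_iff)
qed

lemma Sol_adj_monodromy:
  assumes f: "f \<in> Sol_adj r q z" and g: "path g" "path_image g \<subseteq> A" "pathstart g = z"
  shows "monodromy g f \<in> Sol_adj r q (pathfinish g)"
proof -
  have "pathfinish g \<in> A" using g pathfinish_in_path_image by blast
  moreover have "L_adj_germ r q (pathfinish g) (monodromy g f) = 0"
    using monodromy_L_adj[OF continuable_Sol_adj[OF f] g] monodromy_0[OF g] f by (simp add: Sol_adj_def)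
  ultimately show ?thesis by (simp add: Sol_adj_iff)
qed

end

section \<open>The pairing between the solution spaces at \<open>p\<close>\<close>

locale based_operator = regular_operator +
  fixes p :: complex
  assumes p: "p \<in> A"
begin

abbreviation "Solp \<equiv> Sol r q p"
abbreviation "Adjp \<equiv> Sol_adj r q p"

lemma Sol_add: "f \<in> Solp \<Longrightarrow> g \<in> Solp \<Longrightarrow> f + g \<in> Solp"
  by (simp add: Sol_iff[OF p] L_germ_add)

lemma Sol_diff: "f \<in> Solp \<Longrightarrow> g \<in> Solp \<Longrightarrow> f - g \<in> Solp"
  by (simp add: Sol_iff[OF p] L_germ_diff)

lemma Sol_scale: "f \<in> Solp \<Longrightarrow> fps_const c * f \<in> Solp"
  by (simp add: Sol_iff[OF p] L_germ_scale)

lemma Sol_0: "0 \<in> Solp"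
  using Sol_diff Sol_exists[OF p] by fastforce

lemma Sol_sum: "(\<And>i. i \<in> N \<Longrightarrow> f i \<in> Solp) \<Longrightarrow> (\<Sum>i\<in>N. f i) \<in> Solp"
  by (induction N rule: infinite_finite_induct) (simp_all add: Sol_add Sol_0)

lemma Adj_add: "f \<in> Adjp \<Longrightarrow> g \<in> Adjp \<Longrightarrow> f + g \<in> Adjp"
  by (simp add: Sol_adj_iff[OF p] L_adj_germ_add)

lemma Adj_scale: "f \<in> Adjp \<Longrightarrow> fps_const c * f \<in> Adjp"
  by (simp add: Sol_adj_iff[OF p] L_adj_germ_scale)

lemma Adj_uminus: "f \<in> Adjp \<Longrightarrow> - f \<in> Adjp"
  using Adj_scale[of f "-1"] by (simp flip: fps_const_neg)

lemma Adj_diff: "f \<in> Adjp \<Longrightarrow> g \<in> Adjp \<Longrightarrow> f - g \<in> Adjp"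
  using Adj_add[OF _ Adj_uminus, of f g] by simp

lemma Adj_0: "0 \<in> Adjp"
  using Adj_diff Sol_adj_exists[OF p] by fastforce

lemma Adj_sum: "(\<And>i. i \<in> N \<Longrightarrow> f i \<in> Adjp) \<Longrightarrow> (\<Sum>i\<in>N. f i) \<in> Adjp"
  by (induction N rule: infinite_finite_induct) (simp_all add: Adj_add Adj_0)

text \<open>On a pair of solutions the bracket is constant and this is its value. The definition is
  also applied to the Frobenius germs, which need not solve \<open>L\<close>; there it is the value
  at \<open>p\<close>.\<close>

definition br :: "complex fps \<Rightarrow> complex fps \<Rightarrow> complex" where
  "br \<psi> \<phi> = fps_nth (bracket r q p \<psi> \<phi>) 0"

lemma br_eq: "br \<psi> \<phi> = (\<Sum>i<r. fps_nth (partial_adj q p (r - 1 - i) \<psi>) 0 * fps_nth ((D_germ p ^^ i) \<phi>) 0)"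
  by (simp add: br_def bracket_eq[OF r] fps_sum_nth)

lemma br_add_left: "br (\<psi> + \<psi>') \<phi> = br \<psi> \<phi> + br \<psi>' \<phi>"
  by (simp add: br_eq partial_adj_add sum.distrib distrib_right)

lemma br_add_right: "br \<psi> (\<phi> + \<phi>') = br \<psi> \<phi> + br \<psi> \<phi>'"
  by (simp add: br_eq D_germ_pow_add sum.distrib distrib_left)

lemma br_scale_left: "br (fps_const c * \<psi>) \<phi> = c * br \<psi> \<phi>"
  unfolding br_eq partial_adj_scale sum_distrib_left by (simp add: mult.assoc)

lemma br_scale_right: "br \<psi> (fps_const c * \<phi>) = c * br \<psi> \<phi>"
  unfolding br_eq D_germ_pow_scale sum_distrib_left by (simp add: mult.left_commute)

lemma br_diff_left: "br (\<psi> - \<psi>') \<phi> = br \<psi> \<phi> - br \<psi>' \<phi>"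
  using br_add_left[of "\<psi> - \<psi>'" \<psi>' \<phi>] by simp

lemma br_diff_right: "br \<psi> (\<phi> - \<phi>') = br \<psi> \<phi> - br \<psi> \<phi>'"
  using br_add_right[of \<psi> "\<phi> - \<phi>'" \<phi>'] by simp

lemma br_0_left: "br 0 \<phi> = 0" using br_scale_left[of 0 0 \<phi>] by simp
lemma br_0_right: "br \<psi> 0 = 0" using br_scale_right[of \<psi> 0 0] by simp

lemma br_sum_left: "br (\<Sum>i\<in>N. f i) \<phi> = (\<Sum>i\<in>N. br (f i) \<phi>)"
  by (induction N rule: infinite_finite_induct) (simp_all add: br_add_left br_0_left)

lemma br_sum_right: "br \<psi> (\<Sum>i\<in>N. f i) = (\<Sum>i\<in>N. br \<psi> (f i))"
  by (induction N rule: infinite_finite_induct) (simp_all add: br_add_right br_0_right)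

lemma bracket_const:
  assumes "\<psi> \<in> Adjp" "\<phi> \<in> Solp" shows "bracket r q p \<psi> \<phi> = fps_const (br \<psi> \<phi>)"
proof -
  have "D_germ p (bracket r q p \<psi> \<phi>) = 0"
    using assms by (simp add: D_germ_bracket[OF r] Sol_def Sol_adj_def)
  then have "fps_deriv (bracket r q p \<psi> \<phi>) = 0" using fps_deriv_eq[OF p] by simp
  then show ?thesis by (simp add: br_def fps_deriv_eq_0_iff)
qed

lemma br_monodromy:
  assumes "\<psi> \<in> Adjp" "\<phi> \<in> Solp" and g: "loop p g"
  shows "br (monodromy g \<psi>) (monodromy g \<phi>) = br \<psi> \<phi>"
proof -
  have "monodromy g (bracket r q p \<psi> \<phi>) = bracket r q p (monodromy g \<psi>) (monodromy g \<phi>)"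
    using monodromy_bracket[OF continuable_Sol_adj[OF assms(1)] continuable_Sol[OF assms(2)]] g by simp
  moreover have "monodromy g (bracket r q p \<psi> \<phi>) = bracket r q p \<psi> \<phi>"
    unfolding bracket_const[OF assms(1,2)] using g by (intro monodromy_const) auto
  ultimately show ?thesis by (simp add: br_def)
qed

text \<open>In terms of initial values at \<open>p\<close>, which are free on either side, the
  pairing is the standard bilinear form; pairing with a solution that has a single initial value 1
  extracts one coordinate of \<open>\<psi>\<close>.\<close>

lemma br_nondegenerate_left:
  assumes "\<psi> \<in> Adjp" "\<And>\<phi>. \<phi> \<in> Solp \<Longrightarrow> br \<psi> \<phi> = 0" shows "\<psi> = 0"
proof (rule Sol_adj_unique[OF p assms(1)])
  fix i assume i: "i < r"
  obtain \<phi> where \<phi>: "\<phi> \<in> Solp" "\<forall>j<r. fps_nth ((D_germ p ^^ j) \<phi>) 0 = (if j = r - 1 - i then 1 else 0)"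
    using Sol_exists[OF p, of "\<lambda>j. if j = r - 1 - i then 1 else 0"] by blast
  have "br \<psi> \<phi> = (\<Sum>j<r. if j = r - 1 - i then fps_nth (partial_adj q p (r - 1 - j) \<psi>) 0 else 0)"
    unfolding br_eq by (intro sum.cong refl) (use \<phi>(2) in auto)
  also have "\<dots> = fps_nth (partial_adj q p i \<psi>) 0" using i by simp
  finally show "fps_nth (partial_adj q p i \<psi>) 0 = 0" using assms(2)[OF \<phi>(1)] by simp
qed

definition basis_sol :: "nat \<Rightarrow> complex fps" where
  "basis_sol i = (SOME f. f \<in> Solp \<and> (\<forall>j<r. fps_nth ((D_germ p ^^ j) f) 0 = (if j = i then 1 else 0)))"

lemma basis_sol: "basis_sol i \<in> Solp" "j < r \<Longrightarrow> fps_nth ((D_germ p ^^ j) (basis_sol i)) 0 = (if j = i then 1 else 0)"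
proof -
  have "\<exists>f. f \<in> Solp \<and> (\<forall>j<r. fps_nth ((D_germ p ^^ j) f) 0 = (if j = i then 1 else 0))"
    using Sol_exists[OF p, of "\<lambda>j. if j = i then 1 else 0"] by blast
  from someI_ex[OF this]
  show "basis_sol i \<in> Solp" "j < r \<Longrightarrow> fps_nth ((D_germ p ^^ j) (basis_sol i)) 0 = (if j = i then 1 else 0)"
    unfolding basis_sol_def by blast+
qed

lemma Sol_expand:
  assumes f: "f \<in> Solp" shows "f = (\<Sum>i<r. fps_const (fps_nth ((D_germ p ^^ i) f) 0) * basis_sol i)"
proof -
  let ?S = "\<Sum>i<r. fps_const (fps_nth ((D_germ p ^^ i) f) 0) * basis_sol i"
  have S: "?S \<in> Solp"
    by (intro Sol_sum Sol_scale basis_sol(1))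
  have "f - ?S = 0"
  proof (rule Sol_unique[OF p Sol_diff[OF f S]])
    fix j assume j: "j < r"
    have "fps_nth ((D_germ p ^^ j) ?S) 0 = (\<Sum>i<r. if i = j then fps_nth ((D_germ p ^^ i) f) 0 else 0)"
      unfolding D_germ_pow_sum fps_sum_nth
      by (intro sum.cong refl) (use j in \<open>auto simp: D_germ_pow_scale basis_sol(2)\<close>)
    also have "\<dots> = fps_nth ((D_germ p ^^ j) f) 0" using j by simp
    finally show "fps_nth ((D_germ p ^^ j) (f - ?S)) 0 = 0"
      using D_germ_pow_add[where n = j and f = "f - ?S" and g = ?S and z = p] by simp
  qed
  then show ?thesis by simp
qed

text \<open>The initial values of \<open>\<psi>\<close> are prescribed as the values of
  \<open>l\<close> on the solutions with unit initial values, in reversed order since the bracket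
  pairs index \<open>i\<close> with index \<open>r - 1 - i\<close>.\<close>

lemma functional_represented:
  fixes l :: "complex fps \<Rightarrow> complex"
  assumes add: "\<And>f g. f \<in> Solp \<Longrightarrow> g \<in> Solp \<Longrightarrow> l (f + g) = l f + l g"
    and scale: "\<And>c f. f \<in> Solp \<Longrightarrow> l (fps_const c * f) = c * l f"
  shows "\<exists>\<psi>\<in>Adjp. \<forall>\<phi>\<in>Solp. br \<psi> \<phi> = l \<phi>"
proof -
  obtain \<psi> where \<psi>: "\<psi> \<in> Adjp" "\<forall>i<r. fps_nth (partial_adj q p i \<psi>) 0 = l (basis_sol (r - 1 - i))"
    using Sol_adj_exists[OF p, of "\<lambda>i. l (basis_sol (r - 1 - i))"] by blast
  have "br \<psi> \<phi> = l \<phi>" if \<phi>: "\<phi> \<in> Solp" for \<phi>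
  proof -
    have l0: "l 0 = 0" using scale[OF Sol_0, of 0] by simp
    have *: "(\<Sum>i<n. fps_const (c i) * basis_sol i) \<in> Solp \<and>
        l (\<Sum>i<n. fps_const (c i) * basis_sol i) = (\<Sum>i<n. c i * l (basis_sol i))" for c :: "nat \<Rightarrow> complex" and n
    proof (induction n)
      case 0 show ?case using Sol_0 l0 by simp
    next
      case (Suc n)
      have b: "fps_const (c n) * basis_sol n \<in> Solp" by (rule Sol_scale[OF basis_sol(1)])
      show ?case using Suc b Sol_add[OF conjunct1[OF Suc] b] add[OF conjunct1[OF Suc] b] scale[OF basis_sol(1)]
        by simp
    qed
    have "l \<phi> = l (\<Sum>i<r. fps_const (fps_nth ((D_germ p ^^ i) \<phi>) 0) * basis_sol i)"
      using Sol_expand[OF \<phi>] by (rule arg_cong)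
    also have "\<dots> = (\<Sum>i<r. fps_nth ((D_germ p ^^ i) \<phi>) 0 * l (basis_sol i))"
      by (rule conjunct2[OF *])
    also have "\<dots> = br \<psi> \<phi>"
      unfolding br_eq by (intro sum.cong refl) (use \<psi>(2) in auto)
    finally show ?thesis by simp
  qed
  then show ?thesis using \<psi>(1) by blast
qed

lemma functional_separating:
  assumes "\<delta> \<in> Solp" "\<delta> \<noteq> 0" "\<phi> \<in> Solp" "\<And>c. \<phi> \<noteq> fps_const c * \<delta>"
  shows "\<exists>\<psi>\<in>Adjp. br \<psi> \<delta> = 0 \<and> br \<psi> \<phi> \<noteq> 0"
proof -
  let ?x = "\<lambda>i f. fps_nth ((D_germ p ^^ i) f) 0"
  obtain i where i: "i < r" "?x i \<delta> \<noteq> 0" using Sol_unique[OF p assms(1)] assms(2) by blast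
  define \<mu> where "\<mu> = ?x i \<phi> / ?x i \<delta>"
  have "\<phi> - fps_const \<mu> * \<delta> \<in> Solp" "\<phi> - fps_const \<mu> * \<delta> \<noteq> 0"
    using assms by (auto intro: Sol_diff Sol_scale)
  then obtain j where j: "j < r" "?x j (\<phi> - fps_const \<mu> * \<delta>) \<noteq> 0" using Sol_unique[OF p] by blast
  have xd: "?x k (f - g) = ?x k f - ?x k g" for k f g
    using D_germ_pow_add[where n = k and f = "f - g" and g = g and z = p] by simp
  have j': "?x j \<phi> - \<mu> * ?x j \<delta> \<noteq> 0" using j(2) by (simp add: xd D_germ_pow_scale)
  \<comment> \<open>\<open>l\<close> kills \<open>\<delta>\<close> by construction, and its value at
    \<open>\<phi>\<close> is the \<open>j\<close>-th initial value of
    \<open>\<phi> - \<mu> \<delta>\<close>, nonzero by the choice of \<open>j\<close>.\<close>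
  define l where "l f = ?x j f - ?x i f * (?x j \<delta> / ?x i \<delta>)" for f
  have "l (f + g) = l f + l g" for f g
    unfolding l_def D_germ_pow_add fps_add_nth by (simp only: algebra_simps)
  moreover have "l (fps_const c * f) = c * l f" for c f
    unfolding l_def D_germ_pow_scale fps_mult_left_const_nth by (simp only: algebra_simps)
  ultimately have "\<exists>\<psi>\<in>Adjp. \<forall>\<phi>\<in>Solp. br \<psi> \<phi> = l \<phi>"
    by (intro functional_represented)
  then obtain \<psi> where "\<psi> \<in> Adjp" "\<forall>\<phi>\<in>Solp. br \<psi> \<phi> = l \<phi>" by blast
  moreover have "l \<delta> = 0" using i by (simp add: l_def)
  moreover have "l \<phi> \<noteq> 0" using j' by (simp add: l_def \<mu>_def)
  ultimately show ?thesis using assms by (intro bexI[of _ \<psi>]) auto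
qed

end

section \<open>Laurent polynomials in \<open>e\<^sup>2\<^sup>\<pi>\<^sup>i\<^sup>s\<close>\<close>

definition tt :: "complex \<Rightarrow> int \<Rightarrow> complex" where
  "tt s n = exp (2 * pi * \<i> * s * of_int n)"

lemma tt_add: "tt s (m + n) = tt s m * tt s n"
  by (simp add: tt_def exp_add[symmetric] algebra_simps)

lemma tt_0 [simp]: "tt s 0 = 1"
  by (simp add: tt_def)

lemma tt_nonzero [simp]: "tt s n \<noteq> 0"
  by (simp add: tt_def)

lemma tt_power: "tt s (int n) = tt s 1 ^ n"
  by (induction n) (simp_all add: tt_add)

lemma tt_minus_power: "tt s (- int n) = tt s (- 1) ^ n"
proof (induction n)
  case (Suc n)
  have "- int (Suc n) = - 1 + - int n" by simp
  then show ?case using Suc by (simp only: tt_add) simp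
qed simp

lemma tt_int_period: "n \<in> \<int> \<Longrightarrow> exp (2 * pi * \<i> * n) = 1"
proof -
  assume "n \<in> \<int>"
  then obtain k where "n = of_int k" by (elim Ints_cases)
  then show ?thesis using exp_integer_2pi[of "of_int k"] by (simp add: mult_ac)
qed

lemma tt_surj: "z \<noteq> 0 \<Longrightarrow> \<exists>s. tt s 1 = z"
  by (rule exI[of _ "Ln z / (2 * pi * \<i>)"]) (simp add: tt_def)

text \<open>Multiplication by \<open>tt s (int k)\<close> gives a polynomial in
  \<open>exp (2 pi i s)\<close>, which takes every nonzero value; a polynomial with infinitely many
  zeros vanishes.\<close>

lemma laurent_independent:
  fixes c :: "int \<Rightarrow> complex"
  assumes zero: "\<And>s. (\<Sum>n\<in>{- int k..int k}. tt s n * c n) = 0" and n: "n \<in> {- int k..int k}"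
  shows "c n = 0"
proof -
  define d where "d i = c (int i - int k)" for i :: nat
  have bij: "(\<Sum>n\<in>{- int k..int k}. f n) = (\<Sum>i\<le>2 * k. f (int i - int k))" for f :: "int \<Rightarrow> complex"
    by (rule sum.reindex_bij_witness[of _ "\<lambda>i. int i - int k" "\<lambda>n. nat (n + int k)"]) auto
  have "(\<Sum>i\<le>2 * k. d i * z ^ i) = 0" if z: "z \<noteq> 0" for z
  proof -
    obtain s where s: "tt s 1 = z" using tt_surj[OF z] by blast
    have "(\<Sum>i\<le>2 * k. d i * z ^ i) = tt s (int k) * (\<Sum>n\<in>{- int k..int k}. tt s n * c n)"
      unfolding bij sum_distrib_left
    proof (intro sum.cong refl)
      fix i
      have "tt s (int i) = tt s (int k) * tt s (int i - int k)" by (simp flip: tt_add)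
      then show "d i * z ^ i = tt s (int k) * (tt s (int i - int k) * c (int i - int k))"
        by (simp add: d_def tt_power s)
    qed
    then show ?thesis using zero by simp
  qed
  then have "- {0} \<subseteq> {z. (\<Sum>i\<le>2 * k. d i * z ^ i) = 0}" by auto
  moreover have "infinite (- {0} :: complex set)"
    by (simp add: Compl_eq_Diff_UNIV infinite_UNIV_char_0)
  ultimately have "infinite {z. (\<Sum>i\<le>2 * k. d i * z ^ i) = 0}" using finite_subset by blast
  then have d0: "\<forall>i\<le>2 * k. d i = 0" using polyfun_finite_roots[where n = "2 * k" and c = d] by blast
  have "d (nat (n + int k)) = 0" using n by (intro d0[rule_format]) auto
  then show ?thesis using n by (simp add: d_def)
qed

lemma exp_laurent_iff:
  assumes K: "complex_subfield K"
  shows "u \<in> exp_laurent K \<longleftrightarrow>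
    (\<exists>N f. finite N \<and> (\<forall>n. f n \<in> K) \<and> u = (\<lambda>s. \<Sum>n\<in>N. tt s n * f n))"
proof
  assume "u \<in> exp_laurent K"
  then obtain N f where f: "finite N" "f ` N \<subseteq> K" "u = (\<lambda>s. \<Sum>n\<in>N. f n * exp (2 * pi * \<i> * s * of_int n))"
    unfolding exp_laurent_def by blast
  have "0 \<in> K" using K by (simp add: complex_subfield_def)
  then show "\<exists>N f. finite N \<and> (\<forall>n. f n \<in> K) \<and> u = (\<lambda>s. \<Sum>n\<in>N. tt s n * f n)"
    using f by (intro exI[of _ N] exI[of _ "\<lambda>n. if n \<in> N then f n else 0"]) (auto simp: tt_def mult.commute)
next
  assume "\<exists>N f. finite N \<and> (\<forall>n. f n \<in> K) \<and> u = (\<lambda>s. \<Sum>n\<in>N. tt s n * f n)"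
  then show "u \<in> exp_laurent K"
    unfolding exp_laurent_def by (force simp: tt_def mult.commute)
qed

section \<open>The cycle module\<close>

text \<open>What the argument takes from the geometry. \<open>generation\<close> says that
  \<open>\<sigma>0\<close> and \<open>\<sigma>c\<close> generate the fundamental group of
  \<open>V\<close>. \<open>Dc\<close> is a simply connected domain around \<open>\<sigma>c\<close>
  without 0, so that logarithms and primitives exist on it. \<open>t0\<close> and \<open>tc\<close>
  are polynomial representatives of the two loops, since chains consist of piecewise smooth
  loops.\<close>

locale reflection_setting = based_operator r q A p
  for r q A p +
  fixes K :: "complex set" and SolK :: "complex fps set" and V Dc :: "complex set"
    and \<sigma>0 \<sigma>c t0 tc :: "real \<Rightarrow> complex" and \<delta> :: "complex fps" and l :: complex
  assumes K: "complex_subfield K"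
    and SolK: "rational_structure K (Sol r q p) SolK"
    and SolK_monodromy: "\<And>g \<phi>. loop p g \<Longrightarrow> \<phi> \<in> SolK \<Longrightarrow> monodromy g \<phi> \<in> SolK"
    and V: "V \<subseteq> A" "p \<in> V"
    and generation: "\<And>P g. loop_subgroup V p P \<Longrightarrow> P \<sigma>0 \<Longrightarrow> P \<sigma>c \<Longrightarrow> path g \<Longrightarrow> path_image g \<subseteq> V \<Longrightarrow>
        pathstart g = p \<Longrightarrow> pathfinish g = p \<Longrightarrow> P g"
    and \<sigma>0: "path \<sigma>0" "path_image \<sigma>0 \<subseteq> V" "pathstart \<sigma>0 = p" "pathfinish \<sigma>0 = p" "winding_number \<sigma>0 0 = 1"
    and \<sigma>c: "path \<sigma>c" "path_image \<sigma>c \<subseteq> V" "pathstart \<sigma>c = p" "pathfinish \<sigma>c = p" "winding_number \<sigma>c 0 = 0"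
    and t0: "polynomial_function t0" "homotopic_paths V \<sigma>0 t0"
    and tc: "polynomial_function tc" "homotopic_paths V \<sigma>c tc"
    and Dc: "open Dc" "simply_connected Dc" "0 \<notin> Dc" "path_image \<sigma>c \<subseteq> Dc" "p \<in> Dc"
    and special: "\<And>\<psi>. \<psi> \<in> Sol_adj r q p \<Longrightarrow> monodromy \<sigma>c \<psi> = \<psi> \<Longrightarrow>
        \<exists>g. g holomorphic_on Dc \<and> fps_expansion g p = \<psi>"
    and \<delta>: "\<delta> \<in> SolK" "\<delta> \<noteq> 0" "variation_image \<sigma>c (Sol r q p) = range (\<lambda>k. germ_scale k \<delta>)"
    and l: "exp l = p"
begin

lemma V0: "0 \<notin> V" using V A by blast

lemma loopI: "path g \<Longrightarrow> path_image g \<subseteq> V \<Longrightarrow> pathstart g = p \<Longrightarrow> pathfinish g = p \<Longrightarrow> loop p g"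
  using V by auto

lemma loop_\<sigma>0: "loop p \<sigma>0" and loop_\<sigma>c: "loop p \<sigma>c"
  using loopI \<sigma>0 \<sigma>c by blast+

abbreviation "s0 \<equiv> monodromy \<sigma>0"
abbreviation "sc \<equiv> monodromy \<sigma>c"

lemma mono_Sol: "loop p g \<Longrightarrow> f \<in> Solp \<Longrightarrow> monodromy g f \<in> Solp"
  using Sol_monodromy by metis

lemma mono_Adj: "loop p g \<Longrightarrow> f \<in> Adjp \<Longrightarrow> monodromy g f \<in> Adjp"
  using Sol_adj_monodromy by metis

lemma mono_Adj_add: "loop p g \<Longrightarrow> f \<in> Adjp \<Longrightarrow> h \<in> Adjp \<Longrightarrow> monodromy g (f + h) = monodromy g f + monodromy g h"
  by (rule monodromy_add[where X = A and z = p]) (auto intro: continuable_Sol_adj)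

lemma mono_Adj_diff: "loop p g \<Longrightarrow> f \<in> Adjp \<Longrightarrow> h \<in> Adjp \<Longrightarrow> monodromy g (f - h) = monodromy g f - monodromy g h"
  by (rule monodromy_diff[where X = A and z = p]) (auto intro: continuable_Sol_adj)

lemma mono_Adj_scale: "loop p g \<Longrightarrow> f \<in> Adjp \<Longrightarrow> monodromy g (fps_const c * f) = fps_const c * monodromy g f"
  by (rule monodromy_scale[where X = A and z = p]) (auto intro: continuable_Sol_adj)

lemma mono_Adj_sum: "loop p g \<Longrightarrow> (\<And>i. i \<in> N \<Longrightarrow> f i \<in> Adjp) \<Longrightarrow> monodromy g (\<Sum>i\<in>N. f i) = (\<Sum>i\<in>N. monodromy g (f i))"
  by (rule monodromy_sum[where X = A and z = p]) (auto intro: continuable_Sol_adj)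

lemma mono_0: "loop p g \<Longrightarrow> monodromy g 0 = 0"
  using monodromy_0[of g A p] by blast

section \<open>The variation around \<open>c\<close> on solutions and on adjoint solutions\<close>

definition lam :: "complex fps \<Rightarrow> complex" where
  "lam \<phi> = (SOME c. sc \<phi> - \<phi> = fps_const c * \<delta>)"

lemma lam: assumes "\<phi> \<in> Solp" shows "sc \<phi> - \<phi> = fps_const (lam \<phi>) * \<delta>"
proof -
  have "sc \<phi> - \<phi> \<in> range (\<lambda>k. germ_scale k \<delta>)"
    unfolding \<delta>(3)[symmetric] variation_image_def using assms by blast
  then have "\<exists>c. sc \<phi> - \<phi> = fps_const c * \<delta>" by blast
  then show ?thesis unfolding lam_def by (rule someI_ex)
qed

lemma K_closed: "0 \<in> K" "1 \<in> K" "x \<in> K \<Longrightarrow> y \<in> K \<Longrightarrow> x + y \<in> K" "x \<in> K \<Longrightarrow> y \<in> K \<Longrightarrow> x * y \<in> K"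
    "x \<in> K \<Longrightarrow> - x \<in> K" "x \<in> K \<Longrightarrow> inverse x \<in> K" "x \<in> K \<Longrightarrow> y \<in> K \<Longrightarrow> x - y \<in> K" "x \<in> K \<Longrightarrow> y \<in> K \<Longrightarrow> x / y \<in> K"
  using K unfolding complex_subfield_def divide_inverse diff_conv_add_uminus by blast+

abbreviation "AK \<equiv> dual_structure r q p K SolK"

lemma SolK_basis:
  obtains B where "germ_space.independent B" "germ_space.span B = Solp" "SolK = span_over K B" "B \<subseteq> Solp"
proof -
  obtain B where B: "germ_space.independent B" "germ_space.span B = Solp" "SolK = span_over K B"
    using SolK unfolding rational_structure_def by blast
  moreover have "B \<subseteq> Solp" unfolding B(2)[symmetric] by (rule germ_space.span_superset)
  ultimately show ?thesis by (rule that)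
qed

lemma SolK_subset: "SolK \<subseteq> Solp"
proof -
  obtain B where B: "SolK = span_over K B" "B \<subseteq> Solp" by (rule SolK_basis)
  show ?thesis
  proof
    fix f assume "f \<in> SolK"
    then obtain N k where N: "N \<subseteq> B" "f = (\<Sum>b\<in>N. germ_scale (k b) b)" unfolding B(1) span_over_def by blast
    show "f \<in> Solp" unfolding N(2) by (intro Sol_sum Sol_scale) (use N(1) B(2) in blast)
  qed
qed

lemma \<delta>_Sol: "\<delta> \<in> Solp" using \<delta> SolK_subset by blast

lemma AK_iff: "\<psi> \<in> AK \<longleftrightarrow> \<psi> \<in> Adjp \<and> (\<forall>\<phi>\<in>SolK. br \<psi> \<phi> \<in> K)"
proof -
  have "(\<exists>k\<in>K. bracket r q p \<psi> \<phi> = fps_const k) \<longleftrightarrow> br \<psi> \<phi> \<in> K" if "\<psi> \<in> Adjp" "\<phi> \<in> SolK" for \<phi>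
  proof -
    have "\<phi> \<in> Solp" using that(2) SolK_subset by blast
    from bracket_const[OF that(1) this] show ?thesis by auto
  qed
  then show ?thesis unfolding dual_structure_def by blast
qed

lemma AK_Adj: "\<psi> \<in> AK \<Longrightarrow> \<psi> \<in> Adjp" by (simp add: AK_iff)

lemma AK_add: "f \<in> AK \<Longrightarrow> g \<in> AK \<Longrightarrow> f + g \<in> AK"
  by (simp add: AK_iff Adj_add br_add_left K_closed)

lemma AK_scale: "k \<in> K \<Longrightarrow> f \<in> AK \<Longrightarrow> fps_const k * f \<in> AK"
  by (simp add: AK_iff Adj_scale br_scale_left K_closed)

lemma AK_diff: "f \<in> AK \<Longrightarrow> g \<in> AK \<Longrightarrow> f - g \<in> AK"
  by (simp add: AK_iff Adj_diff br_diff_left K_closed)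

lemma AK_0: "0 \<in> AK"
  by (simp add: AK_iff Adj_0 br_0_left K_closed)

lemma AK_sum: "(\<And>i. i \<in> N \<Longrightarrow> f i \<in> AK) \<Longrightarrow> (\<Sum>i\<in>N. f i) \<in> AK"
  by (induction N rule: infinite_finite_induct) (simp_all add: AK_add AK_0)

lemma loop_reverse: "loop p g \<Longrightarrow> loop p (reversepath g)" by simp

lemma mono_reverse:
  assumes "continuable A p f" "loop p g"
  shows "monodromy g (monodromy (reversepath g) f) = f" "monodromy (reversepath g) (monodromy g f) = f"
  using monodromy_reversepath'[OF assms(1)] monodromy_reversepath[OF assms(1)] assms(2) by auto

lemma AK_monodromy:
  assumes f: "f \<in> AK" and g: "loop p g" shows "monodromy g f \<in> AK"
proof -
  have "br (monodromy g f) \<phi> \<in> K" if \<phi>: "\<phi> \<in> SolK" for \<phi>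
  proof -
    have \<phi>': "\<phi> \<in> Solp" using \<phi> SolK_subset by blast
    have "br (monodromy g f) \<phi> = br (monodromy g f) (monodromy g (monodromy (reversepath g) \<phi>))"
      using mono_reverse(1)[OF continuable_Sol[OF \<phi>'] g] by simp
    also have "\<dots> = br f (monodromy (reversepath g) \<phi>)"
      by (rule br_monodromy[OF AK_Adj[OF f] mono_Sol[OF loop_reverse[OF g] \<phi>'] g])
    finally show ?thesis using f SolK_monodromy[OF loop_reverse[OF g] \<phi>] by (simp add: AK_iff)
  qed
  then show ?thesis using mono_Adj[OF g AK_Adj[OF f]] by (simp add: AK_iff)
qed

text \<open>The coordinate functional of a basis vector \<open>b\<close> occurring in
  \<open>\<delta>\<close>, divided by its coefficient \<open>k b\<close>: it is 1 on
  \<open>\<delta>\<close>, and its values on \<open>SolK\<close> lie in \<open>K\<close> because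
  \<open>K\<close> is a field.\<close>

lemma dual_vector: "\<exists>\<psi>\<in>AK. br \<psi> \<delta> = 1"
proof -
  obtain B where B: "germ_space.independent B" "germ_space.span B = Solp" "SolK = span_over K B" "B \<subseteq> Solp"
    by (rule SolK_basis)
  obtain N k where N: "finite N" "N \<subseteq> B" "k ` N \<subseteq> K" "\<delta> = (\<Sum>b\<in>N. germ_scale (k b) b)"
    using \<delta>(1) unfolding B(3) span_over_def by blast
  have "\<exists>b\<in>N. k b \<noteq> 0"
  proof (rule ccontr)
    assume "\<not> (\<exists>b\<in>N. k b \<noteq> 0)"
    then have "\<delta> = 0" unfolding N(4) by (intro sum.neutral) simp
    then show False using \<delta>(2) by simp
  qed
  then obtain b where b: "b \<in> N" "k b \<noteq> 0" by blast
  define f where "f \<phi> = germ_space.representation B \<phi> b / k b" for \<phi>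
  have spanB: "\<phi> \<in> germ_space.span B \<longleftrightarrow> \<phi> \<in> Solp" for \<phi> using B(2) by simp
  have "\<exists>\<psi>\<in>Adjp. \<forall>\<phi>\<in>Solp. br \<psi> \<phi> = f \<phi>"
    by (rule functional_represented)
       (simp_all add: f_def germ_space.representation_add[OF B(1)] germ_space.representation_scale[OF B(1)] spanB add_divide_distrib)
  then obtain \<psi> where \<psi>: "\<psi> \<in> Adjp" "\<And>\<phi>. \<phi> \<in> Solp \<Longrightarrow> br \<psi> \<phi> = f \<phi>" by blast
  have val: "br \<psi> (\<Sum>x\<in>N'. germ_scale (k' x) x) = (if b \<in> N' then k' b / k b else 0)"
    if N': "finite N'" "N' \<subseteq> B" for N' k'
  proof -
    have "br \<psi> x = (if x = b then 1 / k b else 0)" if "x \<in> N'" for x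
    proof -
      have xB: "x \<in> B" using that N' by blast
      then have "br \<psi> x = f x" using B(4) \<psi>(2) by blast
      then show ?thesis by (simp add: f_def germ_space.representation_basis[OF B(1) xB])
    qed
    then have "br \<psi> (\<Sum>x\<in>N'. germ_scale (k' x) x) = (\<Sum>x\<in>N'. if x = b then k' x / k b else 0)"
      unfolding br_sum_right br_scale_right by (intro sum.cong refl) simp
    then show ?thesis using N'(1) by simp
  qed
  have "br \<psi> \<delta> = 1" using val[OF N(1,2), of k] b unfolding N(4) by simp
  moreover have "br \<psi> \<phi> \<in> K" if \<phi>: "\<phi> \<in> SolK" for \<phi>
  proof -
    obtain N' k' where N': "finite N'" "N' \<subseteq> B" "k' ` N' \<subseteq> K" "\<phi> = (\<Sum>b\<in>N'. germ_scale (k' b) b)"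
      using \<phi> unfolding B(3) span_over_def by blast
    have "k b \<in> K" using N(3) b(1) by blast
    moreover have "b \<in> N' \<Longrightarrow> k' b \<in> K" using N'(3) by blast
    ultimately show ?thesis unfolding N'(4) val[OF N'(1,2)] using K_closed(1,8) by simp
  qed
  ultimately show ?thesis using \<psi>(1) by (intro bexI[of _ \<psi>]) (auto simp: AK_iff)
qed

definition beta :: "complex fps \<Rightarrow> complex" where "beta \<psi> = br (sc \<psi>) \<delta>"

text \<open>A \<open>K\<close>-rational adjoint solution normalised by \<open>beta\<close>. Its
  variation \<open>eps\<close> is a \<open>K\<close>-rational generator of the image of
  \<open>\<sigma>c - 1\<close> on adjoint solutions.\<close>

definition psi1 :: "complex fps" where "psi1 = (SOME \<psi>. \<psi> \<in> AK \<and> beta \<psi> = 1)"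

definition eps :: "complex fps" where "eps = sc psi1 - psi1"

text \<open>\<open>beta\<close> evaluates after continuation along \<open>\<sigma>c\<close>, so the
  vector dual to \<open>\<delta>\<close> is first moved back along the reversed loop.\<close>

lemma psi1: "psi1 \<in> AK" "beta psi1 = 1"
proof -
  obtain \<psi> where \<psi>: "\<psi> \<in> AK" "br \<psi> \<delta> = 1" using dual_vector by blast
  have "monodromy (reversepath \<sigma>c) \<psi> \<in> AK" by (rule AK_monodromy[OF \<psi>(1) loop_reverse[OF loop_\<sigma>c]])
  moreover have "beta (monodromy (reversepath \<sigma>c) \<psi>) = 1"
    using mono_reverse(1)[OF continuable_Sol_adj[OF AK_Adj[OF \<psi>(1)]] loop_\<sigma>c] \<psi>(2) by (simp add: beta_def)
  ultimately have "\<exists>\<psi>. \<psi> \<in> AK \<and> beta \<psi> = 1" by blast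
  from someI_ex[OF this] show "psi1 \<in> AK" "beta psi1 = 1" unfolding psi1_def by blast+
qed

lemma eps_AK: "eps \<in> AK"
  unfolding eps_def by (intro AK_diff AK_monodromy psi1 loop_\<sigma>c)

lemma beta_K: "\<psi> \<in> AK \<Longrightarrow> beta \<psi> \<in> K"
  using AK_monodromy[OF _ loop_\<sigma>c] \<delta>(1) by (simp add: beta_def AK_iff)

lemma beta_scale: "\<psi> \<in> Adjp \<Longrightarrow> beta (fps_const c * \<psi>) = c * beta \<psi>"
  by (simp add: beta_def mono_Adj_scale[OF loop_\<sigma>c] br_scale_left)

lemma beta_add: "f \<in> Adjp \<Longrightarrow> g \<in> Adjp \<Longrightarrow> beta (f + g) = beta f + beta g"
  by (simp add: beta_def mono_Adj_add[OF loop_\<sigma>c] br_add_left)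

lemma beta_sum: "(\<And>i. i \<in> N \<Longrightarrow> f i \<in> Adjp) \<Longrightarrow> beta (\<Sum>i\<in>N. f i) = (\<Sum>i\<in>N. beta (f i))"
  by (simp add: beta_def mono_Adj_sum[OF loop_\<sigma>c] br_sum_left)

text \<open>Invariance of the bracket gives \<open>- lam \<phi> * beta \<psi>\<close> for the
  bracket of \<open>sc \<psi> - \<psi>\<close> with \<open>\<phi>\<close>. In this product
  \<open>\<psi>\<close> enters through \<open>beta\<close> only; so, by nondegeneracy, the variation
  is \<open>beta\<close> times its value at \<open>psi1\<close>.\<close>

lemma variation_adj:
  assumes \<psi>: "\<psi> \<in> Adjp" shows "sc \<psi> - \<psi> = fps_const (beta \<psi>) * eps"
proof -
  have var: "br (sc \<psi> - \<psi>) \<phi> = - lam \<phi> * beta \<psi>" if "\<psi> \<in> Adjp" and \<phi>: "\<phi> \<in> Solp" for \<psi> \<phi>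
  proof -
    have sphi: "sc \<phi> = \<phi> + fps_const (lam \<phi>) * \<delta>" using lam[OF \<phi>] by (simp add: algebra_simps)
    have "br \<psi> \<phi> = br (sc \<psi>) (sc \<phi>)" by (rule br_monodromy[OF that loop_\<sigma>c, symmetric])
    also have "\<dots> = br (sc \<psi>) \<phi> + lam \<phi> * beta \<psi>" unfolding sphi by (simp add: br_add_right br_scale_right beta_def)
    finally show ?thesis by (simp add: br_diff_left)
  qed
  have "sc \<psi> - \<psi> - fps_const (beta \<psi>) * eps = 0"
  proof (rule br_nondegenerate_left)
    show "sc \<psi> - \<psi> - fps_const (beta \<psi>) * eps \<in> Adjp"
      by (intro Adj_diff mono_Adj[OF loop_\<sigma>c] \<psi> Adj_scale AK_Adj eps_AK)
    fix \<phi> assume \<phi>: "\<phi> \<in> Solp"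
    have "br eps \<phi> = - lam \<phi>" unfolding eps_def using var[OF AK_Adj[OF psi1(1)] \<phi>] psi1(2) by simp
    then show "br (sc \<psi> - \<psi> - fps_const (beta \<psi>) * eps) \<phi> = 0"
      using var[OF \<psi> \<phi>] by (simp only: br_diff_left[of "sc \<psi> - \<psi>"] br_scale_left) simp
  qed
  then show ?thesis by simp
qed

lemma variation_image_adj: "variation_image \<sigma>c Adjp = range (\<lambda>k. germ_scale k eps)"
proof
  show "variation_image \<sigma>c Adjp \<subseteq> range (\<lambda>k. germ_scale k eps)"
    unfolding variation_image_def using variation_adj by auto
  show "range (\<lambda>k. germ_scale k eps) \<subseteq> variation_image \<sigma>c Adjp"
  proof
    fix f assume "f \<in> range (\<lambda>k. germ_scale k eps)"
    then obtain k where k: "f = germ_scale k eps" by blast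
    have "germ_scale k psi1 \<in> Adjp" by (intro Adj_scale AK_Adj psi1)
    moreover have "sc (germ_scale k psi1) - germ_scale k psi1 = f"
      using variation_adj[OF calculation] beta_scale[OF AK_Adj[OF psi1(1)]] psi1(2) k by simp
    ultimately show "f \<in> variation_image \<sigma>c Adjp" unfolding variation_image_def by force
  qed
qed

text \<open>An adjoint solution orthogonal to \<open>\<delta>\<close> is
  \<open>\<sigma>c\<close>-invariant, again by invariance of the bracket. If \<open>\<phi>\<close>
  were not a multiple of \<open>\<delta>\<close>, some such solution would pair nontrivially with
  it.\<close>

lemma variation_in_span_if_orthogonal:
  assumes \<phi>: "\<phi> \<in> Solp" and orth: "\<And>\<psi>. \<psi> \<in> Adjp \<Longrightarrow> sc \<psi> = \<psi> \<Longrightarrow> br \<psi> \<phi> = 0"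
  shows "\<exists>c. \<phi> = fps_const c * \<delta>"
proof (rule ccontr)
  assume "\<not> (\<exists>c. \<phi> = fps_const c * \<delta>)"
  then obtain \<psi> where \<psi>: "\<psi> \<in> Adjp" "br \<psi> \<delta> = 0" "br \<psi> \<phi> \<noteq> 0"
    using functional_separating[OF \<delta>_Sol \<delta>(2) \<phi>] by blast
  have "sc \<psi> - \<psi> = 0"
  proof (rule br_nondegenerate_left)
    show "sc \<psi> - \<psi> \<in> Adjp" by (intro Adj_diff mono_Adj[OF loop_\<sigma>c] \<psi>(1))
    fix x assume x: "x \<in> Solp"
    define y where "y = monodromy (reversepath \<sigma>c) x"
    have y: "y \<in> Solp" "sc y = x"
      unfolding y_def by (rule mono_Sol[OF loop_reverse[OF loop_\<sigma>c] x], rule mono_reverse(1)[OF continuable_Sol[OF x] loop_\<sigma>c])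
    have "br (sc \<psi>) x = br \<psi> y" using br_monodromy[OF \<psi>(1) y(1) loop_\<sigma>c] y(2) by simp
    moreover have "br \<psi> x = br \<psi> (y + fps_const (lam y) * \<delta>)" using lam[OF y(1)] y(2) by (simp add: algebra_simps)
    ultimately show "br (sc \<psi> - \<psi>) x = 0" using \<psi>(2) by (simp add: br_diff_left br_add_right br_scale_right)
  qed
  then show False using orth[OF \<psi>(1)] \<psi>(3) by simp
qed

subsection \<open>Integrals along loops\<close>

abbreviation pw :: "complex \<Rightarrow> complex fps" where "pw s \<equiv> power_germ p l s"

lemma continuable_log_germ: "H holomorphic_on UNIV \<Longrightarrow> continuable A p (log_germ H p l)"
  by (rule continuable_subset[OF monodromy_log_germ(2)[OF _ l, of H "linepath p p"]]) (use A p in auto)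

lemma monodromy_log_germ_loop:
  assumes "H holomorphic_on UNIV" "loop p g"
  shows "monodromy g (log_germ H p l) = log_germ (\<lambda>x. H (x + 2 * pi * \<i> * winding_number g 0)) p l"
  by (rule monodromy_log_germ(1)[OF assms(1) l]) (use assms(2) A in auto)

lemma winding_Ints: "loop p g \<Longrightarrow> winding_number g 0 \<in> \<int>"
  by (rule integer_winding_number) (use A in auto)

lemma continuable_pw: "continuable A p (pw s)"
  unfolding power_germ_eq by (rule continuable_log_germ) (intro holomorphic_intros)

lemma monodromy_pw:
  assumes g: "loop p g"
  shows "monodromy g (pw s) = fps_const (exp (2 * pi * \<i> * s * winding_number g 0)) * pw s"
proof -
  have h: "(\<lambda>x. exp (s * x)) holomorphic_on UNIV" by (intro holomorphic_intros)
  have "monodromy g (pw s) = log_germ (\<lambda>x. exp (s * (x + 2 * pi * \<i> * winding_number g 0))) p l"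
    unfolding power_germ_eq by (rule monodromy_log_germ_loop[OF h g])
  also have "(\<lambda>x. exp (s * (x + 2 * pi * \<i> * winding_number g 0))) =
      (\<lambda>x. exp (2 * pi * \<i> * s * winding_number g 0) * exp (s * x))"
    by (simp add: exp_add[symmetric] algebra_simps)
  also have "log_germ \<dots> p l = fps_const (exp (2 * pi * \<i> * s * winding_number g 0)) * pw s"
    unfolding power_germ_eq by (rule log_germ_scale[OF open_UNIV UNIV_I l h])
  finally show ?thesis .
qed

lemma monodromy_pw_minus_1:
  assumes g: "loop p g"
  shows "monodromy g (pw (s - 1)) = fps_const (exp (2 * pi * \<i> * s * winding_number g 0)) * pw (s - 1)"
proof -
  have "2 * pi * \<i> * (s - 1) * winding_number g 0 = 2 * pi * \<i> * s * winding_number g 0 - 2 * pi * \<i> * winding_number g 0"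
    by (simp add: algebra_simps)
  then show ?thesis using monodromy_pw[OF g, of "s - 1"] tt_int_period[OF winding_Ints[OF g]] by (simp add: exp_diff)
qed

text \<open>The integral of \<open>\<psi> t^(s - 1)\<close> along \<open>g\<close>, written as the
  continuation of the primitive that vanishes at \<open>p\<close>. It makes sense for the continuous
  loops \<open>\<sigma>0\<close> and \<open>\<sigma>c\<close>, and its rules follow from those of
  \<open>monodromy\<close>.\<close>

definition E :: "(real \<Rightarrow> complex) \<Rightarrow> complex \<Rightarrow> complex fps \<Rightarrow> complex" where
  "E g s \<psi> = fps_nth (monodromy g (fps_integral (\<psi> * pw (s - 1)) 0)) 0"

lemma continuable_prim: "continuable A p \<psi> \<Longrightarrow> fps_deriv P = \<psi> * pw s \<Longrightarrow> continuable A p P"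
  by (rule continuable_primitive) (simp add: continuable_mult continuable_pw)

lemma E_eq:
  assumes \<psi>: "continuable A p \<psi>" and P: "fps_deriv P = \<psi> * pw (s - 1)" and g: "loop p g"
  shows "E g s \<psi> = fps_nth (monodromy g P) 0 - fps_nth P 0"
proof -
  let ?P = "fps_integral (\<psi> * pw (s - 1)) 0"
  have dP: "fps_deriv ?P = \<psi> * pw (s - 1)" by (rule fps_deriv_fps_integral)
  then have "P = fps_const (fps_nth P 0) + ?P" using P by (metis add.commute add_diff_cancel_left' fps_integral0_deriv diff_add_cancel)
  then have "monodromy g P = monodromy g (fps_const (fps_nth P 0) + ?P)" by simp
  also have "\<dots> = fps_const (fps_nth P 0) + monodromy g ?P"
    using monodromy_add[of g A p, OF _ _ _ continuable_const continuable_prim[OF \<psi> dP]] monodromy_const[of g A p] g by simp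
  finally show ?thesis by (simp add: E_def)
qed

lemma germ_integral_E:
  assumes "valid_path g" "loop p g" "continuable A p \<psi>"
  shows "germ_integral g (\<psi> * pw (s - 1)) = E g s \<psi>"
proof -
  let ?P = "fps_integral (\<psi> * pw (s - 1)) 0"
  have dP: "fps_deriv ?P = \<psi> * pw (s - 1)" by (rule fps_deriv_fps_integral)
  have "germ_integral g (fps_deriv ?P) = fps_nth (monodromy g ?P) 0 - fps_nth ?P 0"
    by (rule germ_integral_eq[OF assms(1)]) (use assms continuable_prim[OF assms(3) dP] in auto)
  then show ?thesis unfolding dP using E_eq[OF assms(3) dP assms(2)] by simp
qed

lemma E_add:
  assumes "continuable A p f" "continuable A p h" "loop p g" shows "E g s (f + h) = E g s f + E g s h"
proof -
  let ?P = "\<lambda>\<psi>. fps_integral (\<psi> * pw (s - 1)) 0"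
  have "fps_deriv (?P f + ?P h) = (f + h) * pw (s - 1)" by (simp add: fps_deriv_fps_integral distrib_right)
  from E_eq[OF continuable_add[OF assms(1,2)] this assms(3)]
  have "E g s (f + h) = fps_nth (monodromy g (?P f + ?P h)) 0" by simp
  then show ?thesis
    using monodromy_add[of g A p "?P f" "?P h"] continuable_prim[OF assms(1) fps_deriv_fps_integral]
      continuable_prim[OF assms(2) fps_deriv_fps_integral] assms(3) by (simp add: E_def)
qed

lemma E_scale:
  assumes "continuable A p f" "loop p g" shows "E g s (fps_const c * f) = c * E g s f"
proof -
  let ?P = "\<lambda>\<psi>. fps_integral (\<psi> * pw (s - 1)) 0"
  have "fps_deriv (fps_const c * ?P f) = (fps_const c * f) * pw (s - 1)" by (simp add: fps_deriv_fps_integral mult.assoc)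
  from E_eq[OF continuable_scale[OF assms(1)] this assms(2)]
  have "E g s (fps_const c * f) = fps_nth (monodromy g (fps_const c * ?P f)) 0" by simp
  then show ?thesis
    using monodromy_scale[of g A p "?P f"] continuable_prim[OF assms(1) fps_deriv_fps_integral] assms(2)
    by (simp add: E_def)
qed

lemma E_0: "loop p g \<Longrightarrow> E g s 0 = 0"
  using E_scale[OF continuable_0, of g s 0] by simp

lemma E_diff:
  assumes "continuable A p f" "continuable A p h" "loop p g" shows "E g s (f - h) = E g s f - E g s h"
  using E_add[OF continuable_diff[OF assms(1,2)] assms(2,3)] by simp

text \<open>Along \<open>h\<close> the integrand is the continuation of \<open>f t^(s - 1)\<close>
  along \<open>g\<close>, to which the power contributes the exponential factor; this is the twisted
  action on coefficients.\<close>

lemma E_join: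
  assumes f: "continuable A p f" and g: "loop p g" and h: "loop p h"
  shows "E (g +++ h) s f = E g s f + E h s (fps_const (exp (2 * pi * \<i> * s * winding_number g 0)) * monodromy g f)"
proof -
  let ?P = "fps_integral (f * pw (s - 1)) 0"
  have cP: "continuable A p ?P" by (rule continuable_prim[OF f fps_deriv_fps_integral])
  have gpath: "path g" "path_image g \<subseteq> A" "pathstart g = p" using g by auto
  have cgP: "continuable A p (monodromy g ?P)" "continuable A p (monodromy g f)"
    by (rule continuable_monodromy[OF cP gpath], use g in simp, rule continuable_monodromy[OF f gpath], use g in simp)
  have "fps_deriv (monodromy g ?P) = monodromy g (f * pw (s - 1))"
    using monodromy_deriv[OF gpath cP] by (simp add: fps_deriv_fps_integral)
  also have "\<dots> = (fps_const (exp (2 * pi * \<i> * s * winding_number g 0)) * monodromy g f) * pw (s - 1)"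
    using monodromy_mult[OF gpath f continuable_pw] monodromy_pw_minus_1[OF g] by (simp add: mult_ac)
  finally have "E h s (fps_const (exp (2 * pi * \<i> * s * winding_number g 0)) * monodromy g f) =
      fps_nth (monodromy h (monodromy g ?P)) 0 - fps_nth (monodromy g ?P) 0"
    by (intro E_eq h continuable_scale cgP)
  moreover have "monodromy (g +++ h) ?P = monodromy h (monodromy g ?P)"
    by (rule monodromy_join[OF cP gpath]) (use g h in auto)
  ultimately show ?thesis by (simp add: E_def)
qed

lemma E_homotopic:
  assumes "homotopic_paths V g h" "pathstart g = p" "continuable A p f"
  shows "E g s f = E h s f"
proof -
  have "continuable V p (fps_integral (f * pw (s - 1)) 0)"
    using continuable_prim[OF assms(3) fps_deriv_fps_integral] V(1) continuable_subset by blast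
  from monodromy_homotopic[OF this assms(1,2)] show ?thesis by (simp add: E_def)
qed

lemma E_trivial:
  assumes f: "continuable A p f" and g: "loop p g" and triv: "\<And>h. continuable A p h \<Longrightarrow> monodromy g h = h"
  shows "E g s f = 0"
  using E_eq[OF f fps_deriv_fps_integral g] triv[OF continuable_prim[OF f fps_deriv_fps_integral]] by simp

text \<open>The special condition makes \<open>\<psi>\<close> holomorphic on all of
  \<open>Dc\<close>, and so is \<open>t^(s - 1)\<close> because \<open>Dc\<close> is simply
  connected without 0. The integrand then has a primitive on \<open>Dc\<close>, which returns to its
  initial value along the loop.\<close>

lemma E_\<sigma>c_invariant:
  assumes \<psi>: "\<psi> \<in> Adjp" "sc \<psi> = \<psi>" shows "E \<sigma>c s \<psi> = 0"
proof -
  obtain g where g: "g holomorphic_on Dc" "fps_expansion g p = \<psi>" using special[OF \<psi>] by blast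
  obtain k where k: "k holomorphic_on Dc" "\<And>z. z \<in> Dc \<Longrightarrow> z = exp (k z)"
    using simply_connected_eq_holomorphic_log[OF Dc(1)] Dc(2,3) holomorphic_on_ident by (metis (no_types, lifting))
  have kp: "exp (k p) = p" using k(2)[OF Dc(5)] by simp
  define h where "h z = g z * exp ((s - 1) * (l + (k z - k p)))" for z
  have hh: "h holomorphic_on Dc" unfolding h_def by (intro holomorphic_intros g k)
  have pwhol: "fps_expansion (\<lambda>z. exp ((s - 1) * (l + (k z - k p)))) p = pw (s - 1)"
  proof -
    \<comment> \<open>The branch on \<open>Dc\<close> is compared with the principal logarithm in
      \<open>power_germ\<close> only near \<open>p\<close>, where \<open>k z - k p\<close> has
      modulus below \<open>pi\<close>.\<close>
    have "continuous_on Dc (\<lambda>z. k z - k p)" using holomorphic_on_imp_continuous_on[OF k(1)] by (intro continuous_intros)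
    then have op: "open (Dc \<inter> (\<lambda>z. k z - k p) -` ball 0 pi)"
      by (rule continuous_open_preimage[OF _ Dc(1) open_ball])
    show ?thesis
      unfolding power_germ_def
    proof (rule fps_expansion_eq_on[OF op])
      show "p \<in> Dc \<inter> (\<lambda>z. k z - k p) -` ball 0 pi" using Dc(5) by simp
      fix z assume z: "z \<in> Dc \<inter> (\<lambda>z. k z - k p) -` ball 0 pi"
      then have "norm (k z - k p) < pi" by simp
      then have "\<bar>Im (k z - k p)\<bar> < pi" using abs_Im_le_cmod le_less_trans by blast
      then have "Ln (exp (k z - k p)) = k z - k p" by (intro Ln_exp) linarith+
      moreover have "exp (k z - k p) = z / p" using k(2)[of z] z kp by (simp add: exp_diff)
      ultimately show "exp ((s - 1) * (l + (k z - k p))) = exp ((s - 1) * log_branch p l z)"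
        by (simp add: log_branch_def)
    qed
  qed
  have eh: "fps_expansion h p = \<psi> * pw (s - 1)"
    unfolding h_def g(2)[symmetric] pwhol[symmetric]
    by (rule fps_expansion_mult[OF Dc(1,5) g(1)]) (intro holomorphic_intros k)
  obtain H where H: "\<And>z. z \<in> Dc \<Longrightarrow> (H has_field_derivative h z) (at z)"
    using simply_connected_eq_global_primitive[OF Dc(1)] Dc(2) hh by blast
  have Hh: "H holomorphic_on Dc" unfolding holomorphic_on_open[OF Dc(1)] using H by blast
  have "fps_deriv (fps_expansion H p) = fps_expansion h p"
    unfolding fps_expansion_deriv[symmetric]
    by (rule fps_expansion_eq_on[OF Dc(1,5)]) (rule DERIV_imp_deriv[OF H])
  then have "E \<sigma>c s \<psi> = fps_nth (sc (fps_expansion H p)) 0 - fps_nth (fps_expansion H p) 0"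
    by (intro E_eq continuable_Sol_adj \<psi>(1) loop_\<sigma>c) (simp add: eh)
  also have "sc (fps_expansion H p) = fps_expansion H (pathfinish \<sigma>c)"
    by (rule monodromy_holomorphic[OF \<sigma>c(1) Dc(4) \<sigma>c(3) Hh Dc(1) order_refl])
  finally show ?thesis using \<sigma>c(4) by simp
qed

text \<open>An adjoint solution on which \<open>beta\<close> vanishes is
  \<open>\<sigma>c\<close>-invariant and has integral 0, so the integral factors through
  \<open>beta\<close>; and \<open>psi1\<close> has \<open>beta\<close> equal to 1.\<close>

lemma E_\<sigma>c: assumes \<psi>: "\<psi> \<in> Adjp" shows "E \<sigma>c s \<psi> = beta \<psi> * E \<sigma>c s psi1"
proof -
  have p1: "psi1 \<in> Adjp" by (intro AK_Adj psi1)
  have c: "continuable A p \<psi>" "continuable A p psi1" using \<psi> p1 continuable_Sol_adj by blast+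
  let ?d = "\<psi> - fps_const (beta \<psi>) * psi1"
  have d: "?d \<in> Adjp" by (intro Adj_diff Adj_scale \<psi> p1)
  have "beta \<psi> = beta (?d + fps_const (beta \<psi>) * psi1)" by simp
  also have "\<dots> = beta ?d + beta \<psi>"
    unfolding beta_add[OF d Adj_scale[OF p1]] beta_scale[OF p1] psi1(2) by simp
  finally have "beta ?d = 0" by simp
  then have "sc ?d = ?d" using variation_adj[OF d] by simp
  from E_\<sigma>c_invariant[OF d this]
  show ?thesis using E_diff[OF c(1) continuable_scale[OF c(2)] loop_\<sigma>c] E_scale[OF c(2) loop_\<sigma>c] by simp
qed

end

section \<open>The twisted coefficient module\<close>

lemma sum_fun_apply: "(\<Sum>i\<in>N. f i) x = (\<Sum>i\<in>N. f i x)"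
  by (induction N rule: infinite_finite_induct) simp_all

lemma laurent_independent_fps:
  fixes c :: "int \<Rightarrow> complex fps"
  assumes zero: "\<And>s. (\<Sum>n\<in>{- int k..int k}. fps_const (tt s n) * c n) = 0" and n: "n \<in> {- int k..int k}"
  shows "c n = 0"
proof (rule fps_ext)
  fix j
  have "(\<Sum>n\<in>{- int k..int k}. tt s n * fps_nth (c n) j) = 0" for s
    using arg_cong[OF zero[of s], of "\<lambda>f. fps_nth f j"] by (simp add: fps_sum_nth)
  from laurent_independent[OF this n] show "fps_nth (c n) j = fps_nth 0 j" by simp
qed

lemma exp_laurent_sum:
  assumes K: "complex_subfield K" and c: "\<And>i. c i \<in> K"
  shows "(\<lambda>s. \<Sum>i\<le>d. tt s (m - int i) * c i) \<in> exp_laurent K"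
proof -
  have inj: "inj_on (\<lambda>i. m - int i) {..d}" by (auto simp: inj_on_def)
  have "(\<Sum>n\<in>(\<lambda>i. m - int i) ` {..d}. tt s n * c (nat (m - n))) = (\<Sum>i\<le>d. tt s (m - int i) * c i)" for s
    by (subst sum.reindex[OF inj]) simp
  then show ?thesis
    unfolding exp_laurent_iff[OF K]
    by (intro exI[of _ "(\<lambda>i. m - int i) ` {..d}"] exI[of _ "\<lambda>n. c (nat (m - n))"]) (simp add: c)
qed

context reflection_setting
begin

abbreviation "M \<equiv> twisted_module AK"

text \<open>A Laurent expansion with exponents in a symmetric range and coefficients that vanish
  outside it. Two elements can then share a range, and coefficients can be shifted past its
  ends.\<close>

definition M_rep :: "nat \<Rightarrow> (int \<Rightarrow> complex fps) \<Rightarrow> (complex \<Rightarrow> complex fps) \<Rightarrow> bool" where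
  "M_rep k \<psi> m \<longleftrightarrow> (\<forall>n. \<psi> n \<in> AK) \<and> (\<forall>n. n \<notin> {- int k..int k} \<longrightarrow> \<psi> n = 0) \<and>
     m = (\<lambda>s. \<Sum>n\<in>{- int k..int k}. fps_const (tt s n) * \<psi> n)"

lemma M_rep_enlarge: assumes "M_rep k \<psi> m" "k \<le> k'" shows "M_rep k' \<psi> m"
proof -
  have "(\<Sum>n\<in>{- int k..int k}. fps_const (tt s n) * \<psi> n) = (\<Sum>n\<in>{- int k'..int k'}. fps_const (tt s n) * \<psi> n)" for s
    by (rule sum.mono_neutral_left) (use assms in \<open>auto simp: M_rep_def\<close>)
  moreover have "n \<notin> {- int k'..int k'} \<longrightarrow> \<psi> n = 0" for n
    using assms by (auto simp: M_rep_def)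
  ultimately show ?thesis using assms(1) unfolding M_rep_def by auto
qed

lemma M_iff: "m \<in> M \<longleftrightarrow> (\<exists>k \<psi>. M_rep k \<psi> m)"
proof
  assume "m \<in> M"
  then obtain N \<psi> where N: "finite N" "\<psi> ` N \<subseteq> AK" "m = (\<lambda>s. \<Sum>n\<in>N. germ_scale (exp (2 * pi * \<i> * s * of_int n)) (\<psi> n))"
    unfolding twisted_module_def by blast
  define k where "k = (\<Sum>n\<in>N. nat \<bar>n\<bar>)"
  have k: "n \<in> {- int k..int k}" if "n \<in> N" for n
  proof -
    have "nat \<bar>n\<bar> \<le> k" unfolding k_def by (rule member_le_sum) (use that N(1) in auto)
    then show ?thesis by auto
  qed
  define \<psi>' where "\<psi>' n = (if n \<in> N then \<psi> n else 0)" for n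
  have "m s = (\<Sum>n\<in>{- int k..int k}. fps_const (tt s n) * \<psi>' n)" for s
    unfolding N(3) by (rule sum.mono_neutral_cong_left) (use k in \<open>auto simp: \<psi>'_def tt_def\<close>)
  then have "M_rep k \<psi>' m" unfolding M_rep_def using N(2) AK_0 k by (auto simp: \<psi>'_def)
  then show "\<exists>k \<psi>. M_rep k \<psi> m" by blast
next
  assume "\<exists>k \<psi>. M_rep k \<psi> m"
  then obtain k \<psi> where r: "M_rep k \<psi> m" by blast
  then have "m = (\<lambda>s. \<Sum>n\<in>{- int k..int k}. germ_scale (exp (2 * pi * \<i> * s * of_int n)) (\<psi> n))"
    unfolding M_rep_def tt_def by blast
  moreover have "\<psi> ` {- int k..int k} \<subseteq> AK" using r unfolding M_rep_def by blast
  ultimately show "m \<in> M" unfolding twisted_module_def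
    by (intro CollectI exI[of _ "{- int k..int k}"] exI[of _ \<psi>]) simp
qed

lemma M_rep_comb:
  assumes "M_rep k \<psi> m" "M_rep k \<psi>' m'"
  shows "M_rep k (\<lambda>n. \<psi> n + \<psi>' n) (\<lambda>s. m s + m' s)" "M_rep k (\<lambda>n. \<psi> n - \<psi>' n) (\<lambda>s. m s - m' s)"
  using assms unfolding M_rep_def
  by (auto simp: AK_add AK_diff sum.distrib[symmetric] sum_subtractf[symmetric] algebra_simps)

lemma M_pair_rep: assumes "m \<in> M" "m' \<in> M" obtains k \<psi> \<psi>' where "M_rep k \<psi> m" "M_rep k \<psi>' m'"
proof -
  obtain k \<psi> k' \<psi>' where "M_rep k \<psi> m" "M_rep k' \<psi>' m'" using assms unfolding M_iff by blast
  then have "M_rep (max k k') \<psi> m" "M_rep (max k k') \<psi>' m'"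
    using M_rep_enlarge by (meson max.cobounded1 max.cobounded2)+
  then show ?thesis by (rule that)
qed

lemma M_add: assumes "m \<in> M" "m' \<in> M" shows "(\<lambda>s. m s + m' s) \<in> M"
proof -
  obtain k \<psi> \<psi>' where "M_rep k \<psi> m" "M_rep k \<psi>' m'" by (rule M_pair_rep[OF assms])
  from M_rep_comb(1)[OF this] show ?thesis unfolding M_iff by blast
qed

lemma M_diff: assumes "m \<in> M" "m' \<in> M" shows "(\<lambda>s. m s - m' s) \<in> M"
proof -
  obtain k \<psi> \<psi>' where "M_rep k \<psi> m" "M_rep k \<psi>' m'" by (rule M_pair_rep[OF assms])
  from M_rep_comb(2)[OF this] show ?thesis unfolding M_iff by blast
qed

lemma M_single: assumes "\<psi> \<in> AK" shows "(\<lambda>s. fps_const (tt s n) * \<psi>) \<in> M"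
  unfolding twisted_module_def
  by (simp, rule exI[of _ "{n}"], rule exI[of _ "\<lambda>_. \<psi>"]) (use assms in \<open>auto simp: tt_def\<close>)

lemma M_0: "(\<lambda>s. 0) \<in> M"
  using M_single[OF AK_0, of 0] by simp

lemma M_sum: "(\<And>i. i \<in> N \<Longrightarrow> m i \<in> M) \<Longrightarrow> (\<lambda>s. \<Sum>i\<in>N. m i s) \<in> M"
proof (induction N rule: infinite_finite_induct)
  case (insert x N)
  then show ?case using M_add[of "m x" "\<lambda>s. \<Sum>i\<in>N. m i s"] by simp
qed (simp_all add: M_0)

lemma M_Adj: assumes "m \<in> M" shows "m s \<in> Adjp"
proof -
  obtain k \<psi> where "M_rep k \<psi> m" using assms unfolding M_iff by blast
  then have "m s = (\<Sum>n\<in>{- int k..int k}. fps_const (tt s n) * \<psi> n)" "\<And>n. \<psi> n \<in> AK"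
    by (simp_all add: M_rep_def)
  then show ?thesis by (simp add: Adj_sum Adj_scale AK_Adj)
qed

lemma M_laurent: assumes u: "u \<in> exp_laurent K" and m: "m \<in> M" shows "(\<lambda>s. fps_const (u s) * m s) \<in> M"
proof -
  obtain N f where N: "\<forall>n. f n \<in> K" "u = (\<lambda>s. \<Sum>n\<in>N. tt s n * f n)" using u exp_laurent_iff[OF K] by blast
  obtain k \<psi> where r: "M_rep k \<psi> m" using m unfolding M_iff by blast
  have const_sum: "fps_const (\<Sum>n\<in>N. g n) = (\<Sum>n\<in>N. fps_const (g n))" for g :: "int \<Rightarrow> complex" and N
    by (induction N rule: infinite_finite_induct) (simp_all flip: fps_const_add)
  have "fps_const (u s) * m s = (\<Sum>a\<in>N. \<Sum>n\<in>{- int k..int k}. fps_const (tt s (a + n)) * (fps_const (f a) * \<psi> n))" for s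
  proof -
    have ms: "m s = (\<Sum>n\<in>{- int k..int k}. fps_const (tt s n) * \<psi> n)" using r by (simp add: M_rep_def)
    have "fps_const (u s) * m s = (\<Sum>a\<in>N. \<Sum>n\<in>{- int k..int k}. fps_const (tt s a * f a) * (fps_const (tt s n) * \<psi> n))"
      unfolding N(2) const_sum ms sum_product ..
    also have "\<dots> = (\<Sum>a\<in>N. \<Sum>n\<in>{- int k..int k}. fps_const (tt s (a + n)) * (fps_const (f a) * \<psi> n))"
      by (intro sum.cong refl) (simp only: tt_add fps_const_mult[symmetric] mult_ac)
    finally show ?thesis .
  qed
  moreover have "(\<lambda>s. \<Sum>a\<in>N. \<Sum>n\<in>{- int k..int k}. fps_const (tt s (a + n)) * (fps_const (f a) * \<psi> n)) \<in> M"
    using N(1) r by (intro M_sum M_single AK_scale) (auto simp: M_rep_def)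
  ultimately show ?thesis by simp
qed

lemma mono_M_rep:
  assumes r: "M_rep k \<psi> m" and g: "loop p g"
  shows "monodromy g (m s) = (\<Sum>n\<in>{- int k..int k}. fps_const (tt s n) * monodromy g (\<psi> n))"
proof -
  have \<psi>: "\<psi> n \<in> Adjp" for n using r AK_Adj by (auto simp: M_rep_def)
  have "monodromy g (m s) = monodromy g (\<Sum>n\<in>{- int k..int k}. fps_const (tt s n) * \<psi> n)"
    using r by (simp add: M_rep_def)
  also have "\<dots> = (\<Sum>n\<in>{- int k..int k}. monodromy g (fps_const (tt s n) * \<psi> n))"
    by (rule mono_Adj_sum[OF g Adj_scale[OF \<psi>]])
  finally show ?thesis by (simp add: mono_Adj_scale[OF g \<psi>])
qed

lemma twisted_action_M: assumes m: "m \<in> M" and g: "loop p g" shows "twisted_action g m \<in> M"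
proof -
  obtain k \<psi> where r: "M_rep k \<psi> m" using m unfolding M_iff by blast
  obtain j where j: "winding_number g 0 = of_int j" using winding_Ints[OF g] by (elim Ints_cases)
  have "twisted_action g m = (\<lambda>s. \<Sum>n\<in>{- int k..int k}. fps_const (tt s (j + n)) * monodromy g (\<psi> n))"
  proof
    fix s
    have "twisted_action g m s = fps_const (tt s j) * monodromy g (m s)"
      by (simp add: twisted_action_def j tt_def)
    then show "twisted_action g m s = (\<Sum>n\<in>{- int k..int k}. fps_const (tt s (j + n)) * monodromy g (\<psi> n))"
      unfolding mono_M_rep[OF r g] sum_distrib_left by (simp only: tt_add fps_const_mult[symmetric] mult.assoc)
  qed
  moreover have "(\<lambda>s. \<Sum>n\<in>{- int k..int k}. fps_const (tt s (j + n)) * monodromy g (\<psi> n)) \<in> M"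
    by (intro M_sum M_single AK_monodromy[OF _ g]) (use r in \<open>simp add: M_rep_def\<close>)
  ultimately show ?thesis by simp
qed

lemma twisted_action_add: "m \<in> M \<Longrightarrow> m' \<in> M \<Longrightarrow> loop p g \<Longrightarrow>
    twisted_action g (\<lambda>s. m s + m' s) s = twisted_action g m s + twisted_action g m' s"
  by (simp add: twisted_action_def mono_Adj_add M_Adj distrib_left)

lemma twisted_action_diff: "m \<in> M \<Longrightarrow> m' \<in> M \<Longrightarrow> loop p g \<Longrightarrow>
    twisted_action g (\<lambda>s. m s - m' s) s = twisted_action g m s - twisted_action g m' s"
  by (simp add: twisted_action_def mono_Adj_diff M_Adj right_diff_distrib)

lemma twisted_action_\<sigma>0: "twisted_action \<sigma>0 m s = fps_const (tt s 1) * s0 (m s)"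
  by (simp add: twisted_action_def \<sigma>0(5) tt_def)

lemma twisted_action_\<sigma>c: "twisted_action \<sigma>c m s = sc (m s)"
  by (simp add: twisted_action_def \<sigma>c(5))

lemma winding_homotopic: "homotopic_paths V g h \<Longrightarrow> winding_number g 0 = winding_number h 0"
  by (rule winding_number_homotopic_paths, rule homotopic_paths_subset) (use V0 in auto)

lemma continuable_M: "m \<in> M \<Longrightarrow> continuable A p (m s)"
  by (rule continuable_Sol_adj[OF M_Adj])

lemma twisted_action_homotopic:
  assumes "homotopic_paths V g h" "pathstart g = p" "m \<in> M"
  shows "twisted_action g m s = twisted_action h m s"
proof -
  have "monodromy g (m s) = monodromy h (m s)"
    using monodromy_homotopic[OF continuable_subset[OF continuable_M[OF assms(3)] V(1)] assms(1,2)] .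
  then show ?thesis using winding_homotopic[OF assms(1)] by (simp add: twisted_action_def)
qed

lemma twisted_action_join:
  assumes g: "loop p g" and h: "loop p h" and m: "m \<in> M"
  shows "twisted_action (g +++ h) m s = twisted_action h (twisted_action g m) s"
proof -
  have "winding_number (g +++ h) 0 = winding_number g 0 + winding_number h 0"
    by (rule winding_number_join) (use g h A in auto)
  moreover have "monodromy (g +++ h) (m s) = monodromy h (monodromy g (m s))"
    by (rule monodromy_join[OF continuable_M[OF m]]) (use g h in auto)
  ultimately show ?thesis
    unfolding twisted_action_def mono_Adj_scale[OF h mono_Adj[OF g M_Adj[OF m]]]
    by (simp add: distrib_left exp_add mult.assoc[symmetric])
qed

lemma E_M_join:
  assumes g: "loop p g" and h: "loop p h" and m: "m \<in> M"
  shows "E (g +++ h) s (m s) = E g s (m s) + E h s (twisted_action g m s)"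
  using E_join[OF continuable_M[OF m] g h] by (simp add: twisted_action_def)

lemma loop_inverse_trivial:
  assumes g: "loop p g" and f: "continuable A p f"
  shows "monodromy (reversepath g +++ g) f = f"
proof -
  have "monodromy (reversepath g +++ g) f = monodromy g (monodromy (reversepath g) f)"
    by (rule monodromy_join[OF f]) (use g in auto)
  then show ?thesis using mono_reverse(1)[OF f g] by simp
qed

subsection \<open>Reduction to the two generators\<close>

text \<open>For boundary and integral, \<open>g\<close> with any coefficient can be traded for the
  two generators, as the augmentation ideal is generated by \<open>\<sigma>0 - 1\<close> and
  \<open>\<sigma>c - 1\<close>. Only these two quantities are recorded: they are what enters the
  cycle equation and the gamma function.\<close>

definition good :: "(real \<Rightarrow> complex) \<Rightarrow> bool" where
  "good g \<longleftrightarrow> (\<forall>m\<in>M. \<exists>m0\<in>M. \<exists>mc\<in>M.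
     (\<forall>s. twisted_action g m s - m s =
        (twisted_action \<sigma>0 m0 s - m0 s) + (twisted_action \<sigma>c mc s - mc s)) \<and>
     (\<forall>s. E g s (m s) = E \<sigma>0 s (m0 s) + E \<sigma>c s (mc s)))"

text \<open>The reversed loop with coefficient \<open>m\<close> has the opposite boundary and
  integral of \<open>g\<close> with the coefficient moved by the reversed loop, because the product
  of the two loops acts trivially.\<close>

lemma good_reverse:
  assumes gd: "good g" and g: "loop p g" shows "good (reversepath g)"
  unfolding good_def
proof
  fix m assume m: "m \<in> M"
  let ?r = "reversepath g"
  have r: "loop p ?r" using g by simp
  have rm: "twisted_action ?r m \<in> M" by (rule twisted_action_M[OF m r])
  obtain m0 mc where h: "m0 \<in> M" "mc \<in> M"
    "\<forall>s. twisted_action g (twisted_action ?r m) s - twisted_action ?r m s =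
        (twisted_action \<sigma>0 m0 s - m0 s) + (twisted_action \<sigma>c mc s - mc s)"
    "\<forall>s. E g s (twisted_action ?r m s) = E \<sigma>0 s (m0 s) + E \<sigma>c s (mc s)"
    using gd rm unfolding good_def by blast
  have rg: "loop p (?r +++ g)" using r g by (auto simp: path_image_join)
  have "winding_number (?r +++ g) 0 = winding_number ?r 0 + winding_number g 0"
    by (rule winding_number_join) (use g A in auto)
  also have "winding_number ?r 0 = - winding_number g 0"
    by (rule winding_number_reversepath) (use g A in auto)
  finally have w0: "winding_number (?r +++ g) 0 = 0" by simp
  have inv: "twisted_action g (twisted_action ?r m) s = m s" for s
    using twisted_action_join[OF r g m] loop_inverse_trivial[OF g continuable_M[OF m]] w0
    by (simp add: twisted_action_def)
  have "E (?r +++ g) s (m s) = 0" for s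
    by (rule E_trivial[OF continuable_M[OF m] rg loop_inverse_trivial[OF g]])
  then have Er: "E ?r s (m s) = - E g s (twisted_action ?r m s)" for s
    using E_M_join[OF r g m, of s] by (simp add: eq_neg_iff_add_eq_0)
  have neg: "(\<lambda>s. 0 - m0 s) \<in> M" "(\<lambda>s. 0 - mc s) \<in> M" using M_diff[OF M_0] h by auto
  have tw0: "twisted_action g (\<lambda>s. 0) s = 0" if "loop p g" for g s
    using that mono_0 by (simp add: twisted_action_def)
  have Eneg: "E g s (0 - f) = - E g s f" if "loop p g" "continuable A p f" for g s f
    using E_diff[OF continuable_0 that(2,1)] E_0[OF that(1)] by simp
  show "\<exists>m0\<in>M. \<exists>mc\<in>M.
     (\<forall>s. twisted_action ?r m s - m s = (twisted_action \<sigma>0 m0 s - m0 s) + (twisted_action \<sigma>c mc s - mc s)) \<and>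
     (\<forall>s. E ?r s (m s) = E \<sigma>0 s (m0 s) + E \<sigma>c s (mc s))"
  proof (rule bexI[OF _ neg(1)], rule bexI[OF _ neg(2)], intro conjI allI)
    fix s
    show "twisted_action ?r m s - m s = (twisted_action \<sigma>0 (\<lambda>s. 0 - m0 s) s - (0 - m0 s)) +
        (twisted_action \<sigma>c (\<lambda>s. 0 - mc s) s - (0 - mc s))"
      unfolding twisted_action_diff[OF M_0 h(1) loop_\<sigma>0] twisted_action_diff[OF M_0 h(2) loop_\<sigma>c]
        tw0[OF loop_\<sigma>0] tw0[OF loop_\<sigma>c]
      using h(3)[rule_format, of s] unfolding inv by (simp add: algebra_simps)
    show "E ?r s (m s) = E \<sigma>0 s (0 - m0 s) + E \<sigma>c s (0 - mc s)"
      unfolding Er h(4)[rule_format] Eneg[OF loop_\<sigma>0 continuable_M[OF h(1)]] Eneg[OF loop_\<sigma>c continuable_M[OF h(2)]] by simp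
  qed
qed

text \<open>Boundary and integral behave like crossed homomorphisms: the second loop contributes
  with the coefficient already moved by \<open>g\<close>.\<close>

lemma good_join:
  assumes gd: "good g" "good k" and g: "loop p g" and k: "loop p k" shows "good (g +++ k)"
  unfolding good_def
proof
  fix m assume m: "m \<in> M"
  have gm: "twisted_action g m \<in> M" by (rule twisted_action_M[OF m g])
  obtain a0 ac where a: "a0 \<in> M" "ac \<in> M"
    "\<forall>s. twisted_action g m s - m s = (twisted_action \<sigma>0 a0 s - a0 s) + (twisted_action \<sigma>c ac s - ac s)"
    "\<forall>s. E g s (m s) = E \<sigma>0 s (a0 s) + E \<sigma>c s (ac s)"
    using gd(1) m unfolding good_def by blast
  obtain b0 bc where b: "b0 \<in> M" "bc \<in> M"
    "\<forall>s. twisted_action k (twisted_action g m) s - twisted_action g m s =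
        (twisted_action \<sigma>0 b0 s - b0 s) + (twisted_action \<sigma>c bc s - bc s)"
    "\<forall>s. E k s (twisted_action g m s) = E \<sigma>0 s (b0 s) + E \<sigma>c s (bc s)"
    using gd(2) gm unfolding good_def by blast
  show "\<exists>m0\<in>M. \<exists>mc\<in>M.
     (\<forall>s. twisted_action (g +++ k) m s - m s = (twisted_action \<sigma>0 m0 s - m0 s) + (twisted_action \<sigma>c mc s - mc s)) \<and>
     (\<forall>s. E (g +++ k) s (m s) = E \<sigma>0 s (m0 s) + E \<sigma>c s (mc s))"
  proof (rule bexI[OF _ M_add[OF a(1) b(1)]], rule bexI[OF _ M_add[OF a(2) b(2)]], intro conjI allI)
    fix s
    show "twisted_action (g +++ k) m s - m s = (twisted_action \<sigma>0 (\<lambda>s. a0 s + b0 s) s - (a0 s + b0 s)) +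
        (twisted_action \<sigma>c (\<lambda>s. ac s + bc s) s - (ac s + bc s))"
      unfolding twisted_action_join[OF g k m] twisted_action_add[OF a(1) b(1) loop_\<sigma>0] twisted_action_add[OF a(2) b(2) loop_\<sigma>c]
      using a(3)[rule_format, of s] b(3)[rule_format, of s] by (simp add: algebra_simps)
    show "E (g +++ k) s (m s) = E \<sigma>0 s (a0 s + b0 s) + E \<sigma>c s (ac s + bc s)"
      unfolding E_M_join[OF g k m] a(4)[rule_format] b(4)[rule_format]
        E_add[OF continuable_M[OF a(1)] continuable_M[OF b(1)] loop_\<sigma>0]
        E_add[OF continuable_M[OF a(2)] continuable_M[OF b(2)] loop_\<sigma>c] by simp
  qed
qed

lemma good_subgroup: "loop_subgroup V p good"
proof
  fix g h assume gd: "good g" and hom: "homotopic_paths V g h" and g: "pathstart g = p" "pathfinish g = p"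
  have "twisted_action h m s = twisted_action g m s" "E h s (m s) = E g s (m s)" if "m \<in> M" for m s
    using twisted_action_homotopic[OF hom g(1) that] E_homotopic[OF hom g(1) continuable_M[OF that]] by simp_all
  then show "good h" using gd unfolding good_def by simp
next
  fix g assume "good g" "path g" "path_image g \<subseteq> V" "pathstart g = p" "pathfinish g = p"
  then show "good (reversepath g)" using good_reverse loopI by blast
next
  fix g h assume "good g" "good h" "path g" "path_image g \<subseteq> V" "pathstart g = p" "pathfinish g = p"
    "path h" "path_image h \<subseteq> V" "pathstart h = p" "pathfinish h = p"
  then show "good (g +++ h)" using good_join loopI by blast
qed

lemma good_\<sigma>0: "good \<sigma>0"
  unfolding good_def
proof
  fix m assume m: "m \<in> M"
  show "\<exists>m0\<in>M. \<exists>mc\<in>M.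
     (\<forall>s. twisted_action \<sigma>0 m s - m s = (twisted_action \<sigma>0 m0 s - m0 s) + (twisted_action \<sigma>c mc s - mc s)) \<and>
     (\<forall>s. E \<sigma>0 s (m s) = E \<sigma>0 s (m0 s) + E \<sigma>c s (mc s))"
    by (rule bexI[OF _ m], rule bexI[OF _ M_0]) (simp add: twisted_action_\<sigma>c mono_0[OF loop_\<sigma>c] E_0[OF loop_\<sigma>c])
qed

lemma good_\<sigma>c: "good \<sigma>c"
  unfolding good_def
proof
  fix m assume m: "m \<in> M"
  show "\<exists>m0\<in>M. \<exists>mc\<in>M.
     (\<forall>s. twisted_action \<sigma>c m s - m s = (twisted_action \<sigma>0 m0 s - m0 s) + (twisted_action \<sigma>c mc s - mc s)) \<and>
     (\<forall>s. E \<sigma>c s (m s) = E \<sigma>0 s (m0 s) + E \<sigma>c s (mc s))"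
    by (rule bexI[OF _ M_0], rule bexI[OF _ m]) (simp add: twisted_action_\<sigma>0 mono_0[OF loop_\<sigma>0] E_0[OF loop_\<sigma>0])
qed

lemma good_loop: "path g \<Longrightarrow> path_image g \<subseteq> V \<Longrightarrow> pathstart g = p \<Longrightarrow> pathfinish g = p \<Longrightarrow> good g"
  by (rule generation[OF good_subgroup good_\<sigma>0 good_\<sigma>c])

subsection \<open>Chains\<close>

abbreviation "loops \<equiv> based_loops V p"
abbreviation "based_chains \<equiv> chains1 V p M"

lemma loops: assumes "g \<in> loops" shows "valid_path g" "loop p g"
  using assms V unfolding based_loops_def by (auto dest: valid_path_imp_path)

text \<open>Common form of the integral \<open>gam\<close> and the boundary \<open>bd\<close>. The
  support of a sum of chains can be smaller than the union of the supports, so additivity is proved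
  by summing over a common finite superset.\<close>

definition chain_eval :: "((real \<Rightarrow> complex) \<Rightarrow> (complex \<Rightarrow> complex fps) \<Rightarrow> 'b) \<Rightarrow> chain \<Rightarrow> 'b::ab_group_add" where
  "chain_eval F x = (\<Sum>\<sigma>\<in>chain_support x. F \<sigma> (x \<sigma>))"

lemma chains_M: "x \<in> based_chains \<Longrightarrow> x \<sigma> \<in> M"
  unfolding chains1_def by blast

lemma plus_fun_eta: "(m + m' :: complex \<Rightarrow> complex fps) = (\<lambda>s. m s + m' s)"
  by (simp add: fun_eq_iff)

lemma minus_fun_eta: "(m - m' :: complex \<Rightarrow> complex fps) = (\<lambda>s. m s - m' s)"
  by (simp add: fun_eq_iff)

lemma chain_support_add: "chain_support (x + y) \<subseteq> chain_support x \<union> chain_support y"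
  unfolding chain_support_def by auto

lemma chain_support_diff: "chain_support (x - y) \<subseteq> chain_support x \<union> chain_support y"
  unfolding chain_support_def by auto

lemma chains_add: "x \<in> based_chains \<Longrightarrow> y \<in> based_chains \<Longrightarrow> x + y \<in> based_chains"
  using chain_support_add[of x y] unfolding chains1_def
  by (auto simp: plus_fun_eta image_subset_iff intro!: M_add elim: finite_subset)

lemma chains_diff: "x \<in> based_chains \<Longrightarrow> y \<in> based_chains \<Longrightarrow> x - y \<in> based_chains"
  using chain_support_diff[of x y] unfolding chains1_def
  by (auto simp: minus_fun_eta image_subset_iff intro!: M_diff elim: finite_subset)

lemma chains_single: "\<sigma> \<in> loops \<Longrightarrow> m \<in> M \<Longrightarrow> single \<sigma> m \<in> based_chains"
  using M_0 unfolding chains1_def chain_support_def single_def zero_fun_def by auto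

context
  fixes F :: "(real \<Rightarrow> complex) \<Rightarrow> (complex \<Rightarrow> complex fps) \<Rightarrow> 'b::ab_group_add"
  assumes F_diff: "\<And>\<sigma> m m'. \<sigma> \<in> loops \<Longrightarrow> m \<in> M \<Longrightarrow> m' \<in> M \<Longrightarrow> F \<sigma> (\<lambda>s. m s - m' s) = F \<sigma> m - F \<sigma> m'"
begin

lemma F_0: "\<sigma> \<in> loops \<Longrightarrow> F \<sigma> 0 = 0"
  using F_diff[OF _ M_0 M_0] by (simp add: zero_fun_def)

lemma F_add: assumes "\<sigma> \<in> loops" "m \<in> M" "m' \<in> M" shows "F \<sigma> (\<lambda>s. m s + m' s) = F \<sigma> m + F \<sigma> m'"
  using F_diff[OF assms(1) M_add[OF assms(2,3)] assms(3)] by simp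

lemma chain_eval_superset:
  assumes "x \<in> based_chains" "finite B" "chain_support x \<subseteq> B" "B \<subseteq> loops"
  shows "chain_eval F x = (\<Sum>\<sigma>\<in>B. F \<sigma> (x \<sigma>))"
  unfolding chain_eval_def
proof (rule sum.mono_neutral_left[OF assms(2,3)], rule ballI)
  fix \<sigma> assume "\<sigma> \<in> B - chain_support x"
  then have "\<sigma> \<in> loops" "x \<sigma> = 0" using assms(4) by (auto simp: chain_support_def)
  then show "F \<sigma> (x \<sigma>) = 0" by (simp add: F_0)
qed

lemma chain_eval_comb:
  assumes x: "x \<in> based_chains" and y: "y \<in> based_chains"
  shows "chain_eval F (x + y) = chain_eval F x + chain_eval F y"
    and "chain_eval F (x - y) = chain_eval F x - chain_eval F y"
proof -
  let ?B = "chain_support x \<union> chain_support y"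
  have B: "finite ?B" "?B \<subseteq> loops" using x y unfolding chains1_def by auto
  note sup = chain_eval_superset[OF _ B(1) _ B(2)]
  have "F \<sigma> ((x + y) \<sigma>) = F \<sigma> (x \<sigma>) + F \<sigma> (y \<sigma>)" "F \<sigma> ((x - y) \<sigma>) = F \<sigma> (x \<sigma>) - F \<sigma> (y \<sigma>)" if "\<sigma> \<in> ?B" for \<sigma>
  proof -
    have "\<sigma> \<in> loops" using that B(2) by blast
    then show "F \<sigma> ((x + y) \<sigma>) = F \<sigma> (x \<sigma>) + F \<sigma> (y \<sigma>)" "F \<sigma> ((x - y) \<sigma>) = F \<sigma> (x \<sigma>) - F \<sigma> (y \<sigma>)"
      using F_add[OF _ chains_M[OF x] chains_M[OF y]] F_diff[OF _ chains_M[OF x] chains_M[OF y]]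
      by (simp_all add: plus_fun_eta minus_fun_eta)
  qed
  then show "chain_eval F (x + y) = chain_eval F x + chain_eval F y" "chain_eval F (x - y) = chain_eval F x - chain_eval F y"
    using sup[OF chains_add[OF x y] chain_support_add] sup[OF chains_diff[OF x y] chain_support_diff] sup[OF x] sup[OF y]
    by (simp_all add: sum.distrib sum_subtractf)
qed

lemma chain_eval_single:
  assumes "\<sigma> \<in> loops" "m \<in> M" shows "chain_eval F (single \<sigma> m) = F \<sigma> m"
proof -
  have "chain_support (single \<sigma> m) \<subseteq> {\<sigma>}" unfolding chain_support_def single_def by auto
  from chain_eval_superset[OF chains_single[OF assms] _ this] assms(1) show ?thesis by (simp add: single_def)
qed

end

lemma E_M_diff: "\<sigma> \<in> loops \<Longrightarrow> m \<in> M \<Longrightarrow> m' \<in> M \<Longrightarrow> E \<sigma> s (m s - m' s) = E \<sigma> s (m s) - E \<sigma> s (m' s)"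
  by (rule E_diff[OF continuable_M continuable_M loops(2)])

lemma bd_M_diff: "\<sigma> \<in> loops \<Longrightarrow> m \<in> M \<Longrightarrow> m' \<in> M \<Longrightarrow> twisted_action \<sigma> (\<lambda>s. m s - m' s) s - (m s - m' s) =
    (twisted_action \<sigma> m s - m s) - (twisted_action \<sigma> m' s - m' s)"
  by (simp add: twisted_action_diff[OF _ _ loops(2)])

abbreviation "gam s \<equiv> chain_eval (\<lambda>\<sigma> m. E \<sigma> s (m s))"
abbreviation "bd s \<equiv> chain_eval (\<lambda>\<sigma> m. twisted_action \<sigma> m s - m s)"

lemma gam_comb:
  assumes "x \<in> based_chains" "y \<in> based_chains"
  shows "gam s (x + y) = gam s x + gam s y" "gam s (x - y) = gam s x - gam s y"
  by (rule chain_eval_comb[OF _ assms], rule E_M_diff, assumption+)+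

lemma bd_comb:
  assumes "x \<in> based_chains" "y \<in> based_chains"
  shows "bd s (x + y) = bd s x + bd s y" "bd s (x - y) = bd s x - bd s y"
  by (rule chain_eval_comb[OF _ assms], rule bd_M_diff, assumption+)+

lemma gam_single: "\<sigma> \<in> loops \<Longrightarrow> m \<in> M \<Longrightarrow> gam s (single \<sigma> m) = E \<sigma> s (m s)"
  by (rule chain_eval_single, rule E_M_diff)

lemma bd_single: "\<sigma> \<in> loops \<Longrightarrow> m \<in> M \<Longrightarrow> bd s (single \<sigma> m) = twisted_action \<sigma> m s - m s"
  by (rule chain_eval_single, rule bd_M_diff)

lemma gamma_chain_eq: assumes x: "x \<in> based_chains" shows "gamma_chain p l x s = gam s x"
  unfolding gamma_chain_def chain_eval_def
proof (rule sum.cong[OF refl])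
  fix \<sigma> assume "\<sigma> \<in> chain_support x"
  then have "\<sigma> \<in> loops" using x unfolding chains1_def by blast
  then show "germ_integral \<sigma> (x \<sigma> s * pw (s - 1)) = E \<sigma> s (x \<sigma> s)"
    by (intro germ_integral_E loops continuable_M chains_M x)
qed

lemma cycles_iff: "x \<in> cycles1 V p M \<longleftrightarrow> x \<in> based_chains \<and> (\<forall>s. bd s x = 0)"
proof -
  have "(\<Sum>\<sigma>\<in>chain_support x. twisted_action \<sigma> (x \<sigma>) - x \<sigma>) = 0 \<longleftrightarrow> (\<forall>s. bd s x = 0)"
    by (simp add: fun_eq_iff sum_fun_apply chain_eval_def)
  then show ?thesis unfolding cycles1_def by simp
qed

text \<open>Homotopic loops have equal integrals, and the bar relation is the product rule
  \<open>E_M_join\<close>. So the gamma function depends on the class alone, whichever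
  representative is chosen.\<close>

lemma boundaries: "x \<in> boundaries1 V p M \<Longrightarrow> x \<in> based_chains \<and> (\<forall>s. gam s x = 0)"
proof (induction rule: boundaries1.induct)
  case (homotopy \<sigma> \<tau> m)
  have E0: "E \<sigma> s (m s) = E \<tau> s (m s)" for s
    by (rule E_homotopic[OF homotopy(3) _ continuable_M[OF homotopy(4)]]) (use loops(2)[OF homotopy(1)] in simp)
  note c = chains_single[OF homotopy(1,4)] chains_single[OF homotopy(2,4)]
  have "gam s (single \<sigma> m - single \<tau> m) = 0" for s
    unfolding gam_comb(2)[OF c] gam_single[OF homotopy(1,4)] gam_single[OF homotopy(2,4)] by (simp add: E0)
  then show ?case using chains_diff[OF c] by blast
next
  case (bar \<sigma> \<tau> m)
  have tm: "twisted_action \<sigma> m \<in> M" by (rule twisted_action_M[OF bar(3) loops(2)[OF bar(1)]])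
  have j: "\<sigma> +++ \<tau> \<in> loops"
    using bar(1,2) unfolding based_loops_def by (auto simp: path_image_join intro: valid_path_join)
  note c = chains_single[OF bar(1,3)] chains_single[OF bar(2) tm] chains_single[OF j bar(3)]
  have "gam s (single \<sigma> m + single \<tau> (twisted_action \<sigma> m) - single (\<sigma> +++ \<tau>) m) = 0" for s
    unfolding gam_comb(2)[OF chains_add[OF c(1,2)] c(3)] gam_comb(1)[OF c(1,2)]
      gam_single[OF bar(1,3)] gam_single[OF bar(2) tm] gam_single[OF j bar(3)]
      E_M_join[OF loops(2)[OF bar(1)] loops(2)[OF bar(2)] bar(3)] by simp
  then show ?case using chains_diff[OF chains_add[OF c(1,2)] c(3)] by blast
next
  case zero
  show ?case using M_0 unfolding chains1_def chain_support_def chain_eval_def zero_fun_def by auto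
next
  case (diff x y)
  have xy: "x \<in> based_chains" "y \<in> based_chains" using diff by blast+
  have "gam s (x - y) = 0" for s unfolding gam_comb(2)[OF xy] using diff by simp
  then show ?case using chains_diff[OF xy] by blast
qed

lemma gamma_function_class:
  assumes x: "x \<in> cycles1 V p M"
  shows "gamma_function p l ((+) x ` boundaries1 V p M) = (\<lambda>s. gam s x)"
proof -
  have "x + 0 \<in> (+) x ` boundaries1 V p M" using boundaries1.zero by blast
  from someI[of "\<lambda>y. y \<in> (+) x ` boundaries1 V p M", OF this]
  have "(SOME y. y \<in> (+) x ` boundaries1 V p M) \<in> (+) x ` boundaries1 V p M" .
  then obtain b where b: "b \<in> boundaries1 V p M" "(SOME y. y \<in> (+) x ` boundaries1 V p M) = x + b" by blast
  have c: "x \<in> based_chains" "b \<in> based_chains" using x b(1) boundaries cycles_iff by blast+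
  have "gamma_chain p l (x + b) s = gam s x" for s
    using gamma_chain_eq[OF chains_add[OF c]] gam_comb(1)[OF c] boundaries[OF b(1)] by simp
  then show ?thesis unfolding gamma_function_def b(2) by blast
qed

lemma cycle_reduce:
  assumes x: "x \<in> cycles1 V p M"
  shows "\<exists>m0\<in>M. \<exists>mc\<in>M. (\<forall>s. (twisted_action \<sigma>0 m0 s - m0 s) + (twisted_action \<sigma>c mc s - mc s) = 0) \<and>
     (\<forall>s. gam s x = E \<sigma>0 s (m0 s) + E \<sigma>c s (mc s))"
proof -
  have xc: "x \<in> based_chains" and bd0: "\<And>s. bd s x = 0" using x by (auto simp: cycles_iff)
  define N where "N = chain_support x"
  have N: "\<sigma> \<in> loops" if "\<sigma> \<in> N" for \<sigma> using xc that unfolding chains1_def N_def by blast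
  have "\<forall>\<sigma>\<in>N. \<exists>m0 mc. m0 \<in> M \<and> mc \<in> M \<and>
    (\<forall>s. twisted_action \<sigma> (x \<sigma>) s - x \<sigma> s = (twisted_action \<sigma>0 m0 s - m0 s) + (twisted_action \<sigma>c mc s - mc s)) \<and>
    (\<forall>s. E \<sigma> s (x \<sigma> s) = E \<sigma>0 s (m0 s) + E \<sigma>c s (mc s))"
  proof
    fix \<sigma> assume "\<sigma> \<in> N"
    then have "good \<sigma>" using N unfolding based_loops_def by (auto intro!: good_loop valid_path_imp_path)
    then show "\<exists>m0 mc. m0 \<in> M \<and> mc \<in> M \<and>
      (\<forall>s. twisted_action \<sigma> (x \<sigma>) s - x \<sigma> s = (twisted_action \<sigma>0 m0 s - m0 s) + (twisted_action \<sigma>c mc s - mc s)) \<and>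
      (\<forall>s. E \<sigma> s (x \<sigma> s) = E \<sigma>0 s (m0 s) + E \<sigma>c s (mc s))"
      using chains_M[OF xc, of \<sigma>] unfolding good_def by blast
  qed
  then obtain a0 where "\<forall>\<sigma>\<in>N. \<exists>mc. a0 \<sigma> \<in> M \<and> mc \<in> M \<and>
    (\<forall>s. twisted_action \<sigma> (x \<sigma>) s - x \<sigma> s = (twisted_action \<sigma>0 (a0 \<sigma>) s - a0 \<sigma> s) + (twisted_action \<sigma>c mc s - mc s)) \<and>
    (\<forall>s. E \<sigma> s (x \<sigma> s) = E \<sigma>0 s (a0 \<sigma> s) + E \<sigma>c s (mc s))"
    unfolding bchoice_iff by blast
  then obtain ac where a: "\<forall>\<sigma>\<in>N. a0 \<sigma> \<in> M \<and> ac \<sigma> \<in> M \<and>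
    (\<forall>s. twisted_action \<sigma> (x \<sigma>) s - x \<sigma> s = (twisted_action \<sigma>0 (a0 \<sigma>) s - a0 \<sigma> s) + (twisted_action \<sigma>c (ac \<sigma>) s - ac \<sigma> s)) \<and>
    (\<forall>s. E \<sigma> s (x \<sigma> s) = E \<sigma>0 s (a0 \<sigma> s) + E \<sigma>c s (ac \<sigma> s))"
    unfolding bchoice_iff by blast
  have aM: "a0 \<sigma> \<in> M" "ac \<sigma> \<in> M" if "\<sigma> \<in> N" for \<sigma> using a that by blast+
  let ?m0 = "\<lambda>s. \<Sum>\<sigma>\<in>N. a0 \<sigma> s" and ?mc = "\<lambda>s. \<Sum>\<sigma>\<in>N. ac \<sigma> s"
  have tw: "twisted_action \<sigma>0 ?m0 s = (\<Sum>\<sigma>\<in>N. twisted_action \<sigma>0 (a0 \<sigma>) s)"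
     "twisted_action \<sigma>c ?mc s = (\<Sum>\<sigma>\<in>N. twisted_action \<sigma>c (ac \<sigma>) s)" for s
    unfolding twisted_action_def
    by (simp_all add: mono_Adj_sum[OF loop_\<sigma>0 M_Adj[OF aM(1)]] mono_Adj_sum[OF loop_\<sigma>c M_Adj[OF aM(2)]] sum_distrib_left)
  have Esum: "E g s (\<Sum>\<sigma>\<in>N'. h \<sigma>) = (\<Sum>\<sigma>\<in>N'. E g s (h \<sigma>))"
    if "loop p g" "\<And>\<sigma>. \<sigma> \<in> N' \<Longrightarrow> continuable A p (h \<sigma>)" for g s h and N' :: "(real \<Rightarrow> complex) set"
    using that(2)
  proof (induction N' rule: infinite_finite_induct)
    case (insert y N')
    then show ?case using E_add[OF _ continuable_sum that(1), of "h y" N' h s] by simp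
  qed (simp_all add: E_0[OF that(1)])
  have MM: "?m0 \<in> M" "?mc \<in> M" using aM by (auto intro!: M_sum)
  show ?thesis
  proof (rule bexI[OF _ MM(1)], rule bexI[OF _ MM(2)], intro conjI allI)
    fix s
    have "(twisted_action \<sigma>0 ?m0 s - ?m0 s) + (twisted_action \<sigma>c ?mc s - ?mc s) =
      (\<Sum>\<sigma>\<in>N. (twisted_action \<sigma>0 (a0 \<sigma>) s - a0 \<sigma> s) + (twisted_action \<sigma>c (ac \<sigma>) s - ac \<sigma> s))"
      unfolding tw by (simp add: sum.distrib sum_subtractf)
    also have "\<dots> = bd s x" unfolding chain_eval_def N_def[symmetric] by (rule sum.cong[OF refl]) (use a in simp)
    finally show "(twisted_action \<sigma>0 ?m0 s - ?m0 s) + (twisted_action \<sigma>c ?mc s - ?mc s) = 0" by (simp add: bd0)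
    have "gam s x = (\<Sum>\<sigma>\<in>N. E \<sigma>0 s (a0 \<sigma> s) + E \<sigma>c s (ac \<sigma> s))"
      unfolding chain_eval_def N_def[symmetric] by (rule sum.cong[OF refl]) (use a in simp)
    then show "gam s x = E \<sigma>0 s (?m0 s) + E \<sigma>c s (?mc s)"
      using Esum[OF loop_\<sigma>0, of N "\<lambda>\<sigma>. a0 \<sigma> s"] Esum[OF loop_\<sigma>c, of N "\<lambda>\<sigma>. ac \<sigma> s"] continuable_M aM
      by (simp add: sum.distrib)
  qed
qed

end

context reflection_setting
begin

subsection \<open>Polynomials annihilating the image of the variation\<close>

definition pact :: "complex poly \<Rightarrow> complex fps \<Rightarrow> complex fps" where
  "pact P f = (\<Sum>i\<le>degree P. fps_const (coeff P i) * (s0 ^^ i) f)"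

lemma pact_eq: "degree P \<le> n \<Longrightarrow> pact P f = (\<Sum>i\<le>n. fps_const (coeff P i) * (s0 ^^ i) f)"
  unfolding pact_def by (rule sum.mono_neutral_left) (auto simp: coeff_eq_0)

lemma s0_pow_AK: "f \<in> AK \<Longrightarrow> (s0 ^^ i) f \<in> AK"
  by (induction i) (simp_all add: AK_monodromy loop_\<sigma>0)

lemma s0_pow_Adj: "f \<in> Adjp \<Longrightarrow> (s0 ^^ i) f \<in> Adjp"
  by (induction i) (simp_all add: mono_Adj loop_\<sigma>0)

lemma s0_pow_scale: "f \<in> Adjp \<Longrightarrow> (s0 ^^ i) (fps_const c * f) = fps_const c * (s0 ^^ i) f"
  by (induction i) (simp_all add: mono_Adj_scale[OF loop_\<sigma>0] s0_pow_Adj)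

lemma s0_pow_sum:
  "(\<And>j. j \<in> N \<Longrightarrow> f j \<in> Adjp) \<Longrightarrow> (s0 ^^ i) (\<Sum>j\<in>N. f j) = (\<Sum>j\<in>N. (s0 ^^ i) (f j))"
  by (induction i) (simp_all add: mono_Adj_sum[OF loop_\<sigma>0] s0_pow_Adj)

lemma s0_pow_0: "(s0 ^^ i) 0 = 0"
  by (induction i) (simp_all add: mono_0[OF loop_\<sigma>0])

lemma pact_diff: "pact (P - Q) f = pact P f - pact Q f"
proof -
  define n where "n = max (degree P) (degree Q)"
  have "degree P \<le> n" "degree Q \<le> n" "degree (P - Q) \<le> n"
    using degree_diff_le[of P n Q] by (auto simp: n_def)
  then show ?thesis by (simp add: pact_eq[of _ n] sum_subtractf[symmetric] left_diff_distrib flip: fps_const_sub)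
qed

lemma pact_monom_mult:
  assumes f: "f \<in> Adjp" shows "pact (monom a k * P) f = fps_const a * (s0 ^^ k) (pact P f)"
proof -
  have "degree (monom a k * P) \<le> k + degree P"
    by (rule order_trans[OF degree_mult_le]) (simp add: degree_monom_le)
  then have "pact (monom a k * P) f = (\<Sum>i\<le>k + degree P. fps_const (coeff (monom a k * P) i) * (s0 ^^ i) f)"
    by (rule pact_eq)
  also have "\<dots> = (\<Sum>i\<in>{k..k + degree P}. fps_const (a * coeff P (i - k)) * (s0 ^^ i) f)"
    by (rule sum.mono_neutral_cong_right) (auto simp: coeff_monom_mult)
  also have "\<dots> = (\<Sum>j\<le>degree P. fps_const (a * coeff P j) * (s0 ^^ (k + j)) f)"
    by (rule sum.reindex_bij_witness[of _ "\<lambda>j. k + j" "\<lambda>i. i - k"]) auto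
  also have "\<dots> = (\<Sum>j\<le>degree P. fps_const a * (s0 ^^ k) (fps_const (coeff P j) * (s0 ^^ j) f))"
    by (intro sum.cong refl)
       (simp only: s0_pow_scale[OF s0_pow_Adj[OF f]] funpow_add comp_apply fps_const_mult[symmetric] mult.assoc)
  also have "\<dots> = fps_const a * (s0 ^^ k) (pact P f)"
    unfolding pact_def s0_pow_sum[OF Adj_scale[OF s0_pow_Adj[OF f]]] sum_distrib_left ..
  finally show ?thesis .
qed

abbreviation K_poly :: "complex poly \<Rightarrow> bool" where "K_poly P \<equiv> \<forall>i. coeff P i \<in> K"

text \<open>The image of the variation is the line through \<open>eps\<close>, and a polynomial in
  the monodromy acts linearly on it.\<close>

lemma annihilates_iff: "annihilates P \<sigma>0 (variation_image \<sigma>c Adjp) \<longleftrightarrow> pact P eps = 0"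
proof -
  have "pact P (germ_scale k eps) = germ_scale k (pact P eps)" for k
    unfolding pact_def s0_pow_scale[OF AK_Adj[OF eps_AK]] sum_distrib_left by (simp only: mult.left_commute)
  then have "annihilates P \<sigma>0 (variation_image \<sigma>c Adjp) \<longleftrightarrow> (\<forall>k. germ_scale k (pact P eps) = 0)"
    unfolding annihilates_def variation_image_adj pact_def[symmetric] by simp
  also have "\<dots> \<longleftrightarrow> pact P eps = 0" by (metis fps_const_1_eq_1 mult_1 mult_zero_right)
  finally show ?thesis .
qed

end

locale minimal_setting = reflection_setting +
  fixes R :: "complex poly"
  assumes R_min: "minimal_annihilator K \<sigma>0 (variation_image \<sigma>c (Sol_adj r q p)) R"
begin

lemma R: "R \<noteq> 0" "K_poly R" "pact R eps = 0"
    "\<And>P. P \<noteq> 0 \<Longrightarrow> K_poly P \<Longrightarrow> pact P eps = 0 \<Longrightarrow> degree R \<le> degree P"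
  using R_min unfolding minimal_annihilator_def is_arg_min_def annihilates_iff by (auto simp: not_less)

text \<open>The polynomials over \<open>K\<close> that kill \<open>eps\<close> form an ideal of
  \<open>K[T]\<close>, which an element of least degree generates. Leading terms are cancelled one
  at a time, so that all coefficients stay in \<open>K\<close>.\<close>

lemma minimal_dvd:
  assumes "K_poly F" "pact F eps = 0" shows "\<exists>Q. K_poly Q \<and> F = R * Q"
  using assms
proof (induction "degree F" arbitrary: F rule: less_induct)
  case less
  show ?case
  proof (cases "F = 0")
    case True then show ?thesis using K_closed(1) by (intro exI[of _ 0]) simp
  next
    case False
    have d: "degree R \<le> degree F" using R(4)[OF False less(2,3)] .
    define a where "a = lead_coeff F / lead_coeff R"
    define k where "k = degree F - degree R"
    have a: "a \<noteq> 0" "a \<in> K" using False R(1,2) less(2) K_closed by (auto simp: a_def)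
    define F' where "F' = F - monom a k * R"
    have KF': "K_poly F'" unfolding F'_def using less(2) R(2) a(2) K_closed by (simp add: coeff_monom_mult)
    have pF': "pact F' eps = 0"
      unfolding F'_def pact_diff pact_monom_mult[OF AK_Adj[OF eps_AK]] less(3) R(3) by (simp add: s0_pow_0)
    have "\<exists>Q. K_poly Q \<and> F' = R * Q"
    proof (cases "F' = 0")
      case True then show ?thesis using K_closed(1) by (intro exI[of _ 0]) simp
    next
      case F': False
      have "degree (monom a k * R) = degree F"
        using a R(1) d by (simp add: degree_mult_eq degree_monom_eq k_def)
      then have le: "degree F' \<le> degree F" unfolding F'_def by (intro degree_diff_le) auto
      have "coeff F' (degree F) = 0"
        unfolding F'_def using d R(1) by (simp add: coeff_monom_mult k_def a_def)
      then have "degree F' \<noteq> degree F" using F' leading_coeff_0_iff[of F'] by metis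
      then have "degree F' < degree F" using le by simp
      then show ?thesis by (rule less(1)[OF _ KF' pF'])
    qed
    then obtain Q where Q: "K_poly Q" "F' = R * Q" by blast
    have "K_poly (Q + monom a k)" using Q(1) a(2) K_closed by (simp add: coeff_monom)
    moreover have "F = R * (Q + monom a k)" using Q(2) unfolding F'_def by (simp add: algebra_simps)
    ultimately show ?thesis by blast
  qed
qed

subsection \<open>The generating cycle\<close>

abbreviation "d \<equiv> degree R"

definition Rv :: "complex \<Rightarrow> complex" where "Rv s = poly R (tt s (- 1))"

text \<open>With \<open>x = tt s (- 1)\<close>, the quotient of \<open>R(T) - R(x)\<close> by
  \<open>T - x\<close> is the sum over \<open>j < d\<close> of \<open>x ^ j\<close> times a
  truncation of \<open>R\<close> with the powers of \<open>T\<close> lowered by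
  \<open>j + 1\<close>. \<open>tail (Suc j)\<close> is this truncation at
  \<open>T = \<sigma>0\<close>, applied to \<open>eps\<close>, and \<open>m0R\<close> is
  \<open>x\<close> times the quotient.\<close>

definition tail :: "nat \<Rightarrow> complex fps" where
  "tail j = (\<Sum>i\<in>{j..d}. fps_const (coeff R i) * (s0 ^^ (i - j)) eps)"

definition m0R :: "complex \<Rightarrow> complex fps" where
  "m0R s = (\<Sum>j<d. fps_const (tt s (- int (Suc j))) * tail (Suc j))"

definition mcR :: "complex \<Rightarrow> complex fps" where "mcR s = fps_const (Rv s) * psi1"

lemma Rv_eq: "Rv s = (\<Sum>j\<le>d. tt s (- int j) * coeff R j)"
  unfolding Rv_def poly_altdef by (intro sum.cong refl) (simp add: tt_minus_power)

lemma Rv_laurent: "Rv \<in> exp_laurent K"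
proof -
  have "Rv = (\<lambda>s. \<Sum>i\<le>d. tt s (0 - int i) * coeff R i)" by (simp add: Rv_eq fun_eq_iff)
  then show ?thesis using exp_laurent_sum[OF K, where c = "coeff R" and d = d and m = 0] R(2) by simp
qed

lemma tail_AK: "tail j \<in> AK"
  unfolding tail_def using R(2) by (intro AK_sum AK_scale s0_pow_AK eps_AK) auto

lemma m0R_M: "m0R \<in> M"
  unfolding m0R_def[abs_def] by (intro M_sum M_single tail_AK)

lemma mcR_M: "mcR \<in> M"
proof -
  have "(\<lambda>s. fps_const (tt s 0) * psi1) \<in> M" by (rule M_single[OF psi1(1)])
  from M_laurent[OF Rv_laurent this] show ?thesis unfolding mcR_def[abs_def] by simp
qed

lemma tail_0: "tail 0 = 0"
  using R(3) by (simp add: tail_def pact_def atLeast0AtMost)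

lemma tail_d: "tail d = fps_const (coeff R d) * eps"
  by (simp add: tail_def)

lemma s0_tail: assumes "j < d" shows "s0 (tail (Suc j)) = tail j - fps_const (coeff R j) * eps"
proof -
  have e: "eps \<in> Adjp" by (rule AK_Adj[OF eps_AK])
  have "s0 (tail (Suc j)) = (\<Sum>i\<in>{Suc j..d}. fps_const (coeff R i) * s0 ((s0 ^^ (i - Suc j)) eps))"
    unfolding tail_def
    by (simp add: mono_Adj_sum[OF loop_\<sigma>0] mono_Adj_scale[OF loop_\<sigma>0] Adj_scale s0_pow_Adj e)
  also have "\<dots> = (\<Sum>i\<in>{Suc j..d}. fps_const (coeff R i) * (s0 ^^ (i - j)) eps)"
  proof (intro sum.cong refl)
    fix i assume "i \<in> {Suc j..d}"
    then have "i - j = Suc (i - Suc j)" by auto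
    then show "fps_const (coeff R i) * s0 ((s0 ^^ (i - Suc j)) eps) = fps_const (coeff R i) * (s0 ^^ (i - j)) eps" by simp
  qed
  also have "\<dots> = tail j - fps_const (coeff R j) * eps"
  proof -
    have "{j..d} = insert j {Suc j..d}" using assms by auto
    then show ?thesis unfolding tail_def by simp
  qed
  finally show ?thesis .
qed

text \<open>By Horner's rule \<open>s0_tail\<close> the sum telescopes to \<open>a 0 - a d\<close>
  minus the lower terms of \<open>R(x) eps\<close>. The term \<open>a d\<close> supplies the leading
  one, and \<open>a 0 = 0\<close> because \<open>R\<close> kills \<open>eps\<close>.\<close>

lemma m0R_equation: "fps_const (tt s 1) * s0 (m0R s) - m0R s = - (fps_const (Rv s) * eps)"
proof -
  define a where "a j = fps_const (tt s (- int j)) * tail j" for j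
  have "s0 (m0R s) = (\<Sum>j<d. fps_const (tt s (- int (Suc j))) * s0 (tail (Suc j)))"
    unfolding m0R_def
    by (simp add: mono_Adj_sum[OF loop_\<sigma>0] mono_Adj_scale[OF loop_\<sigma>0] Adj_scale AK_Adj tail_AK del: of_nat_Suc)
  then have "fps_const (tt s 1) * s0 (m0R s) = (\<Sum>j<d. fps_const (tt s 1 * tt s (- int (Suc j))) * s0 (tail (Suc j)))"
    by (simp only: sum_distrib_left mult.assoc fps_const_mult[symmetric])
  also have "\<dots> = (\<Sum>j<d. a j - fps_const (tt s (- int j) * coeff R j) * eps)"
  proof (intro sum.cong refl)
    fix j assume "j \<in> {..<d}"
    then have j: "j < d" by simp
    have "tt s 1 * tt s (- int (Suc j)) = tt s (- int j)" by (simp flip: tt_add)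
    then show "fps_const (tt s 1 * tt s (- int (Suc j))) * s0 (tail (Suc j)) = a j - fps_const (tt s (- int j) * coeff R j) * eps"
      unfolding s0_tail[OF j] a_def by (simp only: right_diff_distrib mult.assoc fps_const_mult[symmetric])
  qed
  finally have 1: "fps_const (tt s 1) * s0 (m0R s) = (\<Sum>j<d. a j) - (\<Sum>j<d. fps_const (tt s (- int j) * coeff R j) * eps)"
    by (simp add: sum_subtractf)
  have 2: "m0R s = (\<Sum>j<d. a (Suc j))" by (simp add: m0R_def a_def)
  have 3: "(\<Sum>j<d. a j) - (\<Sum>j<d. a (Suc j)) = a 0 - a d"
    using sum_lessThan_telescope'[of a d] by (simp add: sum_subtractf)
  have const_sum: "fps_const (\<Sum>n\<in>N. g n) = (\<Sum>n\<in>N. fps_const (g n))" for g :: "nat \<Rightarrow> complex" and N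
    by (induction N rule: infinite_finite_induct) (simp_all flip: fps_const_add)
  have "fps_const (Rv s) * eps = (\<Sum>j\<le>d. fps_const (tt s (- int j) * coeff R j) * eps)"
    unfolding Rv_eq const_sum sum_distrib_right ..
  also have "\<dots> = (\<Sum>j<d. fps_const (tt s (- int j) * coeff R j) * eps) + a d"
    unfolding a_def tail_d lessThan_Suc_atMost[symmetric] sum.lessThan_Suc
    by (simp only: mult.assoc fps_const_mult[symmetric])
  finally have 4: "fps_const (Rv s) * eps = (\<Sum>j<d. fps_const (tt s (- int j) * coeff R j) * eps) + a d" .
  have "a 0 = 0" by (simp add: a_def tail_0)
  then show ?thesis using 1 2 3 4 by (simp add: algebra_simps)
qed

definition Gam0 :: "complex \<Rightarrow> complex" where "Gam0 s = E \<sigma>0 s (m0R s) + E \<sigma>c s (mcR s)"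

text \<open>
  The twisted cycle equation determines the \<open>\<sigma>0\<close>-component recursively; finiteness of its
  support forces the polynomial attached to the \<open>\<sigma>c\<close>-component to annihilate \<open>eps\<close>.
\<close>

lemma cycle_recursion:
  assumes r: "M_rep k \<psi> m" and f: "\<And>n. n \<notin> {- int k..int k} \<Longrightarrow> f n = 0"
    and eq: "\<And>s. fps_const (tt s 1) * s0 (m s) - m s + (\<Sum>n\<in>{- int k..int k}. fps_const (tt s n * f n)) * eps = 0"
    and j: "j \<le> 2 * Suc k"
  shows "\<psi> (int j - int (Suc k)) = (\<Sum>i<j. fps_const (f (int (Suc i) - int (Suc k))) * (s0 ^^ (j - Suc i)) eps)"
proof -
  \<comment> \<open>The range exceeds the support by one: the factor \<open>tt s 1\<close> raises
    exponents by one, and the recursion starts at an index where \<open>\<psi>\<close> is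
    zero.\<close>
  let ?I = "{- int (Suc k)..int (Suc k)}"
  have psi0: "n \<notin> {- int k..int k} \<Longrightarrow> \<psi> n = 0" for n using r by (simp add: M_rep_def)
  have psiA: "\<psi> n \<in> Adjp" for n using r AK_Adj by (simp add: M_rep_def)
  have ms: "m s = (\<Sum>n\<in>?I. fps_const (tt s n) * \<psi> n)" for s
    using M_rep_enlarge[OF r, of "Suc k"] by (simp add: M_rep_def)
  have es: "(\<Sum>n\<in>{- int k..int k}. fps_const (tt s n * f n)) * eps = (\<Sum>n\<in>?I. fps_const (tt s n) * (fps_const (f n) * eps))" for s
    unfolding sum_distrib_right
  proof (rule sum.mono_neutral_cong_left)
    show "fps_const (tt s n * f n) * eps = fps_const (tt s n) * (fps_const (f n) * eps)" for n
      by (simp only: mult.assoc fps_const_mult[symmetric])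
  qed (use f in auto)
  have ss: "fps_const (tt s 1) * s0 (m s) = (\<Sum>n\<in>?I. fps_const (tt s n) * s0 (\<psi> (n - 1)))" for s
  proof -
    have "fps_const (tt s 1) * s0 (m s) = (\<Sum>n\<in>{- int k..int k}. fps_const (tt s (n + 1)) * s0 (\<psi> n))"
      unfolding mono_M_rep[OF r loop_\<sigma>0] sum_distrib_left
      by (intro sum.cong refl) (simp only: tt_add fps_const_mult[symmetric] mult_ac)
    also have "\<dots> = (\<Sum>n\<in>{- int k + 1..int k + 1}. fps_const (tt s n) * s0 (\<psi> (n - 1)))"
      by (rule sum.reindex_bij_witness[of _ "\<lambda>n. n - 1" "\<lambda>n. n + 1"]) auto
    also have "\<dots> = (\<Sum>n\<in>?I. fps_const (tt s n) * s0 (\<psi> (n - 1)))"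
      by (rule sum.mono_neutral_left) (auto simp: psi0 mono_0[OF loop_\<sigma>0])
    finally show ?thesis .
  qed
  have "(\<Sum>n\<in>?I. fps_const (tt s n) * (s0 (\<psi> (n - 1)) - \<psi> n + fps_const (f n) * eps)) = 0" for s
    using eq[of s, unfolded ss es, unfolded ms] by (simp add: sum.distrib sum_subtractf distrib_left right_diff_distrib)
  from laurent_independent_fps[OF this]
  have step: "\<psi> n = s0 (\<psi> (n - 1)) + fps_const (f n) * eps" if "n \<in> ?I" for n
    using that by (simp add: algebra_simps)
  show ?thesis using j
  proof (induction j)
    case 0 then show ?case using psi0[of "- 1 - int k"] by simp
  next
    case (Suc j)
    let ?g = "\<lambda>i. fps_const (f (int (Suc i) - int (Suc k)))"
    have e: "eps \<in> Adjp" by (rule AK_Adj[OF eps_AK])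
    have "\<psi> (int (Suc j) - int (Suc k)) = s0 (\<psi> (int j - int (Suc k))) + ?g j * eps"
    proof -
      have idx: "int (Suc j) - int (Suc k) - 1 = int j - int (Suc k)" by simp
      have "int (Suc j) - int (Suc k) \<in> ?I" using Suc(2) by auto
      from step[OF this] show ?thesis unfolding idx .
    qed
    also have "s0 (\<psi> (int j - int (Suc k))) = s0 (\<Sum>i<j. ?g i * (s0 ^^ (j - Suc i)) eps)"
      using Suc by simp
    also have "\<dots> = (\<Sum>i<j. s0 (?g i * (s0 ^^ (j - Suc i)) eps))"
      by (rule mono_Adj_sum[OF loop_\<sigma>0]) (intro Adj_scale s0_pow_Adj e)
    also have "\<dots> = (\<Sum>i<j. ?g i * (s0 ^^ (Suc j - Suc i)) eps)"
    proof (intro sum.cong refl)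
      fix i assume "i \<in> {..<j}"
      then have "Suc j - Suc i = Suc (j - Suc i)" by auto
      then show "s0 (?g i * (s0 ^^ (j - Suc i)) eps) = ?g i * (s0 ^^ (Suc j - Suc i)) eps"
        by (simp only: mono_Adj_scale[OF loop_\<sigma>0 s0_pow_Adj[OF e]] funpow.simps comp_apply)
    qed
    finally show ?case by simp
  qed
qed

text \<open>At the exponent \<open>k + 1\<close>, beyond the support of \<open>m0\<close>, the
  recursion says that a polynomial \<open>F\<close> built from \<open>beta (mc s)\<close> kills
  \<open>eps\<close>. Hence \<open>F = R * Q\<close>, and \<open>Q\<close> gives the factor
  \<open>u\<close>. Subtracting \<open>u\<close> times \<open>m0R\<close> from \<open>m0\<close>
  leaves a solution of the homogeneous equation, which the recursion forces to vanish.\<close>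

lemma gamma_multiple:
  assumes m0: "m0 \<in> M" and mc: "mc \<in> M"
    and eq: "\<And>s. (fps_const (tt s 1) * s0 (m0 s) - m0 s) + (sc (mc s) - mc s) = 0"
  shows "\<exists>u\<in>exp_laurent K. \<forall>s. E \<sigma>0 s (m0 s) + E \<sigma>c s (mc s) = u s * Gam0 s"
proof -
  obtain k \<psi> ch where rep: "M_rep k \<psi> m0" "M_rep k ch mc" by (rule M_pair_rep[OF m0 mc])
  have chi: "ch n \<in> AK" "n \<notin> {- int k..int k} \<Longrightarrow> ch n = 0" for n using rep(2) by (simp_all add: M_rep_def)
  define f where "f n = beta (ch n)" for n
  have fK: "f n \<in> K" for n unfolding f_def by (rule beta_K[OF chi(1)])
  have f0: "f n = 0" if "n \<notin> {- int k..int k}" for n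
    using chi(2)[OF that] beta_scale[OF Adj_0, of 0] by (simp add: f_def)
  define fs where "fs s = (\<Sum>n\<in>{- int k..int k}. tt s n * f n)" for s
  have beta_mc: "beta (mc s) = fs s" for s
  proof -
    have "beta (mc s) = beta (\<Sum>n\<in>{- int k..int k}. fps_const (tt s n) * ch n)" using rep(2) by (simp add: M_rep_def)
    also have "\<dots> = fs s"
      by (simp add: beta_sum beta_scale Adj_scale AK_Adj chi(1) fs_def f_def)
    finally show ?thesis .
  qed
  have const_sum: "fps_const (\<Sum>n\<in>N. g n) = (\<Sum>n\<in>N. fps_const (g n))" for g :: "int \<Rightarrow> complex" and N
    by (induction N rule: infinite_finite_induct) (simp_all flip: fps_const_add)
  have eq': "fps_const (tt s 1) * s0 (m0 s) - m0 s + fps_const (fs s) * eps = 0" for s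
    using eq[of s] variation_adj[OF M_Adj[OF mc]] beta_mc by simp
  have rec: "\<psi> (int j - int (Suc k)) = (\<Sum>i<j. fps_const (f (int (Suc i) - int (Suc k))) * (s0 ^^ (j - Suc i)) eps)"
    if "j \<le> 2 * Suc k" for j
    by (rule cycle_recursion[OF rep(1) f0 _ that]) (use eq' in \<open>simp_all add: fs_def const_sum\<close>)
  \<comment> \<open>The polynomial \<open>F\<close> is made so that \<open>fs s\<close> is
    \<open>tt s (k + 1)\<close> times \<open>F\<close> at \<open>tt s (- 1)\<close>. Its degrees
    \<open>0\<close> to \<open>J\<close> correspond to the exponents from \<open>k + 1\<close> down
    to \<open>- k\<close>, the top one with coefficient 0.\<close>
  define J where "J = 2 * k + 1"
  define F where "F = (\<Sum>m\<le>J. monom (f (int (Suc k) - int m)) m)"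
  have cF: "coeff F i = (if i \<le> J then f (int (Suc k) - int i) else 0)" for i
    by (simp add: F_def coeff_sum coeff_monom)
  have degF: "degree F \<le> J" by (rule degree_le) (simp add: cF)
  have "pact F eps = (\<Sum>i\<le>J. fps_const (f (int (Suc k) - int i)) * (s0 ^^ i) eps)"
    unfolding pact_eq[OF degF] by (intro sum.cong refl) (simp add: cF)
  also have "\<dots> = (\<Sum>i<Suc J. fps_const (f (int (Suc k) - int i)) * (s0 ^^ i) eps)"
    by (simp add: lessThan_Suc_atMost)
  also have "\<dots> = (\<Sum>i<Suc J. fps_const (f (int (Suc k) - int (Suc J - Suc i))) * (s0 ^^ (Suc J - Suc i)) eps)"
    by (rule sum.nat_diff_reindex[symmetric])
  also have "\<dots> = (\<Sum>i<Suc J. fps_const (f (int (Suc i) - int (Suc k))) * (s0 ^^ (Suc J - Suc i)) eps)"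
  proof (intro sum.cong refl)
    fix i assume i: "i \<in> {..<Suc J}"
    have "int (Suc k) - int (Suc J - Suc i) = int (Suc i) - int (Suc k)" using i by (auto simp: J_def of_nat_diff)
    then show "fps_const (f (int (Suc k) - int (Suc J - Suc i))) * (s0 ^^ (Suc J - Suc i)) eps =
        fps_const (f (int (Suc i) - int (Suc k))) * (s0 ^^ (Suc J - Suc i)) eps" by (simp only:)
  qed
  also have "\<dots> = \<psi> (int (Suc J) - int (Suc k))" by (rule rec[symmetric]) (simp add: J_def)
  also have "\<dots> = 0" using rep(1) by (simp add: M_rep_def J_def)
  finally have "pact F eps = 0" .
  moreover have "K_poly F" unfolding cF using fK K_closed(1) by simp
  ultimately obtain Q where Q: "K_poly Q" "F = R * Q" using minimal_dvd[of F] by blast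
  define u where "u s = (\<Sum>i\<le>degree Q. tt s (int (Suc k) - int i) * coeff Q i)" for s
  have uL: "u \<in> exp_laurent K" unfolding u_def[abs_def] using Q(1) by (intro exp_laurent_sum[OF K]) auto
  have poly_tt: "tt s n * poly P (tt s (- 1)) = (\<Sum>i\<le>e. tt s (n - int i) * coeff P i)" if "degree P \<le> e" for s n P e
  proof -
    have "poly P (tt s (- 1)) = (\<Sum>i\<le>e. coeff P i * tt s (- 1) ^ i)"
      unfolding poly_altdef by (rule sum.mono_neutral_left) (use that in \<open>auto simp: coeff_eq_0\<close>)
    then show ?thesis
      unfolding sum_distrib_left
      by (simp add: sum_distrib_left) (intro sum.cong refl, simp add: tt_minus_power[symmetric] diff_conv_add_uminus tt_add del: add_uminus_conv_diff)
  qed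
  have fs_u: "fs s = u s * Rv s" for s
  proof -
    have "u s = tt s (int (Suc k)) * poly Q (tt s (- 1))" unfolding u_def by (rule poly_tt[symmetric]) simp
    then have "u s * Rv s = tt s (int (Suc k)) * poly F (tt s (- 1))" unfolding Rv_def Q(2) by (simp add: mult_ac)
    also have "\<dots> = (\<Sum>i\<le>J. tt s (int (Suc k) - int i) * coeff F i)" by (rule poly_tt[OF degF])
    also have "\<dots> = (\<Sum>i\<le>J. tt s (int (Suc k) - int i) * f (int (Suc k) - int i))"
      by (intro sum.cong refl) (simp add: cF)
    also have "\<dots> = (\<Sum>n\<in>{- int k..int k + 1}. tt s n * f n)"
      by (rule sum.reindex_bij_witness[of _ "\<lambda>n. nat (int (Suc k) - n)" "\<lambda>i. int (Suc k) - int i"]) (auto simp: J_def)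
    also have "\<dots> = fs s" unfolding fs_def by (rule sum.mono_neutral_right) (auto simp: f0)
    finally show ?thesis by simp
  qed
  have um: "(\<lambda>s. fps_const (u s) * m0R s) \<in> M" by (rule M_laurent[OF uL m0R_M])
  define n where "n s = m0 s - fps_const (u s) * m0R s" for s
  have nM: "n \<in> M" unfolding n_def[abs_def] by (rule M_diff[OF m0 um])
  obtain k' \<nu> where nrep: "M_rep k' \<nu> n" using nM unfolding M_iff by blast
  have n_eq: "fps_const (tt s 1) * s0 (n s) - n s + (\<Sum>n\<in>{- int k'..int k'}. fps_const (tt s n * 0)) * eps = 0" for s
  proof -
    have sn: "s0 (n s) = s0 (m0 s) - fps_const (u s) * s0 (m0R s)"
      unfolding n_def mono_Adj_diff[OF loop_\<sigma>0 M_Adj[OF m0] M_Adj[OF um]] mono_Adj_scale[OF loop_\<sigma>0 M_Adj[OF m0R_M]] ..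
    have "fps_const (tt s 1) * s0 (n s) - n s =
        (fps_const (tt s 1) * s0 (m0 s) - m0 s) - fps_const (u s) * (fps_const (tt s 1) * s0 (m0R s) - m0R s)"
      unfolding sn unfolding n_def by (simp only: algebra_simps)
    also have "\<dots> = - (fps_const (fs s) * eps) + fps_const (u s) * (fps_const (Rv s) * eps)"
      using eq'[of s] unfolding m0R_equation by (simp add: eq_neg_iff_add_eq_0 add.commute)
    also have "\<dots> = 0" unfolding fs_u by (simp only: mult.assoc fps_const_mult[symmetric] left_minus)
    finally show ?thesis by simp
  qed
  have "\<nu> i = 0" if i: "i \<in> {- int k'..int k'}" for i
  proof -
    have "\<nu> (int (nat (i + int (Suc k'))) - int (Suc k')) =
        (\<Sum>ia<nat (i + int (Suc k')). fps_const 0 * (s0 ^^ (nat (i + int (Suc k')) - Suc ia)) eps)"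
      by (rule cycle_recursion[OF nrep _ n_eq]) (use i in auto)
    then show ?thesis using i by simp
  qed
  then have n0: "n s = 0" for s using nrep by (simp add: M_rep_def)
  then have m0_eq: "m0 s = fps_const (u s) * m0R s" for s using n0[of s] by (simp add: n_def)
  have "E \<sigma>0 s (m0 s) + E \<sigma>c s (mc s) = u s * Gam0 s" for s
  proof -
    have "E \<sigma>c s (mc s) = u s * (Rv s * E \<sigma>c s psi1)"
      using E_\<sigma>c[OF M_Adj[OF mc]] unfolding beta_mc fs_u by simp
    moreover have "E \<sigma>c s (mcR s) = Rv s * E \<sigma>c s psi1"
      unfolding mcR_def by (rule E_scale[OF continuable_Sol_adj[OF AK_Adj[OF psi1(1)]] loop_\<sigma>c])
    moreover have "E \<sigma>0 s (m0 s) = u s * E \<sigma>0 s (m0R s)"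
      unfolding m0_eq by (rule E_scale[OF continuable_M[OF m0R_M] loop_\<sigma>0])
    ultimately show ?thesis by (simp add: Gam0_def distrib_left)
  qed
  then show ?thesis using uL by blast
qed

lemma polynomial_loop: 
  assumes "polynomial_function t" "homotopic_paths V \<sigma> t" "pathstart \<sigma> = p" "pathfinish \<sigma> = p"
  shows "t \<in> loops"
  using assms homotopic_paths_imp_subset[OF assms(2)] homotopic_paths_imp_pathstart[OF assms(2)]
    homotopic_paths_imp_pathfinish[OF assms(2)] valid_path_polynomial_function[OF assms(1)]
  unfolding based_loops_def by simp

lemma t0_loop: "t0 \<in> loops" and tc_loop: "tc \<in> loops"
  using polynomial_loop t0 tc \<sigma>0 \<sigma>c by blast+

lemma E_t0: "continuable A p f \<Longrightarrow> E t0 s f = E \<sigma>0 s f"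
  using E_homotopic[OF t0(2) \<sigma>0(3)] by simp

lemma E_tc: "continuable A p f \<Longrightarrow> E tc s f = E \<sigma>c s f"
  using E_homotopic[OF tc(2) \<sigma>c(3)] by simp

text \<open>The polynomial loops stand in for \<open>\<sigma>0\<close> and \<open>\<sigma>c\<close>,
  which need not be piecewise smooth; the homotopies preserve boundary and integral.\<close>

definition x0 :: chain where "x0 = single t0 m0R + single tc mcR"

lemma x0_chain: "x0 \<in> based_chains"
  unfolding x0_def by (intro chains_add chains_single t0_loop tc_loop m0R_M mcR_M)

lemma x0_cycle: "x0 \<in> cycles1 V p M"
proof -
  note c = chains_single[OF t0_loop m0R_M] chains_single[OF tc_loop mcR_M]
  have "bd s x0 = 0" for s
  proof -
    have "bd s x0 = (twisted_action t0 m0R s - m0R s) + (twisted_action tc mcR s - mcR s)"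
      unfolding x0_def bd_comb(1)[OF c] bd_single[OF t0_loop m0R_M] bd_single[OF tc_loop mcR_M] ..
    also have "twisted_action t0 m0R s = fps_const (tt s 1) * s0 (m0R s)"
      using twisted_action_homotopic[OF t0(2) \<sigma>0(3) m0R_M] twisted_action_\<sigma>0 by simp
    also have "twisted_action tc mcR s = sc (mcR s)"
      using twisted_action_homotopic[OF tc(2) \<sigma>c(3) mcR_M] twisted_action_\<sigma>c by simp
    also have "sc (mcR s) - mcR s = fps_const (Rv s) * eps"
      using variation_adj[OF M_Adj[OF mcR_M], of s] psi1 by (simp add: mcR_def beta_scale AK_Adj)
    finally show ?thesis unfolding m0R_equation by simp
  qed
  then show ?thesis using x0_chain by (simp add: cycles_iff)
qed

lemma gam_x0: "gam s x0 = Gam0 s"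
  unfolding x0_def gam_comb(1)[OF chains_single[OF t0_loop m0R_M] chains_single[OF tc_loop mcR_M]]
    gam_single[OF t0_loop m0R_M] gam_single[OF tc_loop mcR_M] Gam0_def
  by (simp add: E_t0 E_tc continuable_M m0R_M mcR_M)

lemma cycle_scale:
  assumes u: "u \<in> exp_laurent K" and x: "x \<in> cycles1 V p M"
  shows "(\<lambda>\<sigma> s. fps_const (u s) * x \<sigma> s) \<in> cycles1 V p M"
    and "gam s (\<lambda>\<sigma> s. fps_const (u s) * x \<sigma> s) = u s * gam s x"
proof -
  let ?y = "\<lambda>\<sigma> s. fps_const (u s) * x \<sigma> s"
  have xc: "x \<in> based_chains" using x by (simp add: cycles_iff)
  have B: "finite (chain_support x)" "chain_support x \<subseteq> loops" using xc by (auto simp: chains1_def)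
  have sup: "chain_support ?y \<subseteq> chain_support x" unfolding chain_support_def by (auto simp: fun_eq_iff)
  have yc: "?y \<in> based_chains"
    unfolding chains1_def using B sup M_laurent[OF u chains_M[OF xc]] by (auto elim: finite_subset)
  have lp: "loop p \<sigma>" if "\<sigma> \<in> chain_support x" for \<sigma> using that B(2) loops(2) by blast
  have "bd s ?y = 0" for s
  proof -
    have "bd s ?y = (\<Sum>\<sigma>\<in>chain_support x. twisted_action \<sigma> (?y \<sigma>) s - ?y \<sigma> s)"
      by (rule chain_eval_superset[OF _ yc B(1) sup B(2)]) (rule bd_M_diff)
    also have "\<dots> = (\<Sum>\<sigma>\<in>chain_support x. fps_const (u s) * (twisted_action \<sigma> (x \<sigma>) s - x \<sigma> s))"
    proof (intro sum.cong refl)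
      fix \<sigma> assume "\<sigma> \<in> chain_support x"
      from mono_Adj_scale[OF lp[OF this] M_Adj[OF chains_M[OF xc]], of "u s" \<sigma> s]
      show "twisted_action \<sigma> (?y \<sigma>) s - ?y \<sigma> s = fps_const (u s) * (twisted_action \<sigma> (x \<sigma>) s - x \<sigma> s)"
        by (simp add: twisted_action_def right_diff_distrib mult.left_commute)
    qed
    also have "\<dots> = fps_const (u s) * bd s x" by (simp add: chain_eval_def sum_distrib_left)
    finally show ?thesis using x by (simp add: cycles_iff)
  qed
  then show "?y \<in> cycles1 V p M" using yc by (simp add: cycles_iff)
  have "gam s ?y = (\<Sum>\<sigma>\<in>chain_support x. E \<sigma> s (?y \<sigma> s))"
    by (rule chain_eval_superset[OF _ yc B(1) sup B(2)]) (rule E_M_diff)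
  also have "\<dots> = (\<Sum>\<sigma>\<in>chain_support x. u s * E \<sigma> s (x \<sigma> s))"
    by (intro sum.cong refl E_scale continuable_M chains_M[OF xc] lp)
  finally show "gam s ?y = u s * gam s x" by (simp add: chain_eval_def sum_distrib_left)
qed

definition \<xi>0 :: "chain set" where "\<xi>0 = (+) x0 ` boundaries1 V p M"

lemma \<xi>0_H1: "\<xi>0 \<in> H1 V p M"
  unfolding H1_def \<xi>0_def using x0_cycle by blast

lemma gamma_\<xi>0: "gamma_function p l \<xi>0 = Gam0"
  unfolding \<xi>0_def gamma_function_class[OF x0_cycle] gam_x0 ..

lemma gamma_module:
  "gamma_function p l ` H1 V p M = (\<lambda>u s. u s * gamma_function p l \<xi>0 s) ` exp_laurent K"
proof
  show "gamma_function p l ` H1 V p M \<subseteq> (\<lambda>u s. u s * gamma_function p l \<xi>0 s) ` exp_laurent K"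
  proof
    fix h assume "h \<in> gamma_function p l ` H1 V p M"
    then obtain x where x: "x \<in> cycles1 V p M" "h = gamma_function p l ((+) x ` boundaries1 V p M)"
      unfolding H1_def by blast
    obtain m0 mc where m: "m0 \<in> M" "mc \<in> M"
      "\<forall>s. (twisted_action \<sigma>0 m0 s - m0 s) + (twisted_action \<sigma>c mc s - mc s) = 0"
      "\<forall>s. gam s x = E \<sigma>0 s (m0 s) + E \<sigma>c s (mc s)"
      using cycle_reduce[OF x(1)] by blast
    obtain u where u: "u \<in> exp_laurent K" "\<forall>s. E \<sigma>0 s (m0 s) + E \<sigma>c s (mc s) = u s * Gam0 s"
      using gamma_multiple[OF m(1,2)] m(3) unfolding twisted_action_\<sigma>0 twisted_action_\<sigma>c by blast
    have "h = (\<lambda>s. u s * gamma_function p l \<xi>0 s)"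
      unfolding x(2) gamma_function_class[OF x(1)] gamma_\<xi>0 using m(4) u(2) by simp
    then show "h \<in> (\<lambda>u s. u s * gamma_function p l \<xi>0 s) ` exp_laurent K" using u(1) by blast
  qed
  show "(\<lambda>u s. u s * gamma_function p l \<xi>0 s) ` exp_laurent K \<subseteq> gamma_function p l ` H1 V p M"
  proof
    fix h assume "h \<in> (\<lambda>u s. u s * gamma_function p l \<xi>0 s) ` exp_laurent K"
    then obtain u where u: "u \<in> exp_laurent K" "h = (\<lambda>s. u s * Gam0 s)" unfolding gamma_\<xi>0 by blast
    note c = cycle_scale[OF u(1) x0_cycle]
    have "h = gamma_function p l ((+) (\<lambda>\<sigma> s. fps_const (u s) * x0 \<sigma> s) ` boundaries1 V p M)"
      unfolding gamma_function_class[OF c(1)] c(2) gam_x0 u(2) ..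
    then show "h \<in> gamma_function p l ` H1 V p M" using c(1) unfolding H1_def by blast
  qed
qed

end

context minimal_setting
begin

section \<open>The expansion of the generating gamma function\<close>

text \<open>The coefficient of \<open>(s - \<rho>) ^ i\<close> in \<open>exp (s * x)\<close>, that
  is, in \<open>t^s\<close> as a function of \<open>x = log t\<close>.\<close>

abbreviation lg_fun :: "complex \<Rightarrow> nat \<Rightarrow> complex \<Rightarrow> complex" where
  "lg_fun \<rho> i \<equiv> (\<lambda>x. exp (\<rho> * x) * x ^ i / fact i)"

abbreviation lgerm :: "complex \<Rightarrow> nat \<Rightarrow> complex fps" where
  "lgerm \<rho> i \<equiv> log_germ (lg_fun \<rho> i) p l"

lemma lg_fun_holomorphic: "lg_fun \<rho> i holomorphic_on X"
  by (intro holomorphic_intros) simp_all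

lemma inv_z_lgerm: "inv_z p * lgerm \<rho> i = lgerm (\<rho> - 1) i"
proof -
  have "inv_z p = log_germ (\<lambda>x. exp (- x)) p l"
    using log_germ_exp[OF open_UNIV UNIV_I l, of "\<lambda>t. 1 / t"] by (simp add: exp_minus inverse_eq_divide)
  moreover have h: "(\<lambda>x::complex. exp (- x)) holomorphic_on UNIV" by (intro holomorphic_intros)
  ultimately have "inv_z p * lgerm \<rho> i = log_germ (\<lambda>x. exp (- x) * lg_fun \<rho> i x) p l"
    using log_germ_mult[OF open_UNIV UNIV_I l h lg_fun_holomorphic[of \<rho> i UNIV]] by (simp only:)
  also have "(\<lambda>x. exp (- x) * lg_fun \<rho> i x) = lg_fun (\<rho> - 1) i"
    by (simp add: fun_eq_iff exp_add[symmetric] algebra_simps)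
  finally show ?thesis .
qed

text \<open>The candidate Taylor series of the integral at \<open>s = \<rho>\<close>, obtained by
  expanding \<open>t^(s - 1)\<close> under the integral sign.\<close>

definition J :: "(real \<Rightarrow> complex) \<Rightarrow> complex \<Rightarrow> complex fps \<Rightarrow> complex fps" where
  "J t \<rho> \<psi> = Abs_fps (\<lambda>i. germ_integral t (\<psi> * lgerm (\<rho> - 1) i))"

text \<open>The logarithm \<open>\<Lambda>\<close> is bounded along the loop, so the exponential
  series of \<open>x log t\<close> converges uniformly on \<open>{0..1}\<close> and can be
  integrated term by term, for every \<open>x\<close>. A polynomial loop keeps the integrands
  continuous on the whole interval.\<close>

lemma E_sums:
  assumes t: "t \<in> loops" "polynomial_function t" and \<psi>: "continuable A p \<psi>"
  shows "(\<lambda>i. fps_nth (J t \<rho> \<psi>) i * x ^ i) sums E t (\<rho> + x) \<psi>"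
proof -
  have lt: "loop p t" "valid_path t" using loops[OF t(1)] by auto
  obtain F where F: "continuation_on {0..1} t F" "F 0 = \<psi>"
    using \<psi> lt unfolding continuable_def by blast
  obtain t' where t': "polynomial_function t'" "\<And>u. (t has_vector_derivative t' u) (at u)"
    using has_vector_derivative_polynomial_function[OF t(2)] by blast
  have dt: "vector_derivative t (at u within {0..1}) = t' u" if "u \<in> {0..1}" for u
    using vector_derivative_at_within_ivl[OF t'(2), of 0 u 1] that by simp
  have "0 \<notin> path_image t" "path t" using lt A by auto
  then obtain w where w: "path w" "\<And>u. u \<in> {0..1} \<Longrightarrow> t u = 0 + exp (w u)"
    using winding_number_as_continuous_log[of t 0] by metis
  define \<Lambda> where "\<Lambda> u = l + (w u - w 0)" for u
  have "exp (w 0) = p" using w(2)[of 0] lt by (simp add: pathstart_def)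
  then have ex: "exp (\<Lambda> u) = t u" if "u \<in> {0..1}" for u
    using w(2)[OF that] l exp_not_eq_zero[of l] by (simp add: \<Lambda>_def exp_add exp_diff)
  have cL: "continuous_on {0..1} \<Lambda>" unfolding \<Lambda>_def using w(1) by (auto simp: path_def intro!: continuous_intros)
  define a where "a u = fps_nth (F u) 0 * t' u" for u
  have ca: "continuous_on {0..1} a"
    unfolding a_def by (intro continuous_intros continuous_on_germ_value[OF F(1)] continuous_on_polymonial_function t'(1))
  have integ: "germ_integral t (\<psi> * log_germ H p l) = integral {0..1} (\<lambda>u. a u * H (\<Lambda> u))"
    if H: "H holomorphic_on UNIV" for H
  proof -
    have "continuation_on {0..1} t (\<lambda>u. log_germ H (t u) (\<Lambda> u))"
      by (rule continuation_on_log_germ[OF H open_UNIV cL _ ex]) auto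
    from germ_integral_continuation[OF continuation_on_mult[OF F(1) this], of "\<psi> * log_germ H p l"]
    have "germ_integral t (\<psi> * log_germ H p l) = integral {0..1}
       (\<lambda>u. fps_nth (F u * log_germ H (t u) (\<Lambda> u)) 0 * vector_derivative t (at u within {0..1}))"
      using F(2) lt by (simp add: \<Lambda>_def pathstart_def)
    also have "\<dots> = integral {0..1} (\<lambda>u. a u * H (\<Lambda> u))"
    proof (rule integral_cong)
      fix u :: real assume u: "u \<in> {0..1}"
      have "fps_nth (log_germ H (t u) (\<Lambda> u)) 0 = H (\<Lambda> u)"
        by (rule log_germ_nth_0[OF open_UNIV UNIV_I ex[OF u]])
      then show "fps_nth (F u * log_germ H (t u) (\<Lambda> u)) 0 * vector_derivative t (at u within {0..1}) = a u * H (\<Lambda> u)"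
        by (simp add: a_def dt[OF u])
    qed
    finally show ?thesis .
  qed
  have "bounded (\<Lambda> ` {0..1})" "bounded ((\<lambda>u. a u * exp ((\<rho> - 1) * \<Lambda> u)) ` {0..1})"
    by (intro compact_imp_bounded compact_continuous_image continuous_intros cL ca compact_Icc)+
  then obtain B C where "\<forall>x\<in>\<Lambda> ` {0..1}. norm x \<le> B"
     "\<forall>x\<in>(\<lambda>u. a u * exp ((\<rho> - 1) * \<Lambda> u)) ` {0..1}. norm x \<le> C"
    unfolding bounded_iff by blast
  then have B: "\<And>u. u \<in> {0..1} \<Longrightarrow> norm (\<Lambda> u) \<le> B"
     and C: "\<And>u. u \<in> {0..1} \<Longrightarrow> norm (a u * exp ((\<rho> - 1) * \<Lambda> u)) \<le> C"
    by blast+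
  have B0: "0 \<le> B" using order_trans[OF norm_ge_zero B[of 0]] by simp
  define f where "f i u = a u * lg_fun (\<rho> - 1) i (\<Lambda> u) * x ^ i" for i u
  have cf: "continuous_on {0..1} (f i)" for i unfolding f_def by (intro continuous_intros cL ca) auto
  have If: "integral {0..1} (f i) = fps_nth (J t \<rho> \<psi>) i * x ^ i" for i
    unfolding f_def using integ[OF lg_fun_holomorphic] by (simp add: J_def)
  have bound: "norm (f i u) \<le> C * ((B * norm x) ^ i / fact i)" if u: "u \<in> {0..1}" for i u
  proof -
    have "norm (f i u) = norm (a u * exp ((\<rho> - 1) * \<Lambda> u)) * ((norm (\<Lambda> u) * norm x) ^ i / fact i)"
      by (simp add: f_def norm_mult norm_divide norm_power power_mult_distrib)
    also have "\<dots> \<le> C * ((B * norm x) ^ i / fact i)"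
      using B[OF u] C[OF u] B0
      by (intro mult_mono divide_right_mono power_mono mult_right_mono) (auto intro: order_trans[OF norm_ge_zero])
    finally show ?thesis .
  qed
  have "summable (\<lambda>i. C * ((B * norm x) ^ i / fact i))"
    using summable_exp[of "B * norm x"] by (intro summable_mult) (simp add: divide_inverse mult.commute)
  from Weierstrass_m_test[of "{0..1}" f, OF bound this]
  have ul: "uniform_limit {0..1} (\<lambda>n u. \<Sum>i<n. f i u) (\<lambda>u. \<Sum>i. f i u) sequentially" by simp
  have val: "(\<Sum>i. f i u) = a u * exp ((\<rho> + x - 1) * \<Lambda> u)" for u
  proof -
    have "(\<lambda>i. (\<Lambda> u * x) ^ i /\<^sub>R fact i) sums exp (\<Lambda> u * x)" by (rule exp_converges)
    then have "(\<lambda>i. a u * exp ((\<rho> - 1) * \<Lambda> u) * ((\<Lambda> u * x) ^ i /\<^sub>R fact i)) sums (a u * exp ((\<rho> - 1) * \<Lambda> u) * exp (\<Lambda> u * x))"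
      by (rule sums_mult)
    moreover have "a u * exp ((\<rho> - 1) * \<Lambda> u) * ((\<Lambda> u * x) ^ i /\<^sub>R fact i) = f i u" for i
      by (simp add: f_def scaleR_conv_of_real power_mult_distrib divide_inverse mult_ac)
    ultimately have "(\<lambda>i. f i u) sums (a u * (exp ((\<rho> - 1) * \<Lambda> u) * exp (\<Lambda> u * x)))" by (simp add: mult.assoc)
    then show ?thesis by (simp add: sums_iff exp_add[symmetric] algebra_simps)
  qed
  obtain I I' where I: "\<And>n. ((\<lambda>u. \<Sum>i<n. f i u) has_integral I n) {0..1}"
      "((\<lambda>u. \<Sum>i. f i u) has_integral I') {0..1}" "(I \<longlongrightarrow> I') sequentially"
    using uniform_limit_integral[OF ul] continuous_on_sum[of "{..<_}" "{0..1}" f] cf by (metis sequentially_bot)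
  have "I n = (\<Sum>i<n. fps_nth (J t \<rho> \<psi>) i * x ^ i)" for n
  proof -
    have "((\<lambda>u. \<Sum>i<n. f i u) has_integral (\<Sum>i<n. integral {0..1} (f i))) {0..1}"
      by (intro has_integral_sum integrable_integral integrable_continuous_real cf) simp
    then show ?thesis using I(1)[of n] If by (metis (no_types, lifting) has_integral_unique sum.cong)
  qed
  moreover have "I' = E t (\<rho> + x) \<psi>"
  proof -
    have "I' = integral {0..1} (\<lambda>u. a u * exp ((\<rho> + x - 1) * \<Lambda> u))" using I(2) unfolding val by (simp add: integral_unique)
    also have "\<dots> = germ_integral t (\<psi> * pw (\<rho> + x - 1))"
      unfolding power_germ_eq by (rule integ[symmetric]) (intro holomorphic_intros)
    also have "\<dots> = E t (\<rho> + x) \<psi>" by (rule germ_integral_E[OF lt(2,1) \<psi>])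
    finally show ?thesis .
  qed
  ultimately have "I = (\<lambda>n. \<Sum>i<n. fps_nth (J t \<rho> \<psi>) i * x ^ i)" "I' = E t (\<rho> + x) \<psi>" by (simp_all add: fun_eq_iff)
  then show ?thesis using I(3) unfolding sums_def by (simp only:)
qed

lemma E_has_expansion:
  assumes "t \<in> loops" "polynomial_function t" "continuable A p \<psi>"
  shows "(\<lambda>x. E t (\<rho> + x) \<psi>) has_fps_expansion J t \<rho> \<psi>"
  by (rule has_fps_expansionI) (simp add: E_sums[OF assms])

lemma germ_integral_sum:
  assumes t: "t \<in> loops" and f: "\<And>i. i \<in> N \<Longrightarrow> continuable A p (f i)"
  shows "germ_integral t (\<Sum>i\<in>N. fps_const (c i) * f i) = (\<Sum>i\<in>N. c i * germ_integral t (f i))"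
proof -
  have lt: "valid_path t" "path_image t \<subseteq> A" "pathstart t = p" "path t" using loops[OF t] by auto
  define P where "P i = fps_integral (f i) 0" for i
  have dP: "fps_deriv (P i) = f i" for i unfolding P_def by (rule fps_deriv_fps_integral)
  have cP: "continuable A p (P i)" if "i \<in> N" for i by (rule continuable_primitive) (simp add: dP f that)
  have "germ_integral t (fps_deriv (\<Sum>i\<in>N. fps_const (c i) * P i)) =
      fps_nth (monodromy t (\<Sum>i\<in>N. fps_const (c i) * P i)) 0 - fps_nth (\<Sum>i\<in>N. fps_const (c i) * P i) 0"
    by (rule germ_integral_eq[OF lt(1-3)]) (intro continuable_sum continuable_scale cP)
  also have "monodromy t (\<Sum>i\<in>N. fps_const (c i) * P i) = (\<Sum>i\<in>N. fps_const (c i) * monodromy t (P i))"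
    using monodromy_sum[OF lt(4,2,3), of N "\<lambda>i. fps_const (c i) * P i"] continuable_scale[OF cP]
      monodromy_scale[OF lt(4,2,3) cP] by simp
  also have "fps_nth \<dots> 0 - fps_nth (\<Sum>i\<in>N. fps_const (c i) * P i) 0 =
      (\<Sum>i\<in>N. c i * (fps_nth (monodromy t (P i)) 0 - fps_nth (P i) 0))"
    by (simp add: fps_sum_nth sum_subtractf right_diff_distrib)
  also have "\<dots> = (\<Sum>i\<in>N. c i * germ_integral t (f i))"
    by (intro sum.cong refl) (use germ_integral_eq[OF lt(1-3) cP] dP in simp)
  finally show ?thesis by (simp add: fps_deriv_sum dP)
qed

text \<open>Germs at \<open>p\<close> of functions holomorphic on the whole of \<open>Dc\<close>.
  This is stronger than invariance under \<open>sc\<close> and, unlike it, passes to primitives,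
  because \<open>Dc\<close> is simply connected.\<close>

definition single_valued_germ :: "complex fps \<Rightarrow> bool" where
  "single_valued_germ f \<longleftrightarrow> (\<exists>g. g holomorphic_on Dc \<and> fps_expansion g p = f)"

lemma single_valued_sc: "single_valued_germ f \<Longrightarrow> sc f = f"
  unfolding single_valued_germ_def
  using monodromy_holomorphic[OF \<sigma>c(1) Dc(4) \<sigma>c(3) _ Dc(1) order_refl] \<sigma>c(4) by auto

lemma single_valued_mult:
  assumes "single_valued_germ f" "single_valued_germ g" shows "single_valued_germ (f * g)"
proof -
  obtain f' g' where h: "f' holomorphic_on Dc" "fps_expansion f' p = f" "g' holomorphic_on Dc" "fps_expansion g' p = g"
    using assms unfolding single_valued_germ_def by blast
  show ?thesis unfolding single_valued_germ_def
    by (rule exI[of _ "\<lambda>z. f' z * g' z"]) (use h in \<open>simp add: fps_expansion_mult[OF Dc(1,5)] holomorphic_on_mult\<close>)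
qed

lemma single_valued_add:
  assumes "single_valued_germ f" "single_valued_germ g" shows "single_valued_germ (f + g)"
proof -
  obtain f' g' where h: "f' holomorphic_on Dc" "fps_expansion f' p = f" "g' holomorphic_on Dc" "fps_expansion g' p = g"
    using assms unfolding single_valued_germ_def by blast
  show ?thesis unfolding single_valued_germ_def
    by (rule exI[of _ "\<lambda>z. f' z + g' z"]) (use h in \<open>simp add: fps_expansion_add[OF Dc(1,5)] holomorphic_on_add\<close>)
qed

lemma single_valued_const: "single_valued_germ (fps_const c)"
  unfolding single_valued_germ_def by (rule exI[of _ "\<lambda>_. c"]) (simp add: fps_expansion_const)

lemma single_valued_scale: "single_valued_germ f \<Longrightarrow> single_valued_germ (fps_const c * f)"
  by (intro single_valued_mult single_valued_const)

lemma single_valued_sum: "(\<And>i. i \<in> N \<Longrightarrow> single_valued_germ (f i)) \<Longrightarrow> single_valued_germ (\<Sum>i\<in>N. f i)"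
  using single_valued_const[of 0]
  by (induction N rule: infinite_finite_induct) (simp_all add: single_valued_add)

lemma single_valued_primitive:
  assumes "single_valued_germ (fps_deriv f)" shows "single_valued_germ f"
proof -
  obtain h where h: "h holomorphic_on Dc" "fps_expansion h p = fps_deriv f"
    using assms unfolding single_valued_germ_def by blast
  obtain H where H: "\<And>z. z \<in> Dc \<Longrightarrow> (H has_field_derivative h z) (at z)"
    using simply_connected_eq_global_primitive[OF Dc(1)] Dc(2) h(1) by blast
  define k where "k z = H z + (fps_nth f 0 - H p)" for z
  have k: "(k has_field_derivative h z) (at z)" if "z \<in> Dc" for z
    unfolding k_def using H[OF that] by (auto intro!: derivative_eq_intros)
  have "fps_deriv (fps_expansion k p) = fps_expansion h p"
    unfolding fps_expansion_deriv[symmetric]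
    by (rule fps_expansion_eq_on[OF Dc(1,5)]) (rule DERIV_imp_deriv[OF k])
  moreover have "fps_nth (fps_expansion k p) 0 = fps_nth f 0" by (simp add: fps_expansion_nth_0 k_def)
  ultimately have "fps_expansion k p = f" using h(2) by (simp add: fps_deriv_eq_iff)
  moreover have "k holomorphic_on Dc" unfolding holomorphic_on_open[OF Dc(1)] using k by blast
  ultimately show ?thesis unfolding single_valued_germ_def by blast
qed

lemma single_valued_log_germ:
  assumes H: "H holomorphic_on UNIV" shows "single_valued_germ (log_germ H p l)"
proof -
  obtain k where k: "k holomorphic_on Dc" "\<And>z. z \<in> Dc \<Longrightarrow> z = exp (k z)"
    using simply_connected_eq_holomorphic_log[OF Dc(1)] Dc(2,3) holomorphic_on_ident by (metis (no_types, lifting))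
  have kp: "exp (k p) = p" using k(2)[OF Dc(5)] by simp
  define h where "h z = H (l + (k z - k p))" for z
  have "(H \<circ> (\<lambda>z. l + (k z - k p))) holomorphic_on Dc"
    by (rule holomorphic_on_compose_gen[OF _ H]) (auto intro!: holomorphic_intros k)
  then have hh: "h holomorphic_on Dc" by (simp add: h_def[abs_def] o_def)
  have "continuous_on Dc (\<lambda>z. k z - k p)" using holomorphic_on_imp_continuous_on[OF k(1)] by (intro continuous_intros)
  then have op: "open (Dc \<inter> (\<lambda>z. k z - k p) -` ball 0 pi)"
    by (rule continuous_open_preimage[OF _ Dc(1) open_ball])
  have "fps_expansion h p = log_germ H p l"
    unfolding log_germ_def
  proof (rule fps_expansion_eq_on[OF op])
    show "p \<in> Dc \<inter> (\<lambda>z. k z - k p) -` ball 0 pi" using Dc(5) by simp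
    fix z assume z: "z \<in> Dc \<inter> (\<lambda>z. k z - k p) -` ball 0 pi"
    then have "norm (k z - k p) < pi" by simp
    then have "\<bar>Im (k z - k p)\<bar> < pi" using abs_Im_le_cmod le_less_trans by blast
    then have "Ln (exp (k z - k p)) = k z - k p" by (intro Ln_exp) linarith+
    moreover have "exp (k z - k p) = z / p" using k(2)[of z] z kp by (simp add: exp_diff)
    ultimately show "h z = H (log_branch p l z)" by (simp add: h_def log_branch_def)
  qed
  then show ?thesis unfolding single_valued_germ_def using hh by blast
qed

text \<open>The assumptions on the germs \<open>\<phi> k\<close> are the coefficients of
  \<open>(s - \<rho>) ^ k\<close> in \<open>L \<phi>(s) = I(s) t\<^sup>s\<close> and in the rule
  that \<open>\<sigma>0\<close> multiplies \<open>\<phi>(s)\<close> by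
  \<open>exp (2 pi i s)\<close>. Through these properties alone the Frobenius functions enter
  here.\<close>

context
  fixes \<rho> :: complex and I :: "complex \<Rightarrow> complex" and \<phi> :: "nat \<Rightarrow> complex fps"
  assumes I: "I holomorphic_on UNIV"
    and L\<phi>: "\<And>k. L_germ r q p (\<phi> k) = (\<Sum>i\<le>k. fps_const (fps_nth (fps_expansion I \<rho>) (k - i)) * lgerm \<rho> i)"
    and s0\<phi>: "\<And>k. s0 (\<phi> k) = (\<Sum>i\<le>k. fps_const (fps_nth (fps_expansion (\<lambda>s. tt s 1) \<rho>) i) * \<phi> (k - i))"
begin

abbreviation "Ic \<equiv> fps_expansion I \<rho>"

lemma continuable_lgerm: "continuable A p (lgerm \<rho>' i)"
  by (rule continuable_log_germ[OF lg_fun_holomorphic])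

lemma continuable_\<phi>: "continuable A p (\<phi> k)"
  by (rule continuable_L) (unfold L\<phi>, intro continuable_sum continuable_scale continuable_lgerm)

definition \<kappa> :: "nat \<Rightarrow> complex" where "\<kappa> k = (SOME c. sc (\<phi> k) - \<phi> k = fps_const c * \<delta>)"

text \<open>Lagrange's identity for an adjoint solution, coefficientwise in
  \<open>s - \<rho>\<close>; passing from \<open>D\<close> to the derivative lowers the exponent
  from \<open>\<rho>\<close> to \<open>\<rho> - 1\<close>.\<close>

lemma bracket_deriv:
  assumes \<psi>: "\<psi> \<in> Adjp"
  shows "fps_deriv (bracket r q p \<psi> (\<phi> k)) = (\<Sum>i\<le>k. fps_const (fps_nth Ic (k - i)) * (\<psi> * lgerm (\<rho> - 1) i))"
proof -
  have "fps_deriv (bracket r q p \<psi> (\<phi> k)) = inv_z p * (\<psi> * L_germ r q p (\<phi> k))"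
    using \<psi> unfolding fps_deriv_eq[OF p] D_germ_bracket[OF r] by (simp add: Sol_adj_def)
  also have "\<dots> = (\<Sum>i\<le>k. fps_const (fps_nth Ic (k - i)) * (\<psi> * (inv_z p * lgerm \<rho> i)))"
    unfolding L\<phi> sum_distrib_left by (intro sum.cong refl) (simp only: mult_ac)
  finally show ?thesis unfolding inv_z_lgerm .
qed

lemma continuable_br: "\<psi> \<in> Adjp \<Longrightarrow> continuable A p (bracket r q p \<psi> (\<phi> k))"
  by (rule continuable_bracket[OF continuable_Sol_adj continuable_\<phi>])

text \<open>\<open>L (\<phi> k)\<close> is a combination of powers of \<open>log t\<close> times
  \<open>t^\<rho>\<close>, which do not change around \<open>\<sigma>c\<close>; so the variation
  solves \<open>L\<close>. For an invariant \<open>\<psi>\<close> the derivative of its bracket with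
  \<open>\<phi> k\<close> is holomorphic on \<open>Dc\<close>. Hence the bracket is single valued,
  \<open>\<psi>\<close> is orthogonal to the variation, and the latter is a multiple of
  \<open>\<delta>\<close>.\<close>

lemma sc_\<phi>: "sc (\<phi> k) - \<phi> k = fps_const (\<kappa> k) * \<delta>"
proof -
  let ?\<omega> = "sc (\<phi> k) - \<phi> k"
  have gc: "path \<sigma>c" "path_image \<sigma>c \<subseteq> A" "pathstart \<sigma>c = p" using loop_\<sigma>c by auto
  have inv: "sc (lgerm \<rho> i) = lgerm \<rho> i" for i
    using monodromy_log_germ_loop[OF lg_fun_holomorphic loop_\<sigma>c] \<sigma>c(5) by simp
  have "L_germ r q p (sc (\<phi> k)) = sc (L_germ r q p (\<phi> k))"
    using monodromy_L[OF continuable_\<phi> gc] \<sigma>c(4) by simp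
  also have "\<dots> = L_germ r q p (\<phi> k)"
    unfolding L\<phi>
    by (simp add: monodromy_sum[OF gc] continuable_scale continuable_lgerm monodromy_scale[OF gc] inv)
  finally have sol: "?\<omega> \<in> Solp" by (simp add: Sol_iff[OF p] L_germ_diff)
  have "\<exists>c. ?\<omega> = fps_const c * \<delta>"
  proof (rule variation_in_span_if_orthogonal[OF sol])
    fix \<psi> assume \<psi>: "\<psi> \<in> Adjp" "sc \<psi> = \<psi>"
    let ?B = "bracket r q p \<psi> (\<phi> k)"
    have "single_valued_germ ?B"
    proof (rule single_valued_primitive, unfold bracket_deriv[OF \<psi>(1)], intro single_valued_sum single_valued_scale single_valued_mult)
      show "single_valued_germ \<psi>" using special[OF \<psi>] by (simp add: single_valued_germ_def)
      show "single_valued_germ (lgerm (\<rho> - 1) i)" for i by (rule single_valued_log_germ[OF lg_fun_holomorphic])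
    qed
    then have "sc ?B = ?B" by (rule single_valued_sc)
    moreover have "sc ?B = bracket r q p \<psi> (sc (\<phi> k))"
      using monodromy_bracket[OF continuable_Sol_adj[OF \<psi>(1)] continuable_\<phi> gc] \<psi>(2) \<sigma>c(4) by simp
    ultimately show "br \<psi> ?\<omega> = 0" unfolding br_diff_right by (simp add: br_def)
  qed
  then show ?thesis unfolding \<kappa>_def by (rule someI_ex)
qed

text \<open>The bracket of \<open>\<psi>\<close> with \<open>\<phi>(s)\<close> at \<open>p\<close>,
  as a formal series in \<open>s - \<rho>\<close>.\<close>

definition bf :: "complex fps \<Rightarrow> complex fps" where "bf \<psi> = Abs_fps (\<lambda>k. br \<psi> (\<phi> k))"

lemma bf_diff: "bf (f - g) = bf f - bf g"
  by (rule fps_ext) (simp add: bf_def br_diff_left)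

lemma bf_scale: "bf (fps_const c * f) = fps_const c * bf f"
  by (rule fps_ext) (simp add: bf_def br_scale_left)

abbreviation "Tf n \<equiv> fps_expansion (\<lambda>s. tt s n) \<rho>"
abbreviation "\<kappa>f \<equiv> Abs_fps \<kappa>"

lemma Ic_J:
  assumes \<psi>: "\<psi> \<in> Adjp" and t: "t \<in> loops"
  shows "fps_nth (Ic * J t \<rho> \<psi>) k = br (monodromy t \<psi>) (monodromy t (\<phi> k)) - br \<psi> (\<phi> k)"
proof -
  have lt: "valid_path t" "path_image t \<subseteq> A" "pathstart t = p" "path t" "pathfinish t = p" using loops[OF t] by auto
  have "fps_nth (Ic * J t \<rho> \<psi>) k = (\<Sum>i\<le>k. fps_nth Ic (k - i) * germ_integral t (\<psi> * lgerm (\<rho> - 1) i))"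
    unfolding mult.commute[of Ic] fps_mult_nth atLeast0AtMost J_def fps_nth_Abs_fps by (rule sum.cong[OF refl mult.commute])
  also have "\<dots> = germ_integral t (fps_deriv (bracket r q p \<psi> (\<phi> k)))"
    unfolding bracket_deriv[OF \<psi>]
    by (rule germ_integral_sum[OF t, symmetric]) (intro continuable_mult continuable_Sol_adj[OF \<psi>] continuable_lgerm)
  also have "\<dots> = fps_nth (monodromy t (bracket r q p \<psi> (\<phi> k))) 0 - fps_nth (bracket r q p \<psi> (\<phi> k)) 0"
    by (rule germ_integral_eq[OF lt(1-3) continuable_br[OF \<psi>]])
  also have "monodromy t (bracket r q p \<psi> (\<phi> k)) = bracket r q p (monodromy t \<psi>) (monodromy t (\<phi> k))"
    using monodromy_bracket[OF continuable_Sol_adj[OF \<psi>] continuable_\<phi> lt(4,2,3)] lt(5) by simp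
  finally show ?thesis by (simp add: br_def)
qed

lemma monodromy_t0: "continuable A p f \<Longrightarrow> monodromy t0 f = s0 f"
  using monodromy_homotopic[OF continuable_subset[OF _ V(1)] t0(2) \<sigma>0(3)] by simp

lemma monodromy_tc: "continuable A p f \<Longrightarrow> monodromy tc f = sc f"
  using monodromy_homotopic[OF continuable_subset[OF _ V(1)] tc(2) \<sigma>c(3)] by simp

lemma Ic_J_t0: assumes \<psi>: "\<psi> \<in> Adjp" shows "Ic * J t0 \<rho> \<psi> = Tf 1 * bf (s0 \<psi>) - bf \<psi>"
proof (rule fps_ext)
  fix k
  have "fps_nth (Ic * J t0 \<rho> \<psi>) k = br (s0 \<psi>) (s0 (\<phi> k)) - br \<psi> (\<phi> k)"
    unfolding Ic_J[OF \<psi> t0_loop] monodromy_t0[OF continuable_Sol_adj[OF \<psi>]] monodromy_t0[OF continuable_\<phi>] ..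
  also have "br (s0 \<psi>) (s0 (\<phi> k)) = (\<Sum>i\<le>k. fps_nth (Tf 1) i * br (s0 \<psi>) (\<phi> (k - i)))"
    unfolding s0\<phi> br_sum_right br_scale_right ..
  finally show "fps_nth (Ic * J t0 \<rho> \<psi>) k = fps_nth (Tf 1 * bf (s0 \<psi>) - bf \<psi>) k"
    by (simp add: fps_mult_nth bf_def atLeast0AtMost)
qed

lemma Ic_J_tc: assumes \<psi>: "\<psi> \<in> Adjp" shows "Ic * J tc \<rho> \<psi> = bf (sc \<psi>) - bf \<psi> + fps_const (beta \<psi>) * \<kappa>f"
proof (rule fps_ext)
  fix k
  have "fps_nth (Ic * J tc \<rho> \<psi>) k = br (sc \<psi>) (sc (\<phi> k)) - br \<psi> (\<phi> k)"
    unfolding Ic_J[OF \<psi> tc_loop] monodromy_tc[OF continuable_Sol_adj[OF \<psi>]] monodromy_tc[OF continuable_\<phi>] ..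
  also have "sc (\<phi> k) = \<phi> k + fps_const (\<kappa> k) * \<delta>" using sc_\<phi>[of k] by (simp add: algebra_simps)
  finally show "fps_nth (Ic * J tc \<rho> \<psi>) k = fps_nth (bf (sc \<psi>) - bf \<psi> + fps_const (beta \<psi>) * \<kappa>f) k"
    by (simp add: bf_def beta_def br_add_right br_scale_right)
qed

lemma tt_holomorphic: "(\<lambda>s. tt s n) holomorphic_on X"
  unfolding tt_def by (intro holomorphic_intros)

lemma Tf_add: "Tf (m + n) = Tf m * Tf n"
  unfolding tt_add by (rule fps_expansion_mult[OF open_UNIV UNIV_I tt_holomorphic tt_holomorphic])

definition Rf :: "complex fps" where "Rf = fps_expansion Rv \<rho>"

lemma Rv_holomorphic: "Rv holomorphic_on UNIV"
  unfolding Rv_eq[abs_def] by (intro holomorphic_intros tt_holomorphic)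

lemma Rf_eq: "Rf = (\<Sum>j\<le>d. fps_const (coeff R j) * Tf (- int j))"
proof -
  have "Rf = (\<Sum>j\<le>d. fps_expansion (\<lambda>s. tt s (- int j) * coeff R j) \<rho>)"
    unfolding Rf_def Rv_eq[abs_def]
    by (rule fps_expansion_sum[OF open_UNIV UNIV_I]) (intro holomorphic_intros tt_holomorphic)
  also have "\<dots> = (\<Sum>j\<le>d. Tf (- int j) * fps_expansion (\<lambda>s. coeff R j) \<rho>)"
    by (intro sum.cong refl fps_expansion_mult[OF open_UNIV UNIV_I tt_holomorphic]) (rule holomorphic_on_const)
  finally show ?thesis by (simp add: fps_expansion_const mult.commute)
qed

text \<open>\<open>R\<close> may vanish at \<open>exp (- 2 pi i \<rho>)\<close>, so only the series
  as a whole is known to be nonzero. If it were zero, \<open>R\<close> would vanish at every nonzero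
  number, since \<open>exp (- 2 pi i s)\<close> takes all these values.\<close>

lemma Rf_nonzero: "Rf \<noteq> 0"
proof
  assume "Rf = 0"
  then have eq: "fps_expansion Rv \<rho> = fps_expansion (\<lambda>_. 0) \<rho>" by (simp add: Rf_def fps_expansion_const)
  have "Rv z = 0" for z
    by (rule fps_expansion_identity[OF Rv_holomorphic holomorphic_on_const open_UNIV connected_UNIV UNIV_I eq UNIV_I])
  then have "poly R z = 0" if z: "z \<noteq> 0" for z
  proof -
    obtain s where "tt s 1 = inverse z" using tt_surj[of "inverse z"] z by auto
    moreover have "tt s (- 1) * tt s 1 = 1" by (simp flip: tt_add)
    ultimately have "tt s (- 1) * inverse z = 1" by simp
    then have "tt s (- 1) = z" using z by (simp add: field_simps)
    then show ?thesis using \<open>Rv s = 0\<close> by (simp add: Rv_def)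
  qed
  then have "- {0} \<subseteq> {z. poly R z = 0}" by auto
  moreover have "infinite (- {0} :: complex set)"
    by (simp add: Compl_eq_Diff_UNIV infinite_UNIV_char_0)
  ultimately show False using poly_roots_finite[OF R(1)] finite_subset by blast
qed

definition Gf :: "complex fps" where
  "Gf = (\<Sum>j<d. Tf (- int (Suc j)) * J t0 \<rho> (tail (Suc j))) + Rf * J tc \<rho> psi1"

lemma Gam0_expansion: "(\<lambda>x. Gam0 (\<rho> + x)) has_fps_expansion Gf"
proof -
  have c: "continuable A p (tail j)" "continuable A p psi1" for j
    by (rule continuable_Sol_adj[OF AK_Adj[OF tail_AK]], rule continuable_Sol_adj[OF AK_Adj[OF psi1(1)]])
  have E0: "E \<sigma>0 s (\<Sum>j\<in>N. fps_const (a j) * tail (Suc j)) = (\<Sum>j\<in>N. a j * E t0 s (tail (Suc j)))" for s a N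
  proof (induction N rule: infinite_finite_induct)
    case (insert x N)
    have "continuable A p (\<Sum>j\<in>N. fps_const (a j) * tail (Suc j))"
      by (rule continuable_sum) (rule continuable_scale[OF c(1)])
    from E_add[OF continuable_scale[OF c(1)] this loop_\<sigma>0, of s "a x" "Suc x"] insert show ?case
      using E_scale[OF c(1) loop_\<sigma>0] E_t0[OF c(1)] by simp
  qed (simp_all add: E_0[OF loop_\<sigma>0])
  have "Gam0 s = (\<Sum>j<d. tt s (- int (Suc j)) * E t0 s (tail (Suc j))) + Rv s * E tc s psi1" for s
    unfolding Gam0_def m0R_def mcR_def E0 E_scale[OF c(2) loop_\<sigma>c] E_tc[OF c(2)] ..
  moreover have "(\<lambda>x. (\<Sum>j<d. tt (\<rho> + x) (- int (Suc j)) * E t0 (\<rho> + x) (tail (Suc j))) + Rv (\<rho> + x) * E tc (\<rho> + x) psi1)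
      has_fps_expansion Gf"
    unfolding Gf_def Rf_def
    by (intro has_fps_expansion_add has_fps_expansion_sum has_fps_expansion_mult
          has_fps_expansion_at[OF tt_holomorphic open_UNIV UNIV_I] has_fps_expansion_at[OF Rv_holomorphic open_UNIV UNIV_I]
          E_has_expansion t0_loop tc_loop t0 tc c)
  ultimately show ?thesis by simp
qed

text \<open>Multiplied by \<open>I(s)\<close>, the \<sigma>0-integrals telescope by Horner's rule to
  minus \<open>Rf * bf eps\<close>, while the \<sigma>c-integral of \<open>psi1\<close> contributes
  \<open>Rf\<close> times \<open>bf eps + \<kappa>f\<close>; the terms with \<open>eps\<close>
  cancel.\<close>

lemma formal_identity: "Ic * Gf = Rf * \<kappa>f"
proof -
  have Adj: "tail j \<in> Adjp" "psi1 \<in> Adjp" for j by (rule AK_Adj[OF tail_AK], rule AK_Adj[OF psi1(1)])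
  define a where "a j = Tf (- int j) * bf (tail j)" for j
  have summand: "Ic * (Tf (- int (Suc j)) * J t0 \<rho> (tail (Suc j))) =
      (a j - a (Suc j)) - fps_const (coeff R j) * Tf (- int j) * bf eps" if j: "j < d" for j
  proof -
    have T: "Tf (- int (Suc j)) * Tf 1 = Tf (- int j)" by (simp flip: Tf_add)
    have "Ic * (Tf (- int (Suc j)) * J t0 \<rho> (tail (Suc j))) = Tf (- int (Suc j)) * (Ic * J t0 \<rho> (tail (Suc j)))"
      by (simp only: mult_ac)
    also have "\<dots> = (Tf (- int (Suc j)) * Tf 1) * bf (s0 (tail (Suc j))) - a (Suc j)"
      unfolding Ic_J_t0[OF Adj(1)] a_def by (simp only: right_diff_distrib mult.assoc)
    also have "\<dots> = Tf (- int j) * (bf (tail j) - fps_const (coeff R j) * bf eps) - a (Suc j)"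
      unfolding T s0_tail[OF j] bf_diff bf_scale ..
    finally show ?thesis unfolding a_def by (simp only: algebra_simps)
  qed
  have "Ic * Gf = (\<Sum>j<d. Ic * (Tf (- int (Suc j)) * J t0 \<rho> (tail (Suc j)))) + Rf * (Ic * J tc \<rho> psi1)"
    unfolding Gf_def by (simp only: distrib_left sum_distrib_left mult.left_commute)
  also have "(\<Sum>j<d. Ic * (Tf (- int (Suc j)) * J t0 \<rho> (tail (Suc j)))) =
      (\<Sum>j<d. (a j - a (Suc j)) - fps_const (coeff R j) * Tf (- int j) * bf eps)"
    by (intro sum.cong refl summand) simp
  also have "\<dots> = (a 0 - a d) - (\<Sum>j<d. fps_const (coeff R j) * Tf (- int j)) * bf eps"
    unfolding sum_subtractf[of "\<lambda>j. a j - a (Suc j)"] sum_lessThan_telescope' sum_distrib_right ..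
  also have "a 0 = 0"
    using bf_scale[of 0 0] by (simp add: a_def tail_0)
  also have "a d = fps_const (coeff R d) * Tf (- int d) * bf eps"
    unfolding a_def tail_d bf_scale by (simp only: mult_ac)
  also have "0 - fps_const (coeff R d) * Tf (- int d) * bf eps - (\<Sum>j<d. fps_const (coeff R j) * Tf (- int j)) * bf eps = - (Rf * bf eps)"
    unfolding Rf_eq lessThan_Suc_atMost[symmetric] by (simp add: algebra_simps)
  also have "Ic * J tc \<rho> psi1 = bf eps + \<kappa>f"
    unfolding Ic_J_tc[OF Adj(2)] psi1(2) eps_def bf_diff by simp
  finally show ?thesis by (simp add: algebra_simps)
qed

text \<open>By \<open>formal_identity\<close> the series of the \<open>\<kappa> n\<close> is a
  quotient of the expansions of two analytic functions, so it converges near \<open>\<rho>\<close>.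
  A zero of \<open>Rv\<close> at \<open>\<rho>\<close> is absorbed as a removable singularity, and
  the point \<open>\<rho>\<close> itself is left out.\<close>

lemma kappa_sums:
  "\<forall>\<^sub>F s in at \<rho>. (\<lambda>n. \<kappa> n * (s - \<rho>) ^ n) sums (I s / Rv s * Gam0 s)"
proof -
  have exI: "(\<lambda>x. I (\<rho> + x) * Gam0 (\<rho> + x)) has_fps_expansion Rf * \<kappa>f"
    unfolding formal_identity[symmetric]
    by (rule has_fps_expansion_mult[OF has_fps_expansion_at[OF I open_UNIV UNIV_I] Gam0_expansion])
  have exR: "(\<lambda>x. Rv (\<rho> + x)) has_fps_expansion Rf"
    unfolding Rf_def by (rule has_fps_expansion_at[OF Rv_holomorphic open_UNIV UNIV_I])
  have main: "\<forall>\<^sub>F x in at 0. (\<lambda>n. \<kappa> n * x ^ n) sums (I (\<rho> + x) / Rv (\<rho> + x) * Gam0 (\<rho> + x))"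
  \<comment> \<open>The division rule compares orders of vanishing, and the zero series has
    \<open>subdegree\<close> 0 by convention; so it is treated apart.\<close>
  proof (cases "\<kappa>f = 0")
    case True
    have "\<forall>\<^sub>F x in nhds 0. I (\<rho> + x) * Gam0 (\<rho> + x) = 0"
      using exI unfolding True by (simp add: has_fps_expansion_0_iff)
    moreover have "\<kappa> n = 0" for n using arg_cong[OF True, of "\<lambda>f. fps_nth f n"] by simp
    ultimately show ?thesis
      unfolding eventually_at_filter by (auto elim!: eventually_mono)
  next
    case False
    have "(\<lambda>x. if x = 0 then fps_nth (Rf * \<kappa>f) (subdegree Rf) / fps_nth Rf (subdegree Rf)
        else I (\<rho> + x) * Gam0 (\<rho> + x) / Rv (\<rho> + x)) has_fps_expansion (Rf * \<kappa>f / Rf)"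
      by (rule has_fps_expansion_divide[OF exI exR _ Rf_nonzero refl]) (simp add: False Rf_nonzero)
    moreover have "Rf * \<kappa>f / Rf = \<kappa>f" using Rf_nonzero by simp
    ultimately have ex: "(\<lambda>x. if x = 0 then fps_nth (Rf * \<kappa>f) (subdegree Rf) / fps_nth Rf (subdegree Rf)
        else I (\<rho> + x) * Gam0 (\<rho> + x) / Rv (\<rho> + x)) has_fps_expansion \<kappa>f" by simp
    then have rad: "fps_conv_radius \<kappa>f > 0" by (simp add: has_fps_expansion_def)
    then have "\<forall>\<^sub>F x in nhds 0. x \<in> eball 0 (fps_conv_radius \<kappa>f)"
      by (intro eventually_nhds_in_open) (auto simp: zero_ereal_def)
    moreover have "\<forall>\<^sub>F x in nhds 0. eval_fps \<kappa>f x = (if x = 0 then fps_nth (Rf * \<kappa>f) (subdegree Rf) / fps_nth Rf (subdegree Rf)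
        else I (\<rho> + x) * Gam0 (\<rho> + x) / Rv (\<rho> + x))"
      using ex by (simp add: has_fps_expansion_def)
    ultimately have "\<forall>\<^sub>F x in nhds 0. x \<noteq> 0 \<longrightarrow> (\<lambda>n. \<kappa> n * x ^ n) sums (I (\<rho> + x) / Rv (\<rho> + x) * Gam0 (\<rho> + x))"
    proof eventually_elim
      case (elim x)
      have "summable (\<lambda>n. fps_nth \<kappa>f n * x ^ n)" by (rule summable_fps) (use elim(1) in simp)
      then have "(\<lambda>n. \<kappa> n * x ^ n) sums eval_fps \<kappa>f x" unfolding eval_fps_def by (simp add: summable_sums)
      then show ?case using elim(2) by (cases "x = 0") simp_all
    qed
    then show ?thesis unfolding eventually_at_filter by (auto elim: eventually_mono)
  qed
  show ?thesis unfolding eventually_at_to_0[of _ \<rho>] using main by (simp add: add.commute)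
qed

end

end

section \<open>Frobenius functions\<close>

text \<open>The quotients \<open>(n + 1) / (n + \<rho> - x)\<close> tend to 1 and are therefore
  bounded, which is the estimate at \<open>s = \<rho>\<close> with a constant \<open>c\<close>;
  moving \<open>s\<close> by at most \<open>c / 2\<close> costs at most half of it.\<close>

lemma linear_lower_bound:
  fixes \<rho> x :: complex
  assumes "\<And>n::nat. n \<ge> 1 \<Longrightarrow> \<rho> + of_nat n \<noteq> x"
  shows "\<exists>\<epsilon>>0. \<exists>c>0. \<forall>n\<ge>1::nat. \<forall>s\<in>cball \<rho> \<epsilon>. c * (real n + 1) \<le> norm (of_nat n + s - x)"
proof -
  define f where "f n = (of_nat n + 1) / (of_nat n + (\<rho> - x))" for n :: nat
  have "(\<lambda>n. (1 + 1 / of_nat n) / (1 + (\<rho> - x) / of_nat n)) \<longlonglongrightarrow> (1 + 0) / (1 + 0)"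
    by (intro tendsto_intros lim_const_over_n) simp
  moreover have "\<forall>\<^sub>F n in sequentially. (1 + 1 / of_nat n) / (1 + (\<rho> - x) / of_nat n) = f n"
    using eventually_gt_at_top[of 0]
  proof eventually_elim
    case (elim n)
    then have "1 + 1 / of_nat n = (of_nat n + 1 :: complex) / of_nat n"
      "1 + (\<rho> - x) / of_nat n = (of_nat n + (\<rho> - x)) / of_nat n" by (simp_all add: add_divide_distrib)
    then show ?case using elim by (simp add: f_def)
  qed
  ultimately have "f \<longlonglongrightarrow> (1 + 0) / (1 + 0)" by (rule Lim_transform_eventually)
  then have "Bseq f" by (intro convergent_imp_Bseq convergentI)
  then obtain C where C: "C > 0" "\<And>n. norm (f n) \<le> C" unfolding Bseq_def by blast
  define c where "c = 1 / C"
  have c: "c > 0" using C(1) by (simp add: c_def)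
  have lower: "c * (real n + 1) \<le> norm (of_nat n + (\<rho> - x))" if "n \<ge> 1" for n
  proof -
    have nz: "of_nat n + (\<rho> - x) \<noteq> 0" using assms[OF that] by (simp add: algebra_simps)
    have "norm (of_nat n + 1 :: complex) = real n + 1" using norm_of_nat[of "Suc n", where 'a = complex] by (simp add: add.commute)
    then have "(real n + 1) / norm (of_nat n + (\<rho> - x)) \<le> C" using C(2)[of n] by (simp add: f_def norm_divide)
    then show ?thesis using nz C(1) by (simp add: c_def field_simps)
  qed
  have "c / 2 * (real n + 1) \<le> norm (of_nat n + s - x)" if n: "n \<ge> 1" and s: "s \<in> cball \<rho> (c / 2)" for n s
  proof -
    have "norm (of_nat n + (\<rho> - x)) \<le> norm (of_nat n + s - x) + norm (\<rho> - s)"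
      using norm_triangle_ineq[of "of_nat n + s - x" "\<rho> - s"] by (simp add: algebra_simps)
    moreover have "norm (\<rho> - s) \<le> c / 2" using s by (simp add: dist_norm)
    moreover have "c / 2 \<le> c / 2 * (real n + 1)" using c by (simp add: field_simps)
    ultimately show ?thesis using lower[OF n] by (simp add: field_simps)
  qed
  then have "\<forall>n\<ge>1. \<forall>s\<in>cball \<rho> (c / 2). c / 2 * (real n + 1) \<le> norm (of_nat n + s - x)" by blast
  moreover have "c / 2 > 0" using c by simp
  ultimately show ?thesis by blast
qed

text \<open>A root is split off by the fundamental theorem of algebra and its linear factor
  estimated by \<open>linear_lower_bound\<close>; the hypothesis prevents the root from being one of
  the points \<open>\<rho> + n\<close>.\<close>

lemma poly_lower_bound:
  fixes P :: "complex poly"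
  assumes "P \<noteq> 0" "\<And>n::nat. n \<ge> 1 \<Longrightarrow> poly P (\<rho> + of_nat n) \<noteq> 0"
  shows "\<exists>\<epsilon>>0. \<exists>c>0. \<forall>n\<ge>1::nat. \<forall>s\<in>cball \<rho> \<epsilon>. c * (real n + 1) ^ degree P \<le> norm (poly P (of_nat n + s))"
  using assms
proof (induction "degree P" arbitrary: P)
  case 0
  then obtain a where a: "P = [:a:]" by (metis degree_eq_zeroE)
  then show ?case using 0 by (intro exI[of _ 1] conjI exI[of _ "norm a"]) auto
next
  case (Suc d)
  obtain x where "(\<Sum>i\<le>degree P. coeff P i * x ^ i) = 0"
    by (rule fundamental_theorem_of_algebra[of "coeff P" "degree P"])
       (use Suc.hyps(2) Suc.prems(1) in \<open>auto intro!: bexI[of _ "degree P"]\<close>)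
  then have "poly P x = 0" by (simp add: poly_altdef)
  then obtain Q where Q: "P = [:- x, 1:] * Q" by (metis dvdE poly_eq_0_iff_dvd)
  have "Q \<noteq> 0" using Q Suc.prems(1) by auto
  then have dQ: "degree P = Suc (degree Q)" unfolding Q by (subst degree_mult_eq) auto
  have nzx: "\<rho> + of_nat n \<noteq> x" and nzQ: "poly Q (\<rho> + of_nat n) \<noteq> 0" if "n \<ge> 1" for n
    using Suc.prems(2)[OF that] by (auto simp: Q)
  have "d = degree Q" using dQ Suc.hyps(2) by simp
  from Suc.hyps(1)[OF this \<open>Q \<noteq> 0\<close> nzQ] obtain e1 c1 where 1: "e1 > 0" "c1 > 0"
    "\<And>n s. n \<ge> 1 \<Longrightarrow> s \<in> cball \<rho> e1 \<Longrightarrow> c1 * (real n + 1) ^ degree Q \<le> norm (poly Q (of_nat n + s))" by blast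
  obtain e2 c2 where 2: "e2 > 0" "c2 > 0"
    "\<And>n s. n \<ge> 1 \<Longrightarrow> s \<in> cball \<rho> e2 \<Longrightarrow> c2 * (real n + 1) \<le> norm (of_nat n + s - x)"
    using linear_lower_bound[OF nzx] by blast
  have "(c2 * c1) * (real n + 1) ^ degree P \<le> norm (poly P (of_nat n + s))"
    if n: "n \<ge> 1" and s: "s \<in> cball \<rho> (min e1 e2)" for n s
  proof -
    have "(c2 * (real n + 1)) * (c1 * (real n + 1) ^ degree Q) \<le> norm (of_nat n + s - x) * norm (poly Q (of_nat n + s))"
      using n s 1(2) 2(2) by (intro mult_mono 1(3) 2(3)) auto
    also have "\<dots> = norm (poly P (of_nat n + s))" by (simp add: Q norm_mult[symmetric] algebra_simps)
    finally show ?thesis by (simp add: dQ mult_ac)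
  qed
  then show ?case using 1(1,2) 2(1,2) by (intro exI[of _ "min e1 e2"] conjI exI[of _ "c2 * c1"]) auto
qed

text \<open>A geometric majorant reproduces itself: with \<open>(B (1 + C)) ^ m\<close> in place of
  \<open>b m\<close>, the convolution is \<open>B ^ n\<close> times a geometric sum equal to
  \<open>(1 + C) ^ n - 1\<close>.\<close>

lemma convolution_growth:
  fixes b :: "nat \<Rightarrow> real"
  assumes "C \<ge> 0" "B \<ge> 0" "b 0 \<le> 1" and b: "\<And>n. n \<ge> 1 \<Longrightarrow> b n \<le> (\<Sum>j\<in>{1..n}. C * B ^ j * b (n - j))"
  shows "b n \<le> (B * (1 + C)) ^ n"
proof (induction n rule: less_induct)
  case (less n)
  show ?case
  proof (cases "n = 0")
    case False
    then have "b n \<le> (\<Sum>j\<in>{1..n}. C * B ^ j * b (n - j))" using b by simp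
    also have "\<dots> \<le> (\<Sum>j\<in>{1..n}. C * B ^ j * (B * (1 + C)) ^ (n - j))"
      using assms(1,2) less False by (intro sum_mono mult_left_mono) auto
    also have "\<dots> = (\<Sum>j\<in>{1..n}. B ^ n * (C * (1 + C) ^ (n - j)))"
      by (intro sum.cong refl) (auto simp: power_mult_distrib power_add[symmetric] simp flip: mult.assoc)
    also have "\<dots> = B ^ n * (C * (\<Sum>i<n. (1 + C) ^ i))"
      unfolding sum_distrib_left
      by (rule sum.reindex_bij_witness[of _ "\<lambda>i. n - i" "\<lambda>j. n - j"]) auto
    also have "C * (\<Sum>i<n. (1 + C) ^ i) = (1 + C) ^ n - 1"
      using power_diff_1_eq[of "1 + C" n] by simp
    also have "B ^ n * ((1 + C) ^ n - 1) \<le> B ^ n * (1 + C) ^ n" using assms(2) by (intro mult_left_mono) auto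
    finally show ?thesis by (simp add: power_mult_distrib)
  qed (use assms in simp)
qed

section \<open>The coefficients of the Frobenius series\<close>

locale frobenius_setting =
  fixes r :: nat and q :: "nat \<Rightarrow> complex \<Rightarrow> complex" and \<rho> :: complex and e0 :: real
  assumes e0: "e0 > 0" and q_hol: "\<And>j. j \<le> r \<Longrightarrow> q j holomorphic_on ball 0 e0" and q00: "q 0 0 \<noteq> 0"
    and \<rho>: "\<rho> \<in> exponent_set r q"
begin

abbreviation Q :: "nat \<Rightarrow> complex fps" where "Q i \<equiv> fps_expansion (q i) 0"

lemma poly_D_poly: "poly (D_poly r q j) x = (\<Sum>i\<le>r. fps_nth (Q i) j * x ^ (r - i))"
  by (simp add: D_poly_def poly_sum poly_monom)

lemma coeff_D_poly_0: "coeff (D_poly r q 0) r = q 0 0"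
proof -
  have "coeff (D_poly r q 0) r = (\<Sum>i\<le>r. if i = 0 then fps_nth (Q i) 0 else 0)"
    unfolding D_poly_def coeff_sum coeff_monom by (intro sum.cong refl) auto
  then show ?thesis by (simp add: fps_expansion_nth_0)
qed

lemma degree_D_poly_0: "degree (D_poly r q 0) = r"
proof (rule antisym)
  show "degree (D_poly r q 0) \<le> r"
    unfolding D_poly_def by (intro degree_sum_le) (auto intro: order_trans[OF degree_monom_le])
  show "r \<le> degree (D_poly r q 0)" using coeff_D_poly_0 q00 by (intro le_degree) simp
qed

lemma Q_radius: "i \<le> r \<Longrightarrow> fps_conv_radius (Q i) \<ge> ereal e0"
  by (rule conv_radius_fps_expansion_ball[OF q_hol])

lemma Q_bound: "\<exists>C>0. \<exists>B>0. \<forall>i\<le>r. \<forall>j. norm (fps_nth (Q i) j) \<le> C * B ^ j"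
proof -
  define x where "x = e0 / 2"
  have x: "x > 0" using e0 by (simp add: x_def)
  have "\<exists>C>0. \<forall>j. norm (fps_nth (Q i) j) * x ^ j \<le> C" if "i \<le> r" for i
  proof -
    have "ereal (norm (of_real x :: complex)) < ereal e0" using e0 by (simp add: x_def)
    also have "ereal e0 \<le> fps_conv_radius (Q i)" by (rule Q_radius[OF that])
    finally have "summable (\<lambda>j. fps_nth (Q i) j * of_real x ^ j)" by (rule summable_fps)
    then have "Bseq (\<lambda>j. fps_nth (Q i) j * of_real x ^ j)"
      using summable_LIMSEQ_zero convergentI convergent_imp_Bseq by blast
    then obtain C where "C > 0" "\<And>j. norm (fps_nth (Q i) j * of_real x ^ j) \<le> C" unfolding Bseq_def by blast
    then show ?thesis using x by (auto simp: norm_mult norm_power)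
  qed
  then obtain C where C: "\<And>i. i \<le> r \<Longrightarrow> C i > 0" "\<And>i j. i \<le> r \<Longrightarrow> norm (fps_nth (Q i) j) * x ^ j \<le> C i" by metis
  have "norm (fps_nth (Q i) j) \<le> (\<Sum>i\<le>r. C i) * (1 / x) ^ j" if i: "i \<le> r" for i j
  proof -
    have "norm (fps_nth (Q i) j) * x ^ j \<le> (\<Sum>i\<le>r. C i)"
      using C(2)[OF i] member_le_sum[of i "{..r}" C] C(1) i by (force intro: order_trans less_imp_le)
    then show ?thesis using x by (simp add: power_divide field_simps)
  qed
  moreover have "(\<Sum>i\<le>r. C i) > 0" using C(1) by (intro sum_pos) auto
  ultimately show ?thesis using x by (intro exI[of _ "\<Sum>i\<le>r. C i"] conjI exI[of _ "1 / x"]) auto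
qed

text \<open>The indicial polynomial has degree exactly \<open>r\<close> because \<open>q 0 0\<close>
  is nonzero, so the denominators grow at least like \<open>(n + 1) ^ r\<close>, uniformly for
  \<open>s\<close> near \<open>\<rho>\<close>. The numerators grow at most like
  \<open>B1 ^ j * (n + 1) ^ r\<close>. The powers of \<open>n + 1\<close> cancel and
  \<open>convolution_growth\<close> applies.\<close>

lemma frob_coeff_bound:
  obtains \<epsilon> B where "\<epsilon> > 0" "B > 0"
    "\<And>n s. n \<ge> 1 \<Longrightarrow> s \<in> cball \<rho> \<epsilon> \<Longrightarrow> poly (D_poly r q 0) (of_nat n + s) \<noteq> 0"
    "\<And>n s. s \<in> cball \<rho> \<epsilon> \<Longrightarrow> norm (frob_coeff r q n s) \<le> B ^ n"
proof -
  have nz: "D_poly r q 0 \<noteq> 0" using coeff_D_poly_0 q00 by auto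
  have "\<And>n. n \<ge> 1 \<Longrightarrow> poly (D_poly r q 0) (\<rho> + of_nat n) \<noteq> 0"
    using \<rho> by (auto simp: exponent_set_def indicial_poly_def)
  from poly_lower_bound[OF nz this] obtain \<epsilon> c where \<epsilon>: "\<epsilon> > 0" and c: "c > 0"
    and low: "\<And>n s. n \<ge> 1 \<Longrightarrow> s \<in> cball \<rho> \<epsilon> \<Longrightarrow> c * (real n + 1) ^ r \<le> norm (poly (D_poly r q 0) (of_nat n + s))"
    unfolding degree_D_poly_0 by blast
  have pnz: "poly (D_poly r q 0) (of_nat n + s) \<noteq> 0" if "n \<ge> 1" "s \<in> cball \<rho> \<epsilon>" for n s
  proof -
    have "0 < c * (real n + 1) ^ r" using c by (intro mult_pos_pos zero_less_power) auto
    then show ?thesis using low[OF that] by auto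
  qed
  obtain C1 B1 where C1: "C1 > 0" "B1 > 0" and Qb: "\<And>i j. i \<le> r \<Longrightarrow> norm (fps_nth (Q i) j) \<le> C1 * B1 ^ j"
    using Q_bound by blast
  \<comment> \<open>\<open>T * (n + 1)\<close> bounds \<open>m + s\<close> for all
    \<open>m \<le> n\<close> and all \<open>s\<close> in the disk around
    \<open>\<rho>\<close>.\<close>
  define T where "T = norm \<rho> + \<epsilon> + 1"
  have T: "T \<ge> 1" using \<epsilon> by (simp add: T_def)
  define C where "C = (real r + 1) * C1 * T ^ r / c"
  have C: "C > 0" using C1 T c by (simp add: C_def)
  have up: "norm (poly (D_poly r q j) (of_nat m + s)) \<le> (real r + 1) * (C1 * B1 ^ j * (T * (real n + 1)) ^ r)"
    if m: "m \<le> n" and s: "s \<in> cball \<rho> \<epsilon>" for j m n s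
  proof -
    have "norm s \<le> norm \<rho> + \<epsilon>" using s norm_triangle_ineq2[of s \<rho>] by (simp add: dist_norm norm_minus_commute)
    then have "norm (of_nat m + s) \<le> real n + T"
      using norm_triangle_ineq[of "of_nat m" s] m by (simp add: T_def)
    also have "\<dots> \<le> T * (real n + 1)" using T mult_right_mono[of 1 T "real n"] by (simp add: algebra_simps)
    finally have b: "norm (of_nat m + s) \<le> T * (real n + 1)" .
    have one: "1 \<le> T * (real n + 1)" using T mult_mono[of 1 T 1 "real n + 1"] by simp
    have "norm (poly (D_poly r q j) (of_nat m + s)) \<le> (\<Sum>i\<le>r. norm (fps_nth (Q i) j * (of_nat m + s) ^ (r - i)))"
      unfolding poly_D_poly by (rule norm_sum)
    also have "\<dots> \<le> (\<Sum>i\<le>r. C1 * B1 ^ j * (T * (real n + 1)) ^ r)"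
    proof (rule sum_mono)
      fix i assume i: "i \<in> {..r}"
      have "norm ((of_nat m + s) ^ (r - i)) \<le> (T * (real n + 1)) ^ (r - i)"
        unfolding norm_power by (rule power_mono[OF b]) simp
      also have "\<dots> \<le> (T * (real n + 1)) ^ r" by (rule power_increasing[OF _ one]) simp
      finally show "norm (fps_nth (Q i) j * (of_nat m + s) ^ (r - i)) \<le> C1 * B1 ^ j * (T * (real n + 1)) ^ r"
        unfolding norm_mult using Qb[of i j] i C1 by (intro mult_mono) auto
    qed
    finally show ?thesis by (simp add: add.commute)
  qed
  have rec: "norm (frob_coeff r q n s) \<le> (\<Sum>j\<in>{1..n}. C * B1 ^ j * norm (frob_coeff r q (n - j) s))"
    if n: "n \<ge> 1" and s: "s \<in> cball \<rho> \<epsilon>" for n s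
  proof -
    let ?P = "norm (poly (D_poly r q 0) (of_nat n + s))"
    have P: "?P > 0" using pnz[OF n s] by simp
    have "norm (frob_coeff r q n s) =
        norm (\<Sum>j\<in>{1..n}. poly (D_poly r q j) (of_nat (n - j) + s) * frob_coeff r q (n - j) s) / ?P"
      using n by (subst frob_coeff.simps) (simp add: norm_divide)
    also have "\<dots> \<le> (\<Sum>j\<in>{1..n}. norm (poly (D_poly r q j) (of_nat (n - j) + s) * frob_coeff r q (n - j) s)) / ?P"
      by (intro divide_right_mono norm_sum) simp
    also have "\<dots> = (\<Sum>j\<in>{1..n}. norm (poly (D_poly r q j) (of_nat (n - j) + s)) / ?P * norm (frob_coeff r q (n - j) s))"
      by (simp add: sum_divide_distrib norm_mult)
    also have "\<dots> \<le> (\<Sum>j\<in>{1..n}. C * B1 ^ j * norm (frob_coeff r q (n - j) s))"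
    proof (intro sum_mono mult_right_mono norm_ge_zero)
      fix j
      have "norm (poly (D_poly r q j) (of_nat (n - j) + s)) \<le> (real r + 1) * (C1 * B1 ^ j * (T * (real n + 1)) ^ r)"
        by (rule up[OF _ s]) simp
      also have "\<dots> = C * B1 ^ j * (c * (real n + 1) ^ r)" using c by (simp add: C_def power_mult_distrib)
      also have "\<dots> \<le> C * B1 ^ j * ?P" using C C1 low[OF n s] by (intro mult_left_mono) auto
      finally show "norm (poly (D_poly r q j) (of_nat (n - j) + s)) / ?P \<le> C * B1 ^ j" using P by (simp add: divide_le_eq)
    qed
    finally show ?thesis .
  qed
  have "norm (frob_coeff r q n s) \<le> (B1 * (1 + C)) ^ n" if s: "s \<in> cball \<rho> \<epsilon>" for n s
    by (rule convolution_growth[OF _ _ _ rec[OF _ s]]) (use C C1 in \<open>auto simp: frob_coeff.simps\<close>)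
  moreover have "B1 * (1 + C) > 0" using C1 C by (intro mult_pos_pos) auto
  ultimately show ?thesis using that[OF \<epsilon> _ pnz] by blast
qed

definition ac :: "nat \<Rightarrow> complex fps" where "ac n = fps_expansion (frob_coeff r q n) \<rho>"

abbreviation at_exp :: "complex \<Rightarrow> complex fps" where "at_exp c \<equiv> fps_const c + fps_X"

text \<open>The Taylor series at \<open>s = \<rho>\<close> of the polynomial
  \<open>p\<^sub>j(m + s)\<close>.\<close>

definition pf :: "nat \<Rightarrow> nat \<Rightarrow> complex fps" where
  "pf j m = (\<Sum>i\<le>r. fps_const (fps_nth (Q i) j) * at_exp (of_nat m + \<rho>) ^ (r - i))"

lemma fps_expansion_poly_D_poly: "fps_expansion (\<lambda>s. poly (D_poly r q j) (of_nat m + s)) \<rho> = pf j m"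
proof -
  have pw: "fps_expansion (\<lambda>s. (of_nat m + s) ^ k) \<rho> = at_exp (of_nat m + \<rho>) ^ k" for k
  proof (induction k)
    case (Suc k)
    have "fps_expansion (\<lambda>s. (of_nat m + s) * (of_nat m + s) ^ k) \<rho> =
        fps_expansion (\<lambda>s. of_nat m + s) \<rho> * at_exp (of_nat m + \<rho>) ^ k"
      unfolding Suc[symmetric] by (rule fps_expansion_mult[OF open_UNIV UNIV_I]) (intro holomorphic_intros)+
    also have "fps_expansion (\<lambda>s. of_nat m + s) \<rho> = at_exp (of_nat m + \<rho>)"
      using fps_expansion_add[OF open_UNIV UNIV_I holomorphic_on_const holomorphic_on_ident, of "of_nat m" \<rho>]
      by (simp add: fps_expansion_const fps_expansion_ident flip: add.assoc)
    finally show ?case by simp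
  qed (use fps_expansion_const[of 1] in simp)
  have "fps_expansion (\<lambda>s. poly (D_poly r q j) (of_nat m + s)) \<rho> =
     (\<Sum>i\<le>r. fps_expansion (\<lambda>s. fps_nth (Q i) j * (of_nat m + s) ^ (r - i)) \<rho>)"
    unfolding poly_D_poly by (rule fps_expansion_sum[OF open_UNIV UNIV_I]) (intro holomorphic_intros)
  also have "\<dots> = pf j m"
    unfolding pf_def pw[symmetric]
    by (intro sum.cong refl, subst fps_expansion_mult[OF open_UNIV UNIV_I]) (auto intro!: holomorphic_intros simp: fps_expansion_const)
  finally show ?thesis .
qed

lemma frob_holomorphic:
  assumes "\<And>n s. n \<ge> 1 \<Longrightarrow> s \<in> X \<Longrightarrow> poly (D_poly r q 0) (of_nat n + s) \<noteq> 0"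
  shows "frob_coeff r q n holomorphic_on X"
proof (induction n rule: less_induct)
  case (less n)
  show ?case
  proof (cases "n = 0")
    case True
    have "frob_coeff r q n = (\<lambda>s. 1)" using True by (simp add: fun_eq_iff frob_coeff.simps)
    then show ?thesis by simp
  next
    case False
    have "frob_coeff r q n = (\<lambda>s. - (\<Sum>j\<in>{1..n}. poly (D_poly r q j) (of_nat (n - j) + s) * frob_coeff r q (n - j) s)
             / poly (D_poly r q 0) (of_nat n + s))"
      by (rule ext, subst frob_coeff.simps) (simp add: False)
    then show ?thesis
      unfolding poly_D_poly using False assms[unfolded poly_D_poly, of n]
      by (auto intro!: holomorphic_intros less)
  qed
qed

lemma ac_0: "ac 0 = 1"
proof -
  have "frob_coeff r q 0 = (\<lambda>s. 1)" by (simp add: fun_eq_iff frob_coeff.simps)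
  then show ?thesis by (simp add: ac_def fps_expansion_const)
qed

text \<open>The recursion multiplied by its denominator, read as an identity of Taylor series at
  \<open>\<rho>\<close>. All \<open>frob_coeff r q n\<close> are holomorphic on one disk, since the
  denominators have no zeros there for any \<open>n \<ge> 1\<close>.\<close>

lemma ac_rec: assumes "n \<ge> 1" shows "(\<Sum>j\<le>n. pf j (n - j) * ac (n - j)) = 0"
proof -
  obtain \<epsilon> where \<epsilon>: "\<epsilon> > 0"
    and nz: "\<And>n s. n \<ge> 1 \<Longrightarrow> s \<in> cball \<rho> \<epsilon> \<Longrightarrow> poly (D_poly r q 0) (of_nat n + s) \<noteq> 0"
    using frob_coeff_bound by metis
  have nzb: "poly (D_poly r q 0) (of_nat n + s) \<noteq> 0" if "n \<ge> 1" "s \<in> ball \<rho> \<epsilon>" for n s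
    using nz[OF that(1)] that(2) by simp
  have hol: "frob_coeff r q n holomorphic_on ball \<rho> \<epsilon>" for n by (rule frob_holomorphic[OF nzb])
  have hp: "(\<lambda>s. poly (D_poly r q j) (of_nat m + s)) holomorphic_on ball \<rho> \<epsilon>" for j m
    unfolding poly_D_poly by (intro holomorphic_intros)
  have "(\<Sum>j\<le>n. poly (D_poly r q j) (of_nat (n - j) + s) * frob_coeff r q (n - j) s) = 0" if s: "s \<in> ball \<rho> \<epsilon>" for s
  proof -
    let ?f = "\<lambda>j. poly (D_poly r q j) (of_nat (n - j) + s) * frob_coeff r q (n - j) s"
    have "?f 0 = - (\<Sum>j\<in>{1..n}. ?f j)"
      using assms nzb[OF assms s] by (subst (1) frob_coeff.simps) simp
    moreover have "(\<Sum>j\<le>n. ?f j) = ?f 0 + (\<Sum>j\<in>{1..n}. ?f j)"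
      unfolding atMost_atLeast0 by (subst sum.atLeast_Suc_atMost) simp_all
    ultimately show ?thesis by simp
  qed
  then have "fps_expansion (\<lambda>s. \<Sum>j\<le>n. poly (D_poly r q j) (of_nat (n - j) + s) * frob_coeff r q (n - j) s) \<rho> =
      fps_expansion (\<lambda>s. 0) \<rho>"
    using \<epsilon> by (intro fps_expansion_eq_on[OF open_ball]) auto
  also have "\<dots> = 0" using fps_expansion_const[of 0] by simp
  also have "fps_expansion (\<lambda>s. \<Sum>j\<le>n. poly (D_poly r q j) (of_nat (n - j) + s) * frob_coeff r q (n - j) s) \<rho> =
      (\<Sum>j\<le>n. fps_expansion (\<lambda>s. poly (D_poly r q j) (of_nat (n - j) + s) * frob_coeff r q (n - j) s) \<rho>)"
    by (rule fps_expansion_sum[OF open_ball _ holomorphic_on_mult[OF hp hol]]) (use \<epsilon> in simp)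
  finally have "(\<Sum>j\<le>n. fps_expansion (\<lambda>s. poly (D_poly r q j) (of_nat (n - j) + s) * frob_coeff r q (n - j) s) \<rho>) = 0" .
  moreover have "fps_expansion (\<lambda>s. poly (D_poly r q j) (of_nat m + s) * frob_coeff r q m s) \<rho> = pf j m * ac m" for j m
    using fps_expansion_mult[OF open_ball _ hp hol] \<epsilon> by (simp add: fps_expansion_poly_D_poly ac_def)
  ultimately show ?thesis by (simp del: of_nat_diff)
qed

text \<open>Cauchy's inequality on the circle of radius \<open>\<epsilon>\<close> turns the uniform
  bound \<open>B ^ n\<close> into \<open>B ^ n / \<epsilon> ^ k\<close> for the \<open>k\<close>-th
  Taylor coefficient; so \<open>1 / (2 * B)\<close> serves for all \<open>k\<close> at once.\<close>

lemma ac_radius: obtains R where "R > 0" "\<And>k. ereal R \<le> fps_conv_radius (Abs_fps (\<lambda>n. fps_nth (ac n) k))"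
proof -
  obtain \<epsilon> B where \<epsilon>: "\<epsilon> > 0" "B > 0"
    and nz: "\<And>n s. n \<ge> 1 \<Longrightarrow> s \<in> cball \<rho> \<epsilon> \<Longrightarrow> poly (D_poly r q 0) (of_nat n + s) \<noteq> 0"
    and bd: "\<And>n s. s \<in> cball \<rho> \<epsilon> \<Longrightarrow> norm (frob_coeff r q n s) \<le> B ^ n"
    using frob_coeff_bound by metis
  have hol: "frob_coeff r q n holomorphic_on cball \<rho> \<epsilon>" for n by (rule frob_holomorphic[OF nz])
  define R where "R = 1 / (2 * B)"
  have R: "R > 0" using \<epsilon> by (simp add: R_def)
  have "ereal R \<le> fps_conv_radius (Abs_fps (\<lambda>n. fps_nth (ac n) k))" for k
  proof -
    have bound: "norm (fps_nth (ac n) k) \<le> B ^ n / \<epsilon> ^ k" for n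
    proof -
      have "norm ((deriv ^^ k) (frob_coeff r q n) \<rho>) \<le> fact k * B ^ n / \<epsilon> ^ k"
      proof (rule Cauchy_inequality)
        show "frob_coeff r q n holomorphic_on ball \<rho> \<epsilon>" using hol holomorphic_on_subset ball_subset_cball by blast
        show "continuous_on (cball \<rho> \<epsilon>) (frob_coeff r q n)" by (rule holomorphic_on_imp_continuous_on[OF hol])
        show "norm (frob_coeff r q n x) \<le> B ^ n" if "norm (\<rho> - x) = \<epsilon>" for x
          by (rule bd) (use that in \<open>simp add: dist_norm\<close>)
      qed (rule \<epsilon>)
      then show ?thesis by (simp add: ac_def fps_expansion_def norm_divide field_simps)
    qed
    have "summable (\<lambda>n. fps_nth (ac n) k * of_real R ^ n)"
    proof (rule summable_comparison_test'[of "\<lambda>n. (1 / \<epsilon> ^ k) * (1 / 2) ^ n" 0])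
      show "summable (\<lambda>n. (1 / \<epsilon> ^ k) * (1 / 2 :: real) ^ n)" by (intro summable_mult summable_geometric) simp
      show "norm (fps_nth (ac n) k * of_real R ^ n) \<le> (1 / \<epsilon> ^ k) * (1 / 2) ^ n" for n
      proof -
        have "norm (fps_nth (ac n) k * of_real R ^ n) \<le> B ^ n / \<epsilon> ^ k * R ^ n"
          unfolding norm_mult norm_power using R bound \<epsilon> by (intro mult_mono) auto
        also have "\<dots> = (1 / \<epsilon> ^ k) * (B * R) ^ n" by (simp add: power_mult_distrib)
        also have "B * R = 1 / 2" using \<epsilon> by (simp add: R_def)
        finally show ?thesis .
      qed
    qed
    from conv_radius_geI[OF this] show ?thesis using R by (simp add: fps_conv_radius_def)
  qed
  then show ?thesis using that[OF R] by blast
qed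

text \<open>One radius for all \<open>k\<close>, and at most \<open>e0\<close>, so that the series
  and the coefficients \<open>q j\<close> live on the same disk.\<close>

definition rad :: real where
  "rad = (SOME R. R > 0 \<and> R \<le> e0 \<and> (\<forall>k. ereal R \<le> fps_conv_radius (Abs_fps (\<lambda>n. fps_nth (ac n) k))))"

lemma rad: "rad > 0" "rad \<le> e0" "ereal rad \<le> fps_conv_radius (Abs_fps (\<lambda>n. fps_nth (ac n) k))"
proof -
  obtain R where R: "R > 0" "\<And>k. ereal R \<le> fps_conv_radius (Abs_fps (\<lambda>n. fps_nth (ac n) k))" using ac_radius by metis
  have "\<exists>R>0. R \<le> e0 \<and> (\<forall>k. ereal R \<le> fps_conv_radius (Abs_fps (\<lambda>n. fps_nth (ac n) k)))"
    by (rule exI[of _ "min R e0"]) (use R e0 in \<open>auto intro: order_trans[of _ "ereal R"]\<close>)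
  from someI_ex[OF this, folded rad_def]
  show "rad > 0" "rad \<le> e0" "ereal rad \<le> fps_conv_radius (Abs_fps (\<lambda>n. fps_nth (ac n) k))" by blast+
qed

section \<open>The Frobenius series as functions of \<open>log t\<close>\<close>

fun fser :: "nat \<Rightarrow> nat \<Rightarrow> complex fps" where
  "fser 0 k = Abs_fps (\<lambda>n. fps_nth (ac n) k)"
| "fser (Suc m) k = fps_const \<rho> * fser m k + fps_X * fps_deriv (fser m k) + (if k = 0 then 0 else fser m (k - 1))"

text \<open>\<^term>\<open>fser m k\<close> collects the coefficients of the \<open>k\<close>-th power of \<open>s - \<rho>\<close> in \<open>(n + s) ^ m * a\<^sub>n(s)\<close>.\<close>

lemma fser_nth: "fps_nth (fser m k) n = fps_nth (at_exp (of_nat n + \<rho>) ^ m * ac n) k"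
proof (induction m arbitrary: k)
  case (Suc m)
  let ?B = "at_exp (of_nat n + \<rho>) ^ m * ac n"
  \<comment> \<open>The factor \<open>n + s\<close> is \<open>(n + \<rho>) + (s - \<rho>)\<close>:
    the first summand comes from \<open>\<rho> + t d/dt\<close>, the second takes the coefficient of
    index \<open>k - 1\<close>.\<close>
  have "fps_nth (fser (Suc m) k) n = (\<rho> + of_nat n) * fps_nth (fser m k) n + (if k = 0 then 0 else fps_nth (fser m (k - 1)) n)"
    by (cases n) (simp_all add: algebra_simps)
  also have "\<dots> = (\<rho> + of_nat n) * fps_nth ?B k + (if k = 0 then 0 else fps_nth ?B (k - 1))"
    unfolding Suc ..
  also have "\<dots> = fps_nth (at_exp (of_nat n + \<rho>) * ?B) k"
    by (simp add: distrib_right add.commute)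
  finally show ?case by (simp add: mult.assoc)
qed simp

lemma fser_radius: "ereal rad \<le> fps_conv_radius (fser m k)"
proof (induction m arbitrary: k)
  case (Suc m)
  let ?a = "fps_const \<rho> * fser m k" and ?b = "fps_X * fps_deriv (fser m k)" and ?c = "if k = 0 then 0 else fser m (k - 1)"
  have a: "ereal rad \<le> fps_conv_radius ?a"
    using fps_conv_radius_mult[of "fps_const \<rho>" "fser m k"] Suc[of k] by (simp add: min_def split: if_splits)
  have b: "ereal rad \<le> fps_conv_radius ?b"
    using fps_conv_radius_mult[of fps_X "fps_deriv (fser m k)"] fps_conv_radius_deriv[of "fser m k"] Suc[of k]
    by (auto simp: min_def split: if_splits)
  have c: "ereal rad \<le> fps_conv_radius ?c" using Suc by simp
  have "ereal rad \<le> fps_conv_radius (?a + ?b)"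
    by (rule order_trans[OF _ fps_conv_radius_add]) (use a b in simp)
  then have "ereal rad \<le> fps_conv_radius (?a + ?b + ?c)"
    by (intro order_trans[OF _ fps_conv_radius_add]) (use c in simp)
  then show ?case by simp
qed (simp add: rad)

definition Icoef :: "nat \<Rightarrow> complex" where
  "Icoef k = fps_nth (fps_expansion (poly (indicial_poly r q)) \<rho>) k"

text \<open>The coefficient of \<open>t ^ n\<close> is that of \<open>(s - \<rho>) ^ k\<close> in
  \<open>\<Sum>j\<le>n. p\<^sub>j(n - j + s) a\<^sub>n\<^sub>-\<^sub>j(s)\<close>. The recursion
  makes this sum zero for \<open>n \<ge> 1\<close>, and for \<open>n = 0\<close> it is
  \<open>I(s)\<close>.\<close>

lemma operator_fser: "(\<Sum>i\<le>r. Q i * fser (r - i) k) = fps_const (Icoef k)"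
proof (rule fps_ext)
  fix n
  have "fps_nth (\<Sum>i\<le>r. Q i * fser (r - i) k) n =
      (\<Sum>i\<le>r. \<Sum>j\<le>n. fps_nth (fps_const (fps_nth (Q i) j) * at_exp (of_nat (n - j) + \<rho>) ^ (r - i) * ac (n - j)) k)"
    by (simp add: fps_sum_nth fps_mult_nth[of "Q _"] atLeast0AtMost fser_nth mult.assoc del: of_nat_diff)
  also have "\<dots> = fps_nth (\<Sum>j\<le>n. pf j (n - j) * ac (n - j)) k"
    unfolding pf_def sum_distrib_right fps_sum_nth by (rule sum.swap)
  also have "\<dots> = fps_nth (fps_const (Icoef k)) n"
  proof (cases "n = 0")
    case True
    have "pf 0 0 = fps_expansion (poly (indicial_poly r q)) \<rho>"
      unfolding fps_expansion_poly_D_poly[symmetric] indicial_poly_def by simp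
    then show ?thesis using True by (simp add: ac_0 Icoef_def)
  next
    case False
    then show ?thesis using ac_rec[of n] by simp
  qed
  finally show "fps_nth (\<Sum>i\<le>r. Q i * fser (r - i) k) n = fps_nth (fps_const (Icoef k)) n" .
qed

text \<open>All logarithms of the points of the punctured disk of radius \<open>rad\<close>: a half
  plane on which every series \<open>fser m k\<close> converges at \<open>exp x\<close>.\<close>

definition W :: "complex set" where "W = {x. norm (exp x) < rad}"

lemma open_W: "open W" unfolding W_def by (intro open_Collect_less continuous_intros)

lemma W_radius: "x \<in> W \<Longrightarrow> ereal (norm (exp x)) < fps_conv_radius (fser m k)"
  unfolding W_def by (rule less_le_trans[OF _ fser_radius]) simp

text \<open>\<open>D\<^sup>m \<phi>\<^sub>\<rho>\<^sub>,\<^sub>k\<close> as a function of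
  \<open>x = log t\<close>.\<close>

definition flog :: "nat \<Rightarrow> nat \<Rightarrow> complex \<Rightarrow> complex" where
  "flog m k x = (\<Sum>j\<le>k. x ^ j / fact j * (exp (\<rho> * x) * eval_fps (fser m (k - j)) (exp x)))"

lemma frobenius_log_eq:
  assumes x: "x \<in> W" shows "frobenius_log r q \<rho> k x = flog 0 k x"
  unfolding frobenius_log_def flog_def
proof (intro sum.cong refl arg_cong2[of _ _ _ _ "(*)"])
  fix j
  have "summable (\<lambda>n. fps_nth (fser 0 (k - j)) n * exp x ^ n)" by (rule summable_fps[OF W_radius[OF x]])
  have e: "exp ((of_nat n + \<rho>) * x) = exp (\<rho> * x) * exp x ^ n" for n
    by (simp only: distrib_right exp_add exp_of_nat_mult mult.commute[of "exp x ^ n"])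
  from suminf_mult[OF \<open>summable _\<close>, of "exp (\<rho> * x)"]
  show "(\<Sum>n. (deriv ^^ (k - j)) (frob_coeff r q n) \<rho> / fact (k - j) * exp ((of_nat n + \<rho>) * x)) =
      exp (\<rho> * x) * eval_fps (fser 0 (k - j)) (exp x)"
    unfolding e by (simp add: eval_fps_def ac_def fps_expansion_def mult_ac)
qed

lemma eval_fser_deriv:
  assumes x: "x \<in> W"
  shows "((\<lambda>x. exp (\<rho> * x) * eval_fps (fser m k) (exp x)) has_field_derivative
     exp (\<rho> * x) * (eval_fps (fser (Suc m) k) (exp x) - (if k = 0 then 0 else eval_fps (fser m (k - 1)) (exp x)))) (at x)"
proof -
  note rad = W_radius[OF x]
  have rd: "ereal (norm (exp x)) < fps_conv_radius (fps_deriv (fser m k))"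
    using rad[of m k] fps_conv_radius_deriv[of "fser m k"] by (rule less_le_trans)
  have rc: "ereal (norm (exp x)) < fps_conv_radius (if k = 0 then 0 else fser m (k - 1))"
    using rad by simp
  have ra: "ereal (norm (exp x)) < fps_conv_radius (fps_const \<rho> * fser m k)"
    by (rule less_le_trans[OF _ fps_conv_radius_mult]) (use rad in simp)
  have rb: "ereal (norm (exp x)) < fps_conv_radius (fps_X * fps_deriv (fser m k))"
    by (rule less_le_trans[OF _ fps_conv_radius_mult]) (use rd in simp)
  have rab: "ereal (norm (exp x)) < fps_conv_radius (fps_const \<rho> * fser m k + fps_X * fps_deriv (fser m k))"
    by (rule less_le_trans[OF _ fps_conv_radius_add]) (use ra rb in simp)
  have eq: "eval_fps (fser (Suc m) k) (exp x) - (if k = 0 then 0 else eval_fps (fser m (k - 1)) (exp x)) =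
      \<rho> * eval_fps (fser m k) (exp x) + exp x * eval_fps (fps_deriv (fser m k)) (exp x)"
    unfolding fser.simps eval_fps_add[OF rab rc] eval_fps_add[OF ra rb]
    using rad rd by (simp add: eval_fps_mult)
  have "(eval_fps (fser m k) has_field_derivative eval_fps (fps_deriv (fser m k)) (exp x)) (at (exp x))"
    by (rule has_field_derivative_eval_fps[OF rad])
  note e = DERIV_chain2[OF this DERIV_exp]
  have d: "((\<lambda>x. exp (\<rho> * x)) has_field_derivative \<rho> * exp (\<rho> * x)) (at x)"
    by (auto intro!: derivative_eq_intros)
  from DERIV_mult[OF d e] show ?thesis unfolding eq by (rule DERIV_cong) (simp add: algebra_simps)
qed

lemma power_fact_deriv: "((\<lambda>x::complex. x ^ Suc i / fact (Suc i)) has_field_derivative x ^ i / fact i) (at x)"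
proof -
  have "((\<lambda>x. x ^ Suc i) has_field_derivative of_nat (Suc i) * x ^ i) (at x)"
    using DERIV_power[OF DERIV_ident, of "Suc i" x UNIV] by simp
  from DERIV_cdivide[OF this, of "fact (Suc i)"] show ?thesis by (simp del: of_nat_Suc power_Suc)
qed

text \<open>The derivative of \<open>x ^ j / fact j\<close> gives \<open>T j\<close>, and the term
  by which \<open>eval_fser_deriv\<close> differs from \<open>fser (Suc m)\<close> gives
  \<open>- T (Suc j)\<close>. These corrections cancel by telescoping over \<open>j\<close>.\<close>

lemma flog_deriv:
  assumes x: "x \<in> W" shows "(flog m k has_field_derivative flog (Suc m) k x) (at x)"
proof -
  let ?E = "\<lambda>m k x. exp (\<rho> * x) * eval_fps (fser m k) (exp x)"
  define T where "T j = (if j = 0 then 0 else x ^ (j - 1) / fact (j - 1) * ?E m (k - j) x)" for j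
  have "((\<lambda>x. x ^ j / fact j * ?E m (k - j) x) has_field_derivative
      x ^ j / fact j * ?E (Suc m) (k - j) x + (T j - T (Suc j))) (at x)" if j: "j < k" for j
  proof (cases j)
    case 0
    then show ?thesis using eval_fser_deriv[OF x, of m k] j by (simp add: T_def algebra_simps)
  next
    case (Suc i)
    have "((\<lambda>x. x ^ j / fact j) has_field_derivative x ^ i / fact i) (at x)"
      unfolding Suc by (rule power_fact_deriv)
    from DERIV_mult[OF this eval_fser_deriv[OF x, of m "k - j"]] show ?thesis
      by (rule DERIV_cong) (use j in \<open>simp add: T_def Suc algebra_simps\<close>)
  qed
  moreover have "((\<lambda>x. x ^ k / fact k * ?E m (k - k) x) has_field_derivative
      x ^ k / fact k * ?E (Suc m) (k - k) x + T k) (at x)"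
  proof (cases k)
    case 0
    then show ?thesis using eval_fser_deriv[OF x, of m 0] by (simp add: T_def)
  next
    case (Suc i)
    have "((\<lambda>x. x ^ k / fact k) has_field_derivative x ^ i / fact i) (at x)"
      unfolding Suc by (rule power_fact_deriv)
    from DERIV_mult[OF this eval_fser_deriv[OF x, of m "k - k"]] show ?thesis
      by (rule DERIV_cong) (simp add: T_def Suc algebra_simps)
  qed
  ultimately have "((\<lambda>x. (\<Sum>j<k. x ^ j / fact j * ?E m (k - j) x) + x ^ k / fact k * ?E m (k - k) x) has_field_derivative
      (\<Sum>j<k. x ^ j / fact j * ?E (Suc m) (k - j) x + (T j - T (Suc j))) + (x ^ k / fact k * ?E (Suc m) (k - k) x + T k)) (at x)"
    by (intro DERIV_add DERIV_sum) auto
  moreover have "(\<Sum>j<k. T j - T (Suc j)) = - T k"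
    unfolding sum_lessThan_telescope' by (simp add: T_def)
  ultimately show ?thesis
    by (simp add: flog_def[abs_def] lessThan_Suc_atMost[symmetric] sum.distrib add_ac)
qed

lemma flog_holomorphic: "flog m k holomorphic_on W"
  unfolding holomorphic_on_open[OF open_W] using flog_deriv by blast

lemma operator_flog:
  assumes x: "x \<in> W"
  shows "(\<Sum>i\<le>r. q i (exp x) * flog (r - i) k x) = (\<Sum>j\<le>k. Icoef (k - j) * (exp (\<rho> * x) * x ^ j / fact j))"
proof -
  have nx: "norm (exp x) < e0" using x rad(2) by (simp add: W_def)
  have qe: "q i (exp x) = eval_fps (Q i) (exp x)" if "i \<le> r" for i
    using germ_fun_fps_expansion[OF q_hol[OF that], of "exp x"] nx by simp
  have rQ: "ereal (norm (exp x)) < fps_conv_radius (Q i)" if "i \<le> r" for i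
    by (rule less_le_trans[OF _ Q_radius[OF that]]) (use nx in simp)
  have ev: "eval_fps (\<Sum>i\<in>N. Q i * fser (r - i) k) (exp x) = (\<Sum>i\<in>N. q i (exp x) * eval_fps (fser (r - i) k) (exp x)) \<and>
      ereal (norm (exp x)) < fps_conv_radius (\<Sum>i\<in>N. Q i * fser (r - i) k)" if "N \<subseteq> {..r}" "finite N" for N k
    using that(2,1)
  proof (induction N)
    case (insert i N)
    have i: "i \<le> r" using insert by simp
    have "ereal (norm (exp x)) < fps_conv_radius (Q i * fser (r - i) k)"
      by (rule less_le_trans[OF _ fps_conv_radius_mult]) (use rQ[OF i] W_radius[OF x] in simp)
    moreover have "ereal (norm (exp x)) < fps_conv_radius (Q i * fser (r - i) k + (\<Sum>i\<in>N. Q i * fser (r - i) k))"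
      by (rule less_le_trans[OF _ fps_conv_radius_add]) (use calculation insert in simp)
    ultimately show ?case
      using insert by (simp add: eval_fps_add eval_fps_mult[OF rQ[OF i] W_radius[OF x]] qe[OF i])
  qed simp
  have key: "(\<Sum>i\<le>r. q i (exp x) * eval_fps (fser (r - i) k) (exp x)) = Icoef k" for k
    using ev[of "{..r}" k] by (simp add: operator_fser)
  have "(\<Sum>i\<le>r. q i (exp x) * flog (r - i) k x) =
      (\<Sum>j\<le>k. \<Sum>i\<le>r. x ^ j / fact j * (exp (\<rho> * x) * (q i (exp x) * eval_fps (fser (r - i) (k - j)) (exp x))))"
    unfolding flog_def sum_distrib_left by (subst sum.swap) (simp add: mult_ac)
  also have "\<dots> = (\<Sum>j\<le>k. x ^ j / fact j * (exp (\<rho> * x) * Icoef (k - j)))"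
    unfolding sum_distrib_left[symmetric] key ..
  finally show ?thesis by (simp add: mult_ac)
qed

lemma frobenius_germ_near_0_eq:
  "l \<in> W \<Longrightarrow> exp l = z \<Longrightarrow> frobenius_germ_near_0 r q \<rho> k z l = log_germ (flog 0 k) z l"
  unfolding frobenius_germ_near_0_def log_germ_def[symmetric]
  by (rule log_germ_cong[OF open_W _ _ frobenius_log_eq])

lemma L_germ_flog:
  assumes l: "l \<in> W" "exp l = z"
  shows "L_germ r q z (log_germ (flog 0 k) z l) =
     (\<Sum>i\<le>k. fps_const (Icoef (k - i)) * log_germ (\<lambda>x. exp (\<rho> * x) * x ^ i / fact i) z l)"
proof -
  have D: "(D_germ z ^^ m) (log_germ (flog 0 k) z l) = log_germ (flog m k) z l" for m
  proof (induction m)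
    case (Suc m)
    have "D_germ z (log_germ (flog m k) z l) = log_germ (deriv (flog m k)) z l"
      by (rule D_germ_log_germ[OF open_W l flog_holomorphic])
    also have "\<dots> = log_germ (flog (Suc m) k) z l"
      by (rule log_germ_cong[OF open_W l]) (rule DERIV_imp_deriv[OF flog_deriv])
    finally show ?case by (simp add: Suc)
  qed simp
  have qh: "(\<lambda>x. q i (exp x)) holomorphic_on W" if "i \<le> r" for i
  proof -
    have "exp ` W \<subseteq> ball 0 e0" using rad(2) by (auto simp: W_def)
    from holomorphic_on_compose_gen[OF holomorphic_on_exp q_hol[OF that] this] show ?thesis by (simp add: o_def)
  qed
  have "L_germ r q z (log_germ (flog 0 k) z l) = (\<Sum>i\<le>r. log_germ (\<lambda>x. q i (exp x) * flog (r - i) k x) z l)"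
    unfolding L_germ_def D
    by (intro sum.cong refl) (simp add: log_germ_mult[OF open_W l qh flog_holomorphic] log_germ_exp[OF open_W l])
  also have "\<dots> = log_germ (\<lambda>x. \<Sum>i\<le>r. q i (exp x) * flog (r - i) k x) z l"
    by (rule log_germ_sum[OF open_W l, symmetric]) (simp add: holomorphic_on_mult qh flog_holomorphic)
  also have "\<dots> = log_germ (\<lambda>x. \<Sum>i\<le>k. Icoef (k - i) * (exp (\<rho> * x) * x ^ i / fact i)) z l"
    by (rule log_germ_cong[OF open_W l operator_flog])
  also have "\<dots> = (\<Sum>i\<le>k. log_germ (\<lambda>x. Icoef (k - i) * (exp (\<rho> * x) * x ^ i / fact i)) z l)"
    by (rule log_germ_sum[OF open_W l]) (intro holomorphic_intros, simp_all)
  also have "\<dots> = (\<Sum>i\<le>k. fps_const (Icoef (k - i)) * log_germ (\<lambda>x. exp (\<rho> * x) * x ^ i / fact i) z l)"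
    by (intro sum.cong refl log_germ_scale[OF open_W l]) (intro holomorphic_intros, simp_all)
  finally show ?thesis .
qed

text \<open>For fixed \<open>exp x\<close>, the values \<open>flog 0 k x\<close> are
  \<open>exp (\<rho> * x)\<close> times the coefficients of \<open>fps_exp x * G\<close>, with
  formal variable \<open>s - \<rho>\<close>. Adding \<open>2 pi i\<close> to \<open>x\<close>
  multiplies this series by the expansion of \<open>exp (2 pi i s)\<close> at
  \<open>\<rho>\<close>.\<close>

lemma flog_shift:
  "flog 0 k (x + 2 * pi * \<i>) = (\<Sum>i\<le>k. fps_nth (fps_expansion (\<lambda>s. tt s 1) \<rho>) i * flog 0 (k - i) x)"
proof -
  define w where "w = 2 * complex_of_real pi * \<i>"
  define G where "G = Abs_fps (\<lambda>k. eval_fps (fser 0 k) (exp x))"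
  have fl: "flog 0 k y = exp (\<rho> * y) * fps_nth (fps_exp y * G) k" if "exp y = exp x" for y k
    using that by (simp add: flog_def fps_mult_nth atLeast0AtMost G_def sum_distrib_left mult_ac)
  have "(\<lambda>s. tt (\<rho> + s) 1) has_fps_expansion fps_const (exp (w * \<rho>)) * fps_exp w"
  proof -
    have "(\<lambda>s. exp (w * \<rho>) * exp (w * s)) has_fps_expansion fps_const (exp (w * \<rho>)) * fps_exp w"
      by (intro fps_expansion_intros)
    then show ?thesis by (simp add: tt_def w_def exp_add[symmetric] algebra_simps)
  qed
  then have T: "fps_expansion (\<lambda>s. tt s 1) \<rho> = fps_const (exp (w * \<rho>)) * fps_exp w" by (rule fps_expansion_eqI_shift)
  have ew: "exp (x + w) = exp x" by (simp add: exp_add w_def)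
  have a: "fps_exp (x + w) * G = fps_exp w * (fps_exp x * G)" by (simp add: fps_exp_add_mult mult_ac)
  have b: "exp (\<rho> * (x + w)) = exp (\<rho> * x) * exp (w * \<rho>)" by (simp add: exp_add distrib_left mult.commute)
  have "flog 0 k (x + w) = exp (\<rho> * x) * fps_nth (fps_expansion (\<lambda>s. tt s 1) \<rho> * (fps_exp x * G)) k"
    unfolding fl[OF ew] T a b mult.assoc fps_mult_left_const_nth ..
  also have "\<dots> = (\<Sum>i\<le>k. fps_nth (fps_expansion (\<lambda>s. tt s 1) \<rho>) i * flog 0 (k - i) x)"
    unfolding fps_mult_nth[of "fps_expansion (\<lambda>s. tt s 1) \<rho>"] fl[OF refl]
    by (simp add: sum_distrib_left mult_ac atLeast0AtMost)
  finally show ?thesis by (simp add: w_def)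
qed

end

section \<open>Frobenius functions along the path and their monodromy around 0\<close>

locale frobenius_path = regular_operator r q A + frobenius_setting r q \<rho> e0
  for r q A \<rho> e0 +
  fixes \<gamma> lg \<sigma>0 :: "real \<Rightarrow> complex" and \<tau> :: real and D0 :: "complex set"
  assumes \<gamma>: "continuous_on {0..\<tau>} \<gamma>" "\<gamma> 0 = 0" "\<gamma> ` {0<..\<tau>} \<subseteq> D0 - {0}" and \<tau>: "0 < \<tau>"
    and lg: "continuous_on {0<..\<tau>} lg" "\<And>u. u \<in> {0<..\<tau>} \<Longrightarrow> exp (lg u) = \<gamma> u"
    and D0: "open D0" "simply_connected D0" "0 \<in> D0" "D0 - {0} \<subseteq> A"
    and \<sigma>0: "path \<sigma>0" "path_image \<sigma>0 \<subseteq> D0 - {0}" "pathstart \<sigma>0 = \<gamma> \<tau>" "pathfinish \<sigma>0 = \<gamma> \<tau>" "winding_number \<sigma>0 0 = 1"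
begin

abbreviation rhs :: "nat \<Rightarrow> complex \<Rightarrow> complex \<Rightarrow> complex fps" where
  "rhs k z l \<equiv> (\<Sum>i\<le>k. fps_const (Icoef (k - i)) * log_germ (\<lambda>x. exp (\<rho> * x) * x ^ i / fact i) z l)"

text \<open>\<open>v\<close> serves two purposes: up to this parameter the series represent the
  germs, and the disk through \<open>\<gamma> v\<close> lies in \<open>D0\<close>, so that a circle
  around 0 is available.\<close>

lemma near_0:
  obtains v where "0 < v" "v < \<tau>" "\<And>u. u \<in> {0<..v} \<Longrightarrow> lg u \<in> W" "cball 0 (norm (\<gamma> v)) \<subseteq> D0"
proof -
  obtain d0 where d0: "d0 > 0" "ball 0 d0 \<subseteq> D0" using openE[OF D0(1,3)] by blast
  have "min rad d0 > 0" using rad d0 by simp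
  then obtain d where d: "d > 0" "\<And>u. u \<in> {0..\<tau>} \<Longrightarrow> dist u 0 < d \<Longrightarrow> dist (\<gamma> u) (\<gamma> 0) < min rad d0"
    using \<gamma>(1) \<tau> unfolding continuous_on_iff by (metis atLeastAtMost_iff less_eq_real_def)
  define v where "v = min (d / 2) (\<tau> / 2)"
  have v: "0 < v" "v < \<tau>" using d \<tau> by (auto simp: v_def)
  have small: "norm (\<gamma> u) < min rad d0" if "u \<in> {0<..v}" for u
    using d(2)[of u] d(1) that v by (simp add: \<gamma>(2) v_def)
  have "lg u \<in> W" if u: "u \<in> {0<..v}" for u
    using small[OF u] lg(2)[of u] u v by (simp add: W_def del: norm_exp_eq_Re)
  moreover have "cball 0 (norm (\<gamma> v)) \<subseteq> D0" using small[of v] v d0(2) by (auto simp: subset_iff)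
  ultimately show ?thesis using that v by blast
qed

lemma \<gamma>_sub: "u \<in> {0<..\<tau>} \<Longrightarrow> \<gamma> u \<in> A"
  using \<gamma>(3) D0(4) by blast

text \<open>Up to \<open>v\<close> the germs are given by the series. Beyond \<open>v\<close> they
  are continued as solutions of the inhomogeneous equation, whose right-hand side is a function of
  the logarithm and continues along all of \<open>\<gamma>\<close>. The parameter 0 is excluded
  because \<open>\<gamma> 0 = 0\<close>.\<close>

lemma frobenius_continuation:
  assumes v: "0 < v" "v < \<tau>" "\<And>u. u \<in> {0<..v} \<Longrightarrow> lg u \<in> W"
  shows "\<exists>F. continuation_on {0<..\<tau>} \<gamma> F \<and> (\<forall>u\<in>{0<..v}. F u = log_germ (flog 0 k) (\<gamma> u) (lg u)) \<and>
    L_germ r q (\<gamma> \<tau>) (F \<tau>) = rhs k (\<gamma> \<tau>) (lg \<tau>)"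
proof -
  let ?F = "\<lambda>u. log_germ (flog 0 k) (\<gamma> u) (lg u)"
  have c\<gamma>: "continuous_on {v..\<tau>} \<gamma>" by (rule continuous_on_subset[OF \<gamma>(1)]) (use v in auto)
  have clg: "continuous_on {v..\<tau>} lg" by (rule continuous_on_subset[OF lg(1)]) (use v in auto)
  have hol: "(\<lambda>x. exp (\<rho> * x) * x ^ i / fact i) holomorphic_on UNIV" for i :: nat
    by (intro holomorphic_intros) simp_all
  have G: "continuation_on {v..\<tau>} \<gamma> (\<lambda>u. rhs k (\<gamma> u) (lg u))"
    by (intro continuation_on_sum c\<gamma> continuation_on_scale continuation_on_log_germ[OF hol open_UNIV clg])
       (use lg(2) v in auto)
  have "\<gamma> ` {v..\<tau>} \<subseteq> A" using \<gamma>_sub v by auto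
  moreover have "L_germ r q (\<gamma> v) (?F v) = rhs k (\<gamma> v) (lg v)" by (rule L_germ_flog) (use v lg(2) in auto)
  ultimately obtain F' where F': "continuation_on {v..\<tau>} \<gamma> F'" "F' v = ?F v"
    "\<And>u. u \<in> {v..\<tau>} \<Longrightarrow> L_germ r q (\<gamma> u) (F' u) = rhs k (\<gamma> u) (lg u)"
    using continuation_L[OF G, of "?F v"] v by auto
  define F where "F u = (if u \<le> v then ?F u else F' u)" for u
  have I: "{0<..\<tau>} \<inter> {..v} = {0<..v}" "{0<..\<tau>} \<inter> {v..} = {v..\<tau>}" using v by auto
  have "continuation_on {0<..\<tau>} \<gamma> F"
  proof (rule continuation_on_glue[where b = v], unfold I)
    have "continuation_on {0<..v} \<gamma> ?F"
      by (rule continuation_on_log_germ[OF flog_holomorphic open_W])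
         (use v lg in \<open>auto intro: continuous_on_subset\<close>)
    then show "continuation_on {0<..v} \<gamma> F" by (rule continuation_on_cong) (simp_all add: F_def)
    show "continuation_on {v..\<tau>} \<gamma> F" by (rule continuation_on_cong[OF F'(1)]) (auto simp: F_def F'(2))
  qed (use v in simp)
  moreover have "L_germ r q (\<gamma> \<tau>) (F \<tau>) = rhs k (\<gamma> \<tau>) (lg \<tau>)" using F'(3)[of \<tau>] v by (simp add: F_def)
  ultimately show ?thesis by (intro exI[of _ F]) (simp add: F_def)
qed

text \<open>Every small starting parameter \<open>u\<close> leads to the same germ at
  \<open>\<gamma> \<tau>\<close>, namely the end of one continuation over
  \<open>{0<..\<tau>}\<close>; this settles the definite description.\<close>

lemma frobenius_function_eq:
  assumes F: "continuation_on {0<..\<tau>} \<gamma> F" and v: "0 < v" "v < \<tau>" "\<And>u. u \<in> {0<..v} \<Longrightarrow> lg u \<in> W"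
    and Fv: "\<And>u. u \<in> {0<..v} \<Longrightarrow> F u = log_germ (flog 0 k) (\<gamma> u) (lg u)"
  shows "frobenius_function r q \<gamma> lg \<tau> \<rho> k = F \<tau>"
proof -
  have val: "continue (subpath u \<tau> \<gamma>) (frobenius_germ_near_0 r q \<rho> k (\<gamma> u) (lg u)) 1 = F \<tau>" if u: "0 < u" "u < v" for u
  proof -
    have "continuation_on {u..\<tau>} \<gamma> F" by (rule continuation_on_subset[OF F]) (use u in auto)
    then have "continuation_on {0..1} (subpath u \<tau> \<gamma>) (\<lambda>x. F ((\<tau> - u) * x + u))"
      by (rule continuation_on_subpath) (use u v in simp)
    from continue_eq[OF this _ refl, of 1] have "continue (subpath u \<tau> \<gamma>) (F u) 1 = F \<tau>" by simp
    moreover have "frobenius_germ_near_0 r q \<rho> k (\<gamma> u) (lg u) = log_germ (flog 0 k) (\<gamma> u) (lg u)"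
      by (rule frobenius_germ_near_0_eq[OF v(3) lg(2)]) (use u v in auto)
    ultimately show ?thesis using Fv[of u] u by simp
  qed
  have ev: "\<forall>\<^sub>F u in at_right 0. continue (subpath u \<tau> \<gamma>) (frobenius_germ_near_0 r q \<rho> k (\<gamma> u) (lg u)) 1 = F \<tau>"
    unfolding eventually_at_right_field using v(1) val by blast
  show ?thesis unfolding frobenius_function_def
  proof (rule the_equality)
    show "\<forall>\<^sub>F u in at_right 0. continue (subpath u \<tau> \<gamma>) (frobenius_germ_near_0 r q \<rho> k (\<gamma> u) (lg u)) 1 = F \<tau>"
      by (rule ev)
    fix f assume "\<forall>\<^sub>F u in at_right 0. continue (subpath u \<tau> \<gamma>) (frobenius_germ_near_0 r q \<rho> k (\<gamma> u) (lg u)) 1 = f"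
    with ev have "\<forall>\<^sub>F u in at_right (0::real). f = F \<tau>" by eventually_elim simp
    then show "f = F \<tau>" by (simp add: trivial_limit_at_right_real)
  qed
qed

lemma L_frobenius: "L_germ r q (\<gamma> \<tau>) (frobenius_function r q \<gamma> lg \<tau> \<rho> k) = rhs k (\<gamma> \<tau>) (lg \<tau>)"
proof -
  obtain v where v: "0 < v" "v < \<tau>" "\<And>u. u \<in> {0<..v} \<Longrightarrow> lg u \<in> W" by (rule near_0) (rule that; assumption)
  from frobenius_continuation[OF v] obtain F where F: "continuation_on {0<..\<tau>} \<gamma> F"
    "\<forall>u\<in>{0<..v}. F u = log_germ (flog 0 k) (\<gamma> u) (lg u)" "L_germ r q (\<gamma> \<tau>) (F \<tau>) = rhs k (\<gamma> \<tau>) (lg \<tau>)" by blast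
  show ?thesis using F(3) frobenius_function_eq[OF F(1) v] F(2) by simp
qed

lemma winding_number_circle:
  assumes "z \<noteq> 0"
  shows "winding_number (\<lambda>x. z * exp (2 * pi * \<i> * of_real x)) 0 = 1"
proof -
  let ?\<eta> = "\<lambda>x. z * exp (2 * pi * \<i> * of_real x)"
  have der: "(?\<eta> has_vector_derivative 2 * pi * \<i> * ?\<eta> x) (at x within X)" for x X
    by (rule has_vector_derivative_real_field) (auto intro!: derivative_eq_intros)
  have "valid_path ?\<eta>"
    unfolding valid_path_def by (rule C1_differentiable_imp_piecewise)
       (use der in \<open>auto simp: C1_differentiable_on_def intro!: exI[of _ "\<lambda>x. 2 * pi * \<i> * ?\<eta> x"] continuous_intros\<close>)
  then have "winding_number ?\<eta> 0 = 1 / (2 * pi * \<i>) * contour_integral ?\<eta> (\<lambda>w. 1 / (w - 0))"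
    by (rule winding_number_valid_path) (use assms in \<open>auto simp: path_image_def\<close>)
  also have "contour_integral ?\<eta> (\<lambda>w. 1 / (w - 0)) = integral {0..1} (\<lambda>x::real. 2 * pi * \<i>)"
    unfolding contour_integral_integral vector_derivative_at[OF der] by (rule integral_cong) (use assms in simp)
  finally show ?thesis by simp
qed

text \<open>In the punctured domain \<open>\<sigma>0\<close> is homotopic to the loop that runs back
  along \<open>\<gamma>\<close> to \<open>\<gamma> v\<close>, once around the circle through this
  point, and forth again. On the circle the series is available and the logarithm grows by
  \<open>2 pi i\<close>, so \<open>flog_shift\<close> applies.\<close>

lemma monodromy_frobenius:
  "monodromy \<sigma>0 (frobenius_function r q \<gamma> lg \<tau> \<rho> k) =
     (\<Sum>i\<le>k. fps_const (fps_nth (fps_expansion (\<lambda>s. tt s 1) \<rho>) i) * frobenius_function r q \<gamma> lg \<tau> \<rho> (k - i))"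
proof -
  let ?e = "\<lambda>i. fps_nth (fps_expansion (\<lambda>s. tt s 1) \<rho>) i" and ?ff = "frobenius_function r q \<gamma> lg \<tau> \<rho>"
  obtain v where v: "0 < v" "v < \<tau>" "\<And>u. u \<in> {0<..v} \<Longrightarrow> lg u \<in> W" and cb: "cball 0 (norm (\<gamma> v)) \<subseteq> D0"
    by (rule near_0) (rule that; assumption)
  have "\<forall>k. \<exists>F. continuation_on {0<..\<tau>} \<gamma> F \<and> (\<forall>u\<in>{0<..v}. F u = log_germ (flog 0 k) (\<gamma> u) (lg u))"
    using frobenius_continuation[OF v] by blast
  then obtain F where F: "\<And>k. continuation_on {0<..\<tau>} \<gamma> (F k)"
     "\<And>k u. u \<in> {0<..v} \<Longrightarrow> F k u = log_germ (flog 0 k) (\<gamma> u) (lg u)" by metis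
  have ff: "?ff k = F k \<tau>" for k by (rule frobenius_function_eq[OF F(1) v F(2)])
  have ev: "exp (lg v) = \<gamma> v" and lW: "lg v \<in> W" using lg(2) v by auto
  have \<gamma>v: "\<gamma> v \<in> D0 - {0}" by (rule subsetD[OF \<gamma>(3) imageI]) (use v in simp)
  define \<beta> where "\<beta> = subpath v \<tau> \<gamma>"
  define B where "B k x = F k ((\<tau> - v) * x + v)" for k x
  have B: "continuation_on {0..1} \<beta> (B k)" for k
    unfolding \<beta>_def B_def[abs_def]
    by (rule continuation_on_subpath[OF continuation_on_subset[OF F(1)]]) (use v in auto)
  then have path\<beta>: "path \<beta>" by (simp add: continuation_on_def path_def)
  have im\<beta>: "path_image \<beta> \<subseteq> D0 - {0}" 
  proof -
    have "\<gamma> ` {v..\<tau>} \<subseteq> \<gamma> ` {0<..\<tau>}" by (rule image_mono) (use v in auto)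
    then show ?thesis using \<gamma>(3) v by (simp add: \<beta>_def path_image_subpath)
  qed
  define \<eta> where "\<eta> x = \<gamma> v * exp (2 * pi * \<i> * of_real x)" for x :: real
  define H where "H k x = log_germ (flog 0 k) (\<eta> x) (lg v + 2 * pi * \<i> * of_real x)" for k x
  have H: "continuation_on {0..1} \<eta> (H k)" for k
    unfolding H_def[abs_def]
    by (rule continuation_on_log_germ[OF flog_holomorphic open_W])
       (use lW in \<open>auto simp: W_def exp_add ev \<eta>_def norm_mult intro!: continuous_intros\<close>)
  then have path\<eta>: "path \<eta>" by (simp add: continuation_on_def path_def)
  have im\<eta>: "path_image \<eta> \<subseteq> D0 - {0}" using cb \<gamma>v by (auto simp: path_image_def \<eta>_def norm_mult subset_iff)
  have "exp (2 * complex_of_real pi * \<i>) = 1" by simp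
  then have ends: "\<beta> 0 = \<gamma> v" "\<beta> 1 = \<gamma> \<tau>" "\<eta> 0 = \<gamma> v" "\<eta> 1 = \<gamma> v" by (simp_all add: \<beta>_def subpath_def \<eta>_def)
  have B0: "B k 0 = log_germ (flog 0 k) (\<gamma> v) (lg v)" for k using F(2)[of v] v by (simp add: B_def)
  have H0: "H k 0 = B k 0" by (simp add: B0 H_def ends)
  have H1: "H k 1 = (\<Sum>i\<le>k. fps_const (?e i) * B (k - i) 0)"
  proof -
    have "H k 1 = log_germ (\<lambda>x. flog 0 k (x + 2 * pi * \<i>)) (\<gamma> v) (lg v)" by (simp add: H_def ends log_germ_shift)
    also have "\<dots> = (\<Sum>i\<le>k. log_germ (\<lambda>x. ?e i * flog 0 (k - i) x) (\<gamma> v) (lg v))"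
      unfolding flog_shift
      by (rule log_germ_sum[OF open_W lW ev]) (rule holomorphic_on_mult[OF holomorphic_on_const flog_holomorphic])
    finally show ?thesis by (simp add: log_germ_scale[OF open_W lW ev flog_holomorphic] B0)
  qed
  define \<mu> where "\<mu> = reversepath \<beta> +++ (\<eta> +++ \<beta>)"
  have S: "continuation_on {0..1} \<beta> (\<lambda>x. \<Sum>i\<le>k. fps_const (?e i) * B (k - i) x)"
    by (intro continuation_on_sum continuation_on_scale B) (use path\<beta> in \<open>simp add: path_def\<close>)
  have J: "continuation_on {0..1} (\<eta> +++ \<beta>)
      (\<lambda>u. if u \<le> 1/2 then H k (2*u) else (\<Sum>i\<le>k. fps_const (?e i) * B (k - i) (2*u - 1)))"
    by (rule continuation_on_join[OF H S]) (simp_all add: H1 ends)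
  have "continuation_on {0..1} \<mu> (\<lambda>u. if u \<le> 1/2 then B k (1 - 2*u) else
      (if 2*u - 1 \<le> 1/2 then H k (2*(2*u - 1)) else (\<Sum>i\<le>k. fps_const (?e i) * B (k - i) (2*(2*u - 1) - 1))))"
    unfolding \<mu>_def
    by (rule continuation_on_join[OF continuation_on_reversepath[OF B] J]) (simp_all add: H0 ends reversepath_def joinpaths_def)
  from monodromy_eq[OF this] have mu: "monodromy \<mu> (?ff k) = (\<Sum>i\<le>k. fps_const (?e i) * ?ff (k - i))"
    by (simp add: B_def ff)
  have p\<mu>: "path \<mu>" "path_image \<mu> \<subseteq> D0 - {0}" "pathstart \<mu> = \<gamma> \<tau>" "pathfinish \<mu> = \<gamma> \<tau>"
    using path\<beta> path\<eta> im\<beta> im\<eta> ends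
    by (simp_all add: \<mu>_def path_image_join pathstart_def[of \<beta>] pathfinish_def[of \<beta>] pathstart_def[of \<eta>] pathfinish_def[of \<eta>])
  have se: "pathstart \<beta> = \<gamma> v" "pathfinish \<beta> = \<gamma> \<tau>" "pathstart \<eta> = \<gamma> v" "pathfinish \<eta> = \<gamma> v"
    using ends by (simp_all add: pathstart_def pathfinish_def)
  have n0: "0 \<notin> path_image \<beta>" "0 \<notin> path_image \<eta>" "0 \<notin> path_image \<mu>" "0 \<notin> path_image \<sigma>0"
    using im\<beta> im\<eta> p\<mu>(2) \<sigma>0(2) by auto
  have "winding_number \<eta> 0 = 1" unfolding \<eta>_def[abs_def] by (rule winding_number_circle) (use \<gamma>v in simp)
  then have "winding_number \<mu> 0 = 1"
    unfolding \<mu>_def using path\<beta> path\<eta> n0 se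
    by (simp add: winding_number_join winding_number_reversepath path_image_join)
  \<comment> \<open>Both loops wind once around 0, so \<open>\<sigma>0\<close> followed by the
    reversed \<open>\<mu>\<close> contracts in the punctured domain, which makes the two loops
    homotopic.\<close>
  then have w: "winding_number (\<sigma>0 +++ reversepath \<mu>) 0 = 0"
    using \<sigma>0 p\<mu> n0 by (simp add: winding_number_join winding_number_reversepath)
  have "homotopic_paths (D0 - {0}) (\<sigma>0 +++ reversepath \<mu>) (linepath (pathstart (\<sigma>0 +++ reversepath \<mu>)) (pathstart (\<sigma>0 +++ reversepath \<mu>)))"
    by (rule winding_0_imp_null_homotopic[OF D0(1-3) _ _ _ w]) (use \<sigma>0 p\<mu> in \<open>simp_all add: path_image_join\<close>)
  from homotopic_paths_imp_homotopic_loops[OF this]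
  have "homotopic_loops (D0 - {0}) (\<sigma>0 +++ reversepath \<mu>) (linepath (\<gamma> \<tau>) (\<gamma> \<tau>))"
    using \<sigma>0(3) p\<mu>(3) by simp
  from homotopic_paths_loop_parts[OF this p\<mu>(1)] have hom: "homotopic_paths (D0 - {0}) \<sigma>0 \<mu>" .
  have \<tau>A: "\<gamma> \<tau> \<in> A" and el: "exp (lg \<tau>) = \<gamma> \<tau>" using \<gamma>_sub lg(2) \<tau> by auto
  have "continuable A (\<gamma> \<tau>) (log_germ (\<lambda>x. exp (\<rho> * x) * x ^ i / fact i) (\<gamma> \<tau>) (lg \<tau>))" for i
  proof (rule continuable_subset[OF monodromy_log_germ(2)[OF _ el \<sigma>0(1)]])
    show "(\<lambda>x. exp (\<rho> * x) * x ^ i / fact i) holomorphic_on UNIV" by (intro holomorphic_intros) simp_all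
    show "path_image \<sigma>0 \<subseteq> - {0}" using \<sigma>0(2) by blast
    show "A \<subseteq> - {0}" using A(2) by blast
  qed (rule \<sigma>0)+
  then have "continuable A (\<gamma> \<tau>) (L_germ r q (\<gamma> \<tau>) (?ff k))"
    unfolding L_frobenius by (intro continuable_sum continuable_scale)
  then have "continuable A (\<gamma> \<tau>) (?ff k)" by (rule continuable_L)
  then have "continuable (D0 - {0}) (\<gamma> \<tau>) (?ff k)" by (rule continuable_subset[OF _ D0(4)])
  from monodromy_homotopic[OF this hom \<sigma>0(3)] mu show ?thesis by simp
qed

end

section \<open>Passage to the geometric setting\<close>

lemma rational_on_holomorphic:
  assumes "rational_on A f" shows "f holomorphic_on A"
proof -
  obtain a b where ab: "\<And>t. t \<in> A \<Longrightarrow> poly b t \<noteq> 0" "\<And>t. t \<in> A \<Longrightarrow> f t = poly a t / poly b t"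
    using assms unfolding rational_on_def by blast
  have "(\<lambda>t. poly a t / poly b t) holomorphic_on A"
    unfolding poly_altdef by (intro holomorphic_intros) (use ab(1) in \<open>simp add: poly_altdef\<close>)
  then show ?thesis by (rule holomorphic_transform) (simp add: ab(2))
qed

lemma homotopic_polynomial_path:
  fixes g :: "real \<Rightarrow> complex"
  assumes "path g" "open X" "path_image g \<subseteq> X"
  shows "\<exists>h. polynomial_function h \<and> homotopic_paths X g h"
proof -
  obtain e where e: "e > 0" "\<And>h. path h \<Longrightarrow> pathstart h = pathstart g \<Longrightarrow> pathfinish h = pathfinish g \<Longrightarrow>
      (\<And>t. t \<in> {0..1} \<Longrightarrow> norm (h t - g t) < e) \<Longrightarrow> homotopic_paths X g h"
    using homotopic_nearby_paths[OF assms] by metis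
  obtain h where "polynomial_function h" "pathstart h = pathstart g" "pathfinish h = pathfinish g"
      "\<And>t. t \<in> {0..1} \<Longrightarrow> norm (h t - g t) < e"
    using path_approx_polynomial_function[OF assms(1) e(1)] by metis
  then show ?thesis using e(2) path_polynomial_function by blast
qed

lemma germ_dim_0: "germ_space.dim {0} = 0"
  using germ_space.dim_eq_card[of "{}" "{0}"] germ_space.span_insert_0[of "{}"] germ_space.independent_empty by simp

lemma Sol_order_0: "q 0 p \<noteq> 0 \<Longrightarrow> f \<in> Sol 0 q p \<Longrightarrow> f = 0"
  using fps_expansion_nth_0[of "q 0" p] by (auto simp: Sol_def L_germ_def)

theorem theorem3p14:
  fixes S :: "complex set" and r :: nat and q :: "nat \<Rightarrow> complex \<Rightarrow> complex"
    and K :: "complex set" and SolK :: "complex fps set"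
    and c p :: complex and D0 Dc V0 Vc V U :: "complex set"
    and \<gamma> lg \<sigma>0 \<sigma>c :: "real \<Rightarrow> complex" and \<tau> :: real
    and \<delta> :: "complex fps" and R :: "complex poly"
  defines "U \<equiv> - S"
    and "V0 \<equiv> D0 - {0}" and "Vc \<equiv> Dc - {c}" and "V \<equiv> V0 \<union> Vc"
  assumes "finite S" and "0 \<in> S"
    and "\<And>j. j \<le> r \<Longrightarrow> rational_on (U \<union> {0}) (q j)"
    and "\<And>t. t \<in> U \<union> {0} \<Longrightarrow> q 0 t \<noteq> 0"
    and "regular_singularities S r q"
    and "complex_subfield K"
    and "rational_structure K (Sol r q p) SolK"
    and "\<And>\<sigma> \<phi>. \<lbrakk>path \<sigma>; path_image \<sigma> \<subseteq> U; pathstart \<sigma> = p; pathfinish \<sigma> = p; \<phi> \<in> SolK\<rbrakk>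
           \<Longrightarrow> monodromy \<sigma> \<phi> \<in> SolK"
    and "c \<in> S" and "c \<noteq> 0"
    and "open D0" and "simply_connected D0" and "0 \<in> D0"
    and "open Dc" and "simply_connected Dc" and "c \<in> Dc"
    and "V \<subseteq> U" and "contractible (V0 \<inter> Vc)" and "p \<in> V0 \<inter> Vc"
    and "path \<gamma>" and "pathstart \<gamma> = 0" and "pathfinish \<gamma> = c"
    and "0 < \<tau>" and "\<tau> < 1" and "\<gamma> \<tau> = p"
    and "\<gamma> ` {0<..\<tau>} \<subseteq> V0" and "\<gamma> ` {\<tau>..<1} \<subseteq> Vc"
    and "continuous_on {0<..<1} lg" and "\<And>u. u \<in> {0<..<1} \<Longrightarrow> exp (lg u) = \<gamma> u"
    and "path \<sigma>0" and "path_image \<sigma>0 \<subseteq> V0" and "pathstart \<sigma>0 = p" and "pathfinish \<sigma>0 = p"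
    and "winding_number \<sigma>0 0 = 1"
    and "path \<sigma>c" and "path_image \<sigma>c \<subseteq> Vc" and "pathstart \<sigma>c = p" and "pathfinish \<sigma>c = p"
    and "winding_number \<sigma>c c = 1"
    and "special_reflection_point r q Dc p \<sigma>c"
    and "\<delta> \<in> SolK"
    and "variation_image \<sigma>c (Sol r q p) = module.span germ_scale {\<delta>}"
    and "minimal_annihilator K \<sigma>0 (variation_image \<sigma>c (Sol_adj r q p)) R"
  shows "\<exists>\<xi>0 \<in> H1 V p (twisted_module (dual_structure r q p K SolK)).
     gamma_function p (lg \<tau>) ` H1 V p (twisted_module (dual_structure r q p K SolK)) =
       (\<lambda>u s. u s * gamma_function p (lg \<tau>) \<xi>0 s) ` exp_laurent K \<and>
     (\<forall>\<rho>\<in>exponent_set r q. \<forall>\<^sub>F s in at \<rho>.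
        (\<lambda>n. frobenius_constant r q \<gamma> lg \<tau> \<sigma>c \<delta> \<rho> n * (s - \<rho>) ^ n) sums
          (poly (indicial_poly r q) s / poly R (exp (- 2 * pi * \<i> * s))
             * gamma_function p (lg \<tau>) \<xi>0 s))"
proof -
  note D0 = assms(15-17) and Dc = assms(18-20) and \<sigma>0 = assms(34-38) and \<sigma>c = assms(39-43)
  have "closed S" using assms(5) by (rule finite_imp_closed)
  then have U: "open U" unfolding U_def by (rule open_Compl)
  have "closed (S - {0})" using assms(5) by (simp add: finite_imp_closed)
  moreover have "U \<union> {0} = - (S - {0})" by (auto simp: U_def)
  ultimately have U0: "open (U \<union> {0})" by (simp only: open_Compl)
  have VU: "V0 \<subseteq> V" "Vc \<subseteq> V" "V \<subseteq> U" using assms(21) by (auto simp: V_def)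
  have pV: "p \<in> V" "p \<in> Dc" "p \<in> U" using assms(23) VU by (auto simp: Vc_def)
  have hq: "q j holomorphic_on U \<union> {0}" if "j \<le> r" for j by (rule rational_on_holomorphic[OF assms(7)[OF that]])
  have oV: "open V0" "open Vc" "open V" using D0(1) Dc(1) by (auto simp: V0_def Vc_def V_def)
  have c0: "0 \<notin> Dc" using VU assms(6,14) by (auto simp: Vc_def U_def)
  have dim1: "germ_space.dim (variation_image \<sigma>c (Sol r q p)) = 1"
    and special: "\<And>\<psi>. \<psi> \<in> Sol_adj r q p \<Longrightarrow> monodromy \<sigma>c \<psi> = \<psi> \<Longrightarrow> \<exists>g. g holomorphic_on Dc \<and> fps_expansion g p = \<psi>"
    using assms(44) unfolding special_reflection_point_def reflection_point_def by blast+
  \<comment> \<open>The variation has a one-dimensional image, so a vector spanning it is not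
    zero.\<close>
  have \<delta>0: "\<delta> \<noteq> 0"
  proof
    assume "\<delta> = 0"
    then have "variation_image \<sigma>c (Sol r q p) = {0}" using assms(46) germ_space.span_insert_0[of "{}"] by simp
    then show False using dim1 germ_dim_0 by simp
  qed
  \<comment> \<open>An operator of order 0 has only the zero solution here, and its variation would
    be trivial.\<close>
  have r: "r > 0"
  proof (rule ccontr)
    assume "\<not> r > 0"
    then have "Sol r q p \<subseteq> {0}" using Sol_order_0[of q p] assms(8)[of p] pV by auto
    moreover have "monodromy \<sigma>c 0 = 0" by (rule monodromy_0[OF \<sigma>c(1) order_refl \<sigma>c(3)])
    ultimately have "variation_image \<sigma>c (Sol r q p) \<subseteq> {0}" by (auto simp: variation_image_def)
    then have "\<delta> \<in> {0}" using assms(46) germ_space.span_base[of \<delta> "{\<delta>}"] by blast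
    then show False using \<delta>0 by simp
  qed
  have wc: "winding_number \<sigma>c 0 = 0"
    by (rule simply_connected_imp_winding_number_zero[OF Dc(2) \<sigma>c(1) _ _ c0]) (use \<sigma>c in \<open>auto simp: Vc_def\<close>)
  \<comment> \<open>Van Kampen's theorem reduces the claim to loops inside \<open>V0\<close> or
    inside \<open>Vc\<close>, which are up to homotopy powers of \<open>\<sigma>0\<close> or of
    \<open>\<sigma>c\<close>.\<close>
  have generation: "P g" if "loop_subgroup V p P" and P: "P \<sigma>0" "P \<sigma>c"
    and g: "path g" "path_image g \<subseteq> V" "pathstart g = p" "pathfinish g = p" for P g
  proof -
    interpret loop_subgroup V p P by (rule that(1))
    show ?thesis
    proof (rule P_union[OF _ oV(1,2) contractible_imp_path_connected[OF assms(22)] assms(23) _ g])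
      show "V = V0 \<union> Vc" by (simp add: V_def)
      fix X g assume X: "X \<in> {V0, Vc}" and g: "path g" "path_image g \<subseteq> X" "pathstart g = p" "pathfinish g = p"
      from X show "P g"
      proof (elim insertE emptyE)
        assume "X = V0"
        then show ?thesis
          using P_punctured[OF D0 _ \<sigma>0(1) _ \<sigma>0(3-5) P(1) g(1) _ g(3,4)] VU(1) \<sigma>0(2) g(2) by (simp add: V0_def)
      next
        assume "X = Vc"
        then show ?thesis
          using P_punctured[OF Dc _ \<sigma>c(1) _ \<sigma>c(3-5) P(2) g(1) _ g(3,4)] VU(2) \<sigma>c(2) g(2) by (simp add: Vc_def)
      qed
    qed
  qed
  have \<sigma>V: "path_image \<sigma>0 \<subseteq> V" "path_image \<sigma>c \<subseteq> V" using \<sigma>0(2) \<sigma>c(2) VU by auto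
  obtain t0 tc where t: "polynomial_function t0" "homotopic_paths V \<sigma>0 t0" "polynomial_function tc" "homotopic_paths V \<sigma>c tc"
    using homotopic_polynomial_path[OF \<sigma>0(1) oV(3) \<sigma>V(1)] homotopic_polynomial_path[OF \<sigma>c(1) oV(3) \<sigma>V(2)] by blast
  have p: "exp (lg \<tau>) = p" using assms(27-29,33) by simp
  interpret minimal_setting r q U p K SolK V Dc \<sigma>0 \<sigma>c t0 tc \<delta> "lg \<tau>" R
  proof
    show "open U" "0 < r" "p \<in> U" "complex_subfield K" "rational_structure K (Sol r q p) SolK" "V \<subseteq> U" "p \<in> V" by fact+
    show "0 \<notin> U" using assms(6) by (simp add: U_def)
    show "q j holomorphic_on U" if "j \<le> r" for j by (rule holomorphic_on_subset[OF hq[OF that]]) blast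
    show "q 0 z \<noteq> 0" if "z \<in> U" for z using assms(8) that by simp
    show "monodromy g \<phi> \<in> SolK" if "path g \<and> path_image g \<subseteq> U \<and> pathstart g = p \<and> pathfinish g = p" "\<phi> \<in> SolK" for g \<phi>
      using assms(12) that by simp
    show "P g" if "loop_subgroup V p P" "P \<sigma>0" "P \<sigma>c" "path g" "path_image g \<subseteq> V" "pathstart g = p" "pathfinish g = p" for P g
      by (rule generation[OF that])
    show "path_image \<sigma>c \<subseteq> Dc" using \<sigma>c(2) by (auto simp: Vc_def)
    show "variation_image \<sigma>c (Sol r q p) = range (\<lambda>k. germ_scale k \<delta>)"
      using assms(46) germ_space.span_singleton[of \<delta>] by simp
    show "exp (lg \<tau>) = p" by (rule p)
    show "\<exists>g. g holomorphic_on Dc \<and> fps_expansion g p = \<psi>" if "\<psi> \<in> Sol_adj r q p" "monodromy \<sigma>c \<psi> = \<psi>" for \<psi>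
      by (rule special[OF that])
  qed (fact \<sigma>0 \<sigma>c \<sigma>V t Dc pV c0 wc \<delta>0 assms(45,47))+
  have "\<forall>\<^sub>F s in at \<rho>. (\<lambda>n. frobenius_constant r q \<gamma> lg \<tau> \<sigma>c \<delta> \<rho> n * (s - \<rho>) ^ n) sums
          (poly (indicial_poly r q) s / poly R (exp (- 2 * pi * \<i> * s)) * gamma_function p (lg \<tau>) \<xi>0 s)"
    if \<rho>: "\<rho> \<in> exponent_set r q" for \<rho>
  proof -
    \<comment> \<open>The coefficients are regular at 0 although 0 belongs to \<open>S\<close>, so
      they are holomorphic on a full disk around it.\<close>
    obtain e0 where e0: "e0 > 0" "ball 0 e0 \<subseteq> U \<union> {0}" using openE[OF U0, of 0] by blast
    interpret F: frobenius_path r q U \<rho> e0 \<gamma> lg \<sigma>0 \<tau> D0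
    proof
      show "q j holomorphic_on ball 0 e0" if "j \<le> r" for j by (rule holomorphic_on_subset[OF hq[OF that] e0(2)])
      show "q 0 0 \<noteq> 0" using assms(8) by simp
      show "continuous_on {0..\<tau>} \<gamma>"
        using assms(24) unfolding path_def by (rule continuous_on_subset) (use assms(28) in auto)
      show "\<gamma> 0 = 0" using assms(25) by (simp add: pathstart_def)
      show "continuous_on {0<..\<tau>} lg" by (rule continuous_on_subset[OF assms(32)]) (use assms(28) in auto)
      show "exp (lg u) = \<gamma> u" if "u \<in> {0<..\<tau>}" for u using assms(33)[of u] assms(28) that by simp
      show "D0 - {0} \<subseteq> U" using VU by (auto simp: V0_def)
      show "path_image \<sigma>0 \<subseteq> D0 - {0}" using assms(35) by (simp add: V0_def)
    qed (use e0 \<rho> D0 \<sigma>0 assms(27,29,30) in \<open>simp_all add: V0_def\<close>)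
    define \<phi> where "\<phi> k = frobenius_function r q \<gamma> lg \<tau> \<rho> k" for k
    have I: "poly (indicial_poly r q) holomorphic_on UNIV"
      unfolding poly_altdef[abs_def] by (intro holomorphic_intros)
    have L: "L_germ r q p (\<phi> k) = (\<Sum>i\<le>k. fps_const (fps_nth (fps_expansion (poly (indicial_poly r q)) \<rho>) (k - i)) * lgerm \<rho> i)" for k
      using F.L_frobenius[of k] unfolding \<phi>_def F.Icoef_def assms(29) .
    have M: "s0 (\<phi> k) = (\<Sum>i\<le>k. fps_const (fps_nth (fps_expansion (\<lambda>s. tt s 1) \<rho>) i) * \<phi> (k - i))" for k
      unfolding \<phi>_def by (rule F.monodromy_frobenius)
    \<comment> \<open>The multiplier of \<open>\<delta>\<close> is unique because
      \<open>\<delta>\<close> is not zero, so the definite description agrees with the chosen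
      \<open>\<kappa>\<close>.\<close>
    have "frobenius_constant r q \<gamma> lg \<tau> \<sigma>c \<delta> \<rho> k = \<kappa> \<phi> k" for k
      unfolding frobenius_constant_def Let_def \<phi>_def[symmetric]
    proof (rule the_equality)
      show sc: "sc (\<phi> k) - \<phi> k = germ_scale (\<kappa> \<phi> k) \<delta>" by (rule sc_\<phi>[OF I L M])
      show "x = \<kappa> \<phi> k" if "sc (\<phi> k) - \<phi> k = germ_scale x \<delta>" for x
        using that \<delta>0 unfolding sc by simp
    qed
    then show ?thesis using kappa_sums[OF I L M] by (simp add: gamma_\<xi>0 Rv_def tt_def)
  qed
  then show ?thesis using gamma_module \<xi>0_H1 by blast
qed

end
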